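(* Let $P$ be an $r\times r$ refinement mask whose entries are trigonometric polynomials, let $R(P)\subset W_2^s(\mathbb{R}^d)$ be the space of all compactly supported solutions to the refinement equation $\widehat\Phi(2\cdot)=P\widehat\Phi$, and let $v$ be a vector-valued trigonometric polynomial. Suppose that $P$ and $v$ satisfy Condition $Z_k$ for some $k>0$. Then: (1) For each $\Phi\in R(P)$, the (compactly supported) $\psi$ defined by $\widehat\psi=v^*\widehat\Phi$ satisfies the Strang-Fix conditions of order $k$, and in addition $\widehat\psi-\widehat\psi(0)=O(|\cdot|^k)$ near the origin. Consequently, if $v^*(0)\widehat\Phi(0)\ne0$, then $S_\Phi(W_2^s)$ provides approximation order $k$, and $\psi\in S_\Phi(W_2^s)$ is a corresponding superfunction. (2) If $v^*(0)\widehat\Phi(0)\ne0$ for some $\Phi\in R(P)$, then $P$ provides coherent approximation order $k$, and $v$ is a corresponding universal regular supervector.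
   Context: $\widehat f(\omega)=\int f(x)e^{-i\omega\cdot x}dx$; $W_2^s=W_2^s(\mathbb{R}^d)$ is the space of tempered distributions $f$ with $\widehat f$ locally in $L_2$ and $\|f\|_{W_2^s}^2=\int(1+|\omega|)^{2s}|\widehat f(\omega)|^2d\omega<\infty$. $S_\Phi(W_2^s)$ is the smallest closed subspace of $W_2^s$ containing the entries of $\Phi$ and invariant under integer translations. For $k>s$ it provides approximation order $k$ if, with $S^h=\{g(\cdot/h):g\in S_\Phi(W_2^s)\}$, there is $C$ with $\inf_{g\in S^h}\|f-g\|_{W_2^s}\le Ch^{k-s}\|f\|_{W_2^k}$ for all $f\in W_2^k$, $h>0$. That $\psi\in S_\Phi(W_2^s)$ is a corresponding superfunction means that the space $S_\psi(W_2^s)$ already provides the approximation order $k$. $R(P)\subset W_2^s$ means that every entry of every vector in $R(P)$ lies in $W_2^s$. $E=\{0,1\}^d$. Condition $Z_k$ for $P,v$: for each $l\in E$, $v^*(2\cdot)P-\delta_{l,0}v^*$ has a zero of order $k$ at $\pi l$, while $v(0)\ne0$. Strang-Fix conditions of order $k$: near the origin $|\widehat\psi(\cdot+\alpha)|=O(|\cdot|^k)$ for all $\alpha\in2\pi\mathbb{Z}^d\setminus\{0\}$. Combined Gramian: with $(\Phi_1,\dots,\Phi_n)$ a basis of $R(P)$, $G_{R(P),s}=\sum_{j}\sum_{\alpha\in2\pi\mathbb{Z}^d}\widehat\Phi_j(\cdot+\alpha)\widehat\Phi_j^*(\cdot+\alpha)|\cdot+\alpha|^{2s}$, and $G^0_{R(P),s}$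 is the same with the terms $\alpha=0$ removed. $P$ provides coherent approximation order $k$ if for some neighborhood $\Omega$ of $0$ the function $\omega\mapsto|\omega|^{-(2k-2s)}\inf_v\frac{v^*G^0_{R(P),s}(\omega)v}{v^*G_{R(P),s}(\omega)v}$ is in $L_\infty(\Omega)$. A measurable $v$ is a regular universal supervector of order $k$ if, near the origin, $\frac{v^*G_{R(P),s}v}{v^*v}\sim|\cdot|^{2s}$ (two-sided bounds by positive constants) and $\frac{v^*G^0_{R(P),s}v}{v^*v}=O(|\cdot|^{2k})$.
   Formalization: The claims on approximation order and superfunction in (1), and all of (2), are stated for k > s, the range where approximation order is defined; for k < s the regular supervector claim in (2) can fail. *)

theory Defs
  imports
    "HOL-Analysis.Analysis"
    "HOL-Library.Landau_Symbols"
    "HOL-Library.Function_Algebras"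
begin

section \<open>Tempered distributions\<close>

definition dpart :: "'d::finite \<Rightarrow> (real^'d \<Rightarrow> complex) \<Rightarrow> real^'d \<Rightarrow> complex" where
  "dpart j f = (\<lambda>x. frechet_derivative f (at x) (axis j 1))"

text \<open>The iterated partial derivative along a list of coordinate directions.\<close>

definition dparts :: "'d::finite list \<Rightarrow> (real^'d \<Rightarrow> complex) \<Rightarrow> real^'d \<Rightarrow> complex" where
  "dparts js f = foldr dpart js f"

definition smooth_fun :: "(real^'d::finite \<Rightarrow> complex) \<Rightarrow> bool" where
  "smooth_fun f \<longleftrightarrow> (\<forall>js x. dparts js f differentiable (at x))"

definition schwartz :: "(real^'d::finite \<Rightarrow> complex) set" where
  "schwartz = {\<phi>. smooth_fun \<phi> \<and>
     (\<forall>N js. bdd_above (range (\<lambda>x. (1 + norm x) ^ N * cmod (dparts js \<phi> x))))}"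

definition schwartz_norm :: "nat \<Rightarrow> (real^'d::finite \<Rightarrow> complex) \<Rightarrow> real" where
  "schwartz_norm N \<phi> =
     (SUP (js, x) \<in> {js. length js \<le> N} \<times> UNIV. (1 + norm x) ^ N * cmod (dparts js \<phi> x))"

type_synonym 'd tdist = "(real^'d \<Rightarrow> complex) \<Rightarrow> complex"

text \<open>
  A tempered distribution is a functional on the Schwartz space.  It is extended by 0 to
  all other functions, so that HOL equality is equality of distributions.
\<close>

definition tempered :: "'d::finite tdist set" where
  "tempered = {T.
     (\<forall>\<phi>. \<phi> \<notin> schwartz \<longrightarrow> T \<phi> = 0) \<and>
     (\<forall>\<phi>\<in>schwartz. \<forall>\<theta>\<in>schwartz. T (\<lambda>x. \<phi> x + \<theta> x) = T \<phi> + T \<theta>) \<and>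
     (\<forall>\<phi>\<in>schwartz. \<forall>c. T (\<lambda>x. c * \<phi> x) = c * T \<phi>) \<and>
     (\<exists>N C. \<forall>\<phi>\<in>schwartz. cmod (T \<phi>) \<le> C * schwartz_norm N \<phi>)}"

definition tscale :: "complex \<Rightarrow> 'd::finite tdist \<Rightarrow> 'd tdist" where
  "tscale c T = (\<lambda>\<phi>. c * T \<phi>)"

definition tvscale :: "complex \<Rightarrow> ('d::finite tdist)^'r::finite \<Rightarrow> ('d tdist)^'r" where
  "tvscale c \<Phi> = (\<chi> i. tscale c (\<Phi> $ i))"

interpretation tdist: vector_space tscale
  by unfold_locales (auto simp: tscale_def algebra_simps fun_eq_iff)

interpretation tvec: vector_space tvscale
  by unfold_locales
    (auto simp: tvscale_def vec_eq_iff tdist.scale_right_distrib tdist.scale_left_distrib)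

text \<open>The distributions \<open>T(\<cdot> - a)\<close> and \<open>T(\<cdot> / h)\<close>.\<close>

definition ttranslate :: "real^'d::finite \<Rightarrow> 'd tdist \<Rightarrow> 'd tdist" where
  "ttranslate a T = (\<lambda>\<phi>. T (\<lambda>x. \<phi> (x + a)))"

definition tdilate :: "real \<Rightarrow> 'd::finite tdist \<Rightarrow> 'd tdist" where
  "tdilate h T = (\<lambda>\<phi>. of_real (h ^ CARD('d)) * T (\<lambda>x. \<phi> (h *\<^sub>R x)))"

definition compactly_supported :: "'d::finite tdist \<Rightarrow> bool" where
  "compactly_supported T \<longleftrightarrow>
     (\<exists>K. compact K \<and> (\<forall>\<phi>\<in>schwartz. closure {x. \<phi> x \<noteq> 0} \<inter> K = {} \<longrightarrow> T \<phi> = 0))"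


section \<open>Fourier transform and Sobolev spaces\<close>

definition fourier :: "(real^'d::finite \<Rightarrow> complex) \<Rightarrow> real^'d \<Rightarrow> complex" where
  "fourier f \<omega> = (LINT x|lborel. f x * exp (- \<i> * of_real (\<omega> \<bullet> x)))"

text \<open>The Fourier transform of \<open>T\<close> is the locally square integrable function \<open>g\<close>.\<close>

definition has_fourier :: "'d::finite tdist \<Rightarrow> (real^'d \<Rightarrow> complex) \<Rightarrow> bool" where
  "has_fourier T g \<longleftrightarrow> g \<in> borel_measurable borel \<and>
     (\<forall>K. compact K \<longrightarrow> set_integrable lborel K (\<lambda>\<omega>. (cmod (g \<omega>))\<^sup>2)) \<and>
     (\<forall>\<phi>\<in>schwartz. integrable lborel (\<lambda>\<omega>. g \<omega> * \<phi> \<omega>) \<and>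
        T (fourier \<phi>) = (LINT \<omega>|lborel. g \<omega> * \<phi> \<omega>))"

text \<open>
  The function above is determined almost everywhere.  The continuous representative is
  chosen when there is one, as is the case for every compactly supported distribution;
  this gives a meaning to point values.
\<close>

definition tfourier :: "'d::finite tdist \<Rightarrow> real^'d \<Rightarrow> complex" where
  "tfourier T = (SOME g. has_fourier T g \<and>
     ((\<exists>g'. has_fourier T g' \<and> continuous_on UNIV g') \<longrightarrow> continuous_on UNIV g))"

definition vfourier :: "('d::finite tdist)^'r::finite \<Rightarrow> real^'d \<Rightarrow> complex^'r" where
  "vfourier \<Phi> \<omega> = (\<chi> i. tfourier (\<Phi> $ i) \<omega>)"

definition sobolev :: "real \<Rightarrow> 'd::finite tdist set" where
  "sobolev s = {T \<in> tempered. (\<exists>g. has_fourier T g) \<and>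
     integrable lborel (\<lambda>\<omega>. (1 + norm \<omega>) powr (2 * s) * (cmod (tfourier T \<omega>))\<^sup>2)}"

definition sobolev_norm :: "real \<Rightarrow> 'd::finite tdist \<Rightarrow> real" where
  "sobolev_norm s T =
     sqrt (LINT \<omega>|lborel. (1 + norm \<omega>) powr (2 * s) * (cmod (tfourier T \<omega>))\<^sup>2)"

definition int_lattice :: "(real^'d::finite) set" where
  "int_lattice = {x. \<forall>i. x $ i \<in> \<int>}"

definition two_pi_lattice :: "(real^'d::finite) set" where
  "two_pi_lattice = (\<lambda>x. (2 * pi) *\<^sub>R x) ` int_lattice"

definition sobolev_closed :: "real \<Rightarrow> 'd::finite tdist set \<Rightarrow> bool" where
  "sobolev_closed s S \<longleftrightarrow> S \<subseteq> sobolev s \<and>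
     (\<forall>f\<in>sobolev s. (\<forall>\<epsilon>>0. \<exists>g\<in>S. sobolev_norm s (f - g) < \<epsilon>) \<longrightarrow> f \<in> S)"

definition shift_invariant :: "'d::finite tdist set \<Rightarrow> bool" where
  "shift_invariant S \<longleftrightarrow> (\<forall>f\<in>S. \<forall>\<alpha>\<in>int_lattice. ttranslate \<alpha> f \<in> S)"

text \<open>The closed shift-invariant subspace of \<open>W\<^sub>2\<^sup>s\<close> generated by the set \<open>A\<close>.\<close>

definition si_space :: "real \<Rightarrow> 'd::finite tdist set \<Rightarrow> 'd tdist set" where
  "si_space s A =
     \<Inter>{S. tdist.subspace S \<and> sobolev_closed s S \<and> shift_invariant S \<and> A \<subseteq> S}"

abbreviation si_space_vec :: "real \<Rightarrow> ('d::finite tdist)^'r::finite \<Rightarrow> 'd tdist set" where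
  "si_space_vec s \<Phi> \<equiv> si_space s (range (($) \<Phi>))"

text \<open>Only meaningful for \<open>k > s\<close>.\<close>

definition approx_order :: "real \<Rightarrow> real \<Rightarrow> 'd::finite tdist set \<Rightarrow> bool" where
  "approx_order s k S \<longleftrightarrow> (\<exists>C. \<forall>f\<in>sobolev k. \<forall>h>0.
     (INF g \<in> tdilate h ` S. sobolev_norm s (f - g)) \<le> C * h powr (k - s) * sobolev_norm k f)"


section \<open>Refinement equations\<close>

definition trig_poly :: "(real^'d::finite \<Rightarrow> complex) \<Rightarrow> bool" where
  "trig_poly f \<longleftrightarrow> (\<exists>A c. finite A \<and> A \<subseteq> int_lattice \<and>
     f = (\<lambda>\<omega>. \<Sum>\<alpha>\<in>A. c \<alpha> * exp (\<i> * of_real (\<alpha> \<bullet> \<omega>))))"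

definition refinable_space :: "(real^'d::finite \<Rightarrow> complex^'r^'r::finite) \<Rightarrow> (('d tdist)^'r) set" where
  "refinable_space P = {\<Phi>. (\<forall>i. \<Phi> $ i \<in> tempered \<and> compactly_supported (\<Phi> $ i)) \<and>
     (\<forall>\<omega>. vfourier \<Phi> (2 *\<^sub>R \<omega>) = P \<omega> *v vfourier \<Phi> \<omega>)}"

definition cnj_vec :: "complex^'r::finite \<Rightarrow> complex^'r" where
  "cnj_vec x = (\<chi> i. cnj (x $ i))"

text \<open>The product \<open>x\<^sup>* y\<close>.\<close>

definition adj_prod :: "complex^'r::finite \<Rightarrow> complex^'r \<Rightarrow> complex" where
  "adj_prod x y = (\<Sum>i\<in>UNIV. cnj (x $ i) * y $ i)"

text \<open>The row vector \<open>v\<^sup>*\<close> is represented by \<open>cnj_vec v\<close>.\<close>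

definition condition_Z ::
  "real \<Rightarrow> (real^'d::finite \<Rightarrow> complex^'r^'r::finite) \<Rightarrow> (real^'d \<Rightarrow> complex^'r) \<Rightarrow> bool" where
  "condition_Z k P v \<longleftrightarrow> v 0 \<noteq> 0 \<and>
     (\<forall>l. (\<forall>i. l $ i \<in> {0, 1}) \<longrightarrow>
        (\<lambda>\<omega>. norm (cnj_vec (v (2 *\<^sub>R \<omega>)) v* P \<omega> - (if l = 0 then cnj_vec (v \<omega>) else 0)))
          \<in> O[nhds (pi *\<^sub>R l)](\<lambda>\<omega>. norm (\<omega> - pi *\<^sub>R l) powr k))"

definition strang_fix :: "real \<Rightarrow> 'd::finite tdist \<Rightarrow> bool" where
  "strang_fix k \<psi> \<longleftrightarrow> (\<forall>\<alpha> \<in> two_pi_lattice - {0}.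
     (\<lambda>\<omega>. cmod (tfourier \<psi> (\<omega> + \<alpha>))) \<in> O[nhds 0](\<lambda>\<omega>. norm \<omega> powr k))"


section \<open>Coherent approximation orders\<close>

definition refinable_basis ::
  "(real^'d::finite \<Rightarrow> complex^'r^'r::finite) \<Rightarrow> (('d tdist)^'r) list \<Rightarrow> bool" where
  "refinable_basis P \<Phi>s \<longleftrightarrow> distinct \<Phi>s \<and> tvec.independent (set \<Phi>s) \<and>
     tvec.span (set \<Phi>s) = refinable_space P"

text \<open>
  The index set \<open>A\<close> is the lattice, or the lattice without 0.  For \<open>s \<le> 0\<close> the summand at
  \<open>\<omega> + \<alpha> = 0\<close> has the value 0; all uses below ignore null sets.
\<close>

definition gramian_over ::
  "(real^'d::finite) set \<Rightarrow> real \<Rightarrow> (('d tdist)^'r::finite) list \<Rightarrow> real^'d \<Rightarrow> complex^'r^'r" where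
  "gramian_over A s \<Phi>s \<omega> = (\<Sum>\<Phi>\<leftarrow>\<Phi>s. \<Sum>\<^sub>\<infinity>\<alpha>\<in>A. norm (\<omega> + \<alpha>) powr (2 * s) *\<^sub>R
     (\<chi> i j. vfourier \<Phi> (\<omega> + \<alpha>) $ i * cnj (vfourier \<Phi> (\<omega> + \<alpha>) $ j)))"

abbreviation gramian ::
  "real \<Rightarrow> (('d::finite tdist)^'r::finite) list \<Rightarrow> real^'d \<Rightarrow> complex^'r^'r" where
  "gramian \<equiv> gramian_over two_pi_lattice"

abbreviation gramian0 ::
  "real \<Rightarrow> (('d::finite tdist)^'r::finite) list \<Rightarrow> real^'d \<Rightarrow> complex^'r^'r" where
  "gramian0 \<equiv> gramian_over (two_pi_lattice - {0})"

text \<open>The form \<open>x\<^sup>* G x\<close>, which is real for the Hermitian matrices used here.\<close>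

definition herm_form :: "complex^'r^'r::finite \<Rightarrow> complex^'r \<Rightarrow> real" where
  "herm_form G x = Re (adj_prod x (G *v x))"

text \<open>
  Vectors with \<open>x\<^sup>* G x = 0\<close> must be excluded from the infimum: otherwise \<open>0 / 0 = 0\<close> would
  make it vanish wherever \<open>G\<close> is singular (and already for \<open>x = 0\<close>).
\<close>

definition coherent_quotient ::
  "real \<Rightarrow> real \<Rightarrow> (('d::finite tdist)^'r::finite) list \<Rightarrow> real^'d \<Rightarrow> ennreal" where
  "coherent_quotient s k \<Phi>s \<omega> = ennreal (norm \<omega> powr (- (2 * k - 2 * s))) *
     (INF x \<in> {x. herm_form (gramian s \<Phi>s \<omega>) x \<noteq> 0}.
        ennreal (herm_form (gramian0 s \<Phi>s \<omega>) x / herm_form (gramian s \<Phi>s \<omega>) x))"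

text \<open>
  The two notions below do not depend on the choice of the basis of \<open>R(P)\<close>.  They include
  that a finite basis exists.
\<close>

definition coherent_approx_order ::
  "real \<Rightarrow> real \<Rightarrow> (real^'d::finite \<Rightarrow> complex^'r^'r::finite) \<Rightarrow> bool" where
  "coherent_approx_order s k P \<longleftrightarrow> (\<exists>\<Phi>s. refinable_basis P \<Phi>s) \<and>
     (\<forall>\<Phi>s. refinable_basis P \<Phi>s \<longrightarrow>
       (\<exists>\<Omega>. open \<Omega> \<and> 0 \<in> \<Omega> \<and>
          coherent_quotient s k \<Phi>s \<in> borel_measurable (restrict_space lebesgue \<Omega>) \<and>
          (\<exists>C::real. AE \<omega> in lebesgue. \<omega> \<in> \<Omega> \<longrightarrow> coherent_quotient s k \<Phi>s \<omega> \<le> ennreal C)))"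

definition regular_universal_supervector ::
  "real \<Rightarrow> real \<Rightarrow> (real^'d::finite \<Rightarrow> complex^'r^'r::finite) \<Rightarrow> (real^'d \<Rightarrow> complex^'r) \<Rightarrow> bool" where
  "regular_universal_supervector s k P v \<longleftrightarrow> v \<in> borel_measurable lebesgue \<and>
     (\<exists>\<Phi>s. refinable_basis P \<Phi>s) \<and>
     (\<forall>\<Phi>s. refinable_basis P \<Phi>s \<longrightarrow>
       (\<exists>\<Omega> c C. open \<Omega> \<and> 0 \<in> \<Omega> \<and> c > 0 \<and> C > 0 \<and>
          (AE \<omega> in lebesgue. \<omega> \<in> \<Omega> \<longrightarrow>
             c * norm \<omega> powr (2 * s) \<le> herm_form (gramian s \<Phi>s \<omega>) (v \<omega>) / (norm (v \<omega>))\<^sup>2 \<and>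
             herm_form (gramian s \<Phi>s \<omega>) (v \<omega>) / (norm (v \<omega>))\<^sup>2 \<le> C * norm \<omega> powr (2 * s) \<and>
             \<bar>herm_form (gramian0 s \<Phi>s \<omega>) (v \<omega>) / (norm (v \<omega>))\<^sup>2\<bar> \<le> C * norm \<omega> powr (2 * k))))"

end

theory Submission
  imports Defs
begin

text \<open>
Everything takes place on the Fourier side.  Let \<open>F\<close> be the transform of some \<open>\<Phi>\<close> in \<open>R(P)\<close> and
\<open>f = v\<^sup>* F\<close>.  Since \<open>v\<close> is a trigonometric polynomial, \<open>f\<close> is the transform of a finite linear
combination \<open>\<psi>\<close> of integer translates of the entries of \<open>\<Phi>\<close>.

An entry \<open>T\<close> of \<open>\<Phi>\<close> satisfies \<open>T = c T\<close> for a smooth cutoff \<open>c\<close>, so its transform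
is the convolution of itself with a Schwartz function (\<open>csupp_fourier_representation\<close>).  It is
therefore continuous and has Taylor expansions, and Peetre's inequality together with
Cauchy-Schwarz bounds the sums of \<open>(1 + |\<omega> + \<alpha>|)\<^sup>2\<^sup>s |T^(\<omega> + \<alpha>)|\<^sup>2\<close> over a lattice (the bracket
of \<open>T\<close>) uniformly in \<open>\<omega>\<close> (\<open>bracket_bound\<close>).

Let \<open>\<alpha> = 2 \<pi> n\<close> and let \<open>l\<close> be the parity of \<open>n\<close>.  By periodicity, Condition Z
at \<open>\<pi> l\<close> turns the refinement equation into
\<open>f(\<omega> + \<alpha>) = [n even] f((\<omega> + \<alpha>)/2) + O(|\<omega>|\<^sup>k) |F((\<omega> + \<alpha>)/2)|\<close> (\<open>refinement_step\<close>), with a constant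
that depends neither on \<open>\<alpha>\<close> nor on \<open>F\<close>.  A nonzero \<open>\<alpha>\<close> can be halved only finitely often, which
gives the Strang-Fix conditions (\<open>strang_fix_pointwise\<close>).  For \<open>\<alpha> = 0\<close> the recursion telescopes
along \<open>\<omega>, \<omega>/2, \<omega>/4, ...\<close> to \<open>f - f(0) = O(|\<omega>|\<^sup>k)\<close> (\<open>symbol_near_zero\<close>).  For the sum of
\<open>|\<omega> + \<alpha>|\<^sup>2\<^sup>s |f(\<omega> + \<alpha>)|\<^sup>2\<close> over all \<open>\<alpha> \<noteq> 0\<close>, a halving step costs the factor \<open>2\<^sup>s\<close> in the norm and gains
the factor \<open>2\<^sup>-\<^sup>k\<close>; for \<open>k > s\<close> this is a contraction, so that the sum is \<open>O(|\<omega>|\<^sup>2\<^sup>k)\<close>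
(\<open>bracket_zero_order\<close>).

The transforms of the dilated finite combinations of translates of \<open>\<psi>\<close> are
the functions \<open>h\<^sup>d p(h \<omega>) f(h \<omega>)\<close> with a trigonometric polynomial \<open>p\<close>.  Let \<open>f(0) \<noteq> 0\<close>.  To approximate \<open>g^\<close>, the
ideal choice of \<open>p\<close> on the cube \<open>[-\<pi>, \<pi>)\<^sup>d\<close> is \<open>g^(x/h) / (h\<^sup>d f(x))\<close> near the origin, where \<open>f\<close> does
not vanish, and 0 elsewhere.  The high frequencies of \<open>g\<close> are then lost, which costs
\<open>O(h\<^sup>k\<^sup>-\<^sup>s)\<close> because \<open>g\<close> lies in \<open>W\<^sub>2\<^sup>k\<close>; the aliases at \<open>\<alpha> \<noteq> 0\<close> are controlled by
\<open>bracket_zero_order\<close>; and replacing the ideal periodic function by a trigonometric polynomial costs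
arbitrarily little, since these are dense in \<open>L\<^sub>2\<close> of the cube (\<open>trig_dense\<close>) and the lattice sums
are uniformly bounded.  This is \<open>dilated_trig_approximation\<close>.

The form \<open>v\<^sup>* G v\<close> is the sum of \<open>|\<omega> + \<alpha>|\<^sup>2\<^sup>s |f\<^sub>j(\<omega> + \<alpha>)|\<^sup>2\<close> over \<open>\<alpha>\<close> and over a basis of
\<open>R(P)\<close>.  Its terms with \<open>\<alpha> \<noteq> 0\<close> are \<open>O(|\<omega>|\<^sup>2\<^sup>k)\<close>, and its term with \<open>\<alpha> = 0\<close> is comparable with
\<open>|\<omega>|\<^sup>2\<^sup>s\<close> if some \<open>f\<^sub>j(0)\<close> is nonzero (\<open>form_bounds\<close>).  A finite basis exists because an element of \<open>R(P)\<close>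
whose transform vanishes at the origin to an order \<open>m\<close> with \<open>2\<^sup>m > sup |P|\<close> is 0
(\<open>R_flat_imp_zero\<close>), so that finitely many Taylor coefficients determine an element.
\<close>

section \<open>Functions with controlled derivatives\<close>

text \<open>The derivatives up to order \<open>n\<close> exist and satisfy \<open>Q\<close>.  Since one derivative is peeled off at a time,
closure of \<open>Q\<close> under sums, products and affine substitutions passes to all orders by
induction, without a Leibniz formula for higher derivatives.\<close>

primrec reg :: "((real^'d::finite \<Rightarrow> complex) \<Rightarrow> bool) \<Rightarrow> nat \<Rightarrow> (real^'d \<Rightarrow> complex) \<Rightarrow> bool" where
  "reg Q 0 f \<longleftrightarrow> (\<forall>x. f differentiable at x) \<and> Q f"
| "reg Q (Suc n) f \<longleftrightarrow> (\<forall>x. f differentiable at x) \<and> Q f \<and> (\<forall>j. reg Q n (dpart j f))"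

definition rapid :: "(real^'d::finite \<Rightarrow> complex) \<Rightarrow> bool" where
  "rapid f \<longleftrightarrow> (\<forall>N::nat. \<exists>C. \<forall>x. (1 + norm x) ^ N * cmod (f x) \<le> C)"

definition polybd :: "(real^'d::finite \<Rightarrow> complex) \<Rightarrow> bool" where
  "polybd f \<longleftrightarrow> (\<exists>C. \<exists>N::nat. \<forall>x. cmod (f x) \<le> C * (1 + norm x) ^ N)"

text \<open>These functions multiply the Schwartz space into itself.\<close>

definition tame :: "(real^'d::finite \<Rightarrow> complex) \<Rightarrow> bool" where
  "tame f \<longleftrightarrow> (\<forall>n. reg polybd n f)"

lemma dparts_Nil [simp]: "dparts [] f = f"
  and dparts_snoc: "dparts (js @ [j]) f = dparts js (dpart j f)"
  and dparts_Cons: "dparts (j # js) f = dpart j (dparts js f)"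
  by (simp_all add: dparts_def)

text \<open>\<open>dparts\<close> applies the last letter of the word first, so the induction splits words at their end.\<close>

lemma reg_iff:
  "reg Q n f \<longleftrightarrow> (\<forall>js. length js \<le> n \<longrightarrow> (\<forall>x. dparts js f differentiable at x) \<and> Q (dparts js f))"
proof (induction n arbitrary: f)
  case 0
  then show ?case by simp
next
  case (Suc n)
  show ?case (is "?L \<longleftrightarrow> ?R")
  proof
    assume ?L
    show ?R
    proof (intro allI impI)
      fix js :: "'a list" assume l: "length js \<le> Suc n"
      show "(\<forall>x. dparts js f differentiable at x) \<and> Q (dparts js f)"
      proof (cases js rule: rev_cases)
        case Nil
        then show ?thesis using \<open>?L\<close> by simp
      next
        case (snoc ks j)
        have "reg Q n (dpart j f)" using \<open>?L\<close> by simp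
        then have "(\<forall>x. dparts ks (dpart j f) differentiable at x) \<and> Q (dparts ks (dpart j f))"
          using Suc.IH[of "dpart j f"] l snoc by simp
        then show ?thesis using snoc by (simp add: dparts_snoc)
      qed
    qed
  next
    assume R: ?R
    have 1: "reg Q n (dpart j f)" for j
      unfolding Suc.IH
    proof (intro allI impI)
      fix js :: "'a list" assume "length js \<le> n"
      then show "(\<forall>x. dparts js (dpart j f) differentiable at x) \<and> Q (dparts js (dpart j f))"
        using R[rule_format, of "js @ [j]"] by (simp add: dparts_snoc)
    qed
    then show ?L using R[rule_format, of "[]"] by simp
  qed
qed

lemma reg_differentiable: "reg Q n f \<Longrightarrow> f differentiable at x"
  by (cases n) auto

lemma reg_growth: "reg Q n f \<Longrightarrow> Q f"
  by (cases n) auto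

lemma reg_SucD: "reg Q (Suc n) f \<Longrightarrow> reg Q n f"
  by (auto simp: reg_iff)

lemma reg_mono: "reg Q n f \<Longrightarrow> (\<And>g. Q g \<Longrightarrow> Q' g) \<Longrightarrow> reg Q' n f"
  by (auto simp: reg_iff)

lemma schwartz_iff: "f \<in> schwartz \<longleftrightarrow> (\<forall>n. reg rapid n f)"
proof -
  have *: "(\<forall>N. bdd_above (range (\<lambda>x. (1 + norm x) ^ N * cmod (g x)))) \<longleftrightarrow> rapid g" for g :: "real^'a \<Rightarrow> complex"
    unfolding rapid_def bdd_above_def by fastforce
  have "f \<in> schwartz \<longleftrightarrow> (\<forall>js. (\<forall>x. dparts js f differentiable at x) \<and> rapid (dparts js f))"
    unfolding schwartz_def smooth_fun_def *[symmetric] by auto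
  also have "\<dots> \<longleftrightarrow> (\<forall>n. reg rapid n f)"
    unfolding reg_iff by blast
  finally show ?thesis .
qed

lemma dpart_eq:
  assumes "(f has_derivative f') (at x)"
  shows "dpart j f x = f' (axis j 1)"
  unfolding dpart_def using frechet_derivative_at[OF assms] by simp

lemma has_derivative_frechet:
  "f differentiable at x \<Longrightarrow> (f has_derivative frechet_derivative f (at x)) (at x)"
  by (simp add: frechet_derivative_works[symmetric])

lemma dpart_add:
  assumes "\<And>x. f differentiable at x" "\<And>x. g differentiable at x"
  shows "dpart j (\<lambda>x. f x + g x) = (\<lambda>x. dpart j f x + dpart j g x)"
proof
  fix x
  show "dpart j (\<lambda>x. f x + g x) x = dpart j f x + dpart j g x"
    using dpart_eq[OF has_derivative_add[OF has_derivative_frechet[OF assms(1)] has_derivative_frechet[OF assms(2)]], of j x]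
    by (simp add: dpart_def)
qed

lemma dpart_mult:
  assumes "\<And>x. f differentiable at x" "\<And>x. g differentiable at x"
  shows "dpart j (\<lambda>x. f x * g x) = (\<lambda>x. f x * dpart j g x + dpart j f x * g x)"
proof
  fix x
  show "dpart j (\<lambda>x. f x * g x) x = f x * dpart j g x + dpart j f x * g x"
    using dpart_eq[OF has_derivative_mult[OF has_derivative_frechet[OF assms(1)] has_derivative_frechet[OF assms(2)]], of j x]
    by (simp add: dpart_def)
qed

lemma dpart_const: "dpart j (\<lambda>x. c) = (\<lambda>x. 0)"
  by (rule ext, subst dpart_eq[OF has_derivative_const]) simp

lemma dpart_affine:
  assumes "\<And>x. f differentiable at x"
  shows "dpart j (\<lambda>x. f (h *\<^sub>R x + a)) = (\<lambda>x. of_real h * dpart j f (h *\<^sub>R x + a))"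
proof
  fix x
  have "((\<lambda>x. h *\<^sub>R x + a) has_derivative (\<lambda>y. h *\<^sub>R y)) (at x)"
    by (auto intro!: derivative_eq_intros)
  from has_derivative_compose[OF this has_derivative_frechet[OF assms]]
  have "((\<lambda>x. f (h *\<^sub>R x + a)) has_derivative
      (\<lambda>y. frechet_derivative f (at (h *\<^sub>R x + a)) (h *\<^sub>R y))) (at x)" .
  from dpart_eq[OF this, of j]
  have "dpart j (\<lambda>x. f (h *\<^sub>R x + a)) x = frechet_derivative f (at (h *\<^sub>R x + a)) (h *\<^sub>R axis j 1)" .
  also have "\<dots> = h *\<^sub>R frechet_derivative f (at (h *\<^sub>R x + a)) (axis j 1)"
    using linear_frechet_derivative[OF assms] by (simp add: linear_cmul)
  finally show "dpart j (\<lambda>x. f (h *\<^sub>R x + a)) x = of_real h * dpart j f (h *\<^sub>R x + a)"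
    by (simp add: dpart_def scaleR_conv_of_real)
qed

lemma reg_const:
  assumes "\<And>c. Q (\<lambda>x. c)"
  shows "reg Q n (\<lambda>x. c)"
proof (induction n arbitrary: c)
  case 0
  then show ?case using assms by simp
next
  case (Suc n)
  then show ?case using assms by (simp add: dpart_const)
qed

lemma reg_add:
  assumes "\<And>f g. Q f \<Longrightarrow> Q g \<Longrightarrow> Q (\<lambda>x. f x + g x)"
  shows "reg Q n f \<Longrightarrow> reg Q n g \<Longrightarrow> reg Q n (\<lambda>x. f x + g x)"
proof (induction n arbitrary: f g)
  case 0
  then show ?case using assms by auto
next
  case (Suc n)
  have d: "\<And>x. f differentiable at x" "\<And>x. g differentiable at x" using Suc.prems by auto
  show ?case using Suc d assms by (simp add: dpart_add[OF d])
qed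

text \<open>Closure of \<open>Q3\<close> under sums is required because the product rule yields two products.\<close>

lemma reg_prod:
  assumes Q: "\<And>f g. Q1 f \<Longrightarrow> Q2 g \<Longrightarrow> Q3 (\<lambda>x. f x * g x)"
      and "\<And>f g. Q3 f \<Longrightarrow> Q3 g \<Longrightarrow> Q3 (\<lambda>x. f x + g x)"
  shows "reg Q1 n f \<Longrightarrow> reg Q2 n g \<Longrightarrow> reg Q3 n (\<lambda>x. f x * g x)"
proof (induction n arbitrary: f g)
  case 0
  then show ?case using Q by auto
next
  case (Suc n)
  have d: "\<And>x. f differentiable at x" "\<And>x. g differentiable at x" using Suc.prems by auto
  have "reg Q3 n (\<lambda>x. f x * dpart j g x + dpart j f x * g x)" for j
  proof -
    have "reg Q3 n (\<lambda>x. f x * dpart j g x)" "reg Q3 n (\<lambda>x. dpart j f x * g x)"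
      using Suc.prems by (auto intro!: Suc.IH reg_SucD[of _ n f] reg_SucD[of _ n g])
    then show ?thesis by (intro reg_add[where Q=Q3] assms(2))
  qed
  then show ?case using Suc.prems d Q by (simp add: dpart_mult[OF d])
qed

lemma differentiable_affine:
  fixes f :: "real^'d::finite \<Rightarrow> complex"
  assumes "\<And>x. f differentiable at x"
  shows "(\<lambda>x. f (h *\<^sub>R x + a)) differentiable at x" "(\<lambda>x. c * f (h *\<^sub>R x + a)) differentiable at x"
proof -
  have "((\<lambda>x. h *\<^sub>R x + a) has_derivative (\<lambda>y. h *\<^sub>R y)) (at x)"
    by (auto intro!: derivative_eq_intros)
  from has_derivative_compose[OF this has_derivative_frechet[OF assms]]
  show *: "(\<lambda>x. f (h *\<^sub>R x + a)) differentiable at x" by (auto simp: differentiable_def)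
  show "(\<lambda>x. c * f (h *\<^sub>R x + a)) differentiable at x"
    by (rule differentiable_mult[OF differentiable_const *])
qed

text \<open>The constant \<open>c\<close> absorbs the inner derivative \<open>h\<close>, which makes the statement inductive.\<close>

lemma reg_affine:
  assumes "\<And>f. Q f \<Longrightarrow> Q (\<lambda>x. f (h *\<^sub>R x + a))" "\<And>f c. Q f \<Longrightarrow> Q (\<lambda>x. c * f x)"
  shows "reg Q n f \<Longrightarrow> reg Q n (\<lambda>x. c * f (h *\<^sub>R x + a))"
proof (induction n arbitrary: f c)
  case 0
  then have d: "f differentiable at x" for x by simp
  show ?case using 0 assms(1)[of f] assms(2)[of "\<lambda>x. f (h *\<^sub>R x + a)"] differentiable_affine[OF d] by simp
next
  case (Suc n)
  then have d: "f differentiable at x" for x by simp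
  note d' = differentiable_affine[OF d]
  have "dpart j (\<lambda>x. c * f (h *\<^sub>R x + a)) = (\<lambda>x. (c * of_real h) * dpart j f (h *\<^sub>R x + a))" for j
    using dpart_mult[OF differentiable_const d'(1), of j c h a] by (simp add: dpart_const dpart_affine[OF d] mult_ac)
  moreover have "reg Q n (\<lambda>x. (c * of_real h) * dpart j f (h *\<^sub>R x + a))" for j
    using Suc.prems by (intro Suc.IH) simp
  ultimately show ?case using Suc.prems assms(1)[of f] assms(2)[of "\<lambda>x. f (h *\<^sub>R x + a)"] d' by simp
qed

lemma rapidD:
  assumes "rapid f" obtains C where "C > 0" "\<And>x. (1 + norm x) ^ N * cmod (f x) \<le> C"
proof -
  obtain C where C: "\<And>x. (1 + norm x) ^ N * cmod (f x) \<le> C" using assms unfolding rapid_def by blast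
  show ?thesis by (rule that[of "max C 1"]) (use C in \<open>auto intro: max.coboundedI1\<close>)
qed

lemma polybdD:
  assumes "polybd f" obtains C N where "C > 0" "\<And>x. cmod (f x) \<le> C * (1 + norm x) ^ N"
proof -
  obtain C N where C: "\<And>x. cmod (f x) \<le> C * (1 + norm x) ^ N" using assms unfolding polybd_def by blast
  show ?thesis
  proof (rule that[of "max C 1"])
    fix x show "cmod (f x) \<le> max C 1 * (1 + norm x) ^ N"
      by (rule order_trans[OF C]) (auto intro!: mult_right_mono)
  qed auto
qed

lemma rapid_add: "rapid f \<Longrightarrow> rapid g \<Longrightarrow> rapid (\<lambda>x. f x + g x)"
  unfolding rapid_def
proof
  fix N assume "\<forall>N. \<exists>C. \<forall>x. (1 + norm x) ^ N * cmod (f x) \<le> C" "\<forall>N. \<exists>C. \<forall>x. (1 + norm x) ^ N * cmod (g x) \<le> C"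
  then obtain C D where *: "\<And>x. (1 + norm x) ^ N * cmod (f x) \<le> C" "\<And>x. (1 + norm x) ^ N * cmod (g x) \<le> D"
    by blast
  have "(1 + norm x) ^ N * cmod (f x + g x) \<le> C + D" for x
  proof -
    have "(1 + norm x) ^ N * cmod (f x + g x) \<le> (1 + norm x) ^ N * (cmod (f x) + cmod (g x))"
      by (intro mult_left_mono norm_triangle_ineq) auto
    also have "\<dots> \<le> C + D" using *[of x] by (simp add: distrib_left)
    finally show ?thesis .
  qed
  then show "\<exists>C. \<forall>x. (1 + norm x) ^ N * cmod (f x + g x) \<le> C" by blast
qed

lemma rapid_mult_polybd:
  assumes "rapid f" "polybd g" shows "rapid (\<lambda>x. f x * g x)"
  unfolding rapid_def
proof
  fix N
  obtain C M where C: "C > 0" "\<And>x. cmod (g x) \<le> C * (1 + norm x) ^ M" by (rule polybdD[OF assms(2)]) blast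
  obtain D where D: "D > 0" "\<And>x. (1 + norm x) ^ (N + M) * cmod (f x) \<le> D" by (rule rapidD[OF assms(1)]) blast
  have "(1 + norm x) ^ N * cmod (f x * g x) \<le> C * D" for x
  proof -
    have "(1 + norm x) ^ N * cmod (f x * g x) \<le> (1 + norm x) ^ N * (cmod (f x) * (C * (1 + norm x) ^ M))"
      unfolding norm_mult by (intro mult_left_mono C) auto
    also have "\<dots> = C * ((1 + norm x) ^ (N + M) * cmod (f x))" by (simp add: power_add)
    also have "\<dots> \<le> C * D" using C D by (intro mult_left_mono) auto
    finally show ?thesis .
  qed
  then show "\<exists>C. \<forall>x. (1 + norm x) ^ N * cmod (f x * g x) \<le> C" by blast
qed

lemma polybd_const: "polybd (\<lambda>x. c)"
  unfolding polybd_def by (rule exI[of _ "cmod c"], rule exI[of _ 0]) simp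

lemma rapid_cmult: "rapid f \<Longrightarrow> rapid (\<lambda>x. c * f x)"
  using rapid_mult_polybd[of f "\<lambda>_. c"] polybd_const[of c] by (simp add: mult.commute)

lemma polybd_add: assumes "polybd f" "polybd g" shows "polybd (\<lambda>x. f x + g x)"
proof -
  obtain C M where C: "C > 0" "\<And>x. cmod (f x) \<le> C * (1 + norm x) ^ M" by (rule polybdD[OF assms(1)]) blast
  obtain D N where D: "D > 0" "\<And>x. cmod (g x) \<le> D * (1 + norm x) ^ N" by (rule polybdD[OF assms(2)]) blast
  have "cmod (f x + g x) \<le> (C + D) * (1 + norm x) ^ (M + N)" for x
  proof -
    have "cmod (f x) \<le> C * (1 + norm x) ^ (M + N)"
      by (rule order_trans[OF C(2)]) (use C in \<open>auto intro!: mult_left_mono power_increasing\<close>)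
    moreover have "cmod (g x) \<le> D * (1 + norm x) ^ (M + N)"
      by (rule order_trans[OF D(2)]) (use D in \<open>auto intro!: mult_left_mono power_increasing\<close>)
    ultimately show ?thesis using norm_triangle_ineq[of "f x" "g x"] by (simp add: distrib_right)
  qed
  then show ?thesis unfolding polybd_def by blast
qed

lemma polybd_mult: assumes "polybd f" "polybd g" shows "polybd (\<lambda>x. f x * g x)"
proof -
  obtain C M where C: "C > 0" "\<And>x. cmod (f x) \<le> C * (1 + norm x) ^ M" by (rule polybdD[OF assms(1)]) blast
  obtain D N where D: "D > 0" "\<And>x. cmod (g x) \<le> D * (1 + norm x) ^ N" by (rule polybdD[OF assms(2)]) blast
  have "cmod (f x * g x) \<le> (C * D) * (1 + norm x) ^ (M + N)" for x
    unfolding norm_mult power_add using mult_mono[OF C(2)[of x] D(2)[of x]] C D by (simp add: mult_ac)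
  then show ?thesis unfolding polybd_def by blast
qed

text \<open>Peetre's inequality for natural exponents.\<close>

lemma peetre_pow: "(1 + norm (x + y)) ^ N \<le> (1 + norm x) ^ N * (1 + norm (y::'a::real_normed_vector)) ^ N"
proof -
  have "1 + norm (x + y) \<le> (1 + norm x) * (1 + norm y)"
    using norm_triangle_ineq[of x y] mult_nonneg_nonneg[OF norm_ge_zero[of x] norm_ge_zero[of y]]
    by (simp only: distrib_left distrib_right mult_1 mult_1_right)
  then have "(1 + norm (x + y)) ^ N \<le> ((1 + norm x) * (1 + norm y)) ^ N"
    by (intro power_mono) auto
  then show ?thesis by (simp add: power_mult_distrib)
qed

lemma rapid_affine:
  assumes "rapid f" "h \<noteq> 0" shows "rapid (\<lambda>x. f (h *\<^sub>R x + a))"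
  unfolding rapid_def
proof
  fix N
  obtain D where D: "D > 0" "\<And>x. (1 + norm x) ^ N * cmod (f x) \<le> D" by (rule rapidD[OF assms(1)]) blast
  define m where "m = max 1 (1 / \<bar>h\<bar>)"
  have m: "m \<ge> 1" "1 \<le> m * \<bar>h\<bar>" unfolding m_def using assms(2) by (auto simp: max_def field_simps)
  have "(1 + norm x) ^ N * cmod (f (h *\<^sub>R x + a)) \<le> m ^ N * (1 + norm a) ^ N * D" for x
  proof -
    have "1 + norm x \<le> m * (1 + norm (h *\<^sub>R x))"
      using m mult_right_mono[OF m(2), of "norm x"] by (simp add: algebra_simps)
    then have "(1 + norm x) ^ N \<le> (m * (1 + norm (h *\<^sub>R x))) ^ N"
      by (intro power_mono) auto
    then have "(1 + norm x) ^ N \<le> m ^ N * (1 + norm (h *\<^sub>R x)) ^ N"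
      by (simp add: power_mult_distrib)
    also have "(1 + norm (h *\<^sub>R x)) ^ N \<le> (1 + norm (h *\<^sub>R x + a)) ^ N * (1 + norm a) ^ N"
      using peetre_pow[of "h *\<^sub>R x + a" "-a" N] by simp
    finally have "(1 + norm x) ^ N \<le> m ^ N * ((1 + norm (h *\<^sub>R x + a)) ^ N * (1 + norm a) ^ N)"
      using m by (simp add: mult_left_mono)
    then have "(1 + norm x) ^ N * cmod (f (h *\<^sub>R x + a)) \<le>
        m ^ N * ((1 + norm (h *\<^sub>R x + a)) ^ N * (1 + norm a) ^ N) * cmod (f (h *\<^sub>R x + a))"
      by (rule mult_right_mono) simp
    also have "\<dots> = m ^ N * (1 + norm a) ^ N * ((1 + norm (h *\<^sub>R x + a)) ^ N * cmod (f (h *\<^sub>R x + a)))"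
      by simp
    also have "\<dots> \<le> m ^ N * (1 + norm a) ^ N * D" using m D by (intro mult_left_mono) auto
    finally show ?thesis .
  qed
  then show "\<exists>C. \<forall>x. (1 + norm x) ^ N * cmod (f (h *\<^sub>R x + a)) \<le> C" by blast
qed

lemma schwartz_differentiable: "f \<in> schwartz \<Longrightarrow> f differentiable at x"
  unfolding schwartz_iff using reg_differentiable by blast

lemma schwartz_cont: "f \<in> schwartz \<Longrightarrow> continuous_on A f"
  by (meson continuous_at_imp_continuous_on differentiable_imp_continuous_within schwartz_differentiable)

lemma schwartz_measurable: "f \<in> schwartz \<Longrightarrow> f \<in> borel_measurable borel"
  by (intro borel_measurable_continuous_onI schwartz_cont)

lemma schwartz_rapid: "f \<in> schwartz \<Longrightarrow> rapid f"
  unfolding schwartz_iff using reg_growth by blast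

lemma schwartz_dpart: "f \<in> schwartz \<Longrightarrow> dpart j f \<in> schwartz"
  unfolding schwartz_iff
proof
  fix n assume "\<forall>n. reg rapid n f"
  then have "reg rapid (Suc n) f" by blast
  then show "reg rapid n (dpart j f)" by simp
qed

lemma schwartz_dparts: "f \<in> schwartz \<Longrightarrow> dparts js f \<in> schwartz"
  by (induction js) (auto simp: dparts_Cons schwartz_dpart)

lemma schwartz_add: "f \<in> schwartz \<Longrightarrow> g \<in> schwartz \<Longrightarrow> (\<lambda>x. f x + g x) \<in> schwartz"
  unfolding schwartz_iff using reg_add[of rapid] rapid_add by blast

lemma schwartz_mult: "f \<in> schwartz \<Longrightarrow> tame g \<Longrightarrow> (\<lambda>x. f x * g x) \<in> schwartz"
  unfolding schwartz_iff tame_def using reg_prod[of rapid polybd rapid] rapid_add rapid_mult_polybd by blast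

lemma tame_add: "tame f \<Longrightarrow> tame g \<Longrightarrow> tame (\<lambda>x. f x + g x)"
  unfolding tame_def using reg_add[of polybd] polybd_add by blast

lemma tame_mult: "tame f \<Longrightarrow> tame g \<Longrightarrow> tame (\<lambda>x. f x * g x)"
  unfolding tame_def using reg_prod[of polybd polybd polybd] polybd_add polybd_mult by blast

lemma tame_const: "tame (\<lambda>x. c)"
  unfolding tame_def using reg_const[of polybd] polybd_const by blast

lemma schwartz_cmult: "f \<in> schwartz \<Longrightarrow> (\<lambda>x. c * f x) \<in> schwartz"
  using schwartz_mult[OF _ tame_const, of f c] by (simp add: mult.commute)

lemma schwartz_zero: "(\<lambda>x::real^'d::finite. 0) \<in> schwartz"
proof -
  have r: "rapid (\<lambda>x::real^'d. 0)" unfolding rapid_def by auto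
  have "reg rapid n (\<lambda>x::real^'d. 0)" for n
    by (induction n) (auto simp: r dpart_const)
  then show ?thesis unfolding schwartz_iff by simp
qed

lemma schwartz_imp_tame: "f \<in> schwartz \<Longrightarrow> tame f"
proof -
  have "rapid g \<Longrightarrow> polybd g" for g :: "real^'a \<Rightarrow> complex"
  proof -
    assume "rapid g"
    then obtain C where C: "\<And>x. (1 + norm x) ^ 0 * cmod (g x) \<le> C" by (rule rapidD) blast
    show "polybd g" unfolding polybd_def by (rule exI[of _ C], rule exI[of _ 0]) (use C in simp)
  qed
  then show "f \<in> schwartz \<Longrightarrow> tame f"
    unfolding schwartz_iff tame_def using reg_mono[of rapid] by blast
qed

lemma schwartz_affine: "f \<in> schwartz \<Longrightarrow> h \<noteq> 0 \<Longrightarrow> (\<lambda>x. f (h *\<^sub>R x + a)) \<in> schwartz"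
  unfolding schwartz_iff using reg_affine[of rapid h a _ _ 1, simplified] rapid_affine rapid_cmult by blast

lemma dpart_coord: "dpart j (\<lambda>x. complex_of_real (x $ i)) = (\<lambda>x. if i = j then 1 else 0)"
proof
  fix x
  have "((\<lambda>x. complex_of_real (x $ i)) has_derivative (\<lambda>y. complex_of_real (y $ i))) (at x)"
    by (intro bounded_linear_imp_has_derivative bounded_linear_compose[OF bounded_linear_of_real] bounded_linear_vec_nth)
  from dpart_eq[OF this, of j] show "dpart j (\<lambda>x. complex_of_real (x $ i)) x = (if i = j then 1 else 0)"
    by (simp add: axis_def)
qed

lemma coord_differentiable: "(\<lambda>x. complex_of_real ((x::real^'d::finite) $ i)) differentiable at x"
  by (intro bounded_linear_imp_differentiable bounded_linear_compose[OF bounded_linear_of_real] bounded_linear_vec_nth)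

lemma tame_coord: "tame (\<lambda>x. complex_of_real (x $ i))"
  unfolding tame_def
proof
  fix n
  have p: "polybd (\<lambda>x. complex_of_real (x $ i))"
    unfolding polybd_def
    by (rule exI[of _ 1], rule exI[of _ 1]) (auto intro: order_trans[OF component_le_norm_cart])
  show "reg polybd n (\<lambda>x. complex_of_real (x $ i))"
  proof (cases n)
    case 0 then show ?thesis by (simp add: p coord_differentiable)
  next
    case (Suc m)
    have "reg polybd m (dpart j (\<lambda>x. complex_of_real (x $ i)))" for j
      unfolding dpart_coord by (rule reg_const) (rule polybd_const)
    then show ?thesis using Suc by (simp add: p coord_differentiable)
  qed
qed

lemma has_derivative_cexp_inner:
  "((\<lambda>x. exp (c * of_real (a \<bullet> x))) has_derivative (\<lambda>y. c * of_real (a \<bullet> y) * exp (c * of_real (a \<bullet> x)))) (at x)"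
  for a :: "real^'d::finite" and c :: complex
proof -
  have 1: "((\<lambda>x. c * of_real (a \<bullet> x)) has_derivative (\<lambda>y. c * of_real (a \<bullet> y))) (at x)"
    by (intro has_derivative_mult_right has_derivative_of_real has_derivative_inner_right has_derivative_ident)
  have 2: "(exp has_derivative (\<lambda>y. exp (c * of_real (a \<bullet> x)) * y)) (at (c * of_real (a \<bullet> x)))"
    by (rule DERIV_exp[unfolded has_field_derivative_def])
  show ?thesis using has_derivative_compose[OF 1 2] by (simp add: mult_ac)
qed

lemma tame_cis: "tame (\<lambda>x. exp (\<i> * of_real (a \<bullet> x)))"
  unfolding tame_def
proof
  have d: "dpart j (\<lambda>x. exp (\<i> * of_real (a \<bullet> x))) = (\<lambda>x. \<i> * of_real (a $ j) * exp (\<i> * of_real (a \<bullet> x)))" for j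
    by (rule ext, subst dpart_eq[OF has_derivative_cexp_inner]) (simp add: inner_axis)
  have df: "(\<lambda>x. exp (\<i> * of_real (a \<bullet> x))) differentiable at x" for x
    unfolding differentiable_def by (rule exI) (rule has_derivative_cexp_inner)
  have p: "polybd (\<lambda>x. exp (\<i> * of_real (a \<bullet> x)))"
    unfolding polybd_def by (rule exI[of _ 1], rule exI[of _ 0]) simp
  fix n
  show "reg polybd n (\<lambda>x. exp (\<i> * of_real (a \<bullet> x)))"
  proof (induction n)
    case 0 show ?case using df p by simp
  next
    case (Suc n)
    have "reg polybd n (\<lambda>x. (\<i> * of_real (a $ j)) * exp (\<i> * of_real (a \<bullet> x)))" for j
      by (rule reg_prod[of polybd polybd polybd, OF polybd_mult polybd_add reg_const[of polybd, OF polybd_const] Suc])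
    then show ?case using df p by (simp add: d)
  qed
qed

lemma schwartz_sum: "finite A \<Longrightarrow> (\<And>i. i \<in> A \<Longrightarrow> f i \<in> schwartz) \<Longrightarrow> (\<lambda>x. \<Sum>i\<in>A. f i x) \<in> schwartz"
  by (induction A rule: finite_induct) (auto simp: schwartz_zero schwartz_add)

lemma tame_sum: "finite A \<Longrightarrow> (\<And>i. i \<in> A \<Longrightarrow> tame (f i)) \<Longrightarrow> tame (\<lambda>x. \<Sum>i\<in>A. f i x)"
  by (induction A rule: finite_induct) (auto simp: tame_const tame_add)

lemma tame_inner: "tame (\<lambda>x. complex_of_real (a \<bullet> x))"
proof -
  have "tame (\<lambda>x. \<Sum>i\<in>UNIV. complex_of_real (a $ i) * complex_of_real (x $ i))"
    by (intro tame_sum tame_mult tame_const tame_coord) auto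
  then show ?thesis by (simp add: inner_vec_def)
qed

section \<open>The Fourier transform on the Schwartz space\<close>

lemma nn_integral_lborel_affine:
  fixes f :: "'a::euclidean_space \<Rightarrow> ennreal"
  assumes [measurable]: "f \<in> borel_measurable borel" and "h \<noteq> 0"
  shows "(\<integral>\<^sup>+x. f x \<partial>lborel) = ennreal (\<bar>h\<bar> ^ DIM('a)) * (\<integral>\<^sup>+x. f (h *\<^sub>R x + t) \<partial>lborel)"
  by (subst lborel_affine[OF assms(2), of t])
     (simp add: nn_integral_density nn_integral_distr nn_integral_cmult add.commute)

lemma integrable_lborel_affine:
  fixes f :: "'a::euclidean_space \<Rightarrow> 'b::{banach, second_countable_topology}"
  assumes f: "integrable lborel f" and h: "h \<noteq> 0"
  shows "integrable lborel (\<lambda>x. f (h *\<^sub>R x + t))"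
proof -
  have [measurable]: "f \<in> borel_measurable borel" using f by auto
  have "(\<integral>\<^sup>+x. ennreal (norm (f x)) \<partial>lborel) < \<infinity>" using f by (simp add: integrable_iff_bounded)
  then show ?thesis unfolding integrable_iff_bounded
    by (subst (asm) nn_integral_lborel_affine[OF _ h, of _ t]) (use h in \<open>auto simp: ennreal_mult_less_top\<close>)
qed

lemma integral_lborel_affine:
  fixes f :: "'a::euclidean_space \<Rightarrow> 'b::{banach, second_countable_topology}"
  assumes h: "h \<noteq> 0"
  shows "(LINT x|lborel. f x) = (\<bar>h\<bar> ^ DIM('a)) *\<^sub>R (LINT x|lborel. f (h *\<^sub>R x + t))"
proof cases
  assume f: "integrable lborel f"
  then have [measurable]: "f \<in> borel_measurable borel" by auto
  show ?thesis
    using h integrable_lborel_affine[OF f h, of t]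
    by (subst lborel_affine[OF h, of t])
       (simp add: integral_density integral_distr add.commute)
next
  assume nf: "\<not> integrable lborel f"
  have "\<not> integrable lborel (\<lambda>x. f (h *\<^sub>R x + t))"
  proof
    assume "integrable lborel (\<lambda>x. f (h *\<^sub>R x + t))"
    from integrable_lborel_affine[OF this, of "1/h" "- ((1/h) *\<^sub>R t)"] show False using h nf
      by (simp add: scaleR_diff_right scaleR_minus_left)
  qed
  then show ?thesis using nf by (simp add: not_integrable_integral_eq)
qed

lemma emeasure_ball_scale:
  fixes r :: real
  assumes "r > 0"
  shows "emeasure lborel (ball (0::'a::euclidean_space) r) = ennreal (r ^ DIM('a)) * emeasure lborel (ball (0::'a) 1)"
proof -
  have "emeasure lborel (ball (0::'a) r) = (\<integral>\<^sup>+x. indicator (ball (0::'a) r) x \<partial>lborel)" by simp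
  also have "\<dots> = ennreal (r ^ DIM('a)) * (\<integral>\<^sup>+x. indicator (ball (0::'a) r) (r *\<^sub>R x + 0) \<partial>lborel)"
    by (rule nn_integral_lborel_affine[OF _ less_imp_neq[OF assms, symmetric], of _ 0, unfolded abs_of_pos[OF assms]]) (simp add: borel_measurable_indicator)
  also have "(\<lambda>x. indicator (ball (0::'a) r) (r *\<^sub>R x + 0) :: ennreal) = indicator (ball 0 1)"
    using assms by (auto simp: indicator_def fun_eq_iff)
  finally show ?thesis by simp
qed

text \<open>Comparison with a series over the balls of radius \<open>n + 1\<close>: their volumes grow like \<open>(n + 1)\<^sup>d\<close>, so the
two extra powers leave a convergent series.\<close>

lemma integrable_weight:
  "integrable lborel (\<lambda>x::'a::euclidean_space. 1 / (1 + norm x) ^ (DIM('a) + 2))"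
proof -
  let ?N = "DIM('a) + 2"
  have [measurable]: "ball (0::'a) r \<in> sets borel" for r by simp
  have s: "summable (\<lambda>n. 1 / real (Suc n) ^ 2)"
    using inverse_power_summable[of 2, where 'a=real] by (subst summable_Suc_iff) (simp add: divide_inverse)
  define c where "c = measure lborel (ball (0::'a) 1)"
  have c: "emeasure lborel (ball (0::'a) 1) = ennreal c"
    unfolding c_def by (intro emeasure_eq_ennreal_measure) (use emeasure_lborel_ball_finite[of "0::'a" 1] in auto)
  have "(\<integral>\<^sup>+x. ennreal (1 / (1 + norm x) ^ ?N) \<partial>(lborel :: 'a measure))
      \<le> (\<integral>\<^sup>+x. (\<Sum>n. ennreal (1 / real (Suc n) ^ ?N) * indicator (ball 0 (real (Suc n))) x) \<partial>(lborel :: 'a measure))"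
  proof (intro nn_integral_mono)
    fix x :: 'a
    define n where "n = nat \<lfloor>norm x\<rfloor>"
    have n: "real n \<le> norm x" "norm x < real (Suc n)" unfolding n_def using floor_correct[of "norm x"] norm_ge_zero[of x] by (simp_all add: of_nat_nat) linarith?
    have "ennreal (1 / (1 + norm x) ^ ?N) \<le> ennreal (1 / real (Suc n) ^ ?N) * indicator (ball 0 (real (Suc n))) x"
      using n by (auto intro!: ennreal_leI divide_left_mono power_mono simp del: power_Suc)
    also have "\<dots> \<le> (\<Sum>n. ennreal (1 / real (Suc n) ^ ?N) * indicator (ball 0 (real (Suc n))) x)"
    proof -
      have "f n \<le> (\<Sum>n. f n)" for f :: "nat \<Rightarrow> ennreal" using sum_le_suminf[of f "{n}"] by simp
      then show ?thesis .
    qed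
    finally show "ennreal (1 / (1 + norm x) ^ ?N) \<le> (\<Sum>n. ennreal (1 / real (Suc n) ^ ?N) * indicator (ball 0 (real (Suc n))) x)" .
  qed
  also have "\<dots> = (\<Sum>n. ennreal (1 / real (Suc n) ^ ?N) * emeasure lborel (ball (0::'a) (real (Suc n))))"
    by (subst nn_integral_suminf) (auto simp: nn_integral_cmult_indicator)
  also have "\<dots> = (\<Sum>n. ennreal (c * (1 / real (Suc n) ^ 2)))"
  proof (intro suminf_cong)
    fix n
    have "ennreal (1 / real (Suc n) ^ ?N) * emeasure lborel (ball (0::'a) (real (Suc n)))
       = ennreal (1 / real (Suc n) ^ ?N * (real (Suc n) ^ DIM('a) * c))"
      unfolding emeasure_ball_scale[OF of_nat_0_less_iff[THEN iffD2, OF zero_less_Suc]] c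
      by (subst ennreal_mult') (auto simp: ennreal_mult' c_def simp del: power_Suc of_nat_Suc times_divide_eq_left times_divide_eq_right)
    also have "1 / real (Suc n) ^ ?N * (real (Suc n) ^ DIM('a) * c) = c * (1 / real (Suc n) ^ 2)"
    proof -
      have "1 / x ^ ?N * (x ^ DIM('a) * c) = c * (1 / x ^ 2)" if "x > 0" for x :: real
        using that by (simp add: power2_eq_square)
      then show ?thesis using of_nat_0_less_iff[THEN iffD2, OF zero_less_Suc] by blast
    qed
    finally show "ennreal (1 / real (Suc n) ^ ?N) * emeasure lborel (ball (0::'a) (real (Suc n))) = ennreal (c * (1 / real (Suc n) ^ 2))" .
  qed
  also have "\<dots> = ennreal (\<Sum>n. c * (1 / real (Suc n) ^ 2))"
    using s by (intro suminf_ennreal2 summable_mult) (auto simp: c_def)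
  also have "\<dots> < \<infinity>" by simp
  finally have "(\<integral>\<^sup>+x. ennreal (1 / (1 + norm x) ^ ?N) \<partial>(lborel :: 'a measure)) < \<infinity>" .
  then show ?thesis by (subst integrable_iff_bounded) auto
qed

lemma integrable_weight_ge:
  assumes "N \<ge> CARD('d) + 2"
  shows "integrable lborel (\<lambda>x::real^'d::finite. 1 / (1 + norm x) ^ N)"
  by (rule Bochner_Integration.integrable_bound[OF integrable_weight[where 'a="real^'d"]])
     (use assms in \<open>auto intro!: AE_I2 divide_left_mono power_increasing[of "CARD('d) + 2", simplified] mult_pos_pos zero_less_power simp: add_pos_nonneg\<close>)

lemma rapid_integrable:
  fixes f :: "real^'d::finite \<Rightarrow> complex"
  assumes "rapid f" and [measurable]: "f \<in> borel_measurable borel"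
  shows "integrable lborel f"
proof -
  let ?N = "CARD('d) + 2"
  obtain C where C: "C > 0" "\<And>x. (1 + norm x) ^ ?N * cmod (f x) \<le> C" by (rule rapidD[OF assms(1)]) blast
  have pos: "(1 + norm x) ^ ?N > 0" for x :: "real^'d"
    by (intro zero_less_power) (simp add: add_pos_nonneg)
  show ?thesis
  proof (rule Bochner_Integration.integrable_bound)
    show "integrable lborel (\<lambda>x::real^'d. C * (1 / (1 + norm x) ^ ?N))"
      by (intro integrable_mult_right integrable_weight_ge) auto
    show "AE x in lborel. norm (f x) \<le> norm (C * (1 / (1 + norm x) ^ ?N))"
    proof (rule AE_I2)
      fix x :: "real^'d"
      have "cmod (f x) \<le> C * (1 / (1 + norm x) ^ ?N)"
        using C(2)[of x] pos[of x] by (simp add: field_simps)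
      then show "norm (f x) \<le> norm (C * (1 / (1 + norm x) ^ ?N))" using C(1) by simp
    qed
  qed auto
qed

lemma schwartz_integrable: "f \<in> schwartz \<Longrightarrow> integrable lborel f"
  by (intro rapid_integrable schwartz_rapid schwartz_measurable)

lemma has_derivative_quadratic:
  fixes f :: "'a::real_normed_vector \<Rightarrow> 'b::real_normed_vector"
  assumes "bounded_linear L" and b: "\<And>h. norm (f (x + h) - f x - L h) \<le> C * (norm h)\<^sup>2"
  shows "(f has_derivative L) (at x)"
  unfolding has_derivative_at
proof
  show "(\<lambda>h. norm (f (x + h) - f x - L h) / norm h) \<midarrow>0\<rightarrow> 0"
  proof (rule tendsto_sandwich)
    show "\<forall>\<^sub>F h in at 0. 0 \<le> norm (f (x + h) - f x - L h) / norm h" by simp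
    show "\<forall>\<^sub>F h in at 0. norm (f (x + h) - f x - L h) / norm h \<le> C * norm h"
      using b by (auto intro!: always_eventually simp: divide_simps power2_eq_square mult_ac)
    show "((\<lambda>h. C * norm h) \<longlongrightarrow> 0) (at 0)" by (auto intro!: tendsto_eq_intros)
  qed simp
qed fact

lemma fourier_integrable:
  assumes "f \<in> schwartz"
  shows "integrable lborel (\<lambda>x. f x * exp (- \<i> * of_real (\<omega> \<bullet> x)))"
proof -
  have "(\<lambda>x. f x * exp (\<i> * of_real ((-\<omega>) \<bullet> x))) \<in> schwartz"
    by (intro schwartz_mult assms tame_cis)
  then show ?thesis by (intro schwartz_integrable) simp
qed

lemma schwartz_coord: "f \<in> schwartz \<Longrightarrow> (\<lambda>x. c * of_real (x $ j) * f x) \<in> schwartz"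
  using schwartz_mult[OF _ tame_mult[OF tame_const tame_coord], of f c j] by (simp add: mult_ac)

text \<open>Differentiation under the integral sign: the second-order Taylor bound of the exponential is
integrated against \<open>f\<close>, which leaves the integrable factor \<open>|x|\<^sup>2 |f(x)|\<close>.\<close>

lemma has_derivative_fourier:
  fixes f :: "real^'d::finite \<Rightarrow> complex"
  assumes f: "f \<in> schwartz"
  shows "(fourier f has_derivative (\<lambda>h. \<Sum>j\<in>UNIV. of_real (h $ j) * fourier (\<lambda>x. - \<i> * of_real (x $ j) * f x) \<omega>)) (at \<omega>)"
    (is "(_ has_derivative ?L) _")
proof (rule has_derivative_quadratic)
  show "bounded_linear ?L"
  proof (intro bounded_linear_sum)
    fix i :: 'd
    have "bounded_linear (\<lambda>h::real^'d. complex_of_real (h $ i))"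
      by (rule bounded_linear_compose[OF bounded_linear_of_real bounded_linear_vec_nth])
    then show "bounded_linear (\<lambda>h. of_real (h $ i) * fourier (\<lambda>x. - \<i> * of_real (x $ i) * f x) \<omega>)"
      by (rule bounded_linear_mult_const)
  qed
  have xx: "(\<lambda>x. of_real (x \<bullet> x) * f x) \<in> schwartz"
  proof -
    have "(\<lambda>x. \<Sum>j\<in>UNIV. 1 * of_real (x $ j) * (1 * of_real (x $ j) * f x)) \<in> schwartz"
      by (intro schwartz_sum schwartz_coord f) auto
    then show ?thesis by (simp add: inner_vec_def sum_distrib_left sum_distrib_right mult_ac)
  qed
  fix h
  let ?e = "\<lambda>\<omega> x. exp (- \<i> * of_real (\<omega> \<bullet> x))"
  have L: "?L h = (LINT x|lborel. f x * ?e \<omega> x * (- \<i> * of_real (h \<bullet> x)))"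
  proof -
    have "?L h = (\<Sum>j\<in>UNIV. (LINT x|lborel. of_real (h $ j) * (- \<i> * of_real (x $ j) * f x * ?e \<omega> x)))"
      by (simp add: fourier_def)
    also have "\<dots> = (LINT x|lborel. (\<Sum>j\<in>UNIV. of_real (h $ j) * (- \<i> * of_real (x $ j) * f x * ?e \<omega> x)))"
      by (intro Bochner_Integration.integral_sum[symmetric] integrable_mult_right fourier_integrable schwartz_coord f)
    also have "\<dots> = (LINT x|lborel. f x * ?e \<omega> x * (- \<i> * of_real (h \<bullet> x)))"
      by (intro Bochner_Integration.integral_cong) (auto simp: inner_vec_def sum_distrib_left sum_distrib_right mult_ac intro!: sum.cong)
    finally show ?thesis .
  qed
  have iL: "integrable lborel (\<lambda>x. f x * ?e \<omega> x * (- \<i> * of_real (h \<bullet> x)))"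
  proof -
    have "(\<lambda>x. f x * (exp (\<i> * of_real ((-\<omega>) \<bullet> x)) * (- \<i> * of_real (h \<bullet> x)))) \<in> schwartz"
      by (intro schwartz_mult f tame_mult tame_cis tame_const tame_inner)
    then show ?thesis using schwartz_integrable by (fastforce simp: mult_ac)
  qed
  have "fourier f (\<omega> + h) - fourier f \<omega> - ?L h =
      (LINT x|lborel. f x * ?e (\<omega> + h) x - f x * ?e \<omega> x - f x * ?e \<omega> x * (- \<i> * of_real (h \<bullet> x)))"
    unfolding L unfolding fourier_def
    by (simp only: Bochner_Integration.integral_diff fourier_integrable f iL Bochner_Integration.integrable_diff)
  also have "norm \<dots> \<le> (LINT x|lborel. (norm h)\<^sup>2 * cmod (of_real (x \<bullet> x) * f x))"
  proof (rule Bochner_Integration.integral_norm_bound_integral)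
    show "integrable lborel (\<lambda>x. f x * ?e (\<omega> + h) x - f x * ?e \<omega> x - f x * ?e \<omega> x * (- \<i> * of_real (h \<bullet> x)))"
      by (intro Bochner_Integration.integrable_diff fourier_integrable f iL)
    show "integrable lborel (\<lambda>x. (norm h)\<^sup>2 * cmod (of_real (x \<bullet> x) * f x))"
      by (intro integrable_mult_right integrable_norm schwartz_integrable xx)
    fix x
    have "f x * ?e (\<omega> + h) x - f x * ?e \<omega> x - f x * ?e \<omega> x * (- \<i> * of_real (h \<bullet> x))
      = f x * ?e \<omega> x * (exp (- \<i> * of_real (h \<bullet> x)) - (1 + (- \<i> * of_real (h \<bullet> x))))"
      by (simp add: inner_add_left exp_add[symmetric] algebra_simps)
    moreover have "cmod (?e \<omega> x) = 1" by simp
    moreover have "cmod (exp (- \<i> * of_real (h \<bullet> x)) - (1 + (- \<i> * of_real (h \<bullet> x)))) \<le> (h \<bullet> x)\<^sup>2"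
      using Taylor_exp[of "- \<i> * complex_of_real (h \<bullet> x)" 1] by (simp add: norm_mult power2_eq_square)
    moreover have "(h \<bullet> x)\<^sup>2 \<le> (norm h)\<^sup>2 * (x \<bullet> x)"
      using Cauchy_Schwarz_ineq[of h x] by (simp add: power2_norm_eq_inner)
    ultimately show "cmod (f x * ?e (\<omega> + h) x - f x * ?e \<omega> x - f x * ?e \<omega> x * (- \<i> * of_real (h \<bullet> x)))
       \<le> (norm h)\<^sup>2 * cmod (of_real (x \<bullet> x) * f x)"
      by (simp add: norm_mult mult_left_mono mult.commute[of "cmod (f x)"] mult.assoc[symmetric] mult_right_mono del: exp_minus)
  qed
  also have "\<dots> = (LINT x|lborel. cmod (of_real (x \<bullet> x) * f x)) * (norm h)\<^sup>2" by simp
  finally show "norm (fourier f (\<omega> + h) - fourier f \<omega> - ?L h) \<le> (LINT x|lborel. cmod (of_real (x \<bullet> x) * f x)) * (norm h)\<^sup>2" .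
qed

lemma fourier_differentiable: "f \<in> schwartz \<Longrightarrow> fourier f differentiable (at \<omega>)"
  unfolding differentiable_def by (rule exI) (rule has_derivative_fourier)

lemma dpart_fourier:
  assumes f: "f \<in> schwartz"
  shows "dpart j (fourier f) = fourier (\<lambda>x. - \<i> * of_real (x $ j) * f x)"
proof
  fix \<omega>
  have "dpart j (fourier f) \<omega> = (\<Sum>i\<in>UNIV. of_real (axis j 1 $ i) * fourier (\<lambda>x. - \<i> * of_real (x $ i) * f x) \<omega>)"
    by (rule dpart_eq[OF has_derivative_fourier[OF f]])
  also have "\<dots> = (\<Sum>i\<in>UNIV. if i = j then fourier (\<lambda>x. - \<i> * of_real (x $ i) * f x) \<omega> else 0)"
    by (intro sum.cong) (auto simp: axis_def)
  finally show "dpart j (fourier f) \<omega> = fourier (\<lambda>x. - \<i> * of_real (x $ j) * f x) \<omega>" by simp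
qed

lemma has_derivative_dpart:
  fixes f :: "real^'d::finite \<Rightarrow> complex"
  assumes "f differentiable at x"
  shows "(f has_derivative (\<lambda>y. \<Sum>j\<in>UNIV. of_real (y $ j) * dpart j f x)) (at x)"
proof -
  have l: "linear (frechet_derivative f (at x))" using linear_frechet_derivative[OF assms] .
  have "frechet_derivative f (at x) y = (\<Sum>j\<in>UNIV. of_real (y $ j) * dpart j f x)" for y
  proof -
    have "frechet_derivative f (at x) y = frechet_derivative f (at x) (\<Sum>j\<in>UNIV. (y $ j) *\<^sub>R axis j 1)"
      using basis_expansion[of y] by (simp add: scalar_mult_eq_scaleR)
    also have "\<dots> = (\<Sum>j\<in>UNIV. (y $ j) *\<^sub>R frechet_derivative f (at x) (axis j 1))"
      using l by (simp add: linear_sum linear_cmul)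
    finally show ?thesis by (simp add: dpart_def scaleR_conv_of_real)
  qed
  then show ?thesis using has_derivative_frechet[OF assms] by presburger
qed

lemma has_vector_derivative_ray:
  fixes f :: "real^'d::finite \<Rightarrow> complex"
  assumes "\<And>x. f differentiable at x"
  shows "((\<lambda>t. f (x + t *\<^sub>R y)) has_vector_derivative (\<Sum>j\<in>UNIV. of_real (y $ j) * dpart j f (x + t *\<^sub>R y))) (at t within S)"
proof -
  have 1: "((\<lambda>t. x + t *\<^sub>R y) has_derivative (\<lambda>u. u *\<^sub>R y)) (at t within S)"
    by (auto intro!: derivative_eq_intros)
  from has_derivative_compose[OF this has_derivative_dpart[OF assms]]
  show ?thesis unfolding has_vector_derivative_def
    by (simp add: scaleR_right.sum scaleR_conv_of_real[where 'a=complex] sum_distrib_left mult.assoc)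
qed

text \<open>This dominates Taylor remainders: the shift \<open>y\<close> stays in a ball while the bound keeps its decay in \<open>x\<close>.\<close>

lemma rapid_shift_bound:
  fixes f :: "real^'d::finite \<Rightarrow> complex"
  assumes "rapid f"
  obtains C where "C > 0" "\<And>x y. norm y \<le> 1 \<Longrightarrow> cmod (f (x + y)) \<le> C / (1 + norm x) ^ N"
proof -
  obtain C where C: "C > 0" "\<And>x. (1 + norm x) ^ N * cmod (f x) \<le> C" by (rule rapidD[OF assms(1)]) blast
  show thesis
  proof (rule that[of "2 ^ N * C"])
    show "2 ^ N * C > 0" using C by simp
    fix x y :: "real^'d" assume y: "norm y \<le> 1"
    have "(1 + norm x) ^ N \<le> (1 + norm (x + y)) ^ N * (1 + norm y) ^ N"
      using peetre_pow[of "x + y" "-y" N] by simp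
    also have "\<dots> \<le> (1 + norm (x + y)) ^ N * 2 ^ N" using y by (intro mult_left_mono power_mono) auto
    finally have "(1 + norm x) ^ N * cmod (f (x + y)) \<le> (1 + norm (x + y)) ^ N * 2 ^ N * cmod (f (x + y))"
      by (rule mult_right_mono) simp
    also have "\<dots> \<le> 2 ^ N * C" using C(2)[of "x + y"] by (simp add: mult_ac)
    finally show "cmod (f (x + y)) \<le> 2 ^ N * C / (1 + norm x) ^ N"
      by (subst pos_le_divide_eq) (auto intro!: zero_less_power simp: add_pos_nonneg mult.commute)
  qed
qed

text \<open>By translation invariance the increments of \<open>g\<close> along a coordinate axis have integral 0.  The
difference quotient with step \<open>t\<close> differs from the partial derivative by at most \<open>t\<close> times a fixed integrable
function, so the integral of the derivative vanishes in the limit.\<close>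

lemma integral_dpart_zero:
  fixes g :: "real^'d::finite \<Rightarrow> complex"
  assumes g: "g \<in> schwartz"
  shows "(LINT x|lborel. dpart j g x) = 0"
proof -
  let ?N = "CARD('d) + 2" and ?e = "axis j 1 :: real^'d"
  let ?g1 = "dpart j g" and ?g2 = "dpart j (dpart j g)"
  have g1: "?g1 \<in> schwartz" and g2: "?g2 \<in> schwartz" by (intro schwartz_dpart g)+
  obtain C where C: "C > 0" "\<And>x y. norm y \<le> 1 \<Longrightarrow> cmod (?g2 (x + y)) \<le> C / (1 + norm x) ^ ?N"
    by (rule rapid_shift_bound[OF schwartz_rapid[OF g2]]) blast
  have e: "(\<Sum>i\<in>UNIV. of_real (?e $ i) * c i) = c j" for c :: "'d \<Rightarrow> complex"
  proof -
    have "(\<Sum>i\<in>UNIV. of_real (?e $ i) * c i) = (\<Sum>i\<in>UNIV. if i = j then c i else 0)"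
      by (intro sum.cong) (auto simp: axis_def)
    then show ?thesis by simp
  qed
  have vd: "((\<lambda>t. f (x + t *\<^sub>R ?e)) has_vector_derivative dpart j f (x + t *\<^sub>R ?e)) (at t within S)"
    if "f \<in> schwartz" for f x t S
    using has_vector_derivative_ray[OF schwartz_differentiable[OF that], of x ?e t S] unfolding e .
  have quad: "cmod (g (x + t *\<^sub>R ?e) - g x - t *\<^sub>R ?g1 x) \<le> t\<^sup>2 * (C / (1 + norm x) ^ ?N)" if t: "0 < t" "t \<le> 1" for x t
  proof -
    let ?B = "C / (1 + norm x) ^ ?N"
    have B0: "?B \<ge> 0" using C by simp
    have 1: "cmod (?g1 (x + u *\<^sub>R ?e) - ?g1 x) \<le> t * ?B" if u: "u \<in> {0..t}" for u
    proof -
      have "norm (?g1 (x + u *\<^sub>R ?e) - ?g1 (x + 0 *\<^sub>R ?e)) \<le> ?B * norm (u - 0)"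
      proof (rule differentiable_bound[where S="{0..t}"])
        show "((\<lambda>t. ?g1 (x + t *\<^sub>R ?e)) has_derivative (\<lambda>h. h *\<^sub>R ?g2 (x + v *\<^sub>R ?e))) (at v within {0..t})"
          if "v \<in> {0..t}" for v
          using vd[OF g1] unfolding has_vector_derivative_def .
        show "onorm (\<lambda>h. h *\<^sub>R ?g2 (x + v *\<^sub>R ?e)) \<le> ?B" if "v \<in> {0..t}" for v
        proof (rule onorm_le)
          fix h :: real
          have "cmod (?g2 (x + v *\<^sub>R ?e)) \<le> ?B" using that t by (intro C(2)) auto
          then have "cmod (?g2 (x + v *\<^sub>R ?e)) * norm h \<le> ?B * norm h" by (rule mult_right_mono) simp
          then show "norm (h *\<^sub>R ?g2 (x + v *\<^sub>R ?e)) \<le> ?B * norm h" by (simp add: mult.commute[of "cmod _"])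
        qed
      qed (use u t in auto)
      also have "\<dots> \<le> t * ?B" using u B0 by (subst mult.commute) (intro mult_right_mono, auto)
      finally show ?thesis by simp
    qed
    have "norm (g (x + t *\<^sub>R ?e) - g (x + 0 *\<^sub>R ?e) - (t - 0) *\<^sub>R ?g1 (x + 0 *\<^sub>R ?e)) \<le> norm (t - 0) * (t * ?B)"
      by (rule vector_differentiable_bound_linearization[where S="{0..t}" and f="\<lambda>t. g (x + t *\<^sub>R ?e)" and f'="\<lambda>t. ?g1 (x + t *\<^sub>R ?e)" and ?x0.0=0])
         (use t 1 vd[OF g] in \<open>auto simp: closed_segment_eq_real_ivl\<close>)
    then show ?thesis using t by (simp add: power2_eq_square mult.assoc)
  qed
  define K where "K = (LINT x|lborel. C / (1 + norm (x::real^'d)) ^ ?N)"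
  have iw: "integrable lborel (\<lambda>x::real^'d. C / (1 + norm x) ^ ?N)"
  proof -
    have "integrable lborel (\<lambda>x::real^'d. C * (1 / (1 + norm x) ^ ?N))"
      by (intro integrable_mult_right integrable_weight_ge) simp
    then show ?thesis by simp
  qed
  have "cmod (LINT x|lborel. ?g1 x) \<le> t * K" if t: "0 < t" "t \<le> 1" for t
  proof -
    have i: "integrable lborel g" "integrable lborel ?g1" "integrable lborel (\<lambda>x. g (x + t *\<^sub>R ?e))"
      using g g1 schwartz_affine[OF g, of 1 "t *\<^sub>R ?e"] by (auto intro!: schwartz_integrable)
    have "(LINT x|lborel. g (x + t *\<^sub>R ?e)) = (LINT x|lborel. g x)"
      using integral_lborel_affine[of 1 g "t *\<^sub>R ?e"] by simp
    then have "t * cmod (LINT x|lborel. ?g1 x) = cmod (LINT x|lborel. g (x + t *\<^sub>R ?e) - g x - t *\<^sub>R ?g1 x)"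
      using i t by (simp add: Bochner_Integration.integral_diff)
    also have "\<dots> \<le> (LINT x|lborel. t\<^sup>2 * (C / (1 + norm (x::real^'d)) ^ ?N))"
    proof (rule Bochner_Integration.integral_norm_bound_integral)
      show "integrable lborel (\<lambda>x::real^'d. t\<^sup>2 * (C / (1 + norm x) ^ ?N))"
        by (rule integrable_mult_right[OF iw])
    qed (use quad[OF t] i in auto)
    also have "\<dots> = t * (t * K)" unfolding K_def power2_eq_square mult.assoc by (simp only: integral_mult_right_zero)
    finally show ?thesis using t by (simp add: mult_le_cancel_left)
  qed
  then have *: "\<And>t. 0 < t \<Longrightarrow> t \<le> 1 \<Longrightarrow> cmod (LINT x|lborel. ?g1 x) \<le> t * K" .
  have "cmod (LINT x|lborel. ?g1 x) \<le> 0"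
  proof (rule tendsto_lowerbound)
    show "((\<lambda>t. t * K) \<longlongrightarrow> 0) (at_right 0)" by (auto intro!: tendsto_eq_intros)
    show "\<forall>\<^sub>F t in at_right 0. cmod (LINT x|lborel. ?g1 x) \<le> t * K"
      unfolding eventually_at_right_field using * by (intro exI[of _ 1]) auto
  qed simp
  then show ?thesis by simp
qed

text \<open>The product of \<open>f\<close> with the character is a Schwartz function, so the integral of its partial derivative
vanishes; the product rule turns this into integration by parts.\<close>

lemma fourier_dpart:
  assumes f: "f \<in> schwartz"
  shows "fourier (dpart j f) \<omega> = \<i> * of_real (\<omega> $ j) * fourier f \<omega>"
proof -
  let ?e = "\<lambda>x. exp (\<i> * of_real ((-\<omega>) \<bullet> x))"
  have h: "(\<lambda>x. f x * ?e x) \<in> schwartz" by (intro schwartz_mult f tame_cis)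
  have de: "dpart j ?e = (\<lambda>x. - \<i> * of_real (\<omega> $ j) * ?e x)"
    by (rule ext, subst dpart_eq[OF has_derivative_cexp_inner]) (simp add: inner_axis)
  have df: "?e differentiable at x" for x
    unfolding differentiable_def by (rule exI) (rule has_derivative_cexp_inner)
  have d: "dpart j (\<lambda>x. f x * ?e x) = (\<lambda>x. (- \<i> * of_real (\<omega> $ j)) * (f x * ?e x) + dpart j f x * ?e x)"
    unfolding dpart_mult[OF schwartz_differentiable[OF f] df] de by (simp add: mult_ac)
  have "0 = (LINT x|lborel. (- \<i> * of_real (\<omega> $ j)) * (f x * ?e x) + dpart j f x * ?e x)"
    using integral_dpart_zero[OF h, of j] unfolding d by simp
  also have "\<dots> = (- \<i> * of_real (\<omega> $ j)) * (LINT x|lborel. f x * ?e x) + (LINT x|lborel. dpart j f x * ?e x)"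
    using fourier_integrable[OF f, of \<omega>] fourier_integrable[OF schwartz_dpart[OF f], of j \<omega>]
    by (subst Bochner_Integration.integral_add) auto
  finally show ?thesis by (simp add: fourier_def)
qed

lemma fourier_bounded:
  assumes "f \<in> schwartz" shows "cmod (fourier f \<omega>) \<le> (LINT x|lborel. cmod (f x))"
  unfolding fourier_def
  by (rule Bochner_Integration.integral_norm_bound_integral)
     (use fourier_integrable[OF assms] schwartz_integrable[OF assms] in \<open>auto simp: norm_mult\<close>)

text \<open>Each further power of \<open>1 + |\<omega>|\<close> is exchanged for partial derivatives of \<open>f\<close>.\<close>

lemma rapid_fourier:
  fixes f :: "real^'d::finite \<Rightarrow> complex"
  assumes f: "f \<in> schwartz" shows "rapid (fourier f)"
  unfolding rapid_def
proof
  fix N show "\<exists>C. \<forall>x. (1 + norm x) ^ N * cmod (fourier f x) \<le> C"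
    using f
  proof (induction N arbitrary: f)
    case 0
    show ?case by (rule exI[of _ "LINT x|lborel. cmod (f x)"]) (simp add: fourier_bounded[OF 0])
  next
    case (Suc N)
    obtain C0 where C0: "\<And>x. (1 + norm x) ^ N * cmod (fourier f x) \<le> C0" using Suc by blast
    have "\<forall>j. \<exists>C. \<forall>x. (1 + norm x) ^ N * cmod (fourier (dpart j f) x) \<le> C"
      using Suc.IH schwartz_dpart[OF Suc.prems] by blast
    then obtain C where C: "\<And>j x. (1 + norm x) ^ N * cmod (fourier (dpart j f) x) \<le> C j" by metis
    have "(1 + norm x) ^ Suc N * cmod (fourier f x) \<le> C0 + (\<Sum>j\<in>UNIV. C j)" for x
    proof -
      have "(1 + norm x) ^ Suc N * cmod (fourier f x) \<le> (1 + norm x) ^ N * ((1 + (\<Sum>j\<in>UNIV. \<bar>x $ j\<bar>)) * cmod (fourier f x))"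
        unfolding power_Suc2 mult.assoc using norm_le_l1_cart[of x] by (intro mult_left_mono mult_right_mono) auto
      also have "\<dots> = (1 + norm x) ^ N * cmod (fourier f x) + (\<Sum>j\<in>UNIV. (1 + norm x) ^ N * cmod (fourier (dpart j f) x))"
        by (simp add: fourier_dpart[OF Suc.prems] norm_mult distrib_left distrib_right sum_distrib_left sum_distrib_right)
      also have "\<dots> \<le> C0 + (\<Sum>j\<in>UNIV. C j)" by (intro add_mono sum_mono C0 C)
      finally show ?thesis .
    qed
    then show ?case by blast
  qed
qed

lemma fourier_schwartz:
  assumes "f \<in> schwartz" shows "fourier f \<in> schwartz"
  unfolding schwartz_iff
proof
  fix n show "reg rapid n (fourier f)" using assms
  proof (induction n arbitrary: f)
    case 0 then show ?case by (simp add: fourier_differentiable rapid_fourier)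
  next
    case (Suc n)
    have "reg rapid n (fourier (\<lambda>x. - \<i> * of_real (x $ j) * f x))" for j
      by (intro Suc.IH schwartz_coord Suc.prems)
    then show ?case using Suc.prems by (simp add: fourier_differentiable rapid_fourier dpart_fourier)
  qed
qed

section \<open>Fourier inversion\<close>

definition gauss :: "real^'d::finite \<Rightarrow> complex" where
  "gauss x = of_real (exp (- (x \<bullet> x) / 2))"

lemma has_derivative_gauss:
  "(gauss has_derivative (\<lambda>y. - of_real (x \<bullet> y) * gauss x)) (at x)"
  unfolding gauss_def[abs_def]
  by (auto intro!: derivative_eq_intros simp: inner_commute algebra_simps)

lemma gauss_differentiable: "gauss differentiable at x"
  unfolding differentiable_def by (rule exI) (rule has_derivative_gauss)

lemma dpart_gauss: "dpart j gauss = (\<lambda>x. (- 1) * of_real (x $ j) * gauss x)"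
  by (rule ext, subst dpart_eq[OF has_derivative_gauss]) (simp add: inner_axis)

lemma power_le_fact_exp: "0 \<le> (x::real) \<Longrightarrow> x ^ n \<le> fact n * exp x"
proof -
  assume x: "0 \<le> x"
  have "(\<Sum>k\<in>{n}. x ^ k /\<^sub>R fact k) \<le> (\<Sum>k. x ^ k /\<^sub>R fact k)"
    by (rule sum_le_suminf) (use x summable_exp_generic[of x] in auto)
  then have "x ^ n / fact n \<le> exp x" by (simp add: exp_def divide_inverse mult.commute)
  then show ?thesis by (simp add: divide_le_eq mult.commute)
qed

lemma rapid_gauss: "rapid gauss"
  unfolding rapid_def
proof
  fix N
  have "(1 + norm x) ^ N * cmod (gauss x) \<le> fact N * exp 2" for x :: "real^'d"
  proof -
    let ?r = "norm x"
    have "(1 + ?r) ^ N * cmod (gauss x) \<le> (fact N * exp (1 + ?r)) * exp (- (?r\<^sup>2) / 2)"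
      unfolding gauss_def norm_of_real
      by (intro mult_mono power_le_fact_exp) (auto simp: power2_norm_eq_inner)
    also have "\<dots> = fact N * exp (1 + ?r - ?r\<^sup>2 / 2)" by (simp add: exp_add[symmetric] exp_diff exp_minus field_simps)
    also have "1 + ?r - ?r\<^sup>2 / 2 \<le> 2" using zero_le_power2[of "?r - 1"] by (simp add: power2_eq_square algebra_simps)
    finally show ?thesis by simp
  qed
  then show "\<exists>C. \<forall>x. (1 + norm x) ^ N * cmod (gauss (x::real^'d)) \<le> C" by blast
qed

lemma reg_rapid_tame:
  assumes f: "reg rapid n f" and g: "tame g"
  shows "reg rapid n (\<lambda>x. f x * g x)"
proof -
  have g': "reg polybd n g" using g unfolding tame_def by blast
  show ?thesis
    by (rule reg_prod[where ?Q1.0=rapid and ?Q2.0=polybd and ?Q3.0=rapid, OF _ _ f g'])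
       (auto intro: rapid_mult_polybd rapid_add)
qed

lemma gauss_schwartz: "(gauss :: real^'d::finite \<Rightarrow> complex) \<in> schwartz"
  unfolding schwartz_iff
proof
  fix n show "reg rapid n (gauss :: real^'d \<Rightarrow> complex)"
  proof (induction n)
    case 0 show ?case by (simp add: gauss_differentiable rapid_gauss)
  next
    case (Suc n)
    have "tame (\<lambda>x. (- 1) * of_real (x $ j))" for j :: 'd by (intro tame_mult tame_const tame_coord)
    then have "reg rapid n (\<lambda>x. gauss x * ((- 1) * of_real (x $ j)))" for j :: 'd
      by (rule reg_rapid_tame[OF Suc])
    then show ?case by (simp add: gauss_differentiable rapid_gauss dpart_gauss mult.commute)
  qed
qed

text \<open>This is \<open>(2 \<pi>)\<^sup>d\<^sup>/\<^sup>2\<close>; its square is the constant of the inversion formula.\<close>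

definition gmass :: "'d::finite itself \<Rightarrow> complex" where
  "gmass _ = (LINT x|lborel. gauss (x::real^'d))"

lemma gmass_nonzero: "gmass TYPE('d::finite) \<noteq> 0"
proof
  assume "gmass TYPE('d) = 0"
  then have "(LINT x|lborel. exp (- ((x::real^'d) \<bullet> x) / 2)) = 0"
    unfolding gmass_def gauss_def by (simp add: integral_complex_of_real)
  moreover have "integrable lborel (\<lambda>x::real^'d. exp (- (x \<bullet> x) / 2))"
    using schwartz_integrable[OF gauss_schwartz[where 'd='d]] unfolding gauss_def[abs_def]
    using integrable_norm by fastforce
  ultimately have "AE x in (lborel :: (real^'d) measure). exp (- (x \<bullet> x) / 2) = 0"
    by (subst (asm) integral_nonneg_eq_0_iff_AE) auto
  then have "AE x in (lborel :: (real^'d) measure). False" by simp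
  then obtain N where "{x \<in> space (lborel :: (real^'d) measure). \<not> False} \<subseteq> N" "emeasure lborel N = 0" by (rule AE_E)
  then have "N = UNIV" by auto
  then show False using \<open>emeasure lborel N = 0\<close> by simp
qed

text \<open>The Gaussian and its transform both solve \<open>\<partial>\<^sub>j u = - x\<^sub>j u\<close>, so their quotient is constant along every ray
from the origin.\<close>

lemma fourier_gauss: "fourier gauss \<omega> = gmass TYPE('d) * gauss (\<omega> :: real^'d::finite)"
proof -
  let ?F = "fourier (gauss :: real^'d \<Rightarrow> complex)"
  have FS: "?F \<in> schwartz" by (intro fourier_schwartz gauss_schwartz)
  have d: "dpart j ?F x = - of_real (x $ j) * ?F x" for j x
  proof -
    have "dpart j ?F = fourier (\<lambda>x. \<i> * dpart j gauss x)"
      by (simp add: dpart_fourier[OF gauss_schwartz] dpart_gauss mult_ac)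
    then have "dpart j ?F x = \<i> * fourier (dpart j gauss) x"
      by (simp add: fourier_def mult.assoc)
    then show ?thesis by (simp add: fourier_dpart[OF gauss_schwartz] mult.assoc[symmetric])
  qed
  \<comment> \<open>The quotient of the two solutions along the ray through \<open>\<omega>\<close>.\<close>
  define G where "G t = ?F (t *\<^sub>R \<omega>) * of_real (exp (t\<^sup>2 * (\<omega> \<bullet> \<omega>) / 2))" for t
  have 1: "((\<lambda>t. ?F (0 + t *\<^sub>R \<omega>)) has_vector_derivative - of_real (t * (\<omega> \<bullet> \<omega>)) * ?F (t *\<^sub>R \<omega>)) (at t)" for t
    using has_vector_derivative_ray[OF schwartz_differentiable[OF FS], of 0 \<omega> t UNIV]
    by (simp add: d inner_vec_def sum_distrib_left sum_distrib_right sum_negf mult_ac)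
  have 2: "((\<lambda>t. complex_of_real (exp (t\<^sup>2 * (\<omega> \<bullet> \<omega>) / 2))) has_vector_derivative
     of_real (t * (\<omega> \<bullet> \<omega>) * exp (t\<^sup>2 * (\<omega> \<bullet> \<omega>) / 2))) (at t)" for t
    by (intro has_vector_derivative_of_real)
       (auto intro!: derivative_eq_intros simp: has_real_derivative_iff_has_vector_derivative[symmetric])
  have "(G has_vector_derivative 0) (at t)" for t
    unfolding G_def using has_vector_derivative_mult[OF 1[of t] 2[of t]] by (simp add: mult_ac)
  then have "G 1 = G 0"
    using has_vector_derivative_zero_constant[of UNIV G] by (metis UNIV_I convex_UNIV has_vector_derivative_at_within)
  then have "?F \<omega> * of_real (exp ((\<omega> \<bullet> \<omega>) / 2)) = ?F 0" by (simp add: G_def)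
  moreover have "?F 0 = gmass TYPE('d)" by (simp add: fourier_def gmass_def)
  ultimately have "?F \<omega> = gmass TYPE('d) * of_real (inverse (exp ((\<omega> \<bullet> \<omega>) / 2)))"
    by (simp add: field_simps)
  then show ?thesis by (simp add: gauss_def exp_minus)
qed

lemma Fubini_bounded_kernel:
  fixes f :: "'a::euclidean_space \<Rightarrow> complex" and g :: "'b::euclidean_space \<Rightarrow> complex"
  assumes f: "integrable lborel f" and g: "integrable lborel g"
    and k[measurable]: "(\<lambda>(x, y). k x y) \<in> borel_measurable (borel \<Otimes>\<^sub>M borel)" and kb: "\<And>x y. cmod (k x y) \<le> B"
  shows "(LINT x|lborel. f x * (LINT y|lborel. g y * k x y)) = (LINT y|lborel. g y * (LINT x|lborel. f x * k x y))"
    and "integrable lborel (\<lambda>x. f x * (LINT y|lborel. g y * k x y))"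
proof -
  have [measurable]: "f \<in> borel_measurable borel" "g \<in> borel_measurable borel" using f g by auto
  have i: "integrable (lborel \<Otimes>\<^sub>M lborel) (\<lambda>(x, y). f x * (g y * k x y))"
  proof (rule Bochner_Integration.integrable_bound)
    have i1: "integrable (lborel \<Otimes>\<^sub>M lborel) (\<lambda>(x, y). f x * g y)"
    proof (rule lborel_pair.Fubini_integrable)
      show "integrable lborel (\<lambda>x. LINT y|lborel. norm (case (x, y) of (x, y) \<Rightarrow> f x * g y))"
        using f by (simp add: norm_mult)
      show "AE x in lborel. integrable lborel (\<lambda>y. case (x, y) of (x, y) \<Rightarrow> f x * g y)"
        using g by simp
    qed measurable
    show "integrable (lborel \<Otimes>\<^sub>M lborel) (\<lambda>z. of_real B * (case z of (x, y) \<Rightarrow> f x * g y))"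
      by (intro integrable_mult_right i1)
    show "AE z in lborel \<Otimes>\<^sub>M lborel. norm (case z of (x, y) \<Rightarrow> f x * (g y * k x y)) \<le> norm (of_real B * (case z of (x, y) \<Rightarrow> f x * g y))"
    proof (rule AE_I2, clarsimp simp: norm_mult)
      fix x y
      have "cmod (k x y) \<le> \<bar>B\<bar>" using kb[of x y] by linarith
      then have "(cmod (f x) * cmod (g y)) * cmod (k x y) \<le> (cmod (f x) * cmod (g y)) * \<bar>B\<bar>"
        by (intro mult_left_mono) auto
      then show "cmod (f x) * (cmod (g y) * cmod (k x y)) \<le> \<bar>B\<bar> * (cmod (f x) * cmod (g y))" by (simp add: mult_ac)
    qed
  qed measurable
  have "(LINT y|lborel. LINT x|lborel. f x * (g y * k x y)) = (LINT y|lborel. g y * (LINT x|lborel. f x * k x y))"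
    by (simp only: mult.left_commute[of "f _" "g _"] integral_mult_right_zero)
  moreover have "(LINT y|lborel. LINT x|lborel. f x * (g y * k x y)) = (LINT x|lborel. LINT y|lborel. f x * (g y * k x y))"
    by (rule lborel_pair.Fubini_integral[OF i])
  ultimately show "(LINT x|lborel. f x * (LINT y|lborel. g y * k x y)) = (LINT y|lborel. g y * (LINT x|lborel. f x * k x y))"
    by (simp only: integral_mult_right_zero)
  show "integrable lborel (\<lambda>x. f x * (LINT y|lborel. g y * k x y))"
    using lborel_pair.integrable_fst[OF i] by simp
qed

text \<open>Fubini's theorem; the kernel is symmetric in the two variables.\<close>

lemma fourier_multiplication:
  assumes f: "integrable lborel f" and g: "integrable lborel g"
  shows "(LINT x|lborel. f x * fourier g x) = (LINT y|lborel. g y * fourier f y)"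
proof -
  have "(LINT x|lborel. f x * (LINT y|lborel. g y * exp (- \<i> * of_real (x \<bullet> y)))) =
    (LINT y|lborel. g y * (LINT x|lborel. f x * exp (- \<i> * of_real (x \<bullet> y))))"
    by (rule Fubini_bounded_kernel(1)[OF f g, of _ 1]) auto
  then show ?thesis by (simp add: fourier_def inner_commute)
qed

lemma fourier_scale:
  fixes f :: "real^'d::finite \<Rightarrow> complex"
  assumes "h \<noteq> 0"
  shows "fourier (\<lambda>x. f (h *\<^sub>R x)) \<omega> = of_real (1 / \<bar>h\<bar> ^ CARD('d)) * fourier f ((1 / h) *\<^sub>R \<omega>)"
proof -
  have "fourier f ((1 / h) *\<^sub>R \<omega>) = \<bar>h\<bar> ^ CARD('d) *\<^sub>R (LINT x|lborel. f (h *\<^sub>R x) * exp (- \<i> * of_real (((1 / h) *\<^sub>R \<omega>) \<bullet> (h *\<^sub>R x))))"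
    unfolding fourier_def
    by (subst integral_lborel_affine[OF assms, of _ 0]) simp
  also have "\<dots> = of_real (\<bar>h\<bar> ^ CARD('d)) * fourier (\<lambda>x. f (h *\<^sub>R x)) \<omega>"
    using assms by (simp add: fourier_def scaleR_conv_of_real[where 'a=complex])
  finally show ?thesis using assms by (simp add: field_simps)
qed

lemma fourier_shift: "fourier (\<lambda>x. f (x + a)) \<omega> = exp (\<i> * of_real (\<omega> \<bullet> a)) * fourier f \<omega>"
proof -
  have "fourier f \<omega> = (LINT x|lborel. f (x + a) * exp (- \<i> * of_real (\<omega> \<bullet> (x + a))))"
    unfolding fourier_def using integral_lborel_affine[of 1 "\<lambda>x. f x * exp (- \<i> * of_real (\<omega> \<bullet> x))" a] by simp
  also have "\<dots> = exp (- \<i> * of_real (\<omega> \<bullet> a)) * fourier (\<lambda>x. f (x + a)) \<omega>"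
    unfolding fourier_def by (subst integral_mult_right_zero[symmetric])
      (auto simp: inner_add_right exp_add[symmetric] algebra_simps intro!: Bochner_Integration.integral_cong)
  finally show ?thesis by (simp add: exp_minus field_simps)
qed

text \<open>Inversion at the origin.  The multiplication formula is applied to \<open>f\<close> and a dilated Gaussian, and
the dilation parameter tends to 0 on both sides by dominated convergence.\<close>

lemma integral_fourier:
  fixes f :: "real^'d::finite \<Rightarrow> complex"
  assumes f: "f \<in> schwartz"
  shows "(LINT \<omega>|lborel. fourier f \<omega>) = (gmass TYPE('d))\<^sup>2 * f 0"
proof -
  let ?c = "gmass TYPE('d)"
  let ?d = "\<lambda>n. 1 / real (Suc n)"
  have d0: "?d \<longlonglongrightarrow> 0" by (rule LIMSEQ_Suc[OF lim_1_over_n])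
  have Ff: "fourier f \<in> schwartz" by (rule fourier_schwartz[OF f])
  have gc: "isCont (gauss :: real^'d \<Rightarrow> complex) x" for x
    using differentiable_imp_continuous_within[OF gauss_differentiable[of x]] by simp
  have fc: "isCont f x" for x
    using differentiable_imp_continuous_within[OF schwartz_differentiable[OF f, of x]] by simp
  have [measurable]: "f \<in> borel_measurable borel" "fourier f \<in> borel_measurable borel" "(gauss :: real^'d \<Rightarrow> complex) \<in> borel_measurable borel"
    by (intro schwartz_measurable f Ff gauss_schwartz)+
  have eq: "(LINT \<omega>|lborel. fourier f \<omega> * gauss (?d n *\<^sub>R \<omega>)) = ?c * (LINT u|lborel. f (?d n *\<^sub>R u) * gauss u)" for n
  proof -
    let ?h = "?d n"
    have h: "?h > 0" "?h \<noteq> 0" by auto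
    have "(\<lambda>\<omega>. gauss (?h *\<^sub>R \<omega> + 0)) \<in> schwartz"
      by (rule schwartz_affine[OF gauss_schwartz h(2)])
    then have "integrable lborel (\<lambda>\<omega>::real^'d. gauss (?h *\<^sub>R \<omega>))" using schwartz_integrable by auto
    from fourier_multiplication[OF schwartz_integrable[OF f] this]
    have "(LINT \<omega>|lborel. fourier f \<omega> * gauss (?h *\<^sub>R \<omega>)) = (LINT x|lborel. f x * fourier (\<lambda>\<omega>. gauss (?h *\<^sub>R \<omega>)) x)"
      by (simp add: mult.commute)
    also have "\<dots> = (LINT x|lborel. of_real (1 / \<bar>?h\<bar> ^ CARD('d)) * ?c * (f x * gauss ((1/?h) *\<^sub>R x)))"
      by (simp only: fourier_scale[OF h(2)] fourier_gauss mult_ac)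
    also have "\<dots> = of_real (1 / \<bar>?h\<bar> ^ CARD('d)) * ?c * (LINT x|lborel. f x * gauss ((1/?h) *\<^sub>R x))" by (rule integral_mult_right_zero)
    also have "(LINT x|lborel. f x * gauss ((1/?h) *\<^sub>R x)) = \<bar>?h\<bar> ^ CARD('d) *\<^sub>R (LINT u|lborel. f (?h *\<^sub>R u) * gauss u)"
      by (subst integral_lborel_affine[OF h(2), of _ 0]) (use h in simp)
    finally have "(LINT \<omega>|lborel. fourier f \<omega> * gauss (?h *\<^sub>R \<omega>)) =
       (of_real (1 / \<bar>?h\<bar> ^ CARD('d)) * of_real (\<bar>?h\<bar> ^ CARD('d))) * (?c * (LINT u|lborel. f (?h *\<^sub>R u) * gauss u))"
      by (simp only: scaleR_conv_of_real[where 'a=complex] mult_ac)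
    also have "complex_of_real (1 / \<bar>?h\<bar> ^ CARD('d)) * of_real (\<bar>?h\<bar> ^ CARD('d)) = 1"
      by (subst of_real_mult[symmetric]) (use h in simp)
    finally show ?thesis by simp
  qed
  have l1: "(\<lambda>n. LINT \<omega>|lborel. fourier f \<omega> * gauss (?d n *\<^sub>R \<omega>)) \<longlonglongrightarrow> (LINT \<omega>|lborel. fourier f \<omega> * gauss (0 :: real^'d))"
  proof (rule integral_dominated_convergence)
    show "integrable lborel (\<lambda>\<omega>. cmod (fourier f \<omega>))" by (intro integrable_norm schwartz_integrable Ff)
    show "AE x in lborel. (\<lambda>n. fourier f x * gauss (?d n *\<^sub>R x)) \<longlonglongrightarrow> fourier f x * gauss (0 :: real^'d)"
    proof (intro AE_I2 tendsto_intros)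
      fix x :: "real^'d"
      have "(\<lambda>n. ?d n *\<^sub>R x) \<longlonglongrightarrow> 0 *\<^sub>R x" by (intro tendsto_intros d0)
      then have "(\<lambda>n. ?d n *\<^sub>R x) \<longlonglongrightarrow> 0" by simp
      then show "(\<lambda>n. gauss (?d n *\<^sub>R x)) \<longlonglongrightarrow> gauss (0 :: real^'d)" by (rule isCont_tendsto_compose[OF gc])
    qed
    show "AE x in lborel. norm (fourier f x * gauss (?d n *\<^sub>R x)) \<le> cmod (fourier f x)" for n
      by (intro AE_I2) (auto simp: norm_mult gauss_def intro!: mult_left_le)
  qed measurable
  have l2: "(\<lambda>n. LINT u|lborel. f (?d n *\<^sub>R u) * gauss u) \<longlonglongrightarrow> (LINT u|lborel. f 0 * gauss (u :: real^'d))"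
  proof -
    obtain C where C: "C > 0" "\<And>x. (1 + norm x) ^ 0 * cmod (f x) \<le> C" by (rule rapidD[OF schwartz_rapid[OF f]]) blast
    show ?thesis
    proof (rule integral_dominated_convergence)
      show "integrable lborel (\<lambda>u::real^'d. C * cmod (gauss u))" by (intro integrable_mult_right integrable_norm schwartz_integrable gauss_schwartz)
      show "AE x in lborel. (\<lambda>n. f (?d n *\<^sub>R x) * gauss x) \<longlonglongrightarrow> f 0 * gauss x"
      proof (intro AE_I2 tendsto_intros)
        fix x :: "real^'d"
        have "(\<lambda>n. ?d n *\<^sub>R x) \<longlonglongrightarrow> 0 *\<^sub>R x" by (intro tendsto_intros d0)
        then show "(\<lambda>n. f (?d n *\<^sub>R x)) \<longlonglongrightarrow> f 0" using isCont_tendsto_compose[OF fc, of "\<lambda>n. ?d n *\<^sub>R x" 0] by simp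
      qed
      show "AE x in lborel. norm (f (?d n *\<^sub>R x) * gauss x) \<le> C * cmod (gauss x)" for n
        using C by (intro AE_I2) (auto simp: norm_mult intro!: mult_right_mono)
    qed measurable
  qed
  have "(LINT \<omega>|lborel. fourier f \<omega> * gauss (0 :: real^'d)) = ?c * (LINT u|lborel. f 0 * gauss (u :: real^'d))"
    by (rule LIMSEQ_unique[OF l1]) (unfold eq, intro tendsto_intros l2)
  then show ?thesis by (simp add: gauss_def[of 0] gmass_def power2_eq_square)
qed

text \<open>A translation of \<open>f\<close> moves the point of evaluation to the origin, where \<open>integral_fourier\<close> applies.\<close>

lemma fourier_fourier:
  fixes f :: "real^'d::finite \<Rightarrow> complex"
  assumes f: "f \<in> schwartz"
  shows "fourier (fourier f) y = (gmass TYPE('d))\<^sup>2 * f (- y)"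
proof -
  have s: "(\<lambda>x. f (x + - y)) \<in> schwartz" using schwartz_affine[OF f, of 1 "-y"] by simp
  have "fourier (fourier f) y = (LINT \<omega>|lborel. fourier (\<lambda>x. f (x + - y)) \<omega>)"
    unfolding fourier_shift by (subst fourier_def) (simp add: inner_commute mult.commute)
  then show ?thesis using integral_fourier[OF s] by simp
qed

definition ifourier :: "(real^'d::finite \<Rightarrow> complex) \<Rightarrow> real^'d \<Rightarrow> complex" where
  "ifourier f x = fourier f (- x) / (gmass TYPE('d))\<^sup>2"

lemma ifourier_schwartz: "f \<in> schwartz \<Longrightarrow> ifourier f \<in> schwartz"
  using schwartz_cmult[OF schwartz_affine[OF fourier_schwartz[of f], of "-1" 0], of "1 / (gmass TYPE('a))\<^sup>2"]
  unfolding ifourier_def[abs_def] by simp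

lemma fourier_ifourier:
  fixes f :: "real^'d::finite \<Rightarrow> complex"
  assumes f: "f \<in> schwartz"
  shows "fourier (ifourier f) = f"
proof
  fix x
  have "fourier (ifourier f) x = fourier (\<lambda>x. fourier f ((-1) *\<^sub>R x)) x / (gmass TYPE('d))\<^sup>2"
    unfolding ifourier_def[abs_def] by (simp add: fourier_def)
  also have "\<dots> = fourier (fourier f) (- x) / (gmass TYPE('d))\<^sup>2"
    by (subst fourier_scale) simp_all
  also have "\<dots> = f x" using gmass_nonzero[where 'd='d] by (simp add: fourier_fourier[OF f])
  finally show "fourier (ifourier f) x = f x" .
qed

section \<open>Smooth cutoff functions\<close>

text \<open>The case \<open>n = 0\<close> is the smooth function used to build bumps.  The powers in the denominator make the
family closed under differentiation up to linear combinations, so smoothness follows by induction.\<close>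

definition flat :: "nat \<Rightarrow> real \<Rightarrow> real" where
  "flat n t = (if t > 0 then exp (- 1 / t) / t ^ n else 0)"

lemma flat_nonneg: "flat n t \<ge> 0"
  by (simp add: flat_def)

text \<open>This bound gives the derivative 0 at the origin.\<close>

lemma flat_quadratic: "flat n t \<le> fact (n + 2) * t\<^sup>2"
proof (cases "t > 0")
  case True
  have "(1 / t) ^ (n + 2) \<le> fact (n + 2) * exp (1 / t)" using True by (intro power_le_fact_exp) simp
  then have "(1 / t) ^ (n + 2) * exp (- (1 / t)) \<le> (fact (n + 2) * exp (1 / t)) * exp (- (1 / t))"
    by (rule mult_right_mono) simp
  also have "\<dots> = fact (n + 2)" by (simp only: mult.assoc exp_add[symmetric]) simp
  finally have "((1 / t) ^ (n + 2) * exp (- (1 / t))) * t\<^sup>2 \<le> fact (n + 2) * t\<^sup>2"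
    by (rule mult_right_mono) simp
  moreover have "((1 / t) ^ (n + 2) * exp (- (1 / t))) * t\<^sup>2 = exp (- (1 / t)) / t ^ n"
    using True by (simp add: power_add power_divide power2_eq_square)
  ultimately have "exp (- (1 / t)) / t ^ n \<le> fact (n + 2) * t\<^sup>2" by simp
  then show ?thesis using True by (simp add: flat_def)
qed (simp add: flat_def)

lemma DERIV_flat: "(flat n has_real_derivative (flat (n + 2) t - real n * flat (n + 1) t)) (at t)"
proof -
  consider "t > 0" | "t < 0" | "t = 0" by linarith
  then show ?thesis
  proof cases
    case 1
    have "((\<lambda>t. exp (- 1 / t) / t ^ n) has_real_derivative (flat (n + 2) t - real n * flat (n + 1) t)) (at t)"
    proof -
      have A: "((\<lambda>t. exp (- 1 / t)) has_real_derivative exp (- 1 / t) / t\<^sup>2) (at t)"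
        using 1 by (auto intro!: derivative_eq_intros simp: power2_eq_square)
      have B: "((\<lambda>t. t ^ n) has_real_derivative real n * t ^ (n - Suc 0)) (at t)"
        by (rule DERIV_pow)
      have "((\<lambda>t. exp (- 1 / t) / t ^ n) has_real_derivative
          (exp (- 1 / t) / t\<^sup>2 * t ^ n - exp (- 1 / t) * (real n * t ^ (n - Suc 0))) / (t ^ n * t ^ n)) (at t)"
        using 1 by (intro DERIV_divide A B) auto
      moreover have "(exp (- 1 / t) / t\<^sup>2 * t ^ n - exp (- 1 / t) * (real n * t ^ (n - Suc 0))) / (t ^ n * t ^ n)
         = flat (n + 2) t - real n * flat (n + 1) t"
        using 1 by (cases n) (simp_all add: flat_def field_simps power2_eq_square)
      ultimately show ?thesis by simp
    qed
    then show ?thesis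
      by (rule has_field_derivative_transform_within_open[of _ _ _ "{0<..}"]) (use 1 in \<open>auto simp: flat_def\<close>)
  next
    case 2
    have "((\<lambda>t. 0) has_real_derivative (flat (n + 2) t - real n * flat (n + 1) t)) (at t)"
      using 2 by (simp add: flat_def)
    then show ?thesis
      by (rule has_field_derivative_transform_within_open[of _ _ _ "{..<0}"]) (use 2 in \<open>auto simp: flat_def\<close>)
  next
    case 3
    have "(flat n has_derivative (\<lambda>h. 0)) (at t)"
      using flat_quadratic[of n] flat_nonneg[of n] 3
      by (intro has_derivative_quadratic[of _ _ _ "fact (n + 2)"]) (auto simp: flat_def[of _ 0])
    then show ?thesis using 3 by (simp add: has_field_derivative_def flat_def lambda_zero)
  qed
qed

lemma smooth_fun_iff: "smooth_fun f \<longleftrightarrow> (\<forall>n. reg (\<lambda>_. True) n f)"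
  unfolding smooth_fun_def reg_iff by blast

lemma smooth_mult: "smooth_fun f \<Longrightarrow> smooth_fun g \<Longrightarrow> smooth_fun (\<lambda>x. f x * g x)"
  unfolding smooth_fun_iff using reg_prod[of "\<lambda>_. True" "\<lambda>_. True" "\<lambda>_. True"] by blast

lemma smooth_add: "smooth_fun f \<Longrightarrow> smooth_fun g \<Longrightarrow> smooth_fun (\<lambda>x. f x + g x)"
  unfolding smooth_fun_iff using reg_add[of "\<lambda>_. True"] by blast

lemma smooth_const: "smooth_fun (\<lambda>x. c)"
  unfolding smooth_fun_iff using reg_const[of "\<lambda>_. True"] by blast

lemma smooth_prod: "finite A \<Longrightarrow> (\<And>i. i \<in> A \<Longrightarrow> smooth_fun (f i)) \<Longrightarrow> smooth_fun (\<lambda>x. \<Prod>i\<in>A. f i x)"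
  by (induction A rule: finite_induct) (auto simp: smooth_const smooth_mult)

lemma smooth_differentiable: "smooth_fun f \<Longrightarrow> f differentiable at x"
  unfolding smooth_fun_iff using reg_differentiable by blast

lemma smooth_inverse:
  assumes f: "smooth_fun f" and nz: "\<And>x. f x \<noteq> 0"
  shows "smooth_fun (\<lambda>x. inverse (f x))"
  unfolding smooth_fun_iff
proof
  let ?T = "\<lambda>_::real^'a\<Rightarrow>complex. True"
  have hd: "((\<lambda>x. inverse (f x)) has_derivative (\<lambda>y. - (inverse (f x) * frechet_derivative f (at x) y * inverse (f x)))) (at x)" for x
    by (intro Deriv.has_derivative_inverse nz has_derivative_frechet smooth_differentiable f)
  have d: "(\<lambda>x. inverse (f x)) differentiable at x" for x
    using hd unfolding differentiable_def by blast
  have dp: "dpart j (\<lambda>x. inverse (f x)) = (\<lambda>x. (- 1 * dpart j f x) * (inverse (f x) * inverse (f x)))" for j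
    by (rule ext, subst dpart_eq[OF hd]) (simp add: dpart_def)
  fix n show "reg ?T n (\<lambda>x. inverse (f x))"
  proof (induction n)
    case 0 then show ?case using d by simp
  next
    case (Suc n)
    note P = reg_prod[of ?T ?T ?T, OF TrueI TrueI]
    have "reg ?T (Suc n) f" using f unfolding smooth_fun_iff by blast
    then have "reg ?T n (dpart j f)" for j by simp
    then have "reg ?T n (\<lambda>x. (- 1 * dpart j f x) * (inverse (f x) * inverse (f x)))" for j
      by (intro P Suc reg_const TrueI)
    then show ?case using d by (simp add: dp)
  qed
qed

lemma smooth_flat: "smooth_fun (\<lambda>x. complex_of_real (flat n (l \<bullet> x + c)))"
  unfolding smooth_fun_iff
proof
  fix m
  let ?T = "\<lambda>_::real^'a\<Rightarrow>complex. True"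
  have hd: "((\<lambda>x. complex_of_real (flat n (l \<bullet> x + c))) has_derivative (\<lambda>y. of_real ((flat (n + 2) (l \<bullet> x + c) - real n * flat (n + 1) (l \<bullet> x + c)) * (l \<bullet> y)))) (at x)" for n x
  proof -
    have "((\<lambda>x. flat n (l \<bullet> x + c)) has_derivative (\<lambda>y. (flat (n + 2) (l \<bullet> x + c) - real n * flat (n + 1) (l \<bullet> x + c)) * (l \<bullet> y))) (at x)"
      by (rule has_derivative_compose[OF _ DERIV_flat[unfolded has_field_derivative_def]])
         (auto intro!: derivative_eq_intros)
    from has_derivative_of_real[OF this] show ?thesis .
  qed
  have d: "(\<lambda>x. complex_of_real (flat n (l \<bullet> x + c))) differentiable at x" for n x
    using hd unfolding differentiable_def by blast
  show "reg ?T m (\<lambda>x. complex_of_real (flat n (l \<bullet> x + c)))"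
  proof (induction m arbitrary: n)
    case 0
    show ?case using d by simp
  next
    case (Suc m)
    have dp: "dpart j (\<lambda>x. complex_of_real (flat n (l \<bullet> x + c))) =
       (\<lambda>x. of_real (l $ j) * of_real (flat (n + 2) (l \<bullet> x + c)) + (- (of_real (l $ j) * of_nat n)) * of_real (flat (n + 1) (l \<bullet> x + c)))" for j
      by (rule ext, subst dpart_eq[OF hd]) (simp add: inner_axis algebra_simps)
    note P = reg_prod[of ?T ?T ?T, OF TrueI TrueI] and A = reg_add[of ?T, OF TrueI]
    have "reg ?T m (\<lambda>x. of_real (l $ j) * of_real (flat (n + 2) (l \<bullet> x + c)) + (- (of_real (l $ j) * of_nat n)) * of_real (flat (n + 1) (l \<bullet> x + c)))" for j
      by (intro A P Suc reg_const TrueI)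
    then show ?case using d by (simp add: dp)
  qed
qed

lemma smooth_compact_schwartz:
  assumes f: "smooth_fun f" and z: "\<And>x. norm x > R \<Longrightarrow> f x = 0"
  shows "f \<in> schwartz"
proof -
  have dz: "dparts js f x = 0" if "norm x > R" for js x
    using that
  proof (induction js arbitrary: x)
    case Nil then show ?case using z by simp
  next
    case (Cons j js)
    have "((\<lambda>x. 0) has_derivative (\<lambda>x. 0)) (at x)" by simp
    then have "(dparts js f has_derivative (\<lambda>x. 0)) (at x)"
    proof (rule has_derivative_transform_within_open)
      show "open {x::real^'a. norm x > R}" by (intro open_Collect_less continuous_intros)
    qed (use Cons in auto)
    from dpart_eq[OF this] show ?case by (simp add: dparts_Cons)
  qed
  have "rapid (dparts js f)" for js
    unfolding rapid_def
  proof
    fix N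
    have "continuous_on UNIV (dparts js f)"
      using f unfolding smooth_fun_def
      by (intro continuous_at_imp_continuous_on ballI differentiable_imp_continuous_within) simp
    then have "continuous_on (cball 0 R) (dparts js f)" by (rule continuous_on_subset) simp
    then have "continuous_on (cball 0 R) (\<lambda>x. (1 + norm x) ^ N * cmod (dparts js f x))"
      by (intro continuous_intros)
    then have "bounded ((\<lambda>x. (1 + norm x) ^ N * cmod (dparts js f x)) ` cball 0 R)"
      by (intro compact_imp_bounded compact_continuous_image) auto
    then obtain C where "\<forall>y\<in>(\<lambda>x. (1 + norm x) ^ N * cmod (dparts js f x)) ` cball 0 R. norm y \<le> C"
      unfolding bounded_iff by blast
    then have C: "\<bar>(1 + norm x) ^ N * cmod (dparts js f x)\<bar> \<le> C" if "norm x \<le> R" for x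
      using that by (auto simp: dist_norm)
    have "(1 + norm x) ^ N * cmod (dparts js f x) \<le> max C 0" for x
    proof (cases "norm x \<le> R")
      case True then show ?thesis using C[OF True] by linarith
    next
      case False then show ?thesis using dz[of x js] by simp
    qed
    then show "\<exists>C. \<forall>x. (1 + norm x) ^ N * cmod (dparts js f x) \<le> C" by blast
  qed
  then show ?thesis using f by (simp add: schwartz_iff reg_iff smooth_fun_def)
qed

text \<open>As \<open>n\<close> grows, these test functions converge to the indicator function of the box.\<close>

definition box_bump :: "real^'d::finite \<Rightarrow> real^'d \<Rightarrow> nat \<Rightarrow> real^'d \<Rightarrow> real" where
  "box_bump a b n x = (\<Prod>i\<in>UNIV. flat 0 (real n * (x $ i - a $ i)) * flat 0 (real n * (b $ i - x $ i)))"

lemma flat_le_1: "flat 0 t \<le> 1"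
  by (simp add: flat_def)

lemma mem_box_vec: "x \<in> box a b \<longleftrightarrow> (\<forall>i. a $ i < x $ i \<and> x $ i < b $ i)" for x :: "real^'d::finite"
  by (auto simp: mem_box_cart)

lemma box_bump_bounds: "0 \<le> box_bump a b n x" "box_bump a b n x \<le> 1"
  unfolding box_bump_def
  by (auto intro!: prod_nonneg prod_le_1 mult_le_one mult_nonneg_nonneg simp: flat_nonneg flat_le_1)

lemma box_bump_outside: "x \<notin> box a b \<Longrightarrow> box_bump a b n x = 0"
proof -
  assume "x \<notin> box a b"
  then obtain i where i: "x $ i \<le> a $ i \<or> b $ i \<le> x $ i" unfolding mem_box_vec by (metis not_le)
  then have "flat 0 (real n * (x $ i - a $ i)) * flat 0 (real n * (b $ i - x $ i)) = 0"
    by (auto simp: flat_def mult_le_0_iff zero_less_mult_iff)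
  then show ?thesis unfolding box_bump_def by (intro prod_zero) auto
qed

lemma flat_limit: "t > 0 \<Longrightarrow> (\<lambda>n. flat 0 (real n * t)) \<longlonglongrightarrow> 1"
proof -
  assume t: "t > 0"
  have 1: "(\<lambda>n. exp (- (1 / t) * (1 / real n))) \<longlonglongrightarrow> exp (- (1 / t) * 0)"
    by (intro tendsto_intros lim_1_over_n)
  have "\<forall>\<^sub>F n in sequentially. exp (- (1 / t) * (1 / real n)) = flat 0 (real n * t)"
    using eventually_gt_at_top[of 0] by eventually_elim (use t in \<open>simp add: flat_def\<close>)
  from Lim_transform_eventually[OF 1 this] show ?thesis by simp
qed

lemma box_bump_limit: "x \<in> box a b \<Longrightarrow> (\<lambda>n. box_bump a b n x) \<longlonglongrightarrow> 1"
proof -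
  assume x: "x \<in> box a b"
  have "(\<lambda>n. box_bump a b n x) \<longlonglongrightarrow> (\<Prod>i\<in>(UNIV::'a set). 1 * 1)"
    unfolding box_bump_def using x unfolding mem_box_vec by (intro tendsto_intros flat_limit) auto
  then show ?thesis by simp
qed

lemma smooth_flat_coord: "smooth_fun (\<lambda>x. complex_of_real (flat 0 (r * (x $ i) + c)))"
  using smooth_flat[of 0 "r *\<^sub>R axis i 1" c] by (simp add: inner_axis inner_commute)

lemma box_bump_schwartz: "(\<lambda>x. complex_of_real (box_bump a b n x)) \<in> schwartz"
proof -
  have 1: "smooth_fun (\<lambda>x. complex_of_real (flat 0 (real n * (x $ i - a $ i))) * complex_of_real (flat 0 (real n * (b $ i - x $ i))))" for i
    using smooth_mult[OF smooth_flat_coord[of "real n" i "- real n * a $ i"] smooth_flat_coord[of "- real n" i "real n * b $ i"]]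
    by (simp add: algebra_simps)
  have 2: "smooth_fun (\<lambda>x. complex_of_real (box_bump a b n x))"
    unfolding box_bump_def of_real_prod of_real_mult by (intro smooth_prod 1) auto
  have "bounded (box a b)" by simp
  then obtain R where R: "\<And>x. x \<in> box a b \<Longrightarrow> norm x \<le> R" unfolding bounded_iff by blast
  show ?thesis
    by (rule smooth_compact_schwartz[OF 2, of R]) (use R box_bump_outside[of _ a b n] in force)
qed

text \<open>The quotient \<open>flat 0 t / (flat 0 t + flat 0 (1 - t))\<close> is a smooth step from 0 to 1 on the unit interval; the
cutoff is a product of such steps over the coordinates.\<close>

lemma ex_cutoff:
  obtains cut :: "real^'d::finite \<Rightarrow> complex" where "cut \<in> schwartz" "\<And>x. norm x \<le> R \<Longrightarrow> cut x = 1"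
proof -
  define st where "st t = flat 0 t / (flat 0 t + flat 0 (1 - t))" for t
  have pos: "flat 0 t + flat 0 (1 - t) > 0" for t
  proof (cases "t > 0")
    case True
    then have "flat 0 t > 0" by (simp add: flat_def)
    then show ?thesis using flat_nonneg[of 0 "1 - t"] by linarith
  next
    case False
    then have "flat 0 (1 - t) > 0" by (simp add: flat_def)
    then show ?thesis using flat_nonneg[of 0 "t"] by linarith
  qed
  have st1: "st t = 1" if "t \<ge> 1" for t
    using that pos[of t] by (simp add: st_def flat_def[of _ "1 - t"])
  have st0: "st t = 0" if "t \<le> 0" for t
    using that by (simp add: st_def flat_def)
  have sm: "smooth_fun (\<lambda>x. complex_of_real (st (r * (x $ i) + c)))" for r i and c
  proof -
    have "smooth_fun (\<lambda>x. complex_of_real (flat 0 (r * (x $ i) + c)) + complex_of_real (flat 0 (- r * (x $ i) + (1 - c))))"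
      by (intro smooth_add smooth_flat_coord)
    moreover have "complex_of_real (flat 0 (r * (x $ i) + c)) + complex_of_real (flat 0 (- r * (x $ i) + (1 - c))) \<noteq> 0" for x
      using pos[of "r * (x $ i) + c"] by (simp add: algebra_simps of_real_add[symmetric] del: of_real_add)
    ultimately have "smooth_fun (\<lambda>x. inverse (complex_of_real (flat 0 (r * (x $ i) + c)) + complex_of_real (flat 0 (- r * (x $ i) + (1 - c)))))"
      by (rule smooth_inverse)
    from smooth_mult[OF smooth_flat_coord this] show ?thesis by (simp add: st_def divide_inverse algebra_simps)
  qed
  define cut where "cut x = (\<Prod>i\<in>UNIV. complex_of_real (st ((-1) * x $ i + (R + 1))) * complex_of_real (st (1 * x $ i + (R + 1))))" for x :: "real^'d"
  have s: "smooth_fun cut" unfolding cut_def[abs_def] by (intro smooth_prod smooth_mult sm) auto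
  show thesis
  proof (rule that)
    show "cut \<in> schwartz"
    proof (rule smooth_compact_schwartz[OF s, where R="real CARD('d) * \<bar>R + 1\<bar>"])
      fix x :: "real^'d" assume x: "norm x > real CARD('d) * \<bar>R + 1\<bar>"
      have "\<exists>i. \<bar>x $ i\<bar> > \<bar>R + 1\<bar>"
      proof (rule ccontr)
        assume "\<not> ?thesis"
        then have "(\<Sum>i\<in>UNIV. \<bar>x $ i\<bar>) \<le> (\<Sum>i\<in>(UNIV::'d set). \<bar>R + 1\<bar>)" by (intro sum_mono) (simp add: not_less)
        then show False using x norm_le_l1_cart[of x] by simp
      qed
      then obtain i where i: "\<bar>x $ i\<bar> > \<bar>R + 1\<bar>" by blast
      then have "complex_of_real (st ((-1) * x $ i + (R + 1))) * complex_of_real (st (1 * x $ i + (R + 1))) = 0"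
        using st0[of "(-1) * x $ i + (R + 1)"] st0[of "1 * x $ i + (R + 1)"] by (auto simp: abs_if split: if_splits)
      then show "cut x = 0" unfolding cut_def by (intro prod_zero) auto
    qed
    fix x :: "real^'d" assume x: "norm x \<le> R"
    have "\<bar>x $ i\<bar> \<le> R" for i using component_le_norm_cart[of x i] x by linarith
    then show "cut x = 1" unfolding cut_def
    proof (intro prod.neutral ballI)
      fix i
      have "st ((-1) * x $ i + (R + 1)) = 1" "st (1 * x $ i + (R + 1)) = 1"
        using \<open>\<And>i. \<bar>x $ i\<bar> \<le> R\<close>[of i] by (auto intro!: st1)
      then show "complex_of_real (st ((-1) * x $ i + (R + 1))) * complex_of_real (st (1 * x $ i + (R + 1))) = 1" by simp
    qed
  qed
qed

section \<open>Tempered distributions whose Fourier transform is a function\<close>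

text \<open>At almost every point the function is the limit of its averages over small cubes.\<close>

lemma AE_zero_if_box_integrals_zero:
  fixes u :: "real^'d::finite \<Rightarrow> complex"
  assumes [measurable]: "u \<in> borel_measurable borel"
    and i: "\<And>a b. set_integrable lborel (box a b) u"
    and z: "\<And>a b. (LINT x:box a b|lborel. u x) = 0"
  shows "AE x in lborel. u x = 0"
proof -
  have ib: "u integrable_on cbox a b" for a b
    using set_borel_integral_eq_integral(1)[OF i[of a b]] unfolding integrable_on_open_interval .
  have zb: "integral (cbox a b) u = 0" for a b
    using set_borel_integral_eq_integral(2)[OF i[of a b]] z[of a b] unfolding integral_open_interval by simp
  obtain N where N: "negligible N"
    and D: "\<And>x e. \<lbrakk>x \<notin> N; 0 < e\<rbrakk> \<Longrightarrow> \<exists>d>0. \<forall>h. 0 < h \<and> h < d \<longrightarrow>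
                         norm(integral (cbox x (x + h *\<^sub>R One)) u /\<^sub>R h ^ DIM(real^'d) - u x) < e"
    using integrable_ccontinuous_explicit[of u, OF ib] by blast
  have "u x = 0" if "x \<notin> N" for x
  proof (rule ccontr)
    assume "u x \<noteq> 0"
    then have "0 < norm (u x)" by simp
    from D[OF that this] obtain d where "d > 0"
      "\<And>h. 0 < h \<Longrightarrow> h < d \<Longrightarrow> norm(integral (cbox x (x + h *\<^sub>R One)) u /\<^sub>R h ^ DIM(real^'d) - u x) < norm (u x)" by blast
    from this(2)[of "d / 2"] this(1) show False by (simp add: zb)
  qed
  then have "AE x in lebesgue. u x = 0"
    using N by (intro AE_I'[of N]) (auto simp: negligible_iff_null_sets)
  then show ?thesis by (subst (asm) AE_completion_iff) auto
qed

text \<open>The integral over a box is a limit of pairings with the test functions \<open>box_bump\<close>; local integrability comes from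
pairing with a cutoff.\<close>

lemma AE_zero_if_pairings_zero:
  fixes u :: "real^'d::finite \<Rightarrow> complex"
  assumes [measurable]: "u \<in> borel_measurable borel"
    and i: "\<And>\<phi>. \<phi> \<in> schwartz \<Longrightarrow> integrable lborel (\<lambda>x. u x * \<phi> x)"
    and z: "\<And>\<phi>. \<phi> \<in> schwartz \<Longrightarrow> (LINT x|lborel. u x * \<phi> x) = 0"
  shows "AE x in lborel. u x = 0"
proof (rule AE_zero_if_box_integrals_zero)
  fix a b :: "real^'d"
  have [measurable]: "box a b \<in> sets borel" by simp
  have "bounded (box a b)" by simp
  then obtain R where R: "\<And>x. x \<in> box a b \<Longrightarrow> norm x \<le> R" unfolding bounded_iff by blast
  obtain c :: "real^'d \<Rightarrow> complex" where c: "c \<in> schwartz" "\<And>x. norm x \<le> R \<Longrightarrow> c x = 1"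
    using ex_cutoff[of R] by blast
  have [measurable]: "c \<in> borel_measurable borel" by (rule schwartz_measurable[OF c(1)])
  show si: "set_integrable lborel (box a b) u"
    unfolding set_integrable_def
    by (rule Bochner_Integration.integrable_bound[OF i[OF c(1)]])
       (use c(2) R in \<open>auto simp: indicator_def norm_mult\<close>)
  have "(\<lambda>n. LINT x|lborel. u x * of_real (box_bump a b n x)) \<longlonglongrightarrow> (LINT x:box a b|lborel. u x)"
    unfolding set_lebesgue_integral_def
  proof (rule integral_dominated_convergence)
    have m: "(\<lambda>x. complex_of_real (box_bump a b n x)) \<in> borel_measurable borel" for n
      by (rule schwartz_measurable[OF box_bump_schwartz])
    show "(\<lambda>x. u x * of_real (box_bump a b n x)) \<in> borel_measurable lborel" for n
      using m[of n] by measurable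
    show "(\<lambda>x. indicat_real (box a b) x *\<^sub>R u x) \<in> borel_measurable lborel" by measurable
    show "integrable lborel (\<lambda>x. norm (indicat_real (box a b) x *\<^sub>R u x))"
      using si unfolding set_integrable_def by (rule integrable_norm)
    show "AE x in lborel. (\<lambda>n. u x * of_real (box_bump a b n x)) \<longlonglongrightarrow> indicat_real (box a b) x *\<^sub>R u x"
    proof (rule AE_I2)
      fix x
      have "(\<lambda>n. complex_of_real (box_bump a b n x)) \<longlonglongrightarrow> of_real (indicator (box a b) x)"
        by (intro tendsto_of_real) (use box_bump_limit[of x a b] box_bump_outside[of x a b] in \<open>cases "x \<in> box a b"; simp\<close>)
      then have "(\<lambda>n. u x * complex_of_real (box_bump a b n x)) \<longlonglongrightarrow> u x * of_real (indicator (box a b) x)"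
        by (rule tendsto_mult_left)
      then show "(\<lambda>n. u x * of_real (box_bump a b n x)) \<longlonglongrightarrow> indicat_real (box a b) x *\<^sub>R u x"
        by (simp add: scaleR_conv_of_real mult.commute)
    qed
    show "AE x in lborel. norm (u x * of_real (box_bump a b n x)) \<le> norm (indicat_real (box a b) x *\<^sub>R u x)" for n
    proof (rule AE_I2)
      fix x
      show "norm (u x * of_real (box_bump a b n x)) \<le> norm (indicat_real (box a b) x *\<^sub>R u x)"
        using box_bump_bounds[of a b n x] box_bump_outside[of x a b n]
        by (cases "x \<in> box a b") (auto simp: norm_mult mult_left_le)
    qed
  qed
  moreover have "(LINT x|lborel. u x * of_real (box_bump a b n x)) = 0" for n
    by (rule z[OF box_bump_schwartz])
  ultimately have "(\<lambda>n. 0) \<longlonglongrightarrow> (LINT x:box a b|lborel. u x)" by simp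
  then show "(LINT x:box a b|lborel. u x) = 0" by (simp add: LIMSEQ_const_iff)
qed fact

definition loc_L2 :: "(real^'d::finite \<Rightarrow> complex) \<Rightarrow> bool" where
  "loc_L2 g \<longleftrightarrow> (\<forall>K. compact K \<longrightarrow> set_integrable lborel K (\<lambda>\<omega>. (cmod (g \<omega>))\<^sup>2))"

lemma has_fourier_iff: "has_fourier T g \<longleftrightarrow> g \<in> borel_measurable borel \<and> loc_L2 g \<and>
     (\<forall>\<phi>\<in>schwartz. integrable lborel (\<lambda>\<omega>. g \<omega> * \<phi> \<omega>) \<and> T (fourier \<phi>) = (LINT \<omega>|lborel. g \<omega> * \<phi> \<omega>))"
  by (simp add: has_fourier_def loc_L2_def)

lemma has_fourier_measurable: "has_fourier T g \<Longrightarrow> g \<in> borel_measurable borel"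
  by (simp add: has_fourier_def)

lemma has_fourier_int: "has_fourier T g \<Longrightarrow> \<phi> \<in> schwartz \<Longrightarrow> integrable lborel (\<lambda>\<omega>. g \<omega> * \<phi> \<omega>)"
  by (simp add: has_fourier_def)

lemma has_fourier_eq: "has_fourier T g \<Longrightarrow> \<phi> \<in> schwartz \<Longrightarrow> T (fourier \<phi>) = (LINT \<omega>|lborel. g \<omega> * \<phi> \<omega>)"
  by (simp add: has_fourier_def)

lemma cmod_add_sq: "(cmod (a + b))\<^sup>2 \<le> 2 * (cmod a)\<^sup>2 + 2 * (cmod b)\<^sup>2"
proof -
  have "(cmod (a + b))\<^sup>2 \<le> (cmod a + cmod b)\<^sup>2" by (intro power_mono norm_triangle_ineq) auto
  also have "\<dots> \<le> 2 * (cmod a)\<^sup>2 + 2 * (cmod b)\<^sup>2"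
    using zero_le_power2[of "cmod a - cmod b"] by (simp add: power2_eq_square algebra_simps)
  finally show ?thesis .
qed

lemma loc_L2_add:
  assumes [measurable]: "f \<in> borel_measurable borel" "g \<in> borel_measurable borel" and "loc_L2 f" "loc_L2 g"
  shows "loc_L2 (\<lambda>x. f x + g x)"
  unfolding loc_L2_def
proof (intro allI impI)
  fix K :: "(real^'a) set" assume K: "compact K"
  then have [measurable]: "K \<in> sets borel" by (simp add: borel_compact)
  have 1: "set_integrable lborel K (\<lambda>x. 2 * (cmod (f x))\<^sup>2 + 2 * (cmod (g x))\<^sup>2)"
    using assms(3,4) K unfolding loc_L2_def by (intro set_integral_add set_integrable_mult_right) auto
  show "set_integrable lborel K (\<lambda>x. (cmod (f x + g x))\<^sup>2)"
    by (rule set_integrable_bound[OF 1]) (use cmod_add_sq in \<open>auto simp: set_borel_measurable_def\<close>)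
qed

lemma loc_L2_mult_bounded:
  assumes [measurable]: "m \<in> borel_measurable borel" "g \<in> borel_measurable borel" and "loc_L2 g" and b: "\<And>x. cmod (m x) \<le> B"
  shows "loc_L2 (\<lambda>x. m x * g x)"
  unfolding loc_L2_def
proof (intro allI impI)
  fix K :: "(real^'a) set" assume K: "compact K"
  then have [measurable]: "K \<in> sets borel" by (simp add: borel_compact)
  have 1: "set_integrable lborel K (\<lambda>x. B\<^sup>2 * (cmod (g x))\<^sup>2)"
    using assms(3) K unfolding loc_L2_def by (intro set_integrable_mult_right) auto
  show "set_integrable lborel K (\<lambda>x. (cmod (m x * g x))\<^sup>2)"
  proof (rule set_integrable_bound[OF 1])
    show "AE x in lborel. x \<in> K \<longrightarrow> norm ((cmod (m x * g x))\<^sup>2) \<le> norm (B\<^sup>2 * (cmod (g x))\<^sup>2)"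
      using b by (auto simp: norm_mult power_mult_distrib intro!: mult_right_mono power_mono)
  qed (auto simp: set_borel_measurable_def)
qed

lemma loc_L2_affine:
  assumes [measurable]: "g \<in> borel_measurable borel" and "loc_L2 g" and h: "h \<noteq> 0"
  shows "loc_L2 (\<lambda>x. g (h *\<^sub>R x))"
  unfolding loc_L2_def
proof (intro allI impI)
  fix K :: "(real^'a) set" assume K: "compact K"
  then have "compact ((\<lambda>x. h *\<^sub>R x) ` K)" by (rule compact_scaling)
  then have "integrable lborel (\<lambda>x. indicat_real ((\<lambda>x. h *\<^sub>R x) ` K) x *\<^sub>R (cmod (g x))\<^sup>2)"
    using assms(2) unfolding loc_L2_def set_integrable_def by blast
  from integrable_lborel_affine[OF this h, of 0]
  show "set_integrable lborel K (\<lambda>x. (cmod (g (h *\<^sub>R x)))\<^sup>2)"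
    unfolding set_integrable_def using h by (simp add: indicator_def image_iff)
qed

lemma has_fourier_AE_unique:
  assumes "has_fourier T f" "has_fourier T g"
  shows "AE x in lborel. f x = g x"
proof -
  have [measurable]: "f \<in> borel_measurable borel" "g \<in> borel_measurable borel" using assms has_fourier_measurable by auto
  have "AE x in lborel. f x - g x = 0"
  proof (rule AE_zero_if_pairings_zero)
    fix \<phi> :: "real^'a \<Rightarrow> complex" assume p: "\<phi> \<in> schwartz"
    show "integrable lborel (\<lambda>x. (f x - g x) * \<phi> x)"
      unfolding left_diff_distrib by (intro Bochner_Integration.integrable_diff has_fourier_int[OF assms(1)] has_fourier_int[OF assms(2)] p)
    show "(LINT x|lborel. (f x - g x) * \<phi> x) = 0"
      unfolding left_diff_distrib
      by (subst Bochner_Integration.integral_diff)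
         (use has_fourier_int[OF assms(1) p] has_fourier_int[OF assms(2) p] has_fourier_eq[OF assms(1) p] has_fourier_eq[OF assms(2) p] in simp_all)
  qed measurable
  then show ?thesis by simp
qed

lemma has_fourier_tfourier: "has_fourier T g \<Longrightarrow> has_fourier T (tfourier T)"
  and tfourier_cont: "has_fourier T g \<Longrightarrow> continuous_on UNIV g \<Longrightarrow> continuous_on UNIV (tfourier T)"
proof -
  let ?P = "\<lambda>g. has_fourier T g \<and> ((\<exists>g'. has_fourier T g' \<and> continuous_on UNIV g') \<longrightarrow> continuous_on UNIV g)"
  have *: "?P (tfourier T)" if "has_fourier T g" for g
  proof -
    have "\<exists>g. ?P g" using that by blast
    then show ?thesis unfolding tfourier_def by (rule someI_ex)
  qed
  show "has_fourier T g \<Longrightarrow> has_fourier T (tfourier T)" using * by blast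
  show "has_fourier T g \<Longrightarrow> continuous_on UNIV g \<Longrightarrow> continuous_on UNIV (tfourier T)" using * by blast
qed

text \<open>Two continuous functions can differ only on an open set, and a nonempty open set is not negligible.\<close>

lemma continuous_AE_eq:
  fixes f g :: "'a::euclidean_space \<Rightarrow> 'b::real_normed_vector"
  assumes "AE x in lborel. f x = g x" "continuous_on UNIV f" "continuous_on UNIV g"
  shows "f = g"
proof (rule ccontr)
  assume "f \<noteq> g"
  then have ne: "{x. f x \<noteq> g x} \<noteq> {}" by auto
  have o: "open {x. f x \<noteq> g x}" by (intro open_Collect_neq assms)
  have "AE x in lebesgue. x \<notin> {x. f x \<noteq> g x}" using AE_completion[OF assms(1)] by simp
  then have "negligible {x. f x \<noteq> g x}"
    using o by (simp add: negligible_iff_null_sets AE_iff_null_sets)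
  then show False using open_not_negligible[OF o ne] by simp
qed

text \<open>This evaluates the representative chosen in the definition of \<open>tfourier\<close>.\<close>

lemma tfourier_eqI:
  assumes "has_fourier T g" "continuous_on UNIV g"
  shows "tfourier T = g"
  by (intro continuous_AE_eq has_fourier_AE_unique[of T] has_fourier_tfourier[OF assms(1)] assms tfourier_cont[OF assms])

lemma has_fourier_add:
  assumes S: "has_fourier S f" and T: "has_fourier T g"
  shows "has_fourier (\<lambda>\<phi>. S \<phi> + T \<phi>) (\<lambda>\<omega>. f \<omega> + g \<omega>)"
proof -
  have [measurable]: "f \<in> borel_measurable borel" "g \<in> borel_measurable borel" using assms has_fourier_measurable by auto
  show ?thesis unfolding has_fourier_iff
  proof (intro conjI ballI)
    show "loc_L2 (\<lambda>\<omega>. f \<omega> + g \<omega>)" using S T unfolding has_fourier_iff by (intro loc_L2_add) auto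
    fix \<phi> :: "real^'a \<Rightarrow> complex" assume p: "\<phi> \<in> schwartz"
    show "integrable lborel (\<lambda>x. (f x + g x) * \<phi> x)"
      unfolding distrib_right by (intro Bochner_Integration.integrable_add has_fourier_int[OF S] has_fourier_int[OF T] p)
    show "S (fourier \<phi>) + T (fourier \<phi>) = (LINT x|lborel. (f x + g x) * \<phi> x)"
      unfolding distrib_right
      by (subst Bochner_Integration.integral_add)
         (use has_fourier_int[OF S p] has_fourier_int[OF T p] has_fourier_eq[OF S p] has_fourier_eq[OF T p] in simp_all)
  qed measurable
qed

lemma has_fourier_scale:
  assumes T: "has_fourier T g"
  shows "has_fourier (\<lambda>\<phi>. c * T \<phi>) (\<lambda>\<omega>. c * g \<omega>)"
proof -
  have [measurable]: "g \<in> borel_measurable borel" using assms has_fourier_measurable by auto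
  show ?thesis unfolding has_fourier_iff
  proof (intro conjI ballI)
    show "loc_L2 (\<lambda>\<omega>. c * g \<omega>)" using T unfolding has_fourier_iff by (intro loc_L2_mult_bounded[of _ _ "cmod c"]) auto
    fix \<phi> :: "real^'a \<Rightarrow> complex" assume p: "\<phi> \<in> schwartz"
    show "integrable lborel (\<lambda>x. (c * g x) * \<phi> x)"
      unfolding mult.assoc by (intro integrable_mult_right has_fourier_int[OF T] p)
    show "c * T (fourier \<phi>) = (LINT x|lborel. (c * g x) * \<phi> x)"
      unfolding mult.assoc using has_fourier_eq[OF T p] by simp
  qed measurable
qed

lemma has_fourier_zero: "has_fourier (\<lambda>\<phi>. 0) (\<lambda>\<omega>. 0)"
  unfolding has_fourier_iff loc_L2_def set_integrable_def by simp

lemma has_fourier_sum: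
  assumes "finite A" "\<And>i. i \<in> A \<Longrightarrow> has_fourier (T i) (g i)"
  shows "has_fourier (\<lambda>\<phi>. \<Sum>i\<in>A. T i \<phi>) (\<lambda>\<omega>. \<Sum>i\<in>A. g i \<omega>)"
  using assms by (induction A rule: finite_induct) (auto simp: has_fourier_zero intro!: has_fourier_add)

lemma has_fourier_diff:
  assumes S: "has_fourier S f" and T: "has_fourier T g"
  shows "has_fourier (S - T) (\<lambda>\<omega>. f \<omega> - g \<omega>)"
  using has_fourier_add[OF S has_fourier_scale[OF T, of "-1"]] by (simp add: fun_diff_def)

lemma has_fourier_translate:
  assumes T: "has_fourier T g"
  shows "has_fourier (ttranslate a T) (\<lambda>\<omega>. exp (- \<i> * of_real (a \<bullet> \<omega>)) * g \<omega>)"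
proof -
  have [measurable]: "g \<in> borel_measurable borel" using assms has_fourier_measurable by auto
  show ?thesis unfolding has_fourier_iff
  proof (intro conjI ballI)
    show "loc_L2 (\<lambda>\<omega>. exp (- \<i> * of_real (a \<bullet> \<omega>)) * g \<omega>)"
      using T unfolding has_fourier_iff by (intro loc_L2_mult_bounded[of _ _ 1]) auto
    fix \<phi> :: "real^'a \<Rightarrow> complex" assume p: "\<phi> \<in> schwartz"
    have q: "(\<lambda>t. \<phi> t * exp (\<i> * of_real ((-a) \<bullet> t))) \<in> schwartz" by (intro schwartz_mult p tame_cis)
    have e: "(exp (- \<i> * of_real (a \<bullet> x)) * g x) * \<phi> x = g x * (\<phi> x * exp (\<i> * of_real ((-a) \<bullet> x)))" for x
      by simp
    show "integrable lborel (\<lambda>x. (exp (- \<i> * of_real (a \<bullet> x)) * g x) * \<phi> x)"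
      unfolding e by (rule has_fourier_int[OF T q])
    have f: "(\<lambda>x. fourier \<phi> (x + a)) = fourier (\<lambda>t. \<phi> t * exp (\<i> * of_real ((-a) \<bullet> t)))"
      by (auto simp: fourier_def fun_eq_iff inner_add_left exp_add[symmetric] algebra_simps intro!: Bochner_Integration.integral_cong)
    show "ttranslate a T (fourier \<phi>) = (LINT x|lborel. (exp (- \<i> * of_real (a \<bullet> x)) * g x) * \<phi> x)"
      unfolding e ttranslate_def f by (rule has_fourier_eq[OF T q])
  qed measurable
qed

lemma has_fourier_dilate:
  fixes T :: "'d::finite tdist"
  assumes T: "has_fourier T g" and h: "h > 0"
  shows "has_fourier (tdilate h T) (\<lambda>\<omega>. of_real (h ^ CARD('d)) * g (h *\<^sub>R \<omega>))"
proof -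
  have [measurable]: "g \<in> borel_measurable borel" using assms has_fourier_measurable by auto
  show ?thesis unfolding has_fourier_iff
  proof (intro conjI ballI)
    show "loc_L2 (\<lambda>\<omega>. of_real (h ^ CARD('d)) * g (h *\<^sub>R \<omega>))"
      using T h unfolding has_fourier_iff by (intro loc_L2_mult_bounded[of _ _ "h ^ CARD('d)"] loc_L2_affine) (auto simp: norm_power)
    fix \<phi> :: "real^'d \<Rightarrow> complex" assume p: "\<phi> \<in> schwartz"
    have q: "(\<lambda>x. \<phi> ((1/h) *\<^sub>R x)) \<in> schwartz" using schwartz_affine[OF p, of "1/h" 0] h by simp
    have 1: "integrable lborel (\<lambda>x. g (h *\<^sub>R x) * \<phi> x)"
      using integrable_lborel_affine[OF has_fourier_int[OF T q], of h 0] h by simp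
    have 2: "(LINT x|lborel. g x * \<phi> ((1/h) *\<^sub>R x)) = of_real (h ^ CARD('d)) * (LINT x|lborel. g (h *\<^sub>R x) * \<phi> x)"
      using h by (subst integral_lborel_affine[of h _ 0]) (auto simp: scaleR_conv_of_real[where 'a=complex])
    show "integrable lborel (\<lambda>x. (of_real (h ^ CARD('d)) * g (h *\<^sub>R x)) * \<phi> x)"
      using integrable_mult_right[OF 1] by (simp only: mult.assoc)
    have f: "(\<lambda>x. fourier \<phi> (h *\<^sub>R x)) = (\<lambda>x. of_real (1 / h ^ CARD('d)) * fourier (\<lambda>x. \<phi> ((1/h) *\<^sub>R x)) x)"
      using h fourier_scale[of "1/h" \<phi>] by (auto simp: fun_eq_iff power_one_over)
    have g: "(\<lambda>x. fourier \<phi> (h *\<^sub>R x)) = fourier (\<lambda>x. of_real (1 / h ^ CARD('d)) * \<phi> ((1/h) *\<^sub>R x))"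
      unfolding f by (simp add: fourier_def fun_eq_iff)
    have "tdilate h T (fourier \<phi>) = of_real (h ^ CARD('d)) * (LINT x|lborel. g x * (of_real (1 / h ^ CARD('d)) * \<phi> ((1/h) *\<^sub>R x)))"
      unfolding tdilate_def g by (subst has_fourier_eq[OF T schwartz_cmult[OF q]]) simp
    also have "\<dots> = (of_real (h ^ CARD('d)) * of_real (1 / h ^ CARD('d))) * (LINT x|lborel. g x * \<phi> ((1/h) *\<^sub>R x))"
      unfolding mult.left_commute[of "g _"] by (simp only: integral_mult_right_zero mult.assoc)
    also have "of_real (h ^ CARD('d)) * complex_of_real (1 / h ^ CARD('d)) = 1" using h by simp
    finally show "tdilate h T (fourier \<phi>) = (LINT x|lborel. (of_real (h ^ CARD('d)) * g (h *\<^sub>R x)) * \<phi> x)"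
      unfolding 2 by (simp only: mult.assoc mult_1 integral_mult_right_zero)
  qed measurable
qed

text \<open>Every Schwartz function is a Fourier transform, so the transform determines the distribution on the
Schwartz space; elsewhere both functionals are 0 by convention.\<close>

lemma tempered_eqI:
  assumes S: "S \<in> tempered" and T: "T \<in> tempered" and "has_fourier S g" "has_fourier T g"
  shows "S = T"
proof
  fix \<phi>
  show "S \<phi> = T \<phi>"
  proof (cases "\<phi> \<in> schwartz")
    case True
    then have "\<phi> = fourier (ifourier \<phi>)" "ifourier \<phi> \<in> schwartz" by (auto simp: fourier_ifourier ifourier_schwartz)
    then show ?thesis using has_fourier_eq[OF assms(3)] has_fourier_eq[OF assms(4)] by metis
  next
    case False
    then show ?thesis using S T by (simp add: tempered_def)
  qed
qed

lemma schwartz_norm_bdd: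
  fixes \<phi> :: "real^'d::finite \<Rightarrow> complex"
  assumes "\<phi> \<in> schwartz"
  shows "bdd_above ((\<lambda>(js, x). (1 + norm x) ^ N * cmod (dparts js \<phi> x)) ` ({js. length js \<le> N} \<times> UNIV))"
proof -
  have f: "finite {js::'d list. length js \<le> N}" using finite_lists_length_le[of "UNIV :: 'd set" N] by simp
  have "\<exists>C. \<forall>x. (1 + norm x) ^ N * cmod (dparts js \<phi> x) \<le> C" for js
    using schwartz_rapid[OF schwartz_dparts[OF assms]] unfolding rapid_def by blast
  then obtain C where C: "\<And>js x. (1 + norm x) ^ N * cmod (dparts js \<phi> x) \<le> C js" by metis
  have "(1 + norm x) ^ N * cmod (dparts js \<phi> x) \<le> (\<Sum>js | length js \<le> N. \<bar>C js\<bar>)" if "length js \<le> N" for js x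
    using order_trans[OF C[of x js] order_trans[OF abs_ge_self member_le_sum[of js "{js. length js \<le> N}" "\<lambda>js. \<bar>C js\<bar>"]]] that f by auto
  then show ?thesis unfolding bdd_above_def by (intro exI[of _ "\<Sum>js | length js \<le> N. \<bar>C js\<bar>"]) auto
qed

lemma schwartz_norm_upper:
  assumes "\<phi> \<in> schwartz" "length js \<le> N"
  shows "(1 + norm x) ^ N * cmod (dparts js \<phi> x) \<le> schwartz_norm N \<phi>"
  unfolding schwartz_norm_def
  using cSUP_upper[OF _ schwartz_norm_bdd[OF assms(1), of N], of "(js, x)"] assms(2) by simp

lemma schwartz_norm_least:
  assumes "\<And>js x. length js \<le> N \<Longrightarrow> (1 + norm x) ^ N * cmod (dparts js \<phi> x) \<le> C"
  shows "schwartz_norm N \<phi> \<le> C"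
  unfolding schwartz_norm_def
  by (rule cSUP_least) (use assms in \<open>auto intro: exI[of _ "[]"]\<close>)

lemma schwartz_norm_nonneg: "\<phi> \<in> schwartz \<Longrightarrow> 0 \<le> schwartz_norm N \<phi>"
  using schwartz_norm_upper[of \<phi> "[]" N 0] by (simp, meson norm_ge_zero order_trans)

lemma schwartz_norm_mono:
  assumes "\<phi> \<in> schwartz" "N \<le> M" shows "schwartz_norm N \<phi> \<le> schwartz_norm M \<phi>"
proof (rule schwartz_norm_least)
  fix js :: "'a list" and x assume "length js \<le> N"
  have "(1 + norm x) ^ N * cmod (dparts js \<phi> x) \<le> (1 + norm x) ^ M * cmod (dparts js \<phi> x)"
    using assms(2) by (intro mult_right_mono power_increasing) auto
  also have "\<dots> \<le> schwartz_norm M \<phi>" using assms \<open>length js \<le> N\<close> by (intro schwartz_norm_upper) auto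
  finally show "(1 + norm x) ^ N * cmod (dparts js \<phi> x) \<le> schwartz_norm M \<phi>" .
qed

lemma temperedE:
  assumes "T \<in> tempered"
  obtains N C where "C \<ge> 0" "\<And>\<phi>. \<phi> \<in> schwartz \<Longrightarrow> cmod (T \<phi>) \<le> C * schwartz_norm N \<phi>"
proof -
  obtain N C where *: "\<And>\<phi>. \<phi> \<in> schwartz \<Longrightarrow> cmod (T \<phi>) \<le> C * schwartz_norm N \<phi>"
    using assms unfolding tempered_def by blast
  show thesis
  proof (rule that[of "\<bar>C\<bar>" N])
    fix \<phi> :: "real^'a \<Rightarrow> complex" assume p: "\<phi> \<in> schwartz"
    show "cmod (T \<phi>) \<le> \<bar>C\<bar> * schwartz_norm N \<phi>"
      by (rule order_trans[OF *[OF p]]) (auto intro!: mult_right_mono schwartz_norm_nonneg p)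
  qed simp
qed

lemma tempered_zero: "(\<lambda>\<phi>. 0) \<in> tempered"
  unfolding tempered_def by (auto intro!: exI[of _ 0])

lemma tempered_add:
  assumes S: "S \<in> tempered" and T: "T \<in> tempered"
  shows "(\<lambda>\<phi>. S \<phi> + T \<phi>) \<in> tempered"
proof -
  obtain N C where 1: "C \<ge> 0" "\<And>\<phi>. \<phi> \<in> schwartz \<Longrightarrow> cmod (S \<phi>) \<le> C * schwartz_norm N \<phi>" by (rule temperedE[OF S]) blast
  obtain M D where 2: "D \<ge> 0" "\<And>\<phi>. \<phi> \<in> schwartz \<Longrightarrow> cmod (T \<phi>) \<le> D * schwartz_norm M \<phi>" by (rule temperedE[OF T]) blast
  have "cmod (S \<phi> + T \<phi>) \<le> (C + D) * schwartz_norm (N + M) \<phi>" if p: "\<phi> \<in> schwartz" for \<phi>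
  proof -
    have "cmod (S \<phi> + T \<phi>) \<le> cmod (S \<phi>) + cmod (T \<phi>)" by (rule norm_triangle_ineq)
    also have "\<dots> \<le> C * schwartz_norm (N + M) \<phi> + D * schwartz_norm (N + M) \<phi>"
      by (intro add_mono order_trans[OF 1(2)[OF p]] order_trans[OF 2(2)[OF p]] mult_left_mono schwartz_norm_mono p 1 2) auto
    finally show ?thesis by (simp add: distrib_right)
  qed
  then have "\<exists>N C. \<forall>\<phi>\<in>schwartz. cmod (S \<phi> + T \<phi>) \<le> C * schwartz_norm N \<phi>" by blast
  then show ?thesis using S T unfolding tempered_def by (auto simp: algebra_simps)
qed

lemma tempered_scale:
  assumes T: "T \<in> tempered" shows "(\<lambda>\<phi>. c * T \<phi>) \<in> tempered"
proof -
  obtain N C where 1: "C \<ge> 0" "\<And>\<phi>. \<phi> \<in> schwartz \<Longrightarrow> cmod (T \<phi>) \<le> C * schwartz_norm N \<phi>" by (rule temperedE[OF T]) blast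
  have "cmod (c * T \<phi>) \<le> (cmod c * C) * schwartz_norm N \<phi>" if p: "\<phi> \<in> schwartz" for \<phi>
    unfolding norm_mult mult.assoc by (intro mult_left_mono 1 p) auto
  then have "\<exists>N C. \<forall>\<phi>\<in>schwartz. cmod (c * T \<phi>) \<le> C * schwartz_norm N \<phi>" by blast
  then show ?thesis using T unfolding tempered_def by (auto simp: algebra_simps)
qed

lemma tempered_sum:
  assumes "finite A" "\<And>i. i \<in> A \<Longrightarrow> T i \<in> tempered"
  shows "(\<lambda>\<phi>. \<Sum>i\<in>A. T i \<phi>) \<in> tempered"
  using assms by (induction A rule: finite_induct) (auto simp: tempered_zero tempered_add)

lemma schwartz_translate_iff: "(\<lambda>x. \<phi> (x + a)) \<in> schwartz \<longleftrightarrow> \<phi> \<in> schwartz"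
  using schwartz_affine[of \<phi> 1 a] schwartz_affine[of "\<lambda>x. \<phi> (x + a)" 1 "- a"] by auto

lemma dparts_translate: "\<phi> \<in> schwartz \<Longrightarrow> dparts js (\<lambda>x. \<phi> (x + a)) = (\<lambda>x. dparts js \<phi> (x + a))"
proof (induction js)
  case (Cons j js)
  have "dpart j (\<lambda>x. dparts js \<phi> (1 *\<^sub>R x + a)) = (\<lambda>x. of_real 1 * dpart j (dparts js \<phi>) (1 *\<^sub>R x + a))"
    by (rule dpart_affine) (rule schwartz_differentiable[OF schwartz_dparts[OF Cons.prems]])
  then show ?case using Cons by (simp add: dparts_Cons)
qed simp

lemma tempered_translate:
  assumes T: "T \<in> tempered" shows "ttranslate a T \<in> tempered"
proof -
  obtain N C where 1: "C \<ge> 0" "\<And>\<phi>. \<phi> \<in> schwartz \<Longrightarrow> cmod (T \<phi>) \<le> C * schwartz_norm N \<phi>" by (rule temperedE[OF T]) blast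
  have "cmod (ttranslate a T \<phi>) \<le> (C * (1 + norm a) ^ N) * schwartz_norm N \<phi>" if p: "\<phi> \<in> schwartz" for \<phi>
  proof -
    have "cmod (ttranslate a T \<phi>) \<le> C * schwartz_norm N (\<lambda>x. \<phi> (x + a))"
      unfolding ttranslate_def by (rule 1) (simp add: schwartz_translate_iff p)
    also have "schwartz_norm N (\<lambda>x. \<phi> (x + a)) \<le> (1 + norm a) ^ N * schwartz_norm N \<phi>"
    proof (rule schwartz_norm_least)
      fix js :: "'a list" and x assume js: "length js \<le> N"
      have "(1 + norm x) ^ N * cmod (dparts js (\<lambda>x. \<phi> (x + a)) x) \<le> ((1 + norm (x + a)) ^ N * (1 + norm a) ^ N) * cmod (dparts js \<phi> (x + a))"
        unfolding dparts_translate[OF p] using peetre_pow[of "x + a" "- a" N] by (intro mult_right_mono) auto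
      also have "\<dots> = (1 + norm a) ^ N * ((1 + norm (x + a)) ^ N * cmod (dparts js \<phi> (x + a)))" by simp
      also have "\<dots> \<le> (1 + norm a) ^ N * schwartz_norm N \<phi>"
        by (intro mult_left_mono schwartz_norm_upper p js) auto
      finally show "(1 + norm x) ^ N * cmod (dparts js (\<lambda>x. \<phi> (x + a)) x) \<le> (1 + norm a) ^ N * schwartz_norm N \<phi>" .
    qed
    finally show ?thesis using 1 by (simp add: mult_left_mono mult.assoc)
  qed
  then have "\<exists>N C. \<forall>\<phi>\<in>schwartz. cmod (ttranslate a T \<phi>) \<le> C * schwartz_norm N \<phi>" by blast
  then show ?thesis using T unfolding tempered_def by (auto simp: schwartz_translate_iff ttranslate_def)
qed

lemma csupp_add: "compactly_supported S \<Longrightarrow> compactly_supported T \<Longrightarrow> compactly_supported (\<lambda>\<phi>. S \<phi> + T \<phi>)"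
  unfolding compactly_supported_def
proof (elim exE conjE)
  fix K L assume *: "compact K" "compact L" "\<forall>\<phi>\<in>schwartz. closure {x. \<phi> x \<noteq> 0} \<inter> K = {} \<longrightarrow> S \<phi> = 0"
    "\<forall>\<phi>\<in>schwartz. closure {x. \<phi> x \<noteq> 0} \<inter> L = {} \<longrightarrow> T \<phi> = 0"
  then show "\<exists>K. compact K \<and> (\<forall>\<phi>\<in>schwartz. closure {x. \<phi> x \<noteq> 0} \<inter> K = {} \<longrightarrow> S \<phi> + T \<phi> = 0)"
    by (intro exI[of _ "K \<union> L"]) (auto simp: compact_Un Int_Un_distrib)
qed

lemma csupp_scale: "compactly_supported T \<Longrightarrow> compactly_supported (\<lambda>\<phi>. c * T \<phi>)"
  unfolding compactly_supported_def by fastforce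

lemma csupp_zero: "compactly_supported (\<lambda>\<phi>. 0)"
  unfolding compactly_supported_def by (intro exI[of _ "{}"]) auto

lemma csupp_sum:
  assumes "finite A" "\<And>i. i \<in> A \<Longrightarrow> compactly_supported (T i)"
  shows "compactly_supported (\<lambda>\<phi>. \<Sum>i\<in>A. T i \<phi>)"
  using assms by (induction A rule: finite_induct) (auto simp: csupp_zero csupp_add)

lemma csupp_translate:
  assumes "compactly_supported T" shows "compactly_supported (ttranslate a T)"
proof -
  obtain K where K: "compact K" "\<And>\<phi>. \<phi> \<in> schwartz \<Longrightarrow> closure {x. \<phi> x \<noteq> 0} \<inter> K = {} \<Longrightarrow> T \<phi> = 0"
    using assms unfolding compactly_supported_def by blast
  have "ttranslate a T \<phi> = 0" if p: "\<phi> \<in> schwartz" and e: "closure {x. \<phi> x \<noteq> 0} \<inter> ((+) a ` K) = {}" for \<phi>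
    unfolding ttranslate_def
  proof (rule K(2))
    show "(\<lambda>x. \<phi> (x + a)) \<in> schwartz" by (simp add: schwartz_translate_iff p)
    have "{x. \<phi> (x + a) \<noteq> 0} = (+) (- a) ` {x. \<phi> x \<noteq> 0}"
      by (force simp: image_iff)
    then have "closure {x. \<phi> (x + a) \<noteq> 0} = (+) (- a) ` closure {x. \<phi> x \<noteq> 0}" by (simp only: closure_translation)
    then have cl: "closure {x. \<phi> (x + a) \<noteq> 0} = (+) (- a) ` closure {x. \<phi> x \<noteq> 0}" .
    show "closure {x. \<phi> (x + a) \<noteq> 0} \<inter> K = {}"
    proof (rule ccontr)
      assume "closure {x. \<phi> (x + a) \<noteq> 0} \<inter> K \<noteq> {}"
      then obtain y where y: "y \<in> closure {x. \<phi> x \<noteq> 0}" "- a + y \<in> K" unfolding cl by auto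
      then have "y \<in> (+) a ` K" by (intro image_eqI[of _ _ "- a + y"]) auto
      then show False using y e by blast
    qed
  qed
  then show ?thesis unfolding compactly_supported_def
    using K(1) compact_translation[of K a] by blast
qed

section \<open>Compactly supported elements of a Sobolev space\<close>

text \<open>Peetre's inequality for arbitrary real exponents.\<close>

lemma peetre_powr:
  fixes x t :: "'a::real_normed_vector"
  shows "(1 + norm x) powr p \<le> (1 + norm t) powr p * (1 + norm (x - t)) powr \<bar>p\<bar>"
proof -
  have 1: "1 + norm x \<le> (1 + norm t) * (1 + norm (x - t))"
    using peetre_pow[of t "x - t" 1] by simp
  have 2: "1 + norm t \<le> (1 + norm x) * (1 + norm (x - t))"
    using peetre_pow[of x "t - x" 1] by (simp add: norm_minus_commute)
  show ?thesis
  proof (cases "p \<ge> 0")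
    case True
    have "(1 + norm x) powr p \<le> ((1 + norm t) * (1 + norm (x - t))) powr p"
      using 1 True by (intro powr_mono2) auto
    then show ?thesis using True by (simp add: powr_mult)
  next
    case False
    have "((1 + norm x) * (1 + norm (x - t))) powr p \<le> (1 + norm t) powr p"
      using 2 False by (intro powr_mono2') (auto simp: add_pos_nonneg)
    then have "(1 + norm x) powr p * (1 + norm (x - t)) powr p * (1 + norm (x - t)) powr \<bar>p\<bar>
       \<le> (1 + norm t) powr p * (1 + norm (x - t)) powr \<bar>p\<bar>"
      by (intro mult_right_mono) (auto simp: powr_mult)
    moreover have "(1 + norm (x - t)) powr p * (1 + norm (x - t)) powr \<bar>p\<bar> = 1"
    proof -
      have "1 + norm (x - t) > 0" by (simp add: add_pos_nonneg)
      then show ?thesis using False by (simp add: powr_add[symmetric])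
    qed
    ultimately show ?thesis by (simp add: mult.assoc)
  qed
qed

lemma temperedD:
  assumes "T \<in> tempered" "\<phi> \<in> schwartz"
  shows "\<theta> \<in> schwartz \<Longrightarrow> T (\<lambda>x. \<phi> x + \<theta> x) = T \<phi> + T \<theta>" and "T (\<lambda>x. c * \<phi> x) = c * T \<phi>"
  using assms by (simp_all add: tempered_def)

lemma sobolevD:
  assumes "T \<in> sobolev s"
  shows "T \<in> tempered" "has_fourier T (tfourier T)"
    "integrable lborel (\<lambda>\<omega>. (1 + norm \<omega>) powr (2 * s) * (cmod (tfourier T \<omega>))\<^sup>2)"
    "tfourier T \<in> borel_measurable borel"
  using assms has_fourier_tfourier has_fourier_measurable unfolding sobolev_def by auto

lemma sobolevI:
  assumes "T \<in> tempered" and hf: "has_fourier T g"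
    and i: "integrable lborel (\<lambda>\<omega>. (1 + norm \<omega>) powr (2 * s) * (cmod (g \<omega>))\<^sup>2)"
  shows "T \<in> sobolev s"
proof -
  have [measurable]: "g \<in> borel_measurable borel" "tfourier T \<in> borel_measurable borel"
    using has_fourier_measurable[OF hf] has_fourier_measurable[OF has_fourier_tfourier[OF hf]] by auto
  have "AE x in lborel. tfourier T x = g x" by (rule has_fourier_AE_unique[OF has_fourier_tfourier[OF hf] hf])
  then have "integrable lborel (\<lambda>\<omega>. (1 + norm \<omega>) powr (2 * s) * (cmod (tfourier T \<omega>))\<^sup>2)"
    using i by (subst integrable_cong_AE[where g="\<lambda>\<omega>. (1 + norm \<omega>) powr (2 * s) * (cmod (g \<omega>))\<^sup>2"]) auto
  then show ?thesis using assms unfolding sobolev_def by blast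
qed

lemma sobolev_norm_eq:
  assumes hf: "has_fourier T g"
  shows "sobolev_norm s T = sqrt (LINT \<omega>|lborel. (1 + norm \<omega>) powr (2 * s) * (cmod (g \<omega>))\<^sup>2)"
proof -
  have [measurable]: "g \<in> borel_measurable borel" "tfourier T \<in> borel_measurable borel"
    using has_fourier_measurable[OF hf] has_fourier_measurable[OF has_fourier_tfourier[OF hf]] by auto
  have "AE x in lborel. tfourier T x = g x" by (rule has_fourier_AE_unique[OF has_fourier_tfourier[OF hf] hf])
  then show ?thesis unfolding sobolev_norm_def
    by (subst integral_cong_AE[where g="\<lambda>\<omega>. (1 + norm \<omega>) powr (2 * s) * (cmod (g \<omega>))\<^sup>2"]) auto
qed

text \<open>For large \<open>N\<close>, the estimate \<open>a b \<le> a\<^sup>2 + b\<^sup>2\<close> splits the integrand into the Sobolev integrand and an integrable weight.\<close>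

lemma sobolev_moderate:
  fixes T :: "'d::finite tdist"
  assumes T: "T \<in> sobolev s"
  obtains N where "integrable lborel (\<lambda>t. cmod (tfourier T t) / (1 + norm t) ^ N)"
proof -
  note [measurable] = sobolevD(4)[OF T]
  define M where "M = CARD('d) + 2"
  define N where "N = nat \<lceil>real M + \<bar>s\<bar>\<rceil>"
  have N: "real N \<ge> real M + \<bar>s\<bar>" unfolding N_def using real_nat_ceiling_ge by simp
  show thesis
  proof (rule that[of N], rule Bochner_Integration.integrable_bound)
    show "integrable lborel (\<lambda>t. (1 + norm t) powr (2 * s) * (cmod (tfourier T t))\<^sup>2 + 1 / (1 + norm t) ^ M)"
      by (intro Bochner_Integration.integrable_add sobolevD(3)[OF T] integrable_weight_ge) (simp add: M_def)
    show "AE t in lborel. norm (cmod (tfourier T t) / (1 + norm t) ^ N) \<le>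
        norm ((1 + norm t) powr (2 * s) * (cmod (tfourier T t))\<^sup>2 + 1 / (1 + norm t) ^ M)"
    proof (rule AE_I2)
      fix t :: "real^'d"
      let ?w = "1 + norm t" and ?g = "cmod (tfourier T t)"
      have w: "?w \<ge> 1" "?w > 0" by (auto simp: add_pos_nonneg)
      have "?g / ?w ^ N = (?w powr s * ?g) * ?w powr (- s - real N)"
        using w by (simp add: powr_diff powr_minus powr_realpow field_simps)
      also have "\<dots> \<le> (?w powr s * ?g)\<^sup>2 + (?w powr (- s - real N))\<^sup>2"
      proof -
        have "a * b \<le> a\<^sup>2 + b\<^sup>2" for a b :: real
        proof -
          have "2 * (a * b) \<le> a\<^sup>2 + b\<^sup>2" using sum_squares_bound[of a b] by simp
          moreover have "0 \<le> a\<^sup>2 + b\<^sup>2" by simp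
          ultimately show ?thesis by linarith
        qed
        then show ?thesis .
      qed
      also have "(?w powr (- s - real N))\<^sup>2 = ?w powr (2 * (- s - real N))"
        using w by (simp add: powr_add[symmetric] power2_eq_square)
      also have "\<dots> \<le> ?w powr (- real M)"
      proof (rule powr_mono)
        have "\<bar>s\<bar> + s \<ge> 0" by simp
        moreover have "2 * (- s - n) \<le> - m" if "a + s \<ge> 0" "m + a \<le> n" "0 \<le> m" for a m n :: real
          using that by (simp add: algebra_simps)
        ultimately show "2 * (- s - real N) \<le> - real M" using N by auto
      qed (use w in simp)
      also have "?w powr (- real M) = 1 / ?w ^ M" using w by (simp add: powr_minus powr_realpow divide_inverse)
      also have "(?w powr s * ?g)\<^sup>2 = ?w powr (2 * s) * ?g\<^sup>2"
        using w by (simp add: power_mult_distrib powr_add[symmetric] power2_eq_square[of "_ powr _"])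
      finally have "?g / ?w ^ N \<le> ?w powr (2 * s) * ?g\<^sup>2 + 1 / ?w ^ M" by simp
      moreover have "0 \<le> ?g / ?w ^ N" using w by simp
      ultimately show "norm (?g / ?w ^ N) \<le> norm (?w powr (2 * s) * ?g\<^sup>2 + 1 / ?w ^ M)" by simp
    qed
  qed measurable
qed

lemma rapid_peetre:
  assumes "rapid k"
  obtains D where "D > 0" "\<And>x t. cmod (k (x - t)) * (1 + norm t) ^ N \<le> D * (1 + norm x) ^ N"
proof -
  obtain D where D: "D > 0" "\<And>x. (1 + norm x) ^ N * cmod (k x) \<le> D" by (rule rapidD[OF assms]) blast
  show thesis
  proof (rule that[OF D(1)])
    fix x t
    have "cmod (k (x - t)) * (1 + norm t) ^ N \<le> cmod (k (x - t)) * ((1 + norm x) ^ N * (1 + norm (x - t)) ^ N)"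
      using peetre_pow[of x "t - x" N] by (intro mult_left_mono) (auto simp: norm_minus_commute)
    also have "\<dots> = ((1 + norm (x - t)) ^ N * cmod (k (x - t))) * (1 + norm x) ^ N" by simp
    also have "\<dots> \<le> D * (1 + norm x) ^ N" by (intro mult_right_mono D) auto
    finally show "cmod (k (x - t)) * (1 + norm t) ^ N \<le> D * (1 + norm x) ^ N" .
  qed
qed

text \<open>The decay of \<open>k\<close> compensates the moderate growth of \<open>g\<close>, locally uniformly in \<open>x\<close>, so that dominated
convergence applies.\<close>

lemma moderate_convolution:
  fixes k g :: "real^'d::finite \<Rightarrow> complex"
  assumes k: "k \<in> schwartz" and [measurable]: "g \<in> borel_measurable borel"
    and i: "integrable lborel (\<lambda>t. cmod (g t) / (1 + norm t) ^ N)"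
  shows "integrable lborel (\<lambda>t. k (x - t) * g t)"
    and "continuous_on UNIV (\<lambda>x. LINT t|lborel. k (x - t) * g t)"
proof -
  have [measurable]: "k \<in> borel_measurable borel" by (rule schwartz_measurable[OF k])
  obtain D where D: "D > 0" "\<And>x t. cmod (k (x - t)) * (1 + norm t) ^ N \<le> D * (1 + norm x) ^ N"
    by (rule rapid_peetre[OF schwartz_rapid[OF k]]) blast
  have pos: "(1 + norm t) ^ N > 0" for t :: "real^'d" by (intro zero_less_power) (simp add: add_pos_nonneg)
  have b: "cmod (k (x - t) * g t) \<le> (D * (1 + norm x) ^ N) * (cmod (g t) / (1 + norm t) ^ N)" for x t
  proof -
    have "cmod (k (x - t) * g t) = (cmod (k (x - t)) * (1 + norm t) ^ N) * (cmod (g t) / (1 + norm t) ^ N)"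
    proof -
      have "a * b = (a * w) * (b / w)" if "w > 0" for a b w :: real using that by simp
      from this[OF pos] show ?thesis unfolding norm_mult .
    qed
    also have "\<dots> \<le> (D * (1 + norm x) ^ N) * (cmod (g t) / (1 + norm t) ^ N)"
      by (intro mult_right_mono D) (use pos[of t] in auto)
    finally show ?thesis .
  qed
  show ii: "integrable lborel (\<lambda>t. k (x - t) * g t)" for x
  proof (rule Bochner_Integration.integrable_bound[OF integrable_mult_right[OF i]])
    show "AE t in lborel. norm (k (x - t) * g t) \<le> norm ((D * (1 + norm x) ^ N) * (cmod (g t) / (1 + norm t) ^ N))"
      unfolding real_norm_def by (intro AE_I2 order_trans[OF b] abs_ge_self)
  qed measurable
  show "continuous_on UNIV (\<lambda>x. LINT t|lborel. k (x - t) * g t)"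
  proof (rule continuous_on_sequentiallyI)
    fix u :: "nat \<Rightarrow> real^'d" and a assume u: "u \<longlonglongrightarrow> a"
    then have "bounded (range u)" by (metis convergent_imp_bounded)
    then obtain M where M: "\<And>n. norm (u n) \<le> M" unfolding bounded_iff by auto
    show "(\<lambda>n. LINT t|lborel. k (u n - t) * g t) \<longlonglongrightarrow> (LINT t|lborel. k (a - t) * g t)"
    proof (rule integral_dominated_convergence[where w="\<lambda>t. (D * (1 + M) ^ N) * (cmod (g t) / (1 + norm t) ^ N)"])
      show "integrable lborel (\<lambda>t. (D * (1 + M) ^ N) * (cmod (g t) / (1 + norm t) ^ N))"
        by (rule integrable_mult_right[OF i])
      show "AE t in lborel. (\<lambda>n. k (u n - t) * g t) \<longlonglongrightarrow> k (a - t) * g t"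
      proof (intro AE_I2 tendsto_mult tendsto_const)
        fix t
        have "isCont k (a - t)" using differentiable_imp_continuous_within[OF schwartz_differentiable[OF k, of "a - t"]] by simp
        then show "(\<lambda>n. k (u n - t)) \<longlonglongrightarrow> k (a - t)"
          by (rule isCont_tendsto_compose) (intro tendsto_intros u)
      qed
      show "AE t in lborel. norm (k (u n - t) * g t) \<le> (D * (1 + M) ^ N) * (cmod (g t) / (1 + norm t) ^ N)" for n
      proof (intro AE_I2 order_trans[OF b] mult_right_mono mult_left_mono power_mono)
        show "1 + norm (u n) \<le> 1 + M" using M[of n] by simp
      qed (use D pos in \<open>auto intro: divide_nonneg_pos\<close>)
    qed measurable
  qed
qed

lemma schwartz_reflect: "k \<in> schwartz \<Longrightarrow> (\<lambda>t. k (a - t)) \<in> schwartz"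
  using schwartz_affine[of k "-1" a] by simp

text \<open>A cutoff \<open>c\<close> equal to 1 near the support satisfies \<open>c T = T\<close>, and on the Fourier side multiplication by \<open>c\<close> is convolution with
\<open>c^\<close> divided by \<open>(2 \<pi>)\<^sup>d\<close>.  The convolution is a continuous representative of the transform,
hence equal to \<open>tfourier T\<close>, which therefore reproduces itself.\<close>

theorem csupp_fourier_representation:
  fixes T :: "'d::finite tdist"
  assumes sob: "T \<in> sobolev s" and cs: "compactly_supported T"
  obtains k where "k \<in> schwartz" "\<And>x. tfourier T x = (LINT t|lborel. k (x - t) * tfourier T t)"
    "\<And>x. integrable lborel (\<lambda>t. k (x - t) * tfourier T t)" "continuous_on UNIV (tfourier T)"
proof -
  let ?g = "tfourier T"
  note T = sobolevD[OF sob]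
  note [measurable] = T(4)
  obtain N where N: "integrable lborel (\<lambda>t. cmod (?g t) / (1 + norm t) ^ N)" by (rule sobolev_moderate[OF sob])
  obtain K where K: "compact K" "\<And>\<phi>. \<phi> \<in> schwartz \<Longrightarrow> closure {x. \<phi> x \<noteq> 0} \<inter> K = {} \<Longrightarrow> T \<phi> = 0"
    using cs unfolding compactly_supported_def by blast
  obtain R where R: "\<And>x. x \<in> K \<Longrightarrow> norm x \<le> R" using compact_imp_bounded[OF K(1)] unfolding bounded_iff by blast
  obtain c :: "real^'d \<Rightarrow> complex" where c: "c \<in> schwartz" "\<And>x. norm x \<le> R + 1 \<Longrightarrow> c x = 1"
    using ex_cutoff[of "R + 1"] by blast
  have Tc: "T (\<lambda>x. c x * f x) = T f" if f: "f \<in> schwartz" for f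
  proof -
    have cf: "(\<lambda>x. c x * f x) \<in> schwartz" by (intro schwartz_mult c schwartz_imp_tame f)
    have d: "(\<lambda>x. f x + (-1) * (c x * f x)) \<in> schwartz" by (intro schwartz_add schwartz_cmult cf f)
    have "closure {x. f x + (-1) * (c x * f x) \<noteq> 0} \<subseteq> {x. R + 1 \<le> norm x}"
    proof (rule closure_minimal)
      show "{x. f x + (-1) * (c x * f x) \<noteq> 0} \<subseteq> {x. R + 1 \<le> norm x}"
      proof
        fix x assume "x \<in> {x. f x + (-1) * (c x * f x) \<noteq> 0}"
        then have "\<not> norm x \<le> R + 1" using c(2)[of x] by auto
        then show "x \<in> {x. R + 1 \<le> norm x}" by simp
      qed
    qed (intro closed_Collect_le continuous_intros)
    then have "closure {x. f x + (-1) * (c x * f x) \<noteq> 0} \<inter> K = {}" using R by fastforce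
    from K(2)[OF d this] have "T (\<lambda>x. f x + (-1) * (c x * f x)) = 0" .
    moreover have "T (\<lambda>x. f x + (-1) * (c x * f x)) = T f + T (\<lambda>x. (-1) * (c x * f x))"
      by (rule temperedD(1)[OF T(1) f schwartz_cmult[OF cf]])
    moreover have "T (\<lambda>x. (-1) * (c x * f x)) = (-1) * T (\<lambda>x. c x * f x)"
      by (rule temperedD(2)[OF T(1) cf])
    ultimately show ?thesis by simp
  qed
  let ?C = "(gmass TYPE('d))\<^sup>2"
  define k where "k x = (1 / ?C) * fourier c x" for x
  have kS: "k \<in> schwartz" unfolding k_def[abs_def] by (intro schwartz_cmult fourier_schwartz c)
  then have [measurable]: "k \<in> borel_measurable borel" by (rule schwartz_measurable)
  define G where "G x = (LINT t|lborel. k (x - t) * ?g t)" for x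
  have contG: "continuous_on UNIV G" unfolding G_def[abs_def] by (rule moderate_convolution(2)[OF kS T(4) N])
  have intG: "integrable lborel (\<lambda>t. k (x - t) * ?g t)" for x by (rule moderate_convolution(1)[OF kS T(4) N])
  have [measurable]: "G \<in> borel_measurable borel" by (intro borel_measurable_continuous_onI contG)
  have pos: "(1 + norm t) ^ N > 0" for t :: "real^'d" by (intro zero_less_power) (simp add: add_pos_nonneg)
  have pair: "integrable lborel (\<lambda>\<omega>. G \<omega> * \<phi> \<omega>) \<and> T (fourier \<phi>) = (LINT \<omega>|lborel. G \<omega> * \<phi> \<omega>)" if p: "\<phi> \<in> schwartz" for \<phi>
  proof -
    have [measurable]: "\<phi> \<in> borel_measurable borel" by (rule schwartz_measurable[OF p])
    obtain D where D: "D > 0" "\<And>x t. cmod (k (x - t)) * (1 + norm t) ^ N \<le> D * (1 + norm x) ^ N"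
      by (rule rapid_peetre[OF schwartz_rapid[OF kS]]) blast
    let ?p = "\<lambda>\<omega>. \<phi> \<omega> * of_real ((1 + norm \<omega>) ^ N)" and ?q = "\<lambda>t. ?g t / of_real ((1 + norm t) ^ N)"
    \<comment> \<open>Moving the weight from \<open>g\<close> to \<open>\<phi>\<close> makes both factors integrable and keeps the kernel bounded, as Fubini requires.\<close>
    let ?k = "\<lambda>\<omega> t. k (\<omega> - t) * of_real ((1 + norm t) ^ N / (1 + norm \<omega>) ^ N)"
    have ip: "integrable lborel ?p"
    proof (rule rapid_integrable[OF rapid_mult_polybd[OF schwartz_rapid[OF p]]])
      show "polybd (\<lambda>\<omega>::real^'d. complex_of_real ((1 + norm \<omega>) ^ N))"
        unfolding polybd_def by (intro exI[of _ 1] exI[of _ N] allI) (unfold norm_of_real, simp)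
    qed measurable
    have iq: "integrable lborel ?q"
    proof (rule integrable_norm_cancel)
      have "cmod (?q t) = cmod (?g t) / (1 + norm t) ^ N" for t
        unfolding norm_divide norm_of_real using pos[of t] by simp
      then show "integrable lborel (\<lambda>t. cmod (?q t))" using N by simp
    qed measurable
    have kb: "cmod (?k \<omega> t) \<le> D" for \<omega> t
    proof -
      have "cmod (?k \<omega> t) = (cmod (k (\<omega> - t)) * (1 + norm t) ^ N) / (1 + norm \<omega>) ^ N"
        unfolding norm_mult norm_of_real using pos[of t] pos[of \<omega>] by simp
      also have "\<dots> \<le> D" using D(2)[of \<omega> t] pos[of \<omega>] by (simp add: divide_le_eq)
      finally show ?thesis .
    qed
    have km: "(\<lambda>(x, y). ?k x y) \<in> borel_measurable (borel \<Otimes>\<^sub>M borel)" by measurable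
    note F = Fubini_bounded_kernel[OF ip iq km kb]

    have nz: "complex_of_real ((1 + norm x) ^ N) \<noteq> 0" for x :: "real^'d"
      unfolding of_real_eq_0_iff by (rule less_imp_neq[OF pos, symmetric])
    have cancel: "A * ((g / B) * (a * (B / A))) = a * g" "(1 / B) * ((g * A) * (a * (B / A))) = g * a"
      if "A \<noteq> 0" "B \<noteq> 0" for A B a g :: complex
      using that by simp_all
    have e1: "?p \<omega> * (LINT t|lborel. ?q t * ?k \<omega> t) = G \<omega> * \<phi> \<omega>" for \<omega>
    proof -
      have "of_real ((1 + norm \<omega>) ^ N) * (?q t * ?k \<omega> t) = k (\<omega> - t) * ?g t" for t
        unfolding of_real_divide by (rule cancel(1)[OF nz nz])
      then have "of_real ((1 + norm \<omega>) ^ N) * (LINT t|lborel. ?q t * ?k \<omega> t) = G \<omega>"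
        unfolding G_def by (subst integral_mult_right_zero[symmetric]) (simp only:)
      then show ?thesis by (simp only: mult_ac)
    qed
    have e2: "?q t * (LINT \<omega>|lborel. ?p \<omega> * ?k \<omega> t) = ?g t * ifourier (\<lambda>x. c x * fourier \<phi> x) t" for t
    proof -
      have 1: "(\<lambda>x. c x * exp (\<i> * of_real (t \<bullet> x))) \<in> schwartz" by (intro schwartz_mult c tame_cis)
      have "(1 / of_real ((1 + norm t) ^ N)) * (?p \<omega> * ?k \<omega> t) = \<phi> \<omega> * k (\<omega> - t)" for \<omega>
        unfolding of_real_divide by (rule cancel(2)[OF nz nz])
      then have "(1 / of_real ((1 + norm t) ^ N)) * (LINT \<omega>|lborel. ?p \<omega> * ?k \<omega> t) = (LINT \<omega>|lborel. \<phi> \<omega> * k (\<omega> - t))"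
        by (subst integral_mult_right_zero[symmetric]) (simp only:)
      also have "\<dots> = (1 / ?C) * (LINT \<omega>|lborel. \<phi> \<omega> * fourier (\<lambda>x. c x * exp (\<i> * of_real (t \<bullet> x))) \<omega>)"
      proof -
        have "fourier c (\<omega> - t) = fourier (\<lambda>x. c x * exp (\<i> * of_real (t \<bullet> x))) \<omega>" for \<omega>
          unfolding fourier_def
          by (intro Bochner_Integration.integral_cong refl) (simp add: inner_diff_left exp_add[symmetric] algebra_simps)
        then show ?thesis unfolding k_def by (subst integral_mult_right_zero[symmetric]) (simp add: mult_ac)
      qed
      also have "\<dots> = (1 / ?C) * (LINT x|lborel. (c x * exp (\<i> * of_real (t \<bullet> x))) * fourier \<phi> x)"
        by (subst fourier_multiplication[OF schwartz_integrable[OF p] schwartz_integrable[OF 1]]) simp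
      also have "\<dots> = ifourier (\<lambda>x. c x * fourier \<phi> x) t"
        by (simp add: ifourier_def fourier_def mult_ac)
      finally have "?g t * ((1 / of_real ((1 + norm t) ^ N)) * (LINT \<omega>|lborel. ?p \<omega> * ?k \<omega> t)) = ?g t * ifourier (\<lambda>x. c x * fourier \<phi> x) t"
        by (simp only:)
      then show ?thesis by (simp only: mult.assoc[symmetric] times_divide_eq_right mult_1_right)
    qed
    have cS: "(\<lambda>x. c x * fourier \<phi> x) \<in> schwartz" by (intro schwartz_mult c schwartz_imp_tame fourier_schwartz p)
    have "T (fourier \<phi>) = T (fourier (ifourier (\<lambda>x. c x * fourier \<phi> x)))"
      by (simp add: fourier_ifourier[OF cS] Tc fourier_schwartz p)
    also have "\<dots> = (LINT t|lborel. ?g t * ifourier (\<lambda>x. c x * fourier \<phi> x) t)"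
      by (rule has_fourier_eq[OF T(2) ifourier_schwartz[OF cS]])
    also have "\<dots> = (LINT \<omega>|lborel. G \<omega> * \<phi> \<omega>)"
      unfolding e2[symmetric] e1[symmetric] by (rule F(1)[symmetric])
    finally show ?thesis using F(2) unfolding e1 by simp
  qed
  have "has_fourier T G"
    unfolding has_fourier_def
  proof (intro conjI allI impI ballI)
    fix S :: "(real^'d) set" assume S: "compact S"
    show "set_integrable lborel S (\<lambda>\<omega>. (cmod (G \<omega>))\<^sup>2)"
      unfolding set_integrable_def
      by (intro borel_integrable_compact S continuous_intros continuous_on_subset[OF contG]) auto
  qed (use pair in auto)
  then have e: "tfourier T = G" using contG by (rule tfourier_eqI)
  have rep: "tfourier T x = (LINT t|lborel. k (x - t) * tfourier T t)" for x
    by (rule trans[OF fun_cong[OF e] G_def])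
  have "continuous_on UNIV (tfourier T)" unfolding e by (rule contG)
  from that[OF kS rep intG this] show thesis .
qed

section \<open>Uniformly bounded lattice sums\<close>

definition lattice :: "real \<Rightarrow> (real^'d::finite) set" where
  "lattice c = (\<lambda>x. c *\<^sub>R x) ` int_lattice"

lemma lattice_iff: "c \<noteq> 0 \<Longrightarrow> x \<in> lattice c \<longleftrightarrow> (\<forall>i. x $ i / c \<in> \<int>)"
proof
  assume c: "c \<noteq> 0" and "\<forall>i. x $ i / c \<in> \<int>"
  then have "(1 / c) *\<^sub>R x \<in> int_lattice" by (simp add: int_lattice_def)
  then show "x \<in> lattice c" unfolding lattice_def using c by (intro image_eqI[of _ _ "(1 / c) *\<^sub>R x"]) auto
qed (auto simp: lattice_def int_lattice_def)

lemma lattice_close_eq: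
  assumes c: "c > 0" and "x \<in> lattice c" "y \<in> lattice c" and d: "\<And>i. \<bar>x $ i - y $ i\<bar> < c"
  shows "x = y"
proof -
  have "x $ i = y $ i" for i
  proof -
    have "x $ i / c - y $ i / c \<in> \<int>" using assms by (simp add: lattice_iff)
    moreover have "\<bar>x $ i / c - y $ i / c\<bar> < 1" using d[of i] c by (simp add: diff_divide_distrib[symmetric])
    ultimately show ?thesis using c Ints_nonzero_abs_ge1[of "x $ i / c - y $ i / c"] by auto
  qed
  then show ?thesis by (simp add: vec_eq_iff)
qed

text \<open>The translates of a cube by the lattice are disjoint, and the weight varies only by a bounded factor on
each of them.  The sum is thus bounded by the integral of the weight, whatever \<open>x\<close> is.\<close>

lemma lattice_weight_sum:
  assumes c: "c > 0"
  obtains L where "L \<ge> 0" "\<And>F (x::real^'d::finite). finite F \<Longrightarrow> F \<subseteq> lattice c \<Longrightarrow>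
     (\<Sum>\<alpha>\<in>F. 1 / (1 + norm (x + \<alpha>)) ^ (CARD('d) + 2)) \<le> L"
proof -
  let ?M = "CARD('d) + 2"
  let ?w = "\<lambda>x::real^'d. 1 / (1 + norm x) ^ ?M"
  define Q where "Q = box (0::real^'d) (\<chi> i. c)"
  have Qi: "y \<in> Q \<longleftrightarrow> (\<forall>i. 0 < y $ i \<and> y $ i < c)" for y by (simp add: Q_def mem_box_vec)
  have [measurable]: "Q \<in> sets borel" by (simp add: Q_def)
  define m where "m = measure lborel Q"
  have "bounded Q" by (simp add: Q_def)
  then have Qf: "emeasure lborel Q < \<infinity>" using emeasure_bounded_finite[of Q] by simp
  have m: "m > 0"
  proof -
    have "Q \<noteq> {}" using c Qi[of "\<chi> i. c / 2"] by auto
    then have "\<not> negligible Q" using open_not_negligible[of Q] open_box[of 0 "\<chi> i. c"] unfolding Q_def by blast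
    then have "emeasure lborel Q \<noteq> 0" by (auto simp: negligible_iff_null_sets null_sets_def emeasure_completion)
    then show ?thesis using Qf by (simp add: m_def measure_def enn2real_positive_iff less_top zero_less_iff_neq_zero)
  qed
  define D where "D = (1 + real CARD('d) * c) ^ ?M"
  have pos: "(1 + norm x) ^ ?M > 0" for x :: "real^'d" by (intro zero_less_power) (simp add: add_pos_nonneg)
  have iw: "integrable lborel ?w" by (intro integrable_weight_ge) simp
  have iwx: "integrable lborel (\<lambda>y. ?w (x + y))" for x
    using integrable_lborel_affine[OF iw, of 1 x] by (simp add: add.commute)
  have comp: "?w z \<le> D * ?w (z + y)" if "y \<in> Q" for y z
  proof -
    have "norm y \<le> (\<Sum>i\<in>UNIV. \<bar>y $ i\<bar>)" by (rule norm_le_l1_cart)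
    also have "\<dots> \<le> (\<Sum>i\<in>(UNIV::'d set). c)" using that by (intro sum_mono) (auto simp: Qi less_imp_le)
    finally have "(1 + norm y) ^ ?M \<le> D" unfolding D_def by (intro power_mono) auto
    then have "(1 + norm (z + y)) ^ ?M \<le> (1 + norm z) ^ ?M * D"
      using peetre_pow[of z y ?M] pos[of z] by (meson mult_left_mono less_imp_le order_trans)
    moreover have "1 / a \<le> D * (1 / b)" if "b \<le> a * D" "a > 0" "b > 0" for a b :: real
      using that by (simp add: field_simps)
    ultimately show ?thesis using pos by blast
  qed
  have one: "m * ?w z \<le> D * (LINT y|lborel. indicator Q y * ?w (z + y))" for z
  proof -
    have iQ: "integrable lborel (indicat_real Q)" using Qf by (simp add: integrable_indicator_iff)
    have "m * ?w z = (LINT y|lborel. indicator Q y * ?w z)" using iQ Qf by (simp add: m_def)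
    also have "\<dots> \<le> (LINT y|lborel. D * (indicator Q y * ?w (z + y)))"
    proof (rule integral_mono)
      show "integrable lborel (\<lambda>y. indicat_real Q y * ?w z)" by (rule integrable_mult_left[OF iQ])
      show "integrable lborel (\<lambda>y. D * (indicat_real Q y * ?w (z + y)))"
      proof (intro integrable_mult_right Bochner_Integration.integrable_bound[OF iwx[of z]])
        show "AE y in lborel. norm (indicat_real Q y * ?w (z + y)) \<le> norm (?w (z + y))"
          by (intro AE_I2) (auto simp: indicator_def)
      qed measurable
      show "indicator Q y * ?w z \<le> D * (indicator Q y * ?w (z + y))" for y
        using comp[of y z] by (auto simp: indicator_def)
    qed
    finally show ?thesis by (simp only: integral_mult_right_zero)
  qed
  define I where "I = (LINT y|lborel. ?w y)"
  have I0: "I \<ge> 0" unfolding I_def using pos by (intro integral_nonneg_AE AE_I2) (auto simp: less_imp_le)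
  have D0: "D \<ge> 0" unfolding D_def using c by simp
  show thesis
  proof (rule that[of "D * I / m"])
    show "0 \<le> D * I / m" using I0 D0 m by simp
    fix F :: "(real^'d) set" and x :: "real^'d" assume F: "finite F" "F \<subseteq> lattice c"
    have iQ: "integrable lborel (\<lambda>y. indicat_real Q (y - (x + \<alpha>)) * ?w y)" for \<alpha>
    proof (rule Bochner_Integration.integrable_bound[OF iw])
      show "AE y in lborel. norm (indicat_real Q (y - (x + \<alpha>)) * ?w y) \<le> norm (?w y)"
        by (intro AE_I2) (auto simp: indicator_def)
    qed measurable
    have "m * (\<Sum>\<alpha>\<in>F. ?w (x + \<alpha>)) \<le> (\<Sum>\<alpha>\<in>F. D * (LINT y|lborel. indicator Q y * ?w ((x + \<alpha>) + y)))"
      unfolding sum_distrib_left by (intro sum_mono one)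
    also have "\<dots> = D * (\<Sum>\<alpha>\<in>F. (LINT y|lborel. indicator Q (y - (x + \<alpha>)) * ?w y))"
    proof -
      have "(LINT y|lborel. indicator Q (y - (x + \<alpha>)) * ?w y) = (LINT y|lborel. indicator Q y * ?w ((x + \<alpha>) + y))" for \<alpha>
        by (subst integral_lborel_affine[of 1 _ "x + \<alpha>"]) (simp_all add: add.commute)
      then show ?thesis by (simp add: sum_distrib_left)
    qed
    also have "(\<Sum>\<alpha>\<in>F. (LINT y|lborel. indicator Q (y - (x + \<alpha>)) * ?w y)) = (LINT y|lborel. (\<Sum>\<alpha>\<in>F. indicator Q (y - (x + \<alpha>)) * ?w y))"
      by (rule Bochner_Integration.integral_sum[symmetric]) (rule iQ)
    also have "\<dots> \<le> I"
      unfolding I_def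
    proof (rule integral_mono)
      show "integrable lborel (\<lambda>y. \<Sum>\<alpha>\<in>F. indicat_real Q (y - (x + \<alpha>)) * ?w y)"
        by (intro Bochner_Integration.integrable_sum iQ)
      fix y
      have "(\<Sum>\<alpha>\<in>F. indicat_real Q (y - (x + \<alpha>))) \<le> 1"
      proof -
        have "(\<Sum>\<alpha>\<in>F. indicat_real Q (y - (x + \<alpha>))) = real (card {\<alpha>\<in>F. y - (x + \<alpha>) \<in> Q})"
          using F by (simp add: indicator_def sum.If_cases Int_def)
        moreover have "card {\<alpha>\<in>F. y - (x + \<alpha>) \<in> Q} \<le> 1"
        proof (rule card_le_Suc0_iff_eq[THEN iffD2, unfolded One_nat_def[symmetric]])
          show "finite {\<alpha> \<in> F. y - (x + \<alpha>) \<in> Q}" using F by simp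
          show "\<forall>a\<in>{\<alpha> \<in> F. y - (x + \<alpha>) \<in> Q}. \<forall>b\<in>{\<alpha> \<in> F. y - (x + \<alpha>) \<in> Q}. a = b"
          proof (intro ballI)
            fix a b assume a: "a \<in> {\<alpha> \<in> F. y - (x + \<alpha>) \<in> Q}" and b: "b \<in> {\<alpha> \<in> F. y - (x + \<alpha>) \<in> Q}"
            show "a = b"
            proof (rule lattice_close_eq[OF c])
              fix i
              have "0 < (y - (x + a)) $ i" "(y - (x + a)) $ i < c" "0 < (y - (x + b)) $ i" "(y - (x + b)) $ i < c"
                using a b by (auto simp: Qi)
              then show "\<bar>a $ i - b $ i\<bar> < c" by (simp add: abs_if)
            qed (use a b F in auto)
          qed
        qed
        ultimately show ?thesis by simp
      qed
      then show "(\<Sum>\<alpha>\<in>F. indicat_real Q (y - (x + \<alpha>)) * ?w y) \<le> ?w y"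
        unfolding sum_distrib_right[symmetric] using pos[of y] by (intro mult_left_le_one_le) (auto intro: sum_nonneg less_imp_le)
    qed (rule iw)
    finally have "m * (\<Sum>\<alpha>\<in>F. ?w (x + \<alpha>)) \<le> D * I" using D0 by (simp add: mult_left_mono)
    then show "(\<Sum>\<alpha>\<in>F. ?w (x + \<alpha>)) \<le> D * I / m" using m by (simp add: le_divide_eq mult.commute)
  qed
qed

text \<open>The Cauchy-Schwarz inequality for the factors \<open>|k|\<^sup>1\<^sup>/\<^sup>2\<close> and \<open>|k|\<^sup>1\<^sup>/\<^sup>2 |g|\<close>.\<close>

lemma integral_Cauchy_Schwarz_kernel:
  fixes k g :: "'a \<Rightarrow> complex"
  assumes [measurable]: "k \<in> borel_measurable M" "g \<in> borel_measurable M"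
    and i: "integrable M k"
  shows "ennreal ((cmod (LINT t|M. k t * g t))\<^sup>2) \<le> ennreal (LINT t|M. cmod (k t)) * (\<integral>\<^sup>+t. ennreal (cmod (k t) * (cmod (g t))\<^sup>2) \<partial>M)"
proof -
  have "ennreal (cmod (LINT t|M. k t * g t)) \<le> (\<integral>\<^sup>+t. ennreal (cmod (k t * g t)) \<partial>M)"
  proof (cases "integrable M (\<lambda>t. k t * g t)")
    case True then show ?thesis using integral_norm_bound_ennreal by blast
  next
    case False then show ?thesis by (simp add: not_integrable_integral_eq)
  qed
  also have "\<dots> = (\<integral>\<^sup>+t. ennreal (sqrt (cmod (k t))) * ennreal (sqrt (cmod (k t)) * cmod (g t)) \<partial>M)"
    by (intro nn_integral_cong) (simp add: ennreal_mult[symmetric] norm_mult mult.assoc[symmetric])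
  finally have 1: "ennreal (cmod (LINT t|M. k t * g t)) \<le> (\<integral>\<^sup>+t. ennreal (sqrt (cmod (k t))) * ennreal (sqrt (cmod (k t)) * cmod (g t)) \<partial>M)" .
  have "ennreal ((cmod (LINT t|M. k t * g t))\<^sup>2) = (ennreal (cmod (LINT t|M. k t * g t)))\<^sup>2"
    by (simp add: ennreal_power)
  also have "\<dots> \<le> (\<integral>\<^sup>+t. ennreal (sqrt (cmod (k t))) * ennreal (sqrt (cmod (k t)) * cmod (g t)) \<partial>M)\<^sup>2"
    by (intro power_mono 1) auto
  also have "\<dots> \<le> (\<integral>\<^sup>+t. (ennreal (sqrt (cmod (k t))))\<^sup>2 \<partial>M) * (\<integral>\<^sup>+t. (ennreal (sqrt (cmod (k t)) * cmod (g t)))\<^sup>2 \<partial>M)"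
    by (rule Cauchy_Schwarz_nn_integral) measurable
  also have "(\<integral>\<^sup>+t. (ennreal (sqrt (cmod (k t))))\<^sup>2 \<partial>M) = ennreal (LINT t|M. cmod (k t))"
    by (subst nn_integral_eq_integral[symmetric]) (auto simp: ennreal_power i intro!: nn_integral_cong)
  also have "(\<integral>\<^sup>+t. (ennreal (sqrt (cmod (k t)) * cmod (g t)))\<^sup>2 \<partial>M) = (\<integral>\<^sup>+t. ennreal (cmod (k t) * (cmod (g t))\<^sup>2) \<partial>M)"
    by (intro nn_integral_cong) (simp add: ennreal_power power_mult_distrib)
  finally show ?thesis .
qed

text \<open>Cauchy-Schwarz in the convolution formula bounds \<open>|T^(x)|\<^sup>2\<close> by a convolution of \<open>|T^|\<^sup>2\<close> with a rapidly decaying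
kernel.  Peetre's inequality moves the weight under the integral, and summing the kernel
over the lattice first leaves a multiple of the squared Sobolev norm.\<close>

theorem bracket_bound:
  fixes T :: "'d::finite tdist"
  assumes sob: "T \<in> sobolev s" and cs: "compactly_supported T" and c: "c > 0"
  obtains B where "B \<ge> 0" "\<And>F \<omega>. finite F \<Longrightarrow> F \<subseteq> lattice c \<Longrightarrow>
     (\<Sum>\<alpha>\<in>F. (1 + norm (\<omega> + \<alpha>)) powr (2 * s) * (cmod (tfourier T (\<omega> + \<alpha>)))\<^sup>2) \<le> B"
proof -
  let ?g = "tfourier T" and ?M = "CARD('d) + 2"
  let ?w = "\<lambda>x::real^'d. 1 / (1 + norm x) ^ ?M"
  let ?u = "\<lambda>t. (1 + norm t) powr (2 * s) * (cmod (?g t))\<^sup>2"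
  note T = sobolevD[OF sob]
  note [measurable] = T(4)
  obtain k where k: "k \<in> schwartz" and rep: "\<And>x. ?g x = (LINT t|lborel. k (x - t) * ?g t)"
    by (rule csupp_fourier_representation[OF sob cs]) blast
  note [measurable] = schwartz_measurable[OF k]
  obtain L where L: "L \<ge> 0" "\<And>F (x::real^'d). finite F \<Longrightarrow> F \<subseteq> lattice c \<Longrightarrow> (\<Sum>\<alpha>\<in>F. ?w (x + \<alpha>)) \<le> L"
    by (rule lattice_weight_sum[OF c]) blast
  define n where "n = nat \<lceil>\<bar>2 * s\<bar>\<rceil>"
  obtain D where D: "D > 0" "\<And>x. (1 + norm x) ^ (?M + n) * cmod (k x) \<le> D" by (rule rapidD[OF schwartz_rapid[OF k]]) blast
  have pos: "(1 + norm x) ^ ?M > 0" "1 + norm x > 0" for x :: "real^'d"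
    by (auto intro!: zero_less_power simp: add_pos_nonneg)
  have kb: "(1 + norm y) powr \<bar>2 * s\<bar> * cmod (k y) \<le> D * ?w y" for y
  proof -
    have "(1 + norm y) powr \<bar>2 * s\<bar> \<le> (1 + norm y) powr real n"
      unfolding n_def using real_nat_ceiling_ge by (intro powr_mono) auto
    also have "\<dots> = (1 + norm y) ^ n" using pos(2)[of y] by (simp add: powr_realpow)
    finally have "(1 + norm y) powr \<bar>2 * s\<bar> * cmod (k y) * (1 + norm y) ^ ?M \<le> (1 + norm y) ^ n * cmod (k y) * (1 + norm y) ^ ?M"
      using pos(1)[of y] by (intro mult_right_mono) auto
    also have "\<dots> = (1 + norm y) ^ (?M + n) * cmod (k y)" by (simp only: power_add mult_ac)
    also have "\<dots> \<le> D" by (rule D)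
    finally have "(1 + norm y) powr \<bar>2 * s\<bar> * cmod (k y) * (1 + norm y) ^ ?M \<le> D" .
    then show ?thesis using pos(1)[of y] by (simp only: times_divide_eq_right mult_1_right pos_le_divide_eq)
  qed
  define K where "K = (LINT t|lborel. cmod (k t))"
  have K0: "K \<ge> 0" unfolding K_def by simp
  have ik: "integrable lborel (\<lambda>t. k (x - t))" for x by (intro schwartz_integrable schwartz_reflect k)
  have iK: "(LINT t|lborel. cmod (k (x - t))) = K" for x
    unfolding K_def by (subst (2) integral_lborel_affine[of "-1" _ x]) (simp_all add: add.commute)
  have pt: "ennreal ((1 + norm x) powr (2 * s) * (cmod (?g x))\<^sup>2) \<le> ennreal (K * D) * (\<integral>\<^sup>+t. ennreal (?w (x - t) * ?u t) \<partial>lborel)" for x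
  proof -
    have "ennreal ((1 + norm x) powr (2 * s) * (cmod (?g x))\<^sup>2) = ennreal ((1 + norm x) powr (2 * s)) * ennreal ((cmod (LINT t|lborel. k (x - t) * ?g t))\<^sup>2)"
      by (simp add: ennreal_mult rep[symmetric])
    also have "\<dots> \<le> ennreal ((1 + norm x) powr (2 * s)) * (ennreal K * (\<integral>\<^sup>+t. ennreal (cmod (k (x - t)) * (cmod (?g t))\<^sup>2) \<partial>lborel))"
      by (intro mult_left_mono integral_Cauchy_Schwarz_kernel[where k="\<lambda>t. k (x - t)" and M=lborel, unfolded iK] ik) auto
    also have "\<dots> = ennreal K * (\<integral>\<^sup>+t. ennreal ((1 + norm x) powr (2 * s)) * ennreal (cmod (k (x - t)) * (cmod (?g t))\<^sup>2) \<partial>lborel)"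
      by (subst nn_integral_cmult) (auto simp: mult_ac)
    also have "\<dots> \<le> ennreal K * (\<integral>\<^sup>+t. ennreal D * ennreal (?w (x - t) * ?u t) \<partial>lborel)"
    proof (intro mult_left_mono nn_integral_mono)
      fix t
      have "(1 + norm x) powr (2 * s) * cmod (k (x - t)) \<le> ((1 + norm t) powr (2 * s) * (1 + norm (x - t)) powr \<bar>2 * s\<bar>) * cmod (k (x - t))"
        by (intro mult_right_mono peetre_powr) auto
      also have "\<dots> \<le> (1 + norm t) powr (2 * s) * (D * ?w (x - t))"
        unfolding mult.assoc by (intro mult_left_mono kb) auto
      finally have "((1 + norm x) powr (2 * s) * cmod (k (x - t))) * (cmod (?g t))\<^sup>2 \<le> ((1 + norm t) powr (2 * s) * (D * ?w (x - t))) * (cmod (?g t))\<^sup>2"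
        by (rule mult_right_mono) simp
      moreover have "((1 + norm t) powr (2 * s) * (D * ?w (x - t))) * (cmod (?g t))\<^sup>2 = D * (?w (x - t) * ?u t)" by (simp only: mult_ac)
      moreover have "0 \<le> ?w (x - t)" using pos(1)[of "x - t"] by simp
      ultimately show "ennreal ((1 + norm x) powr (2 * s)) * ennreal (cmod (k (x - t)) * (cmod (?g t))\<^sup>2) \<le> ennreal D * ennreal (?w (x - t) * ?u t)"
        using D(1) by (simp only: ennreal_mult'[symmetric] mult_nonneg_nonneg powr_ge_zero less_imp_le norm_ge_zero zero_le_power mult.assoc) (auto intro: ennreal_leI)
    qed auto
    also have "\<dots> = ennreal (K * D) * (\<integral>\<^sup>+t. ennreal (?w (x - t) * ?u t) \<partial>lborel)"
      using K0 D(1) by (subst nn_integral_cmult) (auto simp: ennreal_mult mult_ac)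
    finally show ?thesis .
  qed
  define I where "I = (LINT t|lborel. ?u t)"
  have I0: "I \<ge> 0" unfolding I_def by (intro integral_nonneg_AE AE_I2) auto
  show thesis
  proof (rule that[of "K * D * (L * I)"])
    show "0 \<le> K * D * (L * I)" using K0 D L I0 by simp
    fix F :: "(real^'d) set" and \<omega> :: "real^'d" assume F: "finite F" "F \<subseteq> lattice c"
    have w0: "0 \<le> ?w x" for x using pos(1)[of x] by simp
    have "ennreal (\<Sum>\<alpha>\<in>F. (1 + norm (\<omega> + \<alpha>)) powr (2 * s) * (cmod (?g (\<omega> + \<alpha>)))\<^sup>2) =
       (\<Sum>\<alpha>\<in>F. ennreal ((1 + norm (\<omega> + \<alpha>)) powr (2 * s) * (cmod (?g (\<omega> + \<alpha>)))\<^sup>2))" by (subst sum_ennreal) auto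
    also have "\<dots> \<le> (\<Sum>\<alpha>\<in>F. ennreal (K * D) * (\<integral>\<^sup>+t. ennreal (?w ((\<omega> + \<alpha>) - t) * ?u t) \<partial>lborel))"
      by (intro sum_mono pt)
    also have "\<dots> = ennreal (K * D) * (\<integral>\<^sup>+t. (\<Sum>\<alpha>\<in>F. ennreal (?w ((\<omega> + \<alpha>) - t) * ?u t)) \<partial>lborel)"
      by (subst nn_integral_sum) (auto simp: sum_distrib_left)
    also have "\<dots> \<le> ennreal (K * D) * (\<integral>\<^sup>+t. ennreal (L * ?u t) \<partial>lborel)"
    proof (intro mult_left_mono nn_integral_mono)
      fix t
      have "(\<Sum>\<alpha>\<in>F. ennreal (?w ((\<omega> + \<alpha>) - t) * ?u t)) = ennreal ((\<Sum>\<alpha>\<in>F. ?w ((\<omega> - t) + \<alpha>)) * ?u t)"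
        unfolding sum_distrib_right using w0 by (subst sum_ennreal) (auto simp: algebra_simps)
      also have "\<dots> \<le> ennreal (L * ?u t)" by (intro ennreal_leI mult_right_mono L F) auto
      finally show "(\<Sum>\<alpha>\<in>F. ennreal (?w ((\<omega> + \<alpha>) - t) * ?u t)) \<le> ennreal (L * ?u t)" .
    qed auto
    also have "(\<integral>\<^sup>+t. ennreal (L * ?u t) \<partial>lborel) = ennreal (L * I)"
      unfolding I_def using L(1) integrable_mult_right[OF T(3), of L] by (subst nn_integral_eq_integral) auto
    also have "ennreal (K * D) * ennreal (L * I) = ennreal (K * D * (L * I))"
      using K0 D L I0 by (intro ennreal_mult[symmetric]) auto
    finally show "(\<Sum>\<alpha>\<in>F. (1 + norm (\<omega> + \<alpha>)) powr (2 * s) * (cmod (?g (\<omega> + \<alpha>)))\<^sup>2) \<le> K * D * (L * I)"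
      using K0 D L I0 by (subst (asm) ennreal_le_iff) auto
  qed
qed

section \<open>The refinement recursion\<close>

lemma two_pi_lattice_eq: "two_pi_lattice = lattice (2 * pi)"
  by (simp add: two_pi_lattice_def lattice_def)

lemma int_lattice_inner: "a \<in> int_lattice \<Longrightarrow> b \<in> int_lattice \<Longrightarrow> a \<bullet> b \<in> \<int>"
  unfolding int_lattice_def inner_vec_def by (auto intro!: Ints_sum)

lemma exp_inner_lattice:
  assumes "a \<in> int_lattice" "b \<in> lattice (2 * pi)"
  shows "exp (\<i> * of_real (a \<bullet> b)) = 1"
proof -
  obtain m where m: "m \<in> int_lattice" "b = (2 * pi) *\<^sub>R m" using assms(2) unfolding lattice_def by auto
  obtain n where n: "a \<bullet> m = of_int n" using int_lattice_inner[OF assms(1) m(1)] by (auto elim: Ints_cases)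
  have "exp (\<i> * of_real (a \<bullet> b)) = exp (2 * of_int n * of_real pi * \<i>)"
    by (simp add: m n mult_ac)
  then show ?thesis using exp_integer_2pi[of "of_int n"] by simp
qed

lemma trig_poly_periodic:
  assumes "trig_poly f" "\<alpha> \<in> lattice (2 * pi)"
  shows "f (\<omega> + \<alpha>) = f \<omega>"
proof -
  obtain A c where A: "finite A" "A \<subseteq> int_lattice" "f = (\<lambda>\<omega>. \<Sum>\<alpha>\<in>A. c \<alpha> * exp (\<i> * of_real (\<alpha> \<bullet> \<omega>)))"
    using assms(1) unfolding trig_poly_def by blast
  have "exp (\<i> * of_real (a \<bullet> (\<omega> + \<alpha>))) = exp (\<i> * of_real (a \<bullet> \<omega>))" if "a \<in> A" for a
    using exp_inner_lattice[of a \<alpha>] that A(2) assms(2) by (auto simp: inner_add_right distrib_left exp_add)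
  then show ?thesis unfolding A(3) by (intro sum.cong) auto
qed

lemma trig_poly_cont: "trig_poly f \<Longrightarrow> continuous_on S f"
  unfolding trig_poly_def by (auto intro!: continuous_intros)

lemma trig_poly_bounded:
  assumes "trig_poly f" obtains B where "B \<ge> 0" "\<And>\<omega>. cmod (f \<omega>) \<le> B"
proof -
  obtain A c where A: "finite A" "A \<subseteq> int_lattice" "f = (\<lambda>\<omega>. \<Sum>\<alpha>\<in>A. c \<alpha> * exp (\<i> * of_real (\<alpha> \<bullet> \<omega>)))"
    using assms(1) unfolding trig_poly_def by blast
  show thesis
  proof (rule that[of "\<Sum>\<alpha>\<in>A. cmod (c \<alpha>)"])
    show "cmod (f \<omega>) \<le> (\<Sum>\<alpha>\<in>A. cmod (c \<alpha>))" for \<omega>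
      unfolding A(3) by (rule order_trans[OF norm_sum]) (simp add: norm_mult)
  qed (auto intro: sum_nonneg)
qed

text \<open>Adding the two extreme factors avoids a distinction by the sign of the exponent.\<close>

lemma powr_comparable:
  fixes x y :: real
  assumes "0 < x" "0 < l" "l * x \<le> y" "y \<le> u * x"
  shows "y powr p \<le> (l powr p + u powr p) * x powr p"
proof -
  have y: "y > 0" using assms by (meson less_le_trans mult_pos_pos)
  then have u: "u > 0" using assms by (metis less_le_trans zero_less_mult_pos2)
  show ?thesis
  proof (cases "p \<ge> 0")
    case True
    have "y powr p \<le> (u * x) powr p" using assms y True by (intro powr_mono2) auto
    also have "\<dots> = u powr p * x powr p" using assms u by (simp add: powr_mult)
    also have "\<dots> \<le> (l powr p + u powr p) * x powr p" by (intro mult_right_mono) auto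
    finally show ?thesis .
  next
    case False
    have "y powr p \<le> (l * x) powr p" using assms y False by (intro powr_mono2') auto
    also have "\<dots> = l powr p * x powr p" using assms by (simp add: powr_mult)
    also have "\<dots> \<le> (l powr p + u powr p) * x powr p" by (intro mult_right_mono) auto
    finally show ?thesis .
  qed
qed

lemma cmod_sum_mult_le: "cmod (\<Sum>j\<in>UNIV. a $ j * b $ j) \<le> norm a * norm (b :: complex^'r::finite)"
proof -
  have "cmod (\<Sum>j\<in>UNIV. a $ j * b $ j) \<le> (\<Sum>j\<in>UNIV. \<bar>cmod (a $ j)\<bar> * \<bar>cmod (b $ j)\<bar>)"
    by (rule order_trans[OF norm_sum]) (simp add: norm_mult)
  also have "\<dots> \<le> L2_set (\<lambda>j. cmod (a $ j)) UNIV * L2_set (\<lambda>j. cmod (b $ j)) UNIV"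
    by (rule L2_set_mult_ineq)
  finally show ?thesis by (simp add: norm_vec_def)
qed

lemma norm_cnj_vec: "norm (cnj_vec a) = norm a"
  by (simp add: norm_vec_def cnj_vec_def)

lemma adj_prod_eq: "adj_prod a y = (\<Sum>j\<in>UNIV. cnj_vec a $ j * y $ j)"
  by (simp add: adj_prod_def cnj_vec_def)

lemma adj_prod_bound: "cmod (adj_prod a y) \<le> norm a * norm y"
  unfolding adj_prod_eq using cmod_sum_mult_le[of "cnj_vec a" y] by (simp add: norm_cnj_vec)

lemma adj_prod_matrix: "adj_prod a (M *v y) = (\<Sum>j\<in>UNIV. (cnj_vec a v* M) $ j * y $ j)"
proof -
  have "adj_prod a (M *v y) = (\<Sum>i\<in>UNIV. \<Sum>j\<in>UNIV. cnj_vec a $ i * (M $ i $ j * y $ j))"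
    by (simp add: adj_prod_eq matrix_vector_mult_def sum_distrib_left)
  also have "\<dots> = (\<Sum>j\<in>UNIV. \<Sum>i\<in>UNIV. cnj_vec a $ i * (M $ i $ j * y $ j))" by (rule sum.swap)
  also have "\<dots> = (\<Sum>j\<in>UNIV. (cnj_vec a v* M) $ j * y $ j)"
    by (simp add: vector_matrix_mult_def sum_distrib_right sum_distrib_left mult_ac)
  finally show ?thesis .
qed

lemma finite_binary_vecs: "finite {l::real^'d::finite. \<forall>i. l $ i \<in> {0, 1}}"
proof -
  have "{l::real^'d. \<forall>i. l $ i \<in> {0, 1}} \<subseteq> (\<lambda>b. \<chi> i. if b i then 1 else 0) ` (UNIV :: ('d \<Rightarrow> bool) set)"
  proof
    fix l :: "real^'d" assume "l \<in> {l. \<forall>i. l $ i \<in> {0, 1}}"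
    then have "l = (\<chi> i. if (\<lambda>i. l $ i = 1) i then 1 else 0)" by (auto simp: vec_eq_iff)
    then show "l \<in> (\<lambda>b. \<chi> i. if b i then 1 else 0) ` UNIV" by (rule image_eqI[where x="\<lambda>i. l $ i = 1"]) simp
  qed
  then show ?thesis by (rule finite_subset) simp
qed

lemma bigo_nhdsD:
  fixes f g :: "'a::metric_space \<Rightarrow> real"
  assumes "f \<in> O[nhds a](g)"
  shows "\<exists>d>0. \<exists>c\<ge>0. \<forall>x. dist x a < d \<longrightarrow> \<bar>f x\<bar> \<le> c * \<bar>g x\<bar>"
proof -
  from landau_o.bigE[OF assms] obtain c where c: "c > 0" "\<forall>\<^sub>F x in nhds a. norm (f x) \<le> c * norm (g x)" by blast
  then obtain d where "d > 0" "\<And>x. dist x a < d \<Longrightarrow> norm (f x) \<le> c * norm (g x)"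
    unfolding eventually_nhds_metric by blast
  then show ?thesis using c(1) by (intro exI[of _ d] conjI exI[of _ c]) auto
qed

lemma bigo_nhdsI:
  fixes f g :: "'a::metric_space \<Rightarrow> real"
  assumes "d > 0" "\<And>x. dist x a < d \<Longrightarrow> \<bar>f x\<bar> \<le> c * \<bar>g x\<bar>"
  shows "f \<in> O[nhds a](g)"
  by (rule bigoI[of _ c]) (use assms in \<open>auto simp: eventually_nhds_metric\<close>)

lemma int_lattice_parity:
  fixes n :: "real^'d::finite"
  assumes n: "n \<in> int_lattice"
  obtains l m where "\<forall>i. l $ i \<in> {0, 1}" "m \<in> int_lattice" "n = l + 2 *\<^sub>R m"
proof -
  have "\<exists>l m. l \<in> {0, 1} \<and> m \<in> \<int> \<and> n $ i = l + 2 * m" for i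
  proof -
    obtain z where z: "n $ i = of_int z" using n unfolding int_lattice_def by (auto elim: Ints_cases)
    have "z = z mod 2 + 2 * (z div 2)" by simp
    then have "n $ i = of_int (z mod 2) + 2 * of_int (z div 2)" unfolding z by (metis of_int_add of_int_mult of_int_numeral)
    moreover have "z mod 2 = 0 \<or> z mod 2 = 1" by presburger
    ultimately show ?thesis by (intro exI[of _ "of_int (z mod 2)"] exI[of _ "of_int (z div 2)"]) auto
  qed
  then obtain l m where lm: "\<And>i. l i \<in> {0, 1}" "\<And>i. m i \<in> \<int>" "\<And>i. n $ i = l i + 2 * m i" by metis
  show thesis
    by (rule that[of "vec_lambda l" "vec_lambda m"]) (use lm in \<open>auto simp: int_lattice_def vec_eq_iff\<close>)
qed

text \<open>The function \<open>v\<^sup>* F\<close>; if \<open>F\<close> is the transform of \<open>\<Phi>\<close>, it is the transform of the superfunction.\<close>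

definition symbol :: "(real^'d::finite \<Rightarrow> complex^'r) \<Rightarrow> (real^'d \<Rightarrow> complex^'r::finite) \<Rightarrow> real^'d \<Rightarrow> complex" where
  "symbol v F \<omega> = adj_prod (v \<omega>) (F \<omega>)"

text \<open>The point \<open>(\<omega> + \<alpha>)/2\<close> differs from \<open>\<omega>/2 + \<pi> l\<close> by an element of the lattice \<open>2 \<pi> \<int>\<^sup>d\<close>, where \<open>l\<close> is the parity of \<open>\<alpha> / (2 \<pi>)\<close>.
As \<open>P\<close> and \<open>v\<close> are periodic, the zero of order \<open>k\<close> at \<open>\<pi> l\<close> applies with a constant that does not depend on \<open>\<alpha>\<close>.
The parity vanishes exactly when \<open>\<alpha>/2\<close> is again in the lattice.\<close>

lemma refinement_step:
  fixes P :: "real^'d::finite \<Rightarrow> complex^'r^'r::finite" and v :: "real^'d \<Rightarrow> complex^'r"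
  assumes tP: "\<And>i j. trig_poly (\<lambda>\<omega>. P \<omega> $ i $ j)" and tv: "\<And>i. trig_poly (\<lambda>\<omega>. v \<omega> $ i)"
    and k: "k > 0" and Z: "condition_Z k P v"
  obtains \<rho> C where "\<rho> > 0" "\<rho> < 1" "C \<ge> 0"
    "\<And>F \<omega> \<alpha>. (\<And>\<omega>. F (2 *\<^sub>R \<omega>) = P \<omega> *v F \<omega>) \<Longrightarrow> norm \<omega> < \<rho> \<Longrightarrow> \<alpha> \<in> lattice (2 * pi) \<Longrightarrow>
      cmod (symbol v F (\<omega> + \<alpha>) - (if (1/2) *\<^sub>R \<alpha> \<in> lattice (2 * pi) then symbol v F ((1/2) *\<^sub>R (\<omega> + \<alpha>)) else 0))
        \<le> C * norm \<omega> powr k * norm (F ((1/2) *\<^sub>R (\<omega> + \<alpha>)))"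
proof -
  have vper: "v (\<omega> + \<alpha>) = v \<omega>" if "\<alpha> \<in> lattice (2 * pi)" for \<omega> \<alpha>
    using trig_poly_periodic[OF tv that] by (simp add: vec_eq_iff)
  have Pper: "P (\<omega> + \<alpha>) = P \<omega>" if "\<alpha> \<in> lattice (2 * pi)" for \<omega> \<alpha>
    using trig_poly_periodic[OF tP that] by (simp add: vec_eq_iff)
  let ?E = "{l::real^'d. \<forall>i. l $ i \<in> {0, 1}}"
  let ?e = "\<lambda>l \<omega>. cnj_vec (v (2 *\<^sub>R \<omega>)) v* P \<omega> - (if l = 0 then cnj_vec (v \<omega>) else 0)"
  have "\<forall>l\<in>?E. \<exists>d c. d > 0 \<and> c \<ge> 0 \<and> (\<forall>\<omega>. dist \<omega> (pi *\<^sub>R l) < d \<longrightarrow> norm (?e l \<omega>) \<le> c * norm (\<omega> - pi *\<^sub>R l) powr k)"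
  proof
    fix l :: "real^'d" assume "l \<in> ?E"
    then have "(\<lambda>\<omega>. norm (?e l \<omega>)) \<in> O[nhds (pi *\<^sub>R l)](\<lambda>\<omega>. norm (\<omega> - pi *\<^sub>R l) powr k)"
      using Z unfolding condition_Z_def by blast
    from bigo_nhdsD[OF this] obtain d c where "d > 0" "c \<ge> 0"
      "\<And>x. dist x (pi *\<^sub>R l) < d \<Longrightarrow> \<bar>norm (?e l x)\<bar> \<le> c * \<bar>norm (x - pi *\<^sub>R l) powr k\<bar>" by blast
    then show "\<exists>d c. d > 0 \<and> c \<ge> 0 \<and> (\<forall>\<omega>. dist \<omega> (pi *\<^sub>R l) < d \<longrightarrow> norm (?e l \<omega>) \<le> c * norm (\<omega> - pi *\<^sub>R l) powr k)"
      by (intro exI[of _ d] exI[of _ c]) auto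
  qed
  from bchoice[OF this] obtain d where "\<forall>l\<in>?E. \<exists>c. d l > 0 \<and> c \<ge> 0 \<and> (\<forall>\<omega>. dist \<omega> (pi *\<^sub>R l) < d l \<longrightarrow> norm (?e l \<omega>) \<le> c * norm (\<omega> - pi *\<^sub>R l) powr k)" ..
  from bchoice[OF this] obtain c where dc0: "\<forall>l\<in>?E. d l > 0 \<and> c l \<ge> 0 \<and> (\<forall>\<omega>. dist \<omega> (pi *\<^sub>R l) < d l \<longrightarrow> norm (?e l \<omega>) \<le> c l * norm (\<omega> - pi *\<^sub>R l) powr k)" ..
  have dc: "\<And>l. l \<in> ?E \<Longrightarrow> d l > 0" "\<And>l. l \<in> ?E \<Longrightarrow> c l \<ge> 0"
    "\<And>l \<omega>. l \<in> ?E \<Longrightarrow> dist \<omega> (pi *\<^sub>R l) < d l \<Longrightarrow> norm (?e l \<omega>) \<le> c l * norm (\<omega> - pi *\<^sub>R l) powr k"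
    using dc0 by blast+
  define \<rho> where "\<rho> = Min (insert (1/2) (d ` ?E))"
  define C where "C = (\<Sum>l\<in>?E. c l)"
  have fin: "finite ?E" by (rule finite_binary_vecs)
  have \<rho>: "\<rho> > 0" "\<rho> < 1" "\<And>l. l \<in> ?E \<Longrightarrow> \<rho> \<le> d l"
    unfolding \<rho>_def using fin dc(1) by (auto simp: Min_gr_iff Min_less_iff)
  have C: "C \<ge> 0" "\<And>l. l \<in> ?E \<Longrightarrow> c l \<le> C"
    unfolding C_def using fin dc(2) by (auto intro!: sum_nonneg member_le_sum)
  show thesis
  proof (rule that[OF \<rho>(1,2) C(1)])
    fix F :: "real^'d \<Rightarrow> complex^'r" and \<omega> \<alpha> :: "real^'d"
    assume F: "\<And>\<omega>. F (2 *\<^sub>R \<omega>) = P \<omega> *v F \<omega>" and w: "norm \<omega> < \<rho>" and a: "\<alpha> \<in> lattice (2 * pi)"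
    obtain n where n: "n \<in> int_lattice" "\<alpha> = (2 * pi) *\<^sub>R n" using a unfolding lattice_def by auto
    obtain l m where lm: "\<forall>i. l $ i \<in> {0, 1}" "m \<in> int_lattice" "n = l + 2 *\<^sub>R m" by (rule int_lattice_parity[OF n(1)])
    then have l: "l \<in> ?E" by simp
    let ?x = "(1/2) *\<^sub>R (\<omega> + \<alpha>)"
    define y where "y = (1/2) *\<^sub>R \<omega> + pi *\<^sub>R l"
    have m2: "(2 * pi) *\<^sub>R m \<in> lattice (2 * pi)" using lm(2) unfolding lattice_def by blast
    have xy: "?x = y + (2 * pi) *\<^sub>R m" by (simp add: y_def n(2) lm(3) scaleR_add_right)
    have Px: "P ?x = P y" unfolding xy by (rule Pper[OF m2])
    have "l $ i \<in> \<int>" for i using lm(1)[rule_format, of i] by auto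
    then have "l \<in> int_lattice" by (simp add: int_lattice_def)
    then have l2: "(2 * pi) *\<^sub>R l \<in> lattice (2 * pi)" unfolding lattice_def by blast
    have "2 *\<^sub>R y = \<omega> + (2 * pi) *\<^sub>R l" by (simp add: y_def scaleR_add_right)
    then have v2: "v (2 *\<^sub>R y) = v (\<omega> + \<alpha>)" using vper[OF l2] vper[OF a] by simp
    have even: "(1/2) *\<^sub>R \<alpha> \<in> lattice (2 * pi) \<longleftrightarrow> l = 0"
    proof
      assume "(1/2) *\<^sub>R \<alpha> \<in> lattice (2 * pi)"
      then have h: "n $ i / 2 \<in> \<int>" for i by (simp add: lattice_iff n(2))
      show "l = 0"
      proof (rule ccontr)
        assume "l \<noteq> 0"
        then obtain i where "l $ i = 1" using lm(1) by (auto simp: vec_eq_iff)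
        then have e: "n $ i / 2 - m $ i = 1 / 2" using lm(3) by (simp add: add_divide_distrib)
        have "n $ i / 2 - m $ i \<in> \<int>" using h[of i] lm(2) by (intro Ints_diff) (auto simp: int_lattice_def)
        then have "1 / (2::real) \<in> \<int>" by (simp only: e)
        then show False using Ints_nonzero_abs_ge1[of "1/2::real"] by simp
      qed
    next
      assume "l = 0"
      then show "(1/2) *\<^sub>R \<alpha> \<in> lattice (2 * pi)" using m2 by (simp add: n(2) lm(3))
    qed
    have vx: "v ?x = v y" unfolding xy by (rule vper[OF m2])
    let ?row = "?e l y"
    have "symbol v F (\<omega> + \<alpha>) = adj_prod (v (\<omega> + \<alpha>)) (P ?x *v F ?x)"
      unfolding symbol_def F[symmetric] by simp
    also have "\<dots> = (\<Sum>j\<in>UNIV. (cnj_vec (v (2 *\<^sub>R y)) v* P y) $ j * F ?x $ j)"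
      by (simp add: adj_prod_matrix v2 Px)
    finally have 1: "symbol v F (\<omega> + \<alpha>) = (\<Sum>j\<in>UNIV. (cnj_vec (v (2 *\<^sub>R y)) v* P y) $ j * F ?x $ j)" .
    have 2: "(if (1/2) *\<^sub>R \<alpha> \<in> lattice (2 * pi) then symbol v F ?x else 0) = (\<Sum>j\<in>UNIV. (if l = 0 then cnj_vec (v y) else 0) $ j * F ?x $ j)"
      unfolding even symbol_def adj_prod_eq vx by simp
    have "symbol v F (\<omega> + \<alpha>) - (if (1/2) *\<^sub>R \<alpha> \<in> lattice (2 * pi) then symbol v F ?x else 0) = (\<Sum>j\<in>UNIV. ?row $ j * F ?x $ j)"
      unfolding 1 2 by (simp add: sum_subtractf[symmetric] left_diff_distrib)
    then have "cmod (symbol v F (\<omega> + \<alpha>) - (if (1/2) *\<^sub>R \<alpha> \<in> lattice (2 * pi) then symbol v F ?x else 0)) \<le> norm ?row * norm (F ?x)"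
      by (simp only: cmod_sum_mult_le)
    also have "norm ?row \<le> C * norm \<omega> powr k"
    proof -
      have dy: "y - pi *\<^sub>R l = (1/2) *\<^sub>R \<omega>" by (simp add: y_def)
      have "dist y (pi *\<^sub>R l) < d l" using w \<rho>(3)[OF l] norm_ge_zero[of \<omega>] by (simp add: dist_norm dy del: norm_ge_zero)
      from dc(3)[OF l this] have "norm ?row \<le> c l * ((1/2) * norm \<omega>) powr k" by (simp add: dy)
      also have "\<dots> \<le> C * norm \<omega> powr k"
        using dc(2)[OF l] C k l by (intro mult_mono powr_mono2) auto
      finally show ?thesis .
    qed
    finally show "cmod (symbol v F (\<omega> + \<alpha>) - (if (1/2) *\<^sub>R \<alpha> \<in> lattice (2 * pi) then symbol v F ?x else 0))
        \<le> C * norm \<omega> powr k * norm (F ?x)" by (simp add: mult_right_mono)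
  qed
qed

lemma lattice_norm_ge:
  assumes "c > 0" "\<alpha> \<in> lattice c" "\<alpha> \<noteq> 0" shows "norm \<alpha> \<ge> c"
proof -
  have "0 \<in> lattice c" using assms(1) by (simp add: lattice_iff)
  then obtain i where "\<not> \<bar>\<alpha> $ i - 0 $ i\<bar> < c" using lattice_close_eq[OF assms(1,2)] assms(3) by blast
  then have "c \<le> \<bar>\<alpha> $ i\<bar>" by simp
  then show ?thesis using component_le_norm_cart[of \<alpha> i] by linarith
qed

lemma continuous_bounded_cball:
  fixes F :: "real^'d::finite \<Rightarrow> 'b::real_normed_vector"
  assumes "continuous_on UNIV F"
  obtains M where "M \<ge> 0" "\<And>x. norm x \<le> R \<Longrightarrow> norm (F x) \<le> M"
proof -
  have "compact (F ` cball 0 R)" using assms by (intro compact_continuous_image) (auto intro: continuous_on_subset)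
  from compact_imp_bounded[OF this] obtain M where "\<forall>y\<in>F ` cball 0 R. norm y \<le> M" unfolding bounded_iff by blast
  then show thesis by (intro that[of "max M 0"]) (auto intro: max.coboundedI1)
qed

text \<open>Induction on the size of \<open>\<alpha>\<close>: a step either halves \<open>\<alpha>\<close> or ends the recursion.\<close>

lemma strang_fix_pointwise:
  fixes F :: "real^'d::finite \<Rightarrow> complex^'r::finite"
  assumes cont: "continuous_on UNIV F" and k: "k > 0" and C: "C \<ge> 0"
    and step: "\<And>\<omega> \<alpha>. norm \<omega> < \<rho> \<Longrightarrow> \<alpha> \<in> lattice (2 * pi) \<Longrightarrow>
      cmod (symbol v F (\<omega> + \<alpha>) - (if (1/2) *\<^sub>R \<alpha> \<in> lattice (2 * pi) then symbol v F ((1/2) *\<^sub>R (\<omega> + \<alpha>)) else 0))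
        \<le> C * norm \<omega> powr k * norm (F ((1/2) *\<^sub>R (\<omega> + \<alpha>)))"
  shows "\<alpha> \<in> lattice (2 * pi) \<Longrightarrow> \<alpha> \<noteq> 0 \<Longrightarrow> norm \<alpha> < 2 ^ J \<Longrightarrow>
    \<exists>A\<ge>0. \<forall>\<omega>. norm \<omega> < \<rho> \<longrightarrow> cmod (symbol v F (\<omega> + \<alpha>)) \<le> A * norm \<omega> powr k"
proof (induction J arbitrary: \<alpha>)
  case 0
  then show ?case using lattice_norm_ge[of "2 * pi" \<alpha>] pi_gt3 by simp
next
  case (Suc J)
  let ?b = "(1/2) *\<^sub>R \<alpha>"
  obtain M where M: "M \<ge> 0" "\<And>x. norm x \<le> \<rho> + norm \<alpha> \<Longrightarrow> norm (F x) \<le> M"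
    using continuous_bounded_cball[OF cont] by blast
  have A: "\<exists>A\<ge>0. \<forall>\<omega>. norm \<omega> < \<rho> \<longrightarrow> cmod (if ?b \<in> lattice (2 * pi) then symbol v F ((1/2) *\<^sub>R (\<omega> + \<alpha>)) else 0) \<le> A * norm \<omega> powr k"
  proof (cases "?b \<in> lattice (2 * pi)")
    case True
    have "\<exists>A\<ge>0. \<forall>\<omega>. norm \<omega> < \<rho> \<longrightarrow> cmod (symbol v F (\<omega> + ?b)) \<le> A * norm \<omega> powr k"
      by (rule Suc.IH) (use True Suc.prems in auto)
    then obtain A where A: "A \<ge> 0" "\<And>\<omega>. norm \<omega> < \<rho> \<Longrightarrow> cmod (symbol v F (\<omega> + ?b)) \<le> A * norm \<omega> powr k" by blast
    have "cmod (symbol v F ((1/2) *\<^sub>R (\<omega> + \<alpha>))) \<le> A * norm \<omega> powr k" if w: "norm \<omega> < \<rho>" for \<omega>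
    proof -
      have "cmod (symbol v F ((1/2) *\<^sub>R \<omega> + ?b)) \<le> A * norm ((1/2) *\<^sub>R \<omega>) powr k"
        using w norm_ge_zero[of \<omega>] by (intro A) (simp del: norm_ge_zero)
      also have "\<dots> \<le> A * norm \<omega> powr k" using A k by (intro mult_left_mono powr_mono2) auto
      finally show ?thesis by (simp add: scaleR_add_right)
    qed
    then show ?thesis using A(1) True by auto
  next
    case False then show ?thesis by (intro exI[of _ 0]) auto
  qed
  then obtain A where A: "A \<ge> 0" "\<And>\<omega>. norm \<omega> < \<rho> \<Longrightarrow> cmod (if ?b \<in> lattice (2 * pi) then symbol v F ((1/2) *\<^sub>R (\<omega> + \<alpha>)) else 0) \<le> A * norm \<omega> powr k"
    by blast
  have "cmod (symbol v F (\<omega> + \<alpha>)) \<le> (C * M + A) * norm \<omega> powr k" if w: "norm \<omega> < \<rho>" for \<omega>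
  proof -
    let ?t = "if ?b \<in> lattice (2 * pi) then symbol v F ((1/2) *\<^sub>R (\<omega> + \<alpha>)) else 0"
    have "norm ((1/2) *\<^sub>R (\<omega> + \<alpha>)) \<le> \<rho> + norm \<alpha>"
      using norm_triangle_ineq[of \<omega> \<alpha>] w norm_ge_zero[of \<alpha>] norm_ge_zero[of "\<omega> + \<alpha>"] by (simp del: norm_ge_zero)
    from M(2)[OF this] have "C * norm \<omega> powr k * norm (F ((1/2) *\<^sub>R (\<omega> + \<alpha>))) \<le> C * norm \<omega> powr k * M"
      using C by (intro mult_left_mono) auto
    then have "cmod (symbol v F (\<omega> + \<alpha>) - ?t) \<le> C * M * norm \<omega> powr k"
      using step[OF w Suc.prems(1)] by (simp add: mult_ac)
    then show ?thesis using A(2)[OF w] norm_triangle_ineq[of "symbol v F (\<omega> + \<alpha>) - ?t" ?t]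
      by (simp add: distrib_right)
  qed
  then show ?case using C M A by (intro exI[of _ "C * M + A"]) auto
qed

text \<open>The errors along \<open>\<omega>, \<omega>/2, \<omega>/4, ...\<close> form a geometric series, and continuity identifies the limit.\<close>

lemma symbol_near_zero:
  fixes F :: "real^'d::finite \<Rightarrow> complex^'r::finite"
  assumes cont: "continuous_on UNIV F" and contS: "continuous_on UNIV (symbol v F)" and k: "k > 0" and C: "C \<ge> 0" and "\<rho> > 0"
    and step: "\<And>\<omega> \<alpha>. norm \<omega> < \<rho> \<Longrightarrow> \<alpha> \<in> lattice (2 * pi) \<Longrightarrow>
      cmod (symbol v F (\<omega> + \<alpha>) - (if (1/2) *\<^sub>R \<alpha> \<in> lattice (2 * pi) then symbol v F ((1/2) *\<^sub>R (\<omega> + \<alpha>)) else 0))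
        \<le> C * norm \<omega> powr k * norm (F ((1/2) *\<^sub>R (\<omega> + \<alpha>)))"
  shows "\<exists>A\<ge>0. \<forall>\<omega>. norm \<omega> < \<rho> \<longrightarrow> cmod (symbol v F \<omega> - symbol v F 0) \<le> A * norm \<omega> powr k"
proof -
  obtain M where M: "M \<ge> 0" "\<And>x. norm x \<le> \<rho> \<Longrightarrow> norm (F x) \<le> M"
    using continuous_bounded_cball[OF cont] by blast
  define q where "q = (1/2::real) powr k"
  have q: "0 < q" "q < 1" unfolding q_def using k powr_less_mono2[of k "1/2" "1::real"] by auto
  have z: "(0::real^'d) \<in> lattice (2 * pi)" by (simp add: lattice_iff)
  have one: "cmod (symbol v F \<omega> - symbol v F ((1/2) *\<^sub>R \<omega>)) \<le> C * M * norm \<omega> powr k" if w: "norm \<omega> < \<rho>" for \<omega>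
  proof -
    have "cmod (symbol v F \<omega> - symbol v F ((1/2) *\<^sub>R \<omega>)) \<le> C * norm \<omega> powr k * norm (F ((1/2) *\<^sub>R \<omega>))"
      using step[OF w z] z by simp
    also have "\<dots> \<le> C * norm \<omega> powr k * M"
      using C w norm_ge_zero[of \<omega>] by (intro mult_left_mono M) (simp_all del: norm_ge_zero)
    finally show ?thesis by (simp add: mult_ac)
  qed
  have it: "cmod (symbol v F \<omega> - symbol v F ((1/2) ^ n *\<^sub>R \<omega>)) \<le> C * M / (1 - q) * norm \<omega> powr k" if "norm \<omega> < \<rho>" for n \<omega>
    using that
  proof (induction n arbitrary: \<omega>)
    case 0 show ?case using C M q by simp
  next
    case (Suc n)
    have w2: "norm ((1/2) *\<^sub>R \<omega>) < \<rho>" using Suc.prems norm_ge_zero[of \<omega>] by (simp del: norm_ge_zero)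
    have "cmod (symbol v F \<omega> - symbol v F ((1/2) ^ Suc n *\<^sub>R \<omega>)) \<le>
       cmod (symbol v F \<omega> - symbol v F ((1/2) *\<^sub>R \<omega>)) + cmod (symbol v F ((1/2) *\<^sub>R \<omega>) - symbol v F ((1/2) ^ n *\<^sub>R ((1/2) *\<^sub>R \<omega>)))"
      using norm_triangle_ineq[of "symbol v F \<omega> - symbol v F ((1/2) *\<^sub>R \<omega>)" "symbol v F ((1/2) *\<^sub>R \<omega>) - symbol v F ((1/2) ^ n *\<^sub>R ((1/2) *\<^sub>R \<omega>))"]
      by (simp add: mult.commute)
    also have "\<dots> \<le> C * M * norm \<omega> powr k + C * M / (1 - q) * norm ((1/2) *\<^sub>R \<omega>) powr k"
      by (intro add_mono one Suc.prems Suc.IH w2)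
    also have "norm ((1/2) *\<^sub>R \<omega>) powr k = q * norm \<omega> powr k"
      using powr_mult[of "1/2" "norm \<omega>" k] by (simp add: q_def)
    also have "C * M * norm \<omega> powr k + C * M / (1 - q) * (q * norm \<omega> powr k) = C * M / (1 - q) * norm \<omega> powr k"
      using q by (simp add: field_simps)
    finally show ?case .
  qed
  have "cmod (symbol v F \<omega> - symbol v F 0) \<le> C * M / (1 - q) * norm \<omega> powr k" if w: "norm \<omega> < \<rho>" for \<omega>
  proof (rule LIMSEQ_le_const2)
    have "(\<lambda>n. (1/2::real) ^ n *\<^sub>R \<omega>) \<longlonglongrightarrow> 0 *\<^sub>R \<omega>" by (intro tendsto_intros LIMSEQ_realpow_zero) auto
    then have "(\<lambda>n. (1/2::real) ^ n *\<^sub>R \<omega>) \<longlonglongrightarrow> 0" by simp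
    have c0: "isCont (symbol v F) 0" using contS by (simp add: continuous_on_eq_continuous_at)
    have "(\<lambda>n. symbol v F ((1/2::real) ^ n *\<^sub>R \<omega>)) \<longlonglongrightarrow> symbol v F 0"
      by (rule isCont_tendsto_compose[OF c0]) fact
    then show "(\<lambda>n. cmod (symbol v F \<omega> - symbol v F ((1/2) ^ n *\<^sub>R \<omega>))) \<longlonglongrightarrow> cmod (symbol v F \<omega> - symbol v F 0)"
      by (intro tendsto_intros)
    show "\<exists>N. \<forall>n\<ge>N. cmod (symbol v F \<omega> - symbol v F ((1/2) ^ n *\<^sub>R \<omega>)) \<le> C * M / (1 - q) * norm \<omega> powr k"
      using it[OF w] by blast
  qed
  moreover have "C * M / (1 - q) \<ge> 0" using C M q by simp
  ultimately show ?thesis by blast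
qed

text \<open>The weighted \<open>\<ell>\<^sub>2\<close> norm of the values of \<open>v\<^sup>* F\<close> on a finite part of the lattice satisfies a recursion.
Even points are halved: this multiplies the weight by \<open>2\<^sup>s\<close> and replaces \<open>\<omega>\<close> by \<open>\<omega>/2\<close>, which
contributes \<open>2\<^sup>-\<^sup>k\<close>.  The remaining error has norm \<open>O(|\<omega>|\<^sup>k)\<close> by the bound on the bracket of \<open>F\<close>; the
half points lie in \<open>\<pi> \<int>\<^sup>d\<close>, hence the finer lattice in that hypothesis.  Since \<open>2\<^sup>s\<^sup>-\<^sup>k < 1\<close>, the
constant \<open>A\<close> with \<open>2\<^sup>s\<^sup>-\<^sup>k A + C1 = A\<close> survives the induction.\<close>

theorem bracket_zero_order:
  fixes F :: "real^'d::finite \<Rightarrow> complex^'r::finite"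
  assumes ks: "k > s" and C: "C \<ge> 0" and \<rho>: "\<rho> < 1" and B: "B \<ge> 0"
    and bracket: "\<And>S x. finite S \<Longrightarrow> S \<subseteq> lattice pi \<Longrightarrow> (\<Sum>\<beta>\<in>S. (1 + norm (x + \<beta>)) powr (2 * s) * (norm (F (x + \<beta>)))\<^sup>2) \<le> B"
    and step: "\<And>\<omega> \<alpha>. norm \<omega> < \<rho> \<Longrightarrow> \<alpha> \<in> lattice (2 * pi) \<Longrightarrow>
      cmod (symbol v F (\<omega> + \<alpha>) - (if (1/2) *\<^sub>R \<alpha> \<in> lattice (2 * pi) then symbol v F ((1/2) *\<^sub>R (\<omega> + \<alpha>)) else 0))
        \<le> C * norm \<omega> powr k * norm (F ((1/2) *\<^sub>R (\<omega> + \<alpha>)))"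
  obtains A where "A \<ge> 0" "\<And>S \<omega>. norm \<omega> < \<rho> \<Longrightarrow> finite S \<Longrightarrow> S \<subseteq> lattice (2 * pi) - {0} \<Longrightarrow>
     (\<Sum>\<alpha>\<in>S. norm (\<omega> + \<alpha>) powr (2 * s) * (cmod (symbol v F (\<omega> + \<alpha>)))\<^sup>2) \<le> A * norm \<omega> powr (2 * k)"
proof -
  \<comment> \<open>If \<open>|y| \<ge> 1\<close>, then \<open>|y|\<close> lies between \<open>2/3\<close> and \<open>2\<close> times \<open>1 + |y/2|\<close>.\<close>
  define cs where "cs = (2/3) powr (2 * s) + 2 powr (2 * s)"
  define C1 where "C1 = C * sqrt (cs * B)"
  define q where "q = 2 powr (s - k)"
  have q: "0 < q" "q < 1" unfolding q_def using ks by (auto simp: powr_less_one)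
  define A where "A = C1 / (1 - q)"
  have cs0: "cs \<ge> 0" unfolding cs_def by simp
  have C10: "C1 \<ge> 0" unfolding C1_def using C cs0 B by simp
  have A0: "A \<ge> 0" unfolding A_def using C10 q by simp
  have Aeq: "q * A + C1 = A" unfolding A_def using q by (simp add: field_simps)
  let ?x = "\<lambda>\<omega> \<alpha>. norm (\<omega> + \<alpha>) powr s * cmod (symbol v F (\<omega> + \<alpha>))"
  have main: "L2_set (?x \<omega>) S \<le> A * norm \<omega> powr k"
    if "norm \<omega> < \<rho>" "finite S" "S \<subseteq> lattice (2 * pi) - {0}" "\<And>\<alpha>. \<alpha> \<in> S \<Longrightarrow> norm \<alpha> < 2 ^ J" for \<omega> S J
    using that
  proof (induction J arbitrary: \<omega> S)
    case 0
    have "S = {}"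
    proof (rule ccontr)
      assume "S \<noteq> {}"
      then obtain \<alpha> where "\<alpha> \<in> S" by blast
      then show False using lattice_norm_ge[of "2 * pi" \<alpha>] 0(3) 0(4)[of \<alpha>] pi_gt3 by auto
    qed
    then show ?case using A0 by simp
  next
    case (Suc J)
    note w = Suc.prems(1) and fS = Suc.prems(2) and S = Suc.prems(3)
    let ?ev = "\<lambda>\<alpha>. (1/2) *\<^sub>R \<alpha> \<in> lattice (2 * pi)"
    let ?y = "\<lambda>\<alpha>. norm (\<omega> + \<alpha>) powr s * cmod (if ?ev \<alpha> then symbol v F ((1/2) *\<^sub>R (\<omega> + \<alpha>)) else 0)"
    let ?z = "\<lambda>\<alpha>. norm (\<omega> + \<alpha>) powr s * (C * norm \<omega> powr k * norm (F ((1/2) *\<^sub>R (\<omega> + \<alpha>))))"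
    have "L2_set (?x \<omega>) S \<le> L2_set (\<lambda>\<alpha>. ?y \<alpha> + ?z \<alpha>) S"
    proof (rule L2_set_mono)
      fix \<alpha> assume "\<alpha> \<in> S"
      then have a: "\<alpha> \<in> lattice (2 * pi)" using S by auto
      let ?t = "if ?ev \<alpha> then symbol v F ((1/2) *\<^sub>R (\<omega> + \<alpha>)) else 0"
      have "cmod (symbol v F (\<omega> + \<alpha>)) \<le> cmod ?t + C * norm \<omega> powr k * norm (F ((1/2) *\<^sub>R (\<omega> + \<alpha>)))"
        using step[OF w a] norm_triangle_ineq[of "symbol v F (\<omega> + \<alpha>) - ?t" ?t] by simp
      then have "?x \<omega> \<alpha> \<le> norm (\<omega> + \<alpha>) powr s * (cmod ?t + C * norm \<omega> powr k * norm (F ((1/2) *\<^sub>R (\<omega> + \<alpha>))))"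
        by (rule mult_left_mono) simp
      then show "?x \<omega> \<alpha> \<le> ?y \<alpha> + ?z \<alpha>" by (simp only: distrib_left)
    qed simp
    also have "\<dots> \<le> L2_set ?y S + L2_set ?z S" by (rule L2_set_triangle_ineq)
    also have "L2_set ?y S \<le> q * A * norm \<omega> powr k"
    proof -
      define S' where "S' = (\<lambda>\<alpha>. (1/2) *\<^sub>R \<alpha>) ` {\<alpha>\<in>S. ?ev \<alpha>}"
      have inj: "inj_on (\<lambda>\<alpha>::real^'d. (1/2::real) *\<^sub>R \<alpha>) {\<alpha>\<in>S. ?ev \<alpha>}" by (auto intro: inj_onI)
      have w2: "norm ((1/2) *\<^sub>R \<omega>) < \<rho>" using w norm_ge_zero[of \<omega>] by (simp del: norm_ge_zero)
      have S': "finite S'" "S' \<subseteq> lattice (2 * pi) - {0}" "\<And>\<beta>. \<beta> \<in> S' \<Longrightarrow> norm \<beta> < 2 ^ J"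
      proof -
        show "finite S'" using fS unfolding S'_def by simp
        show "S' \<subseteq> lattice (2 * pi) - {0}" using S unfolding S'_def by auto
        fix \<beta> assume "\<beta> \<in> S'"
        then obtain \<alpha> where "\<alpha> \<in> S" "\<beta> = (1/2) *\<^sub>R \<alpha>" unfolding S'_def by blast
        then show "norm \<beta> < 2 ^ J" using Suc.prems(4)[of \<alpha>] by simp
      qed
      have "(\<Sum>\<alpha>\<in>S. (?y \<alpha>)\<^sup>2) = (\<Sum>\<alpha>\<in>{\<alpha>\<in>S. ?ev \<alpha>}. (?y \<alpha>)\<^sup>2)"
        using fS by (intro sum.mono_neutral_right) auto
      also have "\<dots> = (\<Sum>\<alpha>\<in>{\<alpha>\<in>S. ?ev \<alpha>}. (2 powr s)\<^sup>2 * (?x ((1/2) *\<^sub>R \<omega>) ((1/2) *\<^sub>R \<alpha>))\<^sup>2)"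
      proof (rule sum.cong)
        fix \<alpha> assume a: "\<alpha> \<in> {\<alpha>\<in>S. ?ev \<alpha>}"
        have h: "(1/2) *\<^sub>R \<omega> + (1/2) *\<^sub>R \<alpha> = (1/2) *\<^sub>R (\<omega> + \<alpha>)" by (simp add: scaleR_add_right)
        have n: "norm (\<omega> + \<alpha>) = 2 * norm ((1/2) *\<^sub>R (\<omega> + \<alpha>))" by simp
        have "norm (\<omega> + \<alpha>) powr s = 2 powr s * norm ((1/2) *\<^sub>R (\<omega> + \<alpha>)) powr s"
          by (subst n) (simp only: powr_mult norm_ge_zero zero_le_numeral)
        then have "?y \<alpha> = 2 powr s * ?x ((1/2) *\<^sub>R \<omega>) ((1/2) *\<^sub>R \<alpha>)" using a unfolding h by simp
        then show "(?y \<alpha>)\<^sup>2 = (2 powr s)\<^sup>2 * (?x ((1/2) *\<^sub>R \<omega>) ((1/2) *\<^sub>R \<alpha>))\<^sup>2" by (simp only: power_mult_distrib)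
      qed simp
      also have "\<dots> = (2 powr s)\<^sup>2 * (\<Sum>\<beta>\<in>S'. (?x ((1/2) *\<^sub>R \<omega>) \<beta>)\<^sup>2)"
        unfolding S'_def by (subst sum.reindex[OF inj]) (simp add: sum_distrib_left)
      finally have "L2_set ?y S = 2 powr s * L2_set (?x ((1/2) *\<^sub>R \<omega>)) S'"
        unfolding L2_set_def by (simp add: real_sqrt_mult)
      also have "\<dots> \<le> 2 powr s * (A * norm ((1/2) *\<^sub>R \<omega>) powr k)"
        by (intro mult_left_mono Suc.IH w2 S') auto
      also have "norm ((1/2) *\<^sub>R \<omega>) powr k = (1/2) powr k * norm \<omega> powr k"
        using powr_mult[of "1/2" "norm \<omega>" k] by simp
      also have "2 powr s * (A * ((1/2) powr k * norm \<omega> powr k)) = q * A * norm \<omega> powr k"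
        unfolding q_def powr_diff by (simp add: powr_divide)
      finally show ?thesis .
    qed
    also have "L2_set ?z S \<le> C1 * norm \<omega> powr k"
    proof -
      have "(\<Sum>\<alpha>\<in>S. (?z \<alpha>)\<^sup>2) \<le> (C * norm \<omega> powr k)\<^sup>2 * (cs * B)"
      proof -
        have "(\<Sum>\<alpha>\<in>S. (?z \<alpha>)\<^sup>2) \<le> (\<Sum>\<alpha>\<in>S. (C * norm \<omega> powr k)\<^sup>2 * (cs * ((1 + norm ((1/2) *\<^sub>R \<omega> + (1/2) *\<^sub>R \<alpha>)) powr (2 * s) * (norm (F ((1/2) *\<^sub>R \<omega> + (1/2) *\<^sub>R \<alpha>)))\<^sup>2)))"
        proof (rule sum_mono)
          fix \<alpha> assume a: "\<alpha> \<in> S"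
          have h: "(1/2) *\<^sub>R \<omega> + (1/2) *\<^sub>R \<alpha> = (1/2) *\<^sub>R (\<omega> + \<alpha>)" by (simp add: scaleR_add_right)
          have "norm \<alpha> \<ge> 2 * pi" using a S by (intro lattice_norm_ge) auto
          then have n1: "norm (\<omega> + \<alpha>) \<ge> 1"
            using norm_triangle_ineq4[of "\<omega> + \<alpha>" \<omega>] w \<rho> pi_gt3 by simp
          have "norm (\<omega> + \<alpha>) powr (2 * s) \<le> cs * (1 + norm ((1/2) *\<^sub>R (\<omega> + \<alpha>))) powr (2 * s)"
            unfolding cs_def by (rule powr_comparable) (use n1 in \<open>auto simp: add_pos_nonneg\<close>)
          then have "(norm (\<omega> + \<alpha>) powr s)\<^sup>2 \<le> cs * (1 + norm ((1/2) *\<^sub>R (\<omega> + \<alpha>))) powr (2 * s)"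
            by (simp add: power2_eq_square powr_add[symmetric])
          then have "(norm (\<omega> + \<alpha>) powr s)\<^sup>2 * ((C * norm \<omega> powr k)\<^sup>2 * (norm (F ((1/2) *\<^sub>R (\<omega> + \<alpha>))))\<^sup>2) \<le>
             (cs * (1 + norm ((1/2) *\<^sub>R (\<omega> + \<alpha>))) powr (2 * s)) * ((C * norm \<omega> powr k)\<^sup>2 * (norm (F ((1/2) *\<^sub>R (\<omega> + \<alpha>))))\<^sup>2)"
            by (rule mult_right_mono) simp
          then show "(?z \<alpha>)\<^sup>2 \<le> (C * norm \<omega> powr k)\<^sup>2 * (cs * ((1 + norm ((1/2) *\<^sub>R \<omega> + (1/2) *\<^sub>R \<alpha>)) powr (2 * s) * (norm (F ((1/2) *\<^sub>R \<omega> + (1/2) *\<^sub>R \<alpha>)))\<^sup>2))"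
            unfolding h by (simp only: power_mult_distrib mult_ac)
        qed
        also have "\<dots> = (C * norm \<omega> powr k)\<^sup>2 * (cs * (\<Sum>\<beta>\<in>(\<lambda>\<alpha>. (1/2) *\<^sub>R \<alpha>) ` S. ((1 + norm ((1/2) *\<^sub>R \<omega> + \<beta>)) powr (2 * s) * (norm (F ((1/2) *\<^sub>R \<omega> + \<beta>)))\<^sup>2)))"
          by (subst sum.reindex) (auto simp: sum_distrib_left intro: inj_onI)
        also have "\<dots> \<le> (C * norm \<omega> powr k)\<^sup>2 * (cs * B)"
        proof (intro mult_left_mono bracket)
          show "(\<lambda>\<alpha>. (1/2) *\<^sub>R \<alpha>) ` S \<subseteq> lattice pi" using S by (auto simp: lattice_iff)
        qed (use fS cs0 in auto)
        finally show ?thesis .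
      qed
      then have "L2_set ?z S \<le> sqrt ((C * norm \<omega> powr k)\<^sup>2 * (cs * B))"
        unfolding L2_set_def by (rule real_sqrt_le_mono)
      also have "\<dots> = C1 * norm \<omega> powr k" using C unfolding C1_def by (simp add: real_sqrt_mult)
      finally show ?thesis .
    qed
    also have "q * A * norm \<omega> powr k + C1 * norm \<omega> powr k = A * norm \<omega> powr k"
      by (simp only: distrib_right[symmetric] Aeq)
    finally show ?case by simp
  qed
  show thesis
  proof (rule that[of "A\<^sup>2"])
    fix S :: "(real^'d) set" and \<omega> :: "real^'d" assume w: "norm \<omega> < \<rho>" and fS: "finite S" and S: "S \<subseteq> lattice (2 * pi) - {0}"
    obtain J where J: "\<And>\<alpha>. \<alpha> \<in> S \<Longrightarrow> norm \<alpha> < 2 ^ J"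
    proof -
      obtain J where "(\<Sum>\<alpha>\<in>S. norm \<alpha>) < 2 ^ J" using real_arch_pow[of 2 "\<Sum>\<alpha>\<in>S. norm \<alpha>"] by auto
      then have "norm \<alpha> < 2 ^ J" if "\<alpha> \<in> S" for \<alpha>
        using member_le_sum[of \<alpha> S norm] that fS by auto
      then show thesis using that by blast
    qed
    have "(L2_set (?x \<omega>) S)\<^sup>2 \<le> (A * norm \<omega> powr k)\<^sup>2"
      by (intro power_mono main[OF w fS S J]) auto
    moreover have "(L2_set (?x \<omega>) S)\<^sup>2 = (\<Sum>\<alpha>\<in>S. norm (\<omega> + \<alpha>) powr (2 * s) * (cmod (symbol v F (\<omega> + \<alpha>)))\<^sup>2)"
      unfolding L2_set_def by (subst real_sqrt_pow2) (auto intro!: sum_nonneg sum.cong simp: power_mult_distrib power2_eq_square[of "_ powr s"] powr_add[symmetric])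
    moreover have "(A * norm \<omega> powr k)\<^sup>2 = A\<^sup>2 * norm \<omega> powr (2 * k)"
      by (simp add: power_mult_distrib power2_eq_square[of "_ powr k"] powr_add[symmetric])
    ultimately show "(\<Sum>\<alpha>\<in>S. norm (\<omega> + \<alpha>) powr (2 * s) * (cmod (symbol v F (\<omega> + \<alpha>)))\<^sup>2) \<le> A\<^sup>2 * norm \<omega> powr (2 * k)" by simp
  qed simp
qed

section \<open>Periodization and density of trigonometric polynomials\<close>

lemma nn_integral_count_space_le:
  fixes f :: "'a \<Rightarrow> real"
  assumes A: "countable A" and b: "\<And>F. finite F \<Longrightarrow> F \<subseteq> A \<Longrightarrow> (\<Sum>\<alpha>\<in>F. f \<alpha>) \<le> c" and nn: "\<And>\<alpha>. f \<alpha> \<ge> 0"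
  shows "(\<integral>\<^sup>+\<alpha>. ennreal (f \<alpha>) \<partial>count_space A) \<le> ennreal c"
proof (cases "finite A")
  case True
  then show ?thesis using b[of A] nn by (simp add: nn_integral_count_space_finite ennreal_leI)
next
  case False
  let ?e = "from_nat_into A"
  have e: "bij_betw ?e UNIV A" using A False by (rule bij_betw_from_nat_into)
  have "(\<integral>\<^sup>+\<alpha>. ennreal (f \<alpha>) \<partial>count_space A) = (\<Sum>n. ennreal (f (?e n)))"
    unfolding nn_integral_bij_count_space[OF e, symmetric] by (rule nn_integral_count_space_nat)
  also have "\<dots> \<le> ennreal c"
  proof (rule suminf_le_const)
    fix n
    have "(\<Sum>i<n. ennreal (f (?e i))) = ennreal (\<Sum>\<alpha>\<in>?e ` {..<n}. f \<alpha>)"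
      using nn e by (subst sum.reindex) (auto simp: bij_betw_def intro: inj_on_subset)
    also have "\<dots> \<le> ennreal c"
      using bij_betw_imp_surj_on[OF e] by (intro ennreal_leI b) auto
    finally show "(\<Sum>i<n. ennreal (f (?e i))) \<le> ennreal c" .
  qed simp
  finally show ?thesis .
qed

lemma countable_lattice: "countable (lattice c :: (real^'d::finite) set)"
proof -
  have "(int_lattice :: (real^'d) set) \<subseteq> range (\<lambda>z. \<chi> i. real_of_int (z i))"
  proof
    fix x :: "real^'d" assume "x \<in> int_lattice"
    then have "x = (\<chi> i. real_of_int \<lfloor>x $ i\<rfloor>)" by (simp add: int_lattice_def vec_eq_iff)
    then show "x \<in> range (\<lambda>z. \<chi> i. real_of_int (z i))" by (rule image_eqI[where x="\<lambda>i. \<lfloor>x $ i\<rfloor>"]) simp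
  qed
  then have "countable (int_lattice :: (real^'d) set)" by (rule countable_subset) simp
  then show ?thesis unfolding lattice_def by simp
qed

text \<open>The half-open cube tiles space exactly; the open cube is a box and differs from it by a null set.\<close>

definition cube :: "(real^'d::finite) set" where
  "cube = {x. \<forall>i. - pi \<le> x $ i \<and> x $ i < pi}"

definition open_cube :: "(real^'d::finite) set" where
  "open_cube = box (\<chi> i. - pi) (\<chi> i. pi)"

lemma open_cube_iff: "x \<in> open_cube \<longleftrightarrow> (\<forall>i. - pi < x $ i \<and> x $ i < pi)"
  by (simp add: open_cube_def mem_box_vec)

lemma cube_measurable [measurable]: "cube \<in> sets borel" "open_cube \<in> sets borel"
proof -
  have "cube = (\<Inter>i. {x::real^'a. - pi \<le> x $ i} \<inter> {x. x $ i < pi})" by (auto simp: cube_def)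
  also have "\<dots> \<in> sets borel"
    by (intro sets.countable_INT'' sets.Int borel_closed borel_open closed_Collect_le open_Collect_less continuous_intros) auto
  finally show "(cube :: (real^'a) set) \<in> sets borel" .
qed (simp add: open_cube_def)

lemma nn_integral_cube_open_cube:
  fixes f :: "real^'d::finite \<Rightarrow> ennreal"
  shows "(\<integral>\<^sup>+x. f x * indicator cube x \<partial>lborel) = (\<integral>\<^sup>+x. f x * indicator open_cube x \<partial>lborel)"
proof (rule nn_integral_cong_AE)
  let ?a = "(\<chi> i. - pi) :: real^'d" and ?b = "(\<chi> i. pi) :: real^'d"
  have "cbox ?a ?b - box ?a ?b \<in> null_sets lebesgue" using negligible_frontier_interval negligible_iff_null_sets by blast
  then have "AE x in lebesgue. x \<notin> cbox ?a ?b - box ?a ?b" by (rule AE_not_in)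
  moreover have "{x \<in> space lborel. x \<notin> cbox ?a ?b - box ?a ?b} \<in> sets lborel"
  proof -
    have "{x \<in> space lborel. x \<notin> cbox ?a ?b - box ?a ?b} = - (cbox ?a ?b - box ?a ?b)" by auto
    then show ?thesis by simp
  qed
  ultimately have "AE x in lborel. x \<notin> cbox ?a ?b - box ?a ?b" by (simp add: AE_completion_iff)
  then show "AE x in lborel. f x * indicator cube x = f x * indicator open_cube x"
  proof (eventually_elim)
    case (elim x)
    then have "x \<in> cube \<longleftrightarrow> x \<in> open_cube"
      by (auto simp: cube_def open_cube_def mem_box_vec mem_box_cart less_imp_le)
    then show ?case by (simp add: indicator_def)
  qed
qed

text \<open>Every point lies in exactly one translate of the half-open cube.\<close>

lemma nn_integral_periodize:
  fixes f :: "real^'d::finite \<Rightarrow> ennreal"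
  assumes [measurable]: "f \<in> borel_measurable borel"
  shows "(\<integral>\<^sup>+x. f x \<partial>lborel) = (\<integral>\<^sup>+x. (\<integral>\<^sup>+\<alpha>. f (x + \<alpha>) \<partial>count_space (lattice (2 * pi))) * indicator cube x \<partial>lborel)"
proof -
  let ?L = "lattice (2 * pi) :: (real^'d) set"
  have one: "f y = (\<integral>\<^sup>+\<alpha>. f y * indicator cube (y - \<alpha>) \<partial>count_space ?L)" for y
  proof -
    define a where "a = (\<chi> i. 2 * pi * real_of_int \<lfloor>(y $ i + pi) / (2 * pi)\<rfloor>)"
    have aL: "a \<in> ?L" by (simp add: lattice_iff a_def)
    have aQ: "y - a \<in> cube"
      unfolding cube_def
    proof (clarify, intro conjI)
      fix i
      let ?t = "(y $ i + pi) / (2 * pi)"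
      have fl: "real_of_int \<lfloor>?t\<rfloor> \<le> ?t" "?t < real_of_int \<lfloor>?t\<rfloor> + 1" by linarith+
      have A: "2 * pi * real_of_int \<lfloor>?t\<rfloor> \<le> 2 * pi * ?t" "2 * pi * ?t < 2 * pi * (real_of_int \<lfloor>?t\<rfloor> + 1)"
        by (rule mult_left_mono[OF fl(1)], simp) (rule mult_strict_left_mono[OF fl(2)], simp)
      have B: "2 * pi * ?t = y $ i + pi" by simp
      have "2 * pi * real_of_int \<lfloor>?t\<rfloor> \<le> y $ i + pi" "y $ i + pi < 2 * pi * real_of_int \<lfloor>?t\<rfloor> + 2 * pi"
        using A(1) A(2) unfolding B by (simp_all only: distrib_left mult_1_right)
      then show "- pi \<le> (y - a) $ i" "(y - a) $ i < pi" by (simp_all add: a_def)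
    qed
    have uniq: "b = a" if "b \<in> ?L" "y - b \<in> cube" for b
    proof (rule lattice_close_eq[OF _ that(1) aL])
      fix i
      have "- pi \<le> (y - a) $ i" "(y - a) $ i < pi" "- pi \<le> (y - b) $ i" "(y - b) $ i < pi"
        using aQ that(2) unfolding cube_def by blast+
      then show "\<bar>b $ i - a $ i\<bar> < 2 * pi" by (simp add: abs_if)
    qed simp
    have "(\<integral>\<^sup>+\<alpha>. f y * indicator cube (y - \<alpha>) \<partial>count_space ?L) = (\<Sum>\<alpha>\<in>{a}. f y * indicator cube (y - \<alpha>))"
    proof (rule nn_integral_count_space')
      fix b assume "b \<in> ?L" "b \<notin> {a}"
      then have "y - b \<notin> cube" using uniq by blast
      then show "f y * indicator cube (y - b) = 0" by simp
    qed (use aL in simp_all)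
    then show ?thesis using aQ by simp
  qed
  have "(\<integral>\<^sup>+y. f y \<partial>lborel) = (\<integral>\<^sup>+y. (\<integral>\<^sup>+\<alpha>. f y * indicator cube (y - \<alpha>) \<partial>count_space ?L) \<partial>lborel)"
    by (rule nn_integral_cong) (rule one)
  also have "\<dots> = (\<integral>\<^sup>+\<alpha>. (\<integral>\<^sup>+y. f y * indicator cube (y - \<alpha>) \<partial>lborel) \<partial>count_space ?L)"
    by (rule nn_integral_count_space_nn_integral[OF countable_lattice]) measurable
  also have "\<dots> = (\<integral>\<^sup>+\<alpha>. (\<integral>\<^sup>+x. f (x + \<alpha>) * indicator cube x \<partial>lborel) \<partial>count_space ?L)"
  proof -
    have "(\<integral>\<^sup>+y. f y * indicator cube (y - \<alpha>) \<partial>lborel) = (\<integral>\<^sup>+x. f (x + \<alpha>) * indicator cube x \<partial>lborel)" for \<alpha>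
      using nn_integral_lborel_affine[of "\<lambda>y. f y * indicator cube (y - \<alpha>)" 1 \<alpha>] by simp
    then show ?thesis by simp
  qed
  also have "\<dots> = (\<integral>\<^sup>+x. (\<integral>\<^sup>+\<alpha>. f (x + \<alpha>) * indicator cube x \<partial>count_space ?L) \<partial>lborel)"
    by (rule nn_integral_count_space_nn_integral[OF countable_lattice, symmetric]) measurable
  also have "\<dots> = (\<integral>\<^sup>+x. (\<integral>\<^sup>+\<alpha>. f (x + \<alpha>) \<partial>count_space ?L) * indicator cube x \<partial>lborel)"
    by (intro nn_integral_cong nn_integral_multc) simp
  finally show ?thesis .
qed

lemma trig_poly_monomial: "\<alpha> \<in> int_lattice \<Longrightarrow> trig_poly (\<lambda>\<omega>. c * exp (\<i> * of_real (\<alpha> \<bullet> \<omega>)))"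
  unfolding trig_poly_def by (intro exI[of _ "{\<alpha>}"] exI[of _ "\<lambda>_. c"]) auto

lemma trig_poly_const: "trig_poly (\<lambda>\<omega>. c)"
  using trig_poly_monomial[of 0 c] by (simp add: int_lattice_def)

lemma trig_poly_add:
  assumes "trig_poly f" "trig_poly g" shows "trig_poly (\<lambda>\<omega>. f \<omega> + g \<omega>)"
proof -
  obtain A c where A: "finite A" "A \<subseteq> int_lattice" "f = (\<lambda>\<omega>. \<Sum>\<alpha>\<in>A. c \<alpha> * exp (\<i> * of_real (\<alpha> \<bullet> \<omega>)))"
    using assms(1) unfolding trig_poly_def by blast
  obtain B d where B: "finite B" "B \<subseteq> int_lattice" "g = (\<lambda>\<omega>. \<Sum>\<alpha>\<in>B. d \<alpha> * exp (\<i> * of_real (\<alpha> \<bullet> \<omega>)))"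
    using assms(2) unfolding trig_poly_def by blast
  have 1: "f \<omega> = (\<Sum>\<alpha>\<in>A \<union> B. (if \<alpha> \<in> A then c \<alpha> else 0) * exp (\<i> * of_real (\<alpha> \<bullet> \<omega>)))" for \<omega>
    unfolding A(3) using A B by (intro sum.mono_neutral_cong_left) auto
  have 2: "g \<omega> = (\<Sum>\<alpha>\<in>A \<union> B. (if \<alpha> \<in> B then d \<alpha> else 0) * exp (\<i> * of_real (\<alpha> \<bullet> \<omega>)))" for \<omega>
    unfolding B(3) using A B by (intro sum.mono_neutral_cong_left) auto
  show ?thesis unfolding trig_poly_def 1 2 sum.distrib[symmetric] distrib_right[symmetric]
    using A B by (intro exI[of _ "A \<union> B"] exI[of _ "\<lambda>\<alpha>. (if \<alpha> \<in> A then c \<alpha> else 0) + (if \<alpha> \<in> B then d \<alpha> else 0)"]) auto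
qed

lemma trig_poly_sum: "finite A \<Longrightarrow> (\<And>i. i \<in> A \<Longrightarrow> trig_poly (f i)) \<Longrightarrow> trig_poly (\<lambda>\<omega>. \<Sum>i\<in>A. f i \<omega>)"
  by (induction A rule: finite_induct) (auto simp: trig_poly_const trig_poly_add)

lemma trig_poly_mult:
  assumes "trig_poly f" "trig_poly g" shows "trig_poly (\<lambda>\<omega>. f \<omega> * g \<omega>)"
proof -
  obtain A c where A: "finite A" "A \<subseteq> int_lattice" "f = (\<lambda>\<omega>. \<Sum>\<alpha>\<in>A. c \<alpha> * exp (\<i> * of_real (\<alpha> \<bullet> \<omega>)))"
    using assms(1) unfolding trig_poly_def by blast
  obtain B d where B: "finite B" "B \<subseteq> int_lattice" "g = (\<lambda>\<omega>. \<Sum>\<alpha>\<in>B. d \<alpha> * exp (\<i> * of_real (\<alpha> \<bullet> \<omega>)))"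
    using assms(2) unfolding trig_poly_def by blast
  have e: "f \<omega> * g \<omega> = (\<Sum>\<alpha>\<in>A. \<Sum>\<beta>\<in>B. (c \<alpha> * d \<beta>) * exp (\<i> * of_real ((\<alpha> + \<beta>) \<bullet> \<omega>)))" for \<omega>
    unfolding A(3) B(3) sum_product by (intro sum.cong refl) (simp add: inner_add_left distrib_left exp_add mult_ac)
  have s: "\<alpha> + \<beta> \<in> int_lattice" if "\<alpha> \<in> A" "\<beta> \<in> B" for \<alpha> \<beta>
    using that A B unfolding int_lattice_def by (auto intro!: Ints_add)
  show ?thesis unfolding e by (intro trig_poly_sum A B trig_poly_monomial s)
qed

lemma trig_poly_power: "trig_poly f \<Longrightarrow> trig_poly (\<lambda>\<omega>. f \<omega> ^ n)"
  by (induction n) (auto simp: trig_poly_const trig_poly_mult)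

lemma trig_poly_prod: "finite A \<Longrightarrow> (\<And>i. i \<in> A \<Longrightarrow> trig_poly (f i)) \<Longrightarrow> trig_poly (\<lambda>\<omega>. \<Prod>i\<in>A. f i \<omega>)"
  by (induction A rule: finite_induct) (auto simp: trig_poly_const trig_poly_mult)

lemma trig_poly_cnj: assumes "trig_poly f" shows "trig_poly (\<lambda>\<omega>. cnj (f \<omega>))"
proof -
  obtain A c where A: "finite A" "A \<subseteq> int_lattice" "f = (\<lambda>\<omega>. \<Sum>\<alpha>\<in>A. c \<alpha> * exp (\<i> * of_real (\<alpha> \<bullet> \<omega>)))"
    using assms(1) unfolding trig_poly_def by blast
  have e: "cnj (f \<omega>) = (\<Sum>\<alpha>\<in>A. cnj (c \<alpha>) * exp (\<i> * of_real ((-\<alpha>) \<bullet> \<omega>)))" for \<omega>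
    unfolding A(3) by (simp add: exp_cnj)
  show ?thesis unfolding e using A by (intro trig_poly_sum trig_poly_monomial) (auto simp: int_lattice_def)
qed

lemma trig_poly_cos: "trig_poly (\<lambda>\<omega>. complex_of_real (cos (\<omega> $ i - c)))"
proof -
  have a: "axis i 1 \<in> int_lattice" "- axis i 1 \<in> int_lattice" by (auto simp: int_lattice_def axis_def)
  have e: "complex_of_real (cos (\<omega> $ i - c)) = (exp (- \<i> * of_real c) / 2) * exp (\<i> * of_real (axis i 1 \<bullet> \<omega>)) + (exp (\<i> * of_real c) / 2) * exp (\<i> * of_real ((- axis i 1) \<bullet> \<omega>))" for \<omega>
    by (simp add: cos_of_real[symmetric] cos_exp_eq inner_axis' exp_add[symmetric] algebra_simps add_divide_distrib)
  show ?thesis unfolding e by (intro trig_poly_add trig_poly_monomial a)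
qed

definition sqint :: "(real^'d::finite \<Rightarrow> complex) \<Rightarrow> ennreal" where
  "sqint f = (\<integral>\<^sup>+x. ennreal ((cmod (f x))\<^sup>2) * indicator open_cube x \<partial>lborel)"

lemma sqint_add:
  assumes [measurable]: "f \<in> borel_measurable borel" "g \<in> borel_measurable borel"
  shows "sqint (\<lambda>x. f x + g x) \<le> 2 * sqint f + 2 * sqint g"
proof -
  have "sqint (\<lambda>x. f x + g x) \<le> (\<integral>\<^sup>+x. 2 * (ennreal ((cmod (f x))\<^sup>2) * indicator open_cube x) + 2 * (ennreal ((cmod (g x))\<^sup>2) * indicator open_cube x) \<partial>lborel)"
    unfolding sqint_def
  proof (rule nn_integral_mono)
    fix x
    have "ennreal ((cmod (f x + g x))\<^sup>2) \<le> ennreal (2 * (cmod (f x))\<^sup>2 + 2 * (cmod (g x))\<^sup>2)" by (intro ennreal_leI cmod_add_sq)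
    also have "\<dots> = 2 * ennreal ((cmod (f x))\<^sup>2) + 2 * ennreal ((cmod (g x))\<^sup>2)" by (simp add: ennreal_mult)
    finally show "ennreal ((cmod (f x + g x))\<^sup>2) * indicator open_cube x \<le> 2 * (ennreal ((cmod (f x))\<^sup>2) * indicator open_cube x) + 2 * (ennreal ((cmod (g x))\<^sup>2) * indicator open_cube x)"
      by (cases "x \<in> open_cube") auto
  qed
  also have "\<dots> = 2 * sqint f + 2 * sqint g" unfolding sqint_def
    by (subst nn_integral_add) (auto simp: nn_integral_cmult)
  finally show ?thesis .
qed

definition trig_approx :: "(real^'d::finite \<Rightarrow> complex) \<Rightarrow> bool" where
  "trig_approx f \<longleftrightarrow> f \<in> borel_measurable borel \<and> (\<forall>e>0. \<exists>p. trig_poly p \<and> sqint (\<lambda>x. f x - p x) \<le> ennreal e)"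

lemma trig_poly_measurable: "trig_poly p \<Longrightarrow> p \<in> borel_measurable borel"
  by (intro borel_measurable_continuous_onI trig_poly_cont)

lemma trig_approx_closure:
  assumes [measurable]: "f \<in> borel_measurable borel"
    and "\<And>e. e > 0 \<Longrightarrow> \<exists>g. trig_approx g \<and> sqint (\<lambda>x. f x - g x) \<le> ennreal e"
  shows "trig_approx f"
  unfolding trig_approx_def
proof (intro conjI allI impI)
  fix e :: real assume e: "e > 0"
  obtain g where g: "trig_approx g" "sqint (\<lambda>x. f x - g x) \<le> ennreal (e / 4)" using assms(2)[of "e/4"] e by auto
  obtain p where p: "trig_poly p" "sqint (\<lambda>x. g x - p x) \<le> ennreal (e / 4)"
    using g(1) e unfolding trig_approx_def by (metis divide_pos_pos zero_less_numeral)
  have [measurable]: "g \<in> borel_measurable borel" "p \<in> borel_measurable borel" using g(1) trig_poly_measurable[OF p(1)] by (auto simp: trig_approx_def)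
  have "sqint (\<lambda>x. f x - p x) = sqint (\<lambda>x. (f x - g x) + (g x - p x))" by simp
  also have "\<dots> \<le> 2 * sqint (\<lambda>x. f x - g x) + 2 * sqint (\<lambda>x. g x - p x)" by (rule sqint_add) measurable
  also have "\<dots> \<le> 2 * ennreal (e / 4) + 2 * ennreal (e / 4)" by (intro add_mono mult_left_mono g p) auto
  also have "\<dots> = ennreal (2 * (e / 4) + 2 * (e / 4))" using e by (simp only: ennreal_plus ennreal_mult' ennreal_numeral)
  also have "2 * (e / 4) + 2 * (e / 4) = e" by simp
  finally show "\<exists>p. trig_poly p \<and> sqint (\<lambda>x. f x - p x) \<le> ennreal e" using p(1) by blast
qed simp

lemma trig_poly_approx: "trig_poly p \<Longrightarrow> trig_approx p"
  unfolding trig_approx_def using trig_poly_measurable[of p] by (auto intro!: exI[of _ p] simp: sqint_def)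

lemma trig_approx_add:
  assumes f: "trig_approx f" and g: "trig_approx g" shows "trig_approx (\<lambda>x. f x + g x)"
proof (rule trig_approx_closure)
  have [measurable]: "f \<in> borel_measurable borel" "g \<in> borel_measurable borel" using f g by (auto simp: trig_approx_def)
  show "(\<lambda>x. f x + g x) \<in> borel_measurable borel" by measurable
  fix e :: real assume e: "e > 0"
  then have e4: "e / 4 > 0" by simp
  obtain p where p: "trig_poly p" "sqint (\<lambda>x. f x - p x) \<le> ennreal (e / 4)" using f e4 unfolding trig_approx_def by blast
  obtain q where q: "trig_poly q" "sqint (\<lambda>x. g x - q x) \<le> ennreal (e / 4)" using g e4 unfolding trig_approx_def by blast
  note [measurable] = trig_poly_measurable[OF p(1)] trig_poly_measurable[OF q(1)]
  have "sqint (\<lambda>x. (f x + g x) - (p x + q x)) = sqint (\<lambda>x. (f x - p x) + (g x - q x))" by (simp add: algebra_simps)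
  also have "\<dots> \<le> 2 * sqint (\<lambda>x. f x - p x) + 2 * sqint (\<lambda>x. g x - q x)" by (rule sqint_add) measurable
  also have "\<dots> \<le> 2 * ennreal (e / 4) + 2 * ennreal (e / 4)" by (intro add_mono mult_left_mono p q) auto
  also have "\<dots> = ennreal (2 * (e / 4) + 2 * (e / 4))" using e by (simp only: ennreal_plus ennreal_mult' ennreal_numeral)
  also have "2 * (e / 4) + 2 * (e / 4) = e" by simp
  finally show "\<exists>h. trig_approx h \<and> sqint (\<lambda>x. (f x + g x) - h x) \<le> ennreal e"
    by (intro exI[of _ "\<lambda>x. p x + q x"] conjI trig_poly_approx trig_poly_add p q)
qed

lemma trig_approx_scale:
  assumes f: "trig_approx f" shows "trig_approx (\<lambda>x. c * f x)"
proof (rule trig_approx_closure)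
  have [measurable]: "f \<in> borel_measurable borel" using f by (auto simp: trig_approx_def)
  show "(\<lambda>x. c * f x) \<in> borel_measurable borel" by measurable
  fix e :: real assume e: "e > 0"
  define m where "m = (cmod c)\<^sup>2 + 1"
  have m: "m > 0" "(cmod c)\<^sup>2 \<le> m" unfolding m_def by (auto simp: add_nonneg_pos)
  have em: "e / m > 0" using e m by simp
  obtain p where p: "trig_poly p" "sqint (\<lambda>x. f x - p x) \<le> ennreal (e / m)" using f em unfolding trig_approx_def by blast
  note [measurable] = trig_poly_measurable[OF p(1)]
  have "sqint (\<lambda>x. c * f x - c * p x) = ennreal ((cmod c)\<^sup>2) * sqint (\<lambda>x. f x - p x)"
    unfolding sqint_def right_diff_distrib[symmetric] norm_mult power_mult_distrib
    by (subst nn_integral_cmult[symmetric]) (auto simp: ennreal_mult mult.assoc)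
  also have "\<dots> \<le> ennreal m * ennreal (e / m)" by (intro mult_mono p ennreal_leI m) auto
  also have "\<dots> = ennreal e" using m e by (subst ennreal_mult[symmetric]) auto
  finally show "\<exists>h. trig_approx h \<and> sqint (\<lambda>x. c * f x - h x) \<le> ennreal e"
    by (intro exI[of _ "\<lambda>x. c * p x"] conjI trig_poly_approx trig_poly_mult trig_poly_const p)
qed

lemma trig_approx_sum: "finite A \<Longrightarrow> (\<And>i. i \<in> A \<Longrightarrow> trig_approx (f i)) \<Longrightarrow> trig_approx (\<lambda>\<omega>. \<Sum>i\<in>A. f i \<omega>)"
  by (induction A rule: finite_induct) (auto simp: trig_approx_add intro!: trig_poly_approx trig_poly_const)

lemma trig_approx_dct:
  assumes g: "\<And>n. trig_approx (g n)" and [measurable]: "f \<in> borel_measurable borel" "w \<in> borel_measurable borel"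
    and lim: "\<And>x. x \<in> open_cube \<Longrightarrow> (\<lambda>n. g n x) \<longlonglongrightarrow> f x"
    and dom: "\<And>n x. x \<in> open_cube \<Longrightarrow> (cmod (f x - g n x))\<^sup>2 \<le> w x"
    and fin: "(\<integral>\<^sup>+x. ennreal (w x) * indicator open_cube x \<partial>lborel) < \<infinity>"
  shows "trig_approx f"
proof (rule trig_approx_closure)
  have [measurable]: "g n \<in> borel_measurable borel" for n using g by (auto simp: trig_approx_def)
  have "(\<lambda>n. sqint (\<lambda>x. f x - g n x)) \<longlonglongrightarrow> (\<integral>\<^sup>+x. 0 \<partial>(lborel :: (real^'a) measure))"
    unfolding sqint_def
  proof (rule nn_integral_dominated_convergence[where w="\<lambda>x. ennreal (w x) * indicator open_cube x"])
    show "AE x in lborel. ennreal ((cmod (f x - g n x))\<^sup>2) * indicator open_cube x \<le> ennreal (w x) * indicator open_cube x" for n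
      using dom by (intro AE_I2) (auto simp: indicator_def intro: ennreal_leI)
    show "AE x in lborel. (\<lambda>n. ennreal ((cmod (f x - g n x))\<^sup>2) * indicator open_cube x) \<longlonglongrightarrow> 0"
    proof (rule AE_I2)
      fix x
      show "(\<lambda>n. ennreal ((cmod (f x - g n x))\<^sup>2) * indicator open_cube x) \<longlonglongrightarrow> 0"
      proof (cases "x \<in> open_cube")
        case True
        have "(\<lambda>n. (cmod (f x - g n x))\<^sup>2) \<longlonglongrightarrow> (cmod (f x - f x))\<^sup>2" by (intro tendsto_intros lim True)
        then have "(\<lambda>n. ennreal ((cmod (f x - g n x))\<^sup>2)) \<longlonglongrightarrow> ennreal ((cmod (f x - f x))\<^sup>2)" by (rule tendsto_ennrealI)
        then show ?thesis using True by simp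
      qed simp
    qed
  qed (use fin in auto)
  then have lim0: "(\<lambda>n. sqint (\<lambda>x. f x - g n x)) \<longlonglongrightarrow> 0" by simp
  fix e :: real assume "e > 0"
  then have "\<forall>\<^sub>F n in sequentially. sqint (\<lambda>x. f x - g n x) < ennreal e" by (intro order_tendstoD(2)[OF lim0]) simp
  then obtain n where "sqint (\<lambda>x. f x - g n x) < ennreal e" by (auto simp: eventually_sequentially)
  then show "\<exists>h. trig_approx h \<and> sqint (\<lambda>x. f x - h x) \<le> ennreal e" using g by (intro exI[of _ "g n"]) (auto simp: less_imp_le)
qed fact

lemma open_cube_const_finite: "(\<integral>\<^sup>+x. ennreal c * indicator (open_cube :: (real^'d::finite) set) x \<partial>lborel) < \<infinity>"
proof -
  have "bounded (open_cube :: (real^'d) set)" by (simp add: open_cube_def)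
  then have "emeasure lborel (open_cube :: (real^'d) set) < \<infinity>" using emeasure_bounded_finite by blast
  then show ?thesis by (simp add: nn_integral_cmult_indicator ennreal_mult_less_top)
qed

text \<open>An interval inside one period is a superlevel set of a cosine; this makes it accessible to
trigonometric polynomials.\<close>

lemma cos_arc:
  assumes ab: "- pi \<le> a" "a < b" "b \<le> pi" and t: "- pi < t" "t < pi"
  shows "cos (t - (a + b) / 2) > cos ((b - a) / 2) \<longleftrightarrow> a < t \<and> t < b"
proof -
  define u d where "u = \<bar>t - (a + b) / 2\<bar>" and "d = (b - a) / 2"
  have cu: "cos (t - (a + b) / 2) = cos u" unfolding u_def by (simp only: cos_abs_real)
  have d: "0 < d" "d \<le> pi" using ab unfolding d_def by auto
  have u: "0 \<le> u" "u < 2 * pi - d" "(a < t \<and> t < b) \<longleftrightarrow> u < d"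
    using ab t unfolding u_def d_def by (auto simp: abs_if field_simps)
  have "cos u > cos d \<longleftrightarrow> u < d"
  proof (cases "u \<le> pi")
    case True then show ?thesis using d u by (intro cos_mono_less_eq) auto
  next
    case False
    have "cos u = cos (2 * pi - u)" by (simp add: cos_diff)
    also have "\<dots> \<le> cos d" using False d u by (subst cos_mono_le_eq) auto
    finally show ?thesis using False d by auto
  qed
  then show ?thesis unfolding cu using u(3) unfolding d_def by simp
qed

lemma clip_approx:
  fixes y0 :: real
  obtains r where "real_polynomial_function r" "\<And>y. \<bar>y\<bar> \<le> 1 \<Longrightarrow> \<bar>min 1 (max 0 (real n * (y - y0))) - r y\<bar> < 1 / real (Suc n)"
proof -
  have "continuous_on {-1..1} (\<lambda>y. min 1 (max 0 (real n * (y - y0))))" by (intro continuous_intros)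
  from Stone_Weierstrass_real_polynomial_function[OF compact_Icc this, of "1 / real (Suc n)"] obtain r where
    "real_polynomial_function r" "\<And>y. y \<in> {-1..1} \<Longrightarrow> \<bar>min 1 (max 0 (real n * (y - y0))) - r y\<bar> < 1 / real (Suc n)" by auto
  then show thesis using that[of r] by (auto simp: abs_le_iff)
qed

text \<open>In each coordinate the indicator is a step function of a cosine.  The step is a limit of clipped
linear functions, and these are uniform limits of polynomials by Stone-Weierstrass; polynomials
in a cosine are trigonometric polynomials.\<close>

lemma trig_approx_box_indicator:
  fixes a b :: "real^'d::finite"
  assumes ab: "\<And>i. - pi \<le> a $ i" "\<And>i. a $ i < b $ i" "\<And>i. b $ i \<le> pi"
  shows "trig_approx (\<lambda>x. complex_of_real (indicator (box a b) x))"
proof -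
  define c where "c i = (a $ i + b $ i) / 2" for i
  define y0 where "y0 i = cos ((b $ i - a $ i) / 2)" for i
  have "\<forall>n i. \<exists>r. real_polynomial_function r \<and> (\<forall>y. \<bar>y\<bar> \<le> 1 \<longrightarrow> \<bar>min 1 (max 0 (real n * (y - y0 i))) - r y\<bar> < 1 / real (Suc n))"
    using clip_approx by metis
  then obtain r where r: "\<And>n i. real_polynomial_function (r n i)"
    "\<And>n i y. \<bar>y\<bar> \<le> 1 \<Longrightarrow> \<bar>min 1 (max 0 (real n * (y - y0 i))) - r n i y\<bar> < 1 / real (Suc n)" by metis
  define g where "g n x = (\<Prod>i\<in>UNIV. complex_of_real (r n i (cos (x $ i - c i))))" for n and x :: "real^'d"
  have tg: "trig_poly (g n)" for n
    unfolding g_def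
  proof (intro trig_poly_prod)
    fix i
    obtain co m where "r n i = (\<lambda>x. \<Sum>j\<le>(m::nat). co j * x ^ j)" using r(1) unfolding real_polynomial_function_iff_sum by metis
    then have e: "complex_of_real (r n i (cos (x $ i - c i))) = (\<Sum>j\<le>m. of_real (co j) * complex_of_real (cos (x $ i - c i)) ^ j)" for x by simp
    show "trig_poly (\<lambda>x. complex_of_real (r n i (cos (x $ i - c i))))"
      unfolding e by (intro trig_poly_sum trig_poly_mult trig_poly_const trig_poly_power trig_poly_cos) auto
  qed simp
  have rb: "\<bar>r n i (cos t)\<bar> \<le> 2" for n i t
  proof -
    have "\<bar>min 1 (max 0 (real n * (cos t - y0 i))) - r n i (cos t)\<bar> < 1 / real (Suc n)" by (rule r) simp
    moreover have "1 / real (Suc n) \<le> 1" by simp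
    moreover have "\<bar>z\<bar> \<le> 2" if "0 \<le> m" "m \<le> 1" "\<bar>m - z\<bar> < q" "q \<le> 1" for m z q :: real
      using that by linarith
    ultimately show ?thesis by (smt (verit) max_def min_def)
  qed
  have rlim: "(\<lambda>n. r n i y) \<longlonglongrightarrow> of_bool (y > y0 i)" if y: "\<bar>y\<bar> \<le> 1" for i y
  proof -
    have 1: "(\<lambda>n. min 1 (max 0 (real n * (y - y0 i)))) \<longlonglongrightarrow> of_bool (y > y0 i)"
    proof (cases "y > y0 i")
      case True
      then obtain N :: nat where N: "1 / (y - y0 i) < real N" using reals_Archimedean2 by blast
      have "\<forall>\<^sub>F n in sequentially. min 1 (max 0 (real n * (y - y0 i))) = 1"
        using eventually_ge_at_top[of N]
      proof eventually_elim
        case (elim n)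
        have "1 < real N * (y - y0 i)" using N True by (simp add: divide_less_eq)
        also have "\<dots> \<le> real n * (y - y0 i)" using elim True by (intro mult_right_mono) auto
        finally show ?case by simp
      qed
      then show ?thesis using True by (simp add: tendsto_eventually)
    next
      case False
      then have "max 0 (real n * (y - y0 i)) = 0" for n by (simp add: max_def mult_nonneg_nonpos antisym)
      then show ?thesis using False by simp
    qed
    have 2: "(\<lambda>n. min 1 (max 0 (real n * (y - y0 i))) - r n i y) \<longlonglongrightarrow> 0"
      by (rule Lim_null_comparison[OF _ LIMSEQ_Suc[OF lim_1_over_n]]) (use r(2)[OF y] in \<open>auto intro!: always_eventually less_imp_le\<close>)
    from tendsto_diff[OF 1 2] show ?thesis by simp
  qed
  show ?thesis
  proof (rule trig_approx_dct[where w="\<lambda>_. (1 + 2 ^ CARD('d))\<^sup>2"])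
    show "trig_approx (g n)" for n by (rule trig_poly_approx[OF tg])
    have [measurable]: "box a b \<in> sets borel" by simp
    show "(\<lambda>x. complex_of_real (indicator (box a b) x)) \<in> borel_measurable borel" by measurable
    show "(\<lambda>_. (1 + 2 ^ CARD('d))\<^sup>2 :: real) \<in> borel_measurable borel" by simp
    fix x :: "real^'d" assume x: "x \<in> open_cube"
    have "(\<lambda>n. g n x) \<longlonglongrightarrow> (\<Prod>i\<in>UNIV. complex_of_real (of_bool (cos (x $ i - c i) > y0 i)))"
      unfolding g_def by (intro tendsto_prod tendsto_of_real rlim) simp
    also have "(\<Prod>i\<in>UNIV. complex_of_real (of_bool (cos (x $ i - c i) > y0 i))) = complex_of_real (indicator (box a b) x)"
    proof -
      have "cos (x $ i - c i) > y0 i \<longleftrightarrow> a $ i < x $ i \<and> x $ i < b $ i" for i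
        unfolding c_def y0_def using x ab by (intro cos_arc) (auto simp: open_cube_iff)
      then show ?thesis
        by (cases "x \<in> box a b") (auto simp: mem_box_vec intro!: prod.neutral prod_zero)
    qed
    finally show "(\<lambda>n. g n x) \<longlonglongrightarrow> complex_of_real (indicator (box a b) x)" .
    fix n
    have "cmod (g n x) \<le> (\<Prod>i\<in>(UNIV::'d set). 2)"
      unfolding g_def prod_norm[symmetric] by (intro prod_mono) (use rb in auto)
    then have "cmod (complex_of_real (indicator (box a b) x) - g n x) \<le> 1 + 2 ^ CARD('d)"
      by (intro order_trans[OF norm_triangle_ineq4] add_mono) (auto simp: indicator_def)
    then show "(cmod (complex_of_real (indicator (box a b) x) - g n x))\<^sup>2 \<le> (1 + 2 ^ CARD('d))\<^sup>2" by (intro power_mono) auto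
  qed (rule open_cube_const_finite)
qed

text \<open>Boxes form an intersection-stable generator of the Borel sets, so it suffices to pass to complements and to
countable disjoint unions.\<close>

lemma trig_approx_indicator:
  fixes A :: "(real^'d::finite) set"
  assumes "A \<in> sets borel"
  shows "trig_approx (\<lambda>x. complex_of_real (indicator (A \<inter> open_cube) x))"
proof -
  let ?G = "range (\<lambda>(a, b). box a b :: (real^'d) set)"
  have Gs: "sets borel = sigma_sets UNIV ?G" unfolding borel_eq_box by (simp add: sets_measure_of)
  have one: "trig_approx (\<lambda>x::real^'d. complex_of_real (indicator open_cube x))"
    unfolding open_cube_def by (rule trig_approx_box_indicator) auto
  have "Int_stable ?G"
  proof (rule Int_stableI, clarify)
    fix a b c d :: "real^'d"
    show "box a b \<inter> box c d \<in> ?G"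
      by (rule image_eqI[of _ _ "(\<chi> i. max (a $ i) (c $ i), \<chi> i. min (b $ i) (d $ i))"]) (auto simp: mem_box_vec)
  qed
  moreover have "?G \<subseteq> Pow UNIV" by simp
  moreover have "A \<in> sigma_sets UNIV ?G" using assms Gs by simp
  ultimately show ?thesis
  proof (induction rule: sigma_sets_induct_disjoint)
    case (basic A)
    then obtain a b where A: "A = box a b" by auto
    define a' b' where "a' = (\<chi> i. max (a $ i) (- pi))" and "b' = (\<chi> i. min (b $ i) pi)"
    have e: "A \<inter> open_cube = box a' b'" by (auto simp: A a'_def b'_def mem_box_vec open_cube_iff)
    show ?case
    proof (cases "\<forall>i. a' $ i < b' $ i")
      case True
      show ?thesis unfolding e by (rule trig_approx_box_indicator) (use True in \<open>auto simp: a'_def b'_def\<close>)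
    next
      case False
      then have "box a' b' = {}" unfolding set_eq_iff mem_box_vec by (auto, meson less_trans)
      then show ?thesis unfolding e by (simp add: trig_poly_approx trig_poly_const)
    qed
  next
    case empty
    show ?case by (simp add: trig_poly_approx trig_poly_const)
  next
    case (compl A)
    have "complex_of_real (indicator ((UNIV - A) \<inter> open_cube) x) = complex_of_real (indicator open_cube x) + (-1) * complex_of_real (indicator (A \<inter> open_cube) x)" for x
      by (simp add: indicator_def)
    then show ?case using trig_approx_add[OF one trig_approx_scale[OF compl.IH, of "-1"]] by simp
  next
    case (union A)
    have mA [measurable]: "A i \<in> sets borel" for i using union(2) Gs by auto
    have un: "complex_of_real (indicator ((\<Union>i<n. A i) \<inter> open_cube) x) = (\<Sum>i<n. complex_of_real (indicator (A i \<inter> open_cube) x))" for n x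
    proof -
      have "(\<Union>i<n. A i) \<inter> open_cube = (\<Union>i<n. A i \<inter> open_cube)" by auto
      moreover have "indicator (\<Union>i<n. A i \<inter> open_cube) x = (\<Sum>i<n. indicat_real (A i \<inter> open_cube) x)"
        using union(1) by (intro indicator_UN_disjoint) (auto simp: disjoint_family_on_def)
      ultimately show ?thesis by simp
    qed
    show ?case
    proof (rule trig_approx_dct[where g="\<lambda>n x. \<Sum>i<n. complex_of_real (indicator (A i \<inter> open_cube) x)" and w="\<lambda>_. 1"])
      show "trig_approx (\<lambda>x. \<Sum>i<n. complex_of_real (indicator (A i \<inter> open_cube) x))" for n
        by (intro trig_approx_sum union) auto
      fix x :: "real^'d"
      show "(\<lambda>n. \<Sum>i<n. complex_of_real (indicator (A i \<inter> open_cube) x)) \<longlonglongrightarrow> complex_of_real (indicator ((\<Union>i. A i) \<inter> open_cube) x)"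
        unfolding un[symmetric]
      proof (cases "x \<in> (\<Union>i. A i) \<inter> open_cube")
        case True
        then obtain j where j: "x \<in> A j" "x \<in> open_cube" by auto
        have "\<forall>\<^sub>F n in sequentially. complex_of_real (indicator ((\<Union>i<n. A i) \<inter> open_cube) x) = 1"
          using eventually_gt_at_top[of j] by eventually_elim (use j in \<open>auto simp: indicator_def\<close>)
        then show "(\<lambda>n. complex_of_real (indicator ((\<Union>i<n. A i) \<inter> open_cube) x)) \<longlonglongrightarrow> complex_of_real (indicator ((\<Union>i. A i) \<inter> open_cube) x)"
          using True by (simp add: tendsto_eventually)
      next
        case False
        then have "indicator ((\<Union>i<n. A i) \<inter> open_cube) x = (0::real)" for n by (auto simp: indicator_def)
        then show "(\<lambda>n. complex_of_real (indicator ((\<Union>i<n. A i) \<inter> open_cube) x)) \<longlonglongrightarrow> complex_of_real (indicator ((\<Union>i. A i) \<inter> open_cube) x)"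
          using False by simp
      qed
      show "(cmod (complex_of_real (indicator ((\<Union>i. A i) \<inter> open_cube) x) - (\<Sum>i<n. complex_of_real (indicator (A i \<inter> open_cube) x))))\<^sup>2 \<le> 1" for n
        unfolding un[symmetric] by (auto simp: indicator_def)
    qed (use open_cube_const_finite[of 1] in auto)
  qed
qed

text \<open>Simple functions are dense by dominated convergence.\<close>

theorem trig_dense:
  fixes t :: "real^'d::finite \<Rightarrow> complex"
  assumes [measurable]: "t \<in> borel_measurable borel" and fin: "sqint t < \<infinity>" and e: "e > 0"
  obtains p where "trig_poly p" "sqint (\<lambda>x. t x - p x) \<le> ennreal e"
proof -
  obtain s where s: "\<And>i. simple_function borel (s i)" "\<And>x. (\<lambda>i. s i x) \<longlonglongrightarrow> t x" "\<And>i x. dist (s i x) 0 \<le> 2 * dist (t x) 0"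
    using borel_measurable_implies_sequence_metric[OF assms(1), of 0] by auto
  have sa: "trig_approx (\<lambda>x. s n x * complex_of_real (indicator open_cube x))" for n
  proof -
    have fr: "finite (range (s n))" and ms: "s n -` {y} \<in> sets borel" for y
      using s(1)[of n] simple_functionD[OF s(1)[of n]] by auto
    have "s n x * complex_of_real (indicator open_cube x) = (\<Sum>y\<in>range (s n). y * complex_of_real (indicator (s n -` {y} \<inter> open_cube) x))" for x
    proof -
      have "(\<Sum>y\<in>range (s n). y * complex_of_real (indicator (s n -` {y} \<inter> open_cube) x)) = (\<Sum>y\<in>range (s n). if y = s n x then y * complex_of_real (indicator open_cube x) else 0)"
        by (intro sum.cong) (auto simp: indicator_def)
      also have "\<dots> = s n x * complex_of_real (indicator open_cube x)" using fr by (subst sum.delta) auto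
      finally show ?thesis by simp
    qed
    then show ?thesis using fr by (auto intro!: trig_approx_sum trig_approx_scale trig_approx_indicator ms)
  qed
  have "trig_approx t"
  proof (rule trig_approx_dct[OF sa, where w="\<lambda>x. 9 * (cmod (t x))\<^sup>2"])
    fix x :: "real^'d" assume x: "x \<in> open_cube"
    then show "(\<lambda>n. s n x * complex_of_real (indicator open_cube x)) \<longlonglongrightarrow> t x" using s(2) by simp
    fix n
    have "cmod (t x - s n x) \<le> 3 * cmod (t x)" using s(3)[of n x] norm_triangle_ineq4[of "t x" "s n x"] by (simp add: dist_norm)
    then have "(cmod (t x - s n x))\<^sup>2 \<le> (3 * cmod (t x))\<^sup>2" by (intro power_mono) auto
    then show "(cmod (t x - s n x * complex_of_real (indicator open_cube x)))\<^sup>2 \<le> 9 * (cmod (t x))\<^sup>2" using x by (simp add: power_mult_distrib)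
  next
    have "(\<integral>\<^sup>+x. ennreal (9 * (cmod (t x))\<^sup>2) * indicator open_cube x \<partial>lborel) = 9 * sqint t"
      unfolding sqint_def by (subst nn_integral_cmult[symmetric]) (auto simp: ennreal_mult mult.assoc)
    then show "(\<integral>\<^sup>+x. ennreal (9 * (cmod (t x))\<^sup>2) * indicator open_cube x \<partial>lborel) < \<infinity>"
      using fin by (simp add: ennreal_mult_less_top)
  qed measurable
  then have "\<exists>p. trig_poly p \<and> sqint (\<lambda>x. t x - p x) \<le> ennreal e" using e unfolding trig_approx_def by simp
  then show thesis using that by (elim exE conjE)
qed

section \<open>Approximation order of a superfunction\<close>

lemma subspace_pointwise_sum:
  assumes S: "tdist.subspace S" and "finite A" "\<And>i. i \<in> A \<Longrightarrow> T i \<in> S"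
  shows "(\<lambda>\<phi>. \<Sum>i\<in>A. T i \<phi>) \<in> S"
  using assms(2,3)
proof (induction A rule: finite_induct)
  case empty
  show ?case using tdist.subspace_0[OF S] by (simp add: zero_fun_def)
next
  case (insert i A)
  have "T i + (\<lambda>\<phi>. \<Sum>i\<in>A. T i \<phi>) \<in> S" using insert by (intro tdist.subspace_add[OF S]) auto
  then show ?case using insert by (simp add: plus_fun_def)
qed

text \<open>Multiplication of the transform by a trigonometric polynomial is a finite combination of integer translations.\<close>

lemma trig_multiple:
  assumes T: "has_fourier T g" and p: "trig_poly p"
  obtains T' where "has_fourier T' (\<lambda>\<omega>. p \<omega> * g \<omega>)"
    "\<And>S. tdist.subspace S \<Longrightarrow> shift_invariant S \<Longrightarrow> T \<in> S \<Longrightarrow> T' \<in> S"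
    "T \<in> tempered \<Longrightarrow> T' \<in> tempered" "compactly_supported T \<Longrightarrow> compactly_supported T'"
proof -
  obtain A c where A: "finite A" "A \<subseteq> int_lattice" "p = (\<lambda>\<omega>. \<Sum>\<alpha>\<in>A. c \<alpha> * exp (\<i> * of_real (\<alpha> \<bullet> \<omega>)))"
    using p unfolding trig_poly_def by blast
  define T' where "T' = (\<lambda>\<phi>. \<Sum>\<alpha>\<in>A. c \<alpha> * ttranslate (- \<alpha>) T \<phi>)"
  have "has_fourier T' (\<lambda>\<omega>. \<Sum>\<alpha>\<in>A. c \<alpha> * (exp (- \<i> * of_real ((- \<alpha>) \<bullet> \<omega>)) * g \<omega>))"
    unfolding T'_def by (intro has_fourier_sum A has_fourier_scale has_fourier_translate T)
  then have 1: "has_fourier T' (\<lambda>\<omega>. p \<omega> * g \<omega>)" by (simp add: A(3) sum_distrib_right mult.assoc)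
  have 2: "T' \<in> S" if S: "tdist.subspace S" "shift_invariant S" "T \<in> S" for S
    unfolding T'_def
  proof (intro subspace_pointwise_sum[OF S(1)] A(1))
    fix \<alpha> assume "\<alpha> \<in> A"
    then have "- \<alpha> \<in> int_lattice" using A(2) by (auto simp: int_lattice_def)
    then have "ttranslate (- \<alpha>) T \<in> S" using S(2,3) unfolding shift_invariant_def by blast
    from tdist.subspace_scale[OF S(1) this, of "c \<alpha>"] show "(\<lambda>\<phi>. c \<alpha> * ttranslate (- \<alpha>) T \<phi>) \<in> S"
      by (simp add: tscale_def)
  qed
  have 3: "T \<in> tempered \<Longrightarrow> T' \<in> tempered" unfolding T'_def by (intro tempered_sum A tempered_scale tempered_translate)
  have 4: "compactly_supported T \<Longrightarrow> compactly_supported T'" unfolding T'_def by (intro csupp_sum A csupp_scale csupp_translate)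
  show thesis by (rule that[OF 1 2 3 4])
qed

lemma measurable_nn_integral_count_space:
  fixes f :: "'a \<Rightarrow> 'b \<Rightarrow> ennreal"
  assumes A: "countable A" and [measurable]: "\<And>\<alpha>. f \<alpha> \<in> borel_measurable M"
  shows "(\<lambda>x. \<integral>\<^sup>+\<alpha>. f \<alpha> x \<partial>count_space A) \<in> borel_measurable M"
proof (cases "finite A")
  case True
  then show ?thesis by (simp add: nn_integral_count_space_finite)
next
  case False
  have "(\<integral>\<^sup>+\<alpha>. f \<alpha> x \<partial>count_space A) = (\<Sum>n. f (from_nat_into A n) x)" for x
    unfolding nn_integral_bij_count_space[OF bij_betw_from_nat_into[OF A False], symmetric]
    by (rule nn_integral_count_space_nat)
  then show ?thesis by simp
qed

lemma sobolev_norm_nonneg: "sobolev_norm s T \<ge> 0"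
  unfolding sobolev_norm_def by (intro real_sqrt_ge_zero integral_nonneg_AE AE_I2) auto

lemma sobolev_norm_le_nn:
  assumes hf: "has_fourier T g" and c: "c \<ge> 0"
    and b: "(\<integral>\<^sup>+\<omega>. ennreal ((1 + norm \<omega>) powr (2 * s) * (cmod (g \<omega>))\<^sup>2) \<partial>lborel) \<le> ennreal c"
  shows "sobolev_norm s T \<le> sqrt c"
proof -
  have [measurable]: "g \<in> borel_measurable borel" by (rule has_fourier_measurable[OF hf])
  have "(LINT \<omega>|lborel. (1 + norm \<omega>) powr (2 * s) * (cmod (g \<omega>))\<^sup>2) \<le> c"
    by (subst integral_eq_nn_integral) (use enn2real_mono[OF b] c in auto)
  then show ?thesis unfolding sobolev_norm_eq[OF hf] by (rule real_sqrt_le_mono)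
qed

text \<open>In the variable \<open>x = h \<omega>\<close>, the ideal multiplier \<open>t\<close> reproduces \<open>g\<close> exactly on the ball of radius \<open>r\<close> and is extended
periodically from the cube.  Three errors remain: \<open>U1\<close>, the part of \<open>g\<close> outside the ball; \<open>U2\<close>, the
aliases of the ball at nonzero lattice points; \<open>U3\<close>, the error of approximating \<open>t\<close> by a trigonometric
polynomial \<open>p\<close>.  The first is small because \<open>(1 + |\<omega>|)\<^sup>2\<^sup>s\<close> is at most \<open>(h/r)\<^sup>2\<^sup>(\<^sup>k\<^sup>-\<^sup>s\<^sup>)\<close> times \<open>(1 + |\<omega>|)\<^sup>2\<^sup>k\<close> there, the
second by the hypothesis on \<open>A\<close>, and the third by density, as the lattice sums of \<open>\<Psi>\<close> are bounded.\<close>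

lemma dilated_trig_approximation:
  fixes g \<Psi> :: "real^'d::finite \<Rightarrow> complex"
  assumes ks: "k > s" and k: "k > 0" and h: "0 < h" "h < 1" and r: "0 < r" "r < 1" and m: "m > 0"
    and [measurable]: "g \<in> borel_measurable borel" and cont: "continuous_on UNIV \<Psi>"
    and low: "\<And>x. norm x \<le> r \<Longrightarrow> m \<le> cmod (\<Psi> x)"
    and B: "B \<ge> 0" "\<And>S x. finite S \<Longrightarrow> S \<subseteq> lattice (2 * pi) \<Longrightarrow> (\<Sum>\<alpha>\<in>S. (1 + norm (x + \<alpha>)) powr (2 * s) * (cmod (\<Psi> (x + \<alpha>)))\<^sup>2) \<le> B"
    and A: "A \<ge> 0" "\<And>S x. norm x \<le> r \<Longrightarrow> finite S \<Longrightarrow> S \<subseteq> lattice (2 * pi) - {0} \<Longrightarrow>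
      (\<Sum>\<alpha>\<in>S. norm (x + \<alpha>) powr (2 * s) * (cmod (\<Psi> (x + \<alpha>)))\<^sup>2) \<le> A * norm x powr (2 * k)"
    and ig: "integrable lborel (\<lambda>\<omega>. (1 + norm \<omega>) powr (2 * k) * (cmod (g \<omega>))\<^sup>2)"
    and e: "e > 0"
  defines "I \<equiv> LINT \<omega>|lborel. (1 + norm \<omega>) powr (2 * k) * (cmod (g \<omega>))\<^sup>2"
  shows "\<exists>p. trig_poly p \<and> (\<integral>\<^sup>+\<omega>. ennreal ((1 + norm \<omega>) powr (2 * s) *
      (cmod (g \<omega> - of_real (h ^ CARD('d)) * (p (h *\<^sub>R \<omega>) * \<Psi> (h *\<^sub>R \<omega>))))\<^sup>2) \<partial>lborel)
    \<le> ennreal ((4 * (1 / r) powr (2 * (k - s)) + 4 * (1 + 2 powr (2 * s)) * A / m\<^sup>2) * h powr (2 * (k - s)) * I + e)"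
proof -
  note [measurable] = borel_measurable_continuous_onI[OF cont]
  let ?L = "lattice (2 * pi) :: (real^'d) set"
  let ?hd = "complex_of_real (h ^ CARD('d))" and ?i = "1 / h"
  let ?W = "\<lambda>x. (1 + norm (?i *\<^sub>R x)) powr (2 * s)"
  define G where "G x = (cmod (g (?i *\<^sub>R x)))\<^sup>2" for x
  define J where "J x = (1 + norm (?i *\<^sub>R x)) powr (2 * k) * G x" for x
  have [measurable]: "G \<in> borel_measurable borel" "J \<in> borel_measurable borel" unfolding G_def[abs_def] J_def[abs_def] by measurable
  have G0: "G x \<ge> 0" for x by (simp add: G_def)
  have J0: "J x \<ge> 0" for x by (simp add: J_def G_def)
  have hd: "h ^ CARD('d) > 0" using h by simp
  have I0: "I \<ge> 0" unfolding I_def by (intro integral_nonneg_AE AE_I2) auto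
  have intJ: "(\<integral>\<^sup>+x. ennreal (J x) \<partial>lborel) = ennreal (h ^ CARD('d) * I)"
  proof -
    have "(\<integral>\<^sup>+\<omega>. ennreal ((1 + norm \<omega>) powr (2 * k) * (cmod (g \<omega>))\<^sup>2) \<partial>lborel) = ennreal I"
      unfolding I_def by (rule nn_integral_eq_integral[OF ig]) auto
    moreover have "(\<integral>\<^sup>+\<omega>. ennreal ((1 + norm \<omega>) powr (2 * k) * (cmod (g \<omega>))\<^sup>2) \<partial>lborel) = ennreal (\<bar>?i\<bar> ^ DIM(real^'d)) * (\<integral>\<^sup>+x. ennreal (J x) \<partial>lborel)"
      using h by (subst nn_integral_lborel_affine[of _ ?i 0]) (auto simp: J_def G_def)
    ultimately have "ennreal I = ennreal (\<bar>?i\<bar> ^ CARD('d)) * (\<integral>\<^sup>+x. ennreal (J x) \<partial>lborel)" by simp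
    then have "ennreal (h ^ CARD('d)) * ennreal I = (ennreal (h ^ CARD('d)) * ennreal (\<bar>?i\<bar> ^ CARD('d))) * (\<integral>\<^sup>+x. ennreal (J x) \<partial>lborel)"
      by (simp add: mult.assoc)
    also have "ennreal (h ^ CARD('d)) * ennreal (\<bar>?i\<bar> ^ CARD('d)) = 1"
      using h by (subst ennreal_mult[symmetric]) (auto simp: power_one_over)
    finally show ?thesis using hd I0 by (simp add: ennreal_mult)
  qed
  \<comment> \<open>The cutoff keeps to the ball where the divisor is bounded away from 0.\<close>
  define t where "t x = (if norm x \<le> r then g (?i *\<^sub>R x) / (?hd * \<Psi> x) else 0)" for x
  have [measurable]: "t \<in> borel_measurable borel" unfolding t_def[abs_def] by measurable
  have th: "?hd * t x * \<Psi> x = g (?i *\<^sub>R x)" if "norm x \<le> r" for x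
    using low[OF that] m h that by (auto simp: t_def)
  have GJ: "G x \<le> J x" for x
  proof -
    have "1 \<le> (1 + norm (?i *\<^sub>R x)) powr (2 * k)" using k by (intro ge_one_powr_ge_zero) auto
    then show ?thesis unfolding J_def using mult_right_mono[of 1 _ "G x"] G0 by simp
  qed
  have fin: "sqint t < \<infinity>"
  proof -
    have "sqint t \<le> (\<integral>\<^sup>+x. ennreal (1 / (h ^ CARD('d) * m)\<^sup>2) * ennreal (J x) \<partial>lborel)"
      unfolding sqint_def
    proof (rule nn_integral_mono)
      fix x
      have "(cmod (t x))\<^sup>2 \<le> 1 / (h ^ CARD('d) * m)\<^sup>2 * J x"
      proof (cases "norm x \<le> r")
        case True
        have "cmod (t x) = cmod (g (?i *\<^sub>R x)) / (h ^ CARD('d) * cmod (\<Psi> x))"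
          using True h by (simp add: t_def norm_divide norm_mult norm_power)
        also have "\<dots> \<le> cmod (g (?i *\<^sub>R x)) / (h ^ CARD('d) * m)"
          using low[OF True] m hd by (intro divide_left_mono mult_left_mono mult_pos_pos) auto
        finally have "(cmod (t x))\<^sup>2 \<le> (cmod (g (?i *\<^sub>R x)) / (h ^ CARD('d) * m))\<^sup>2" by (intro power_mono) auto
        also have "\<dots> = 1 / (h ^ CARD('d) * m)\<^sup>2 * G x" by (simp add: power_divide G_def)
        also have "\<dots> \<le> 1 / (h ^ CARD('d) * m)\<^sup>2 * J x" by (intro mult_left_mono GJ) auto
        finally show ?thesis .
      next
        case False then show ?thesis using J0 by (simp add: t_def)
      qed
      then have "ennreal ((cmod (t x))\<^sup>2) \<le> ennreal (1 / (h ^ CARD('d) * m)\<^sup>2) * ennreal (J x)"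
        using J0 by (subst ennreal_mult[symmetric]) (auto intro: ennreal_leI)
      then show "ennreal ((cmod (t x))\<^sup>2) * indicator open_cube x \<le> ennreal (1 / (h ^ CARD('d) * m)\<^sup>2) * ennreal (J x)"
        by (cases "x \<in> open_cube") auto
    qed
    also have "\<dots> = ennreal (1 / (h ^ CARD('d) * m)\<^sup>2) * ennreal (h ^ CARD('d) * I)"
      by (subst nn_integral_cmult) (auto simp: intJ)
    also have "\<dots> < \<infinity>" by (simp add: ennreal_mult_less_top)
    finally show ?thesis .
  qed
  define K where "K = 1 + ?i powr (2 * s)"
  define c3 where "c3 = 2 * (h ^ CARD('d))\<^sup>2 * (K * B)"
  have c30: "c3 \<ge> 0" unfolding c3_def K_def using B hd by simp
  \<comment> \<open>The accuracy for \<open>p\<close> that keeps the total contribution of \<open>U3\<close> below \<open>e\<close> after rescaling.\<close>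
  define e' where "e' = e * h ^ CARD('d) / (c3 + 1)"
  have e': "e' > 0" "c3 * e' \<le> e * h ^ CARD('d)" unfolding e'_def using e hd c30 by (auto simp: field_simps)
  obtain p where p: "trig_poly p" "sqint (\<lambda>x. t x - p x) \<le> ennreal e'" by (rule trig_dense[OF _ fin e'(1)]) measurable
  note [measurable] = trig_poly_measurable[OF p(1)]
  define F where "F y = ?W y * (cmod (g (?i *\<^sub>R y) - ?hd * (p y * \<Psi> y)))\<^sup>2" for y
  have [measurable]: "F \<in> borel_measurable borel" unfolding F_def[abs_def] by measurable
  define U1 where "U1 y = (if norm y \<ge> r then 4 * (?W y * G y) else 0)" for y
  have [measurable]: "U1 \<in> borel_measurable borel" unfolding U1_def[abs_def] by measurable
  define U2 where "U2 x \<alpha> = (if norm x \<le> r \<and> \<alpha> \<noteq> 0 then 4 * (G x / m\<^sup>2) * (?W (x + \<alpha>) * (cmod (\<Psi> (x + \<alpha>)))\<^sup>2) else 0)" for x \<alpha>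
  define U3 where "U3 x \<alpha> = 2 * (h ^ CARD('d))\<^sup>2 * (cmod (t x - p x))\<^sup>2 * (?W (x + \<alpha>) * (cmod (\<Psi> (x + \<alpha>)))\<^sup>2)" for x \<alpha>
  have U0: "U1 y \<ge> 0" "U2 x \<alpha> \<ge> 0" "U3 x \<alpha> \<ge> 0" for x y \<alpha> by (auto simp: U1_def U2_def U3_def G0)
  have pt: "F (x + \<alpha>) \<le> U1 (x + \<alpha>) + U2 x \<alpha> + U3 x \<alpha>" if x: "x \<in> cube" and a: "\<alpha> \<in> ?L" for x \<alpha>
  proof -
    let ?y = "x + \<alpha>"
    have py: "p ?y = p x" by (rule trig_poly_periodic[OF p(1) a])
    let ?a = "g (?i *\<^sub>R ?y) - ?hd * t x * \<Psi> ?y" and ?b = "?hd * (t x - p x) * \<Psi> ?y"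
    have W0: "?W ?y \<ge> 0" by simp
    have "g (?i *\<^sub>R ?y) - ?hd * (p ?y * \<Psi> ?y) = ?a + ?b" unfolding py by (simp add: algebra_simps)
    then have "F ?y \<le> ?W ?y * (2 * (cmod ?a)\<^sup>2 + 2 * (cmod ?b)\<^sup>2)"
      unfolding F_def using cmod_add_sq[of ?a ?b] W0 by (simp only: mult_left_mono)
    also have "\<dots> = 2 * (?W ?y * (cmod ?a)\<^sup>2) + U3 x \<alpha>"
    proof -
      have "cmod ?b = h ^ CARD('d) * cmod (t x - p x) * cmod (\<Psi> ?y)" using h by (simp add: norm_mult norm_power)
      then have "(cmod ?b)\<^sup>2 = (h ^ CARD('d))\<^sup>2 * (cmod (t x - p x))\<^sup>2 * (cmod (\<Psi> ?y))\<^sup>2" by (simp only: power_mult_distrib)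
      then show ?thesis unfolding U3_def by (simp only: distrib_left mult_ac)
    qed
    finally have 1: "F ?y \<le> 2 * (?W ?y * (cmod ?a)\<^sup>2) + U3 x \<alpha>" .
    have "2 * (?W ?y * (cmod ?a)\<^sup>2) \<le> U1 ?y + U2 x \<alpha>"
    proof (cases "norm x \<le> r")
      case True
      show ?thesis
      proof (cases "\<alpha> = 0")
        case \<alpha>: True
        then have "?a = 0" using th[OF True] by simp
        then show ?thesis using U0 by simp
      next
        case False
        have "norm \<alpha> \<ge> 2 * pi" using lattice_norm_ge[of "2 * pi" \<alpha>] a False by simp
        then have ny: "norm ?y \<ge> r" using norm_triangle_ineq4[of ?y x] True r pi_gt3 by simp
        have "cmod (?hd * t x) \<le> cmod (g (?i *\<^sub>R x)) / m"
        proof -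
          have nz: "\<Psi> x \<noteq> 0" using low[OF True] m by auto
          then have "?hd * t x = g (?i *\<^sub>R x) / \<Psi> x" using th[OF True] by (simp add: eq_divide_eq)
          then have "cmod (?hd * t x) = cmod (g (?i *\<^sub>R x)) / cmod (\<Psi> x)" by (simp only: norm_divide)
          also have "\<dots> \<le> cmod (g (?i *\<^sub>R x)) / m" using low[OF True] m by (intro frac_le) auto
          finally show ?thesis .
        qed
        then have "(cmod (?hd * t x))\<^sup>2 \<le> (cmod (g (?i *\<^sub>R x)) / m)\<^sup>2" by (intro power_mono) auto
        then have q: "(cmod (?hd * t x))\<^sup>2 \<le> G x / m\<^sup>2" by (simp add: G_def power_divide)
        have "(cmod ?a)\<^sup>2 \<le> 2 * (cmod (g (?i *\<^sub>R ?y)))\<^sup>2 + 2 * (cmod (- (?hd * t x * \<Psi> ?y)))\<^sup>2"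
          using cmod_add_sq[of "g (?i *\<^sub>R ?y)" "- (?hd * t x * \<Psi> ?y)"] by simp
        also have "(cmod (- (?hd * t x * \<Psi> ?y)))\<^sup>2 = (cmod (?hd * t x))\<^sup>2 * (cmod (\<Psi> ?y))\<^sup>2"
          by (simp only: norm_minus_cancel norm_mult[of _ "\<Psi> ?y"] power_mult_distrib)
        also have "2 * (cmod (g (?i *\<^sub>R ?y)))\<^sup>2 + 2 * ((cmod (?hd * t x))\<^sup>2 * (cmod (\<Psi> ?y))\<^sup>2) \<le> 2 * G ?y + 2 * (G x / m\<^sup>2 * (cmod (\<Psi> ?y))\<^sup>2)"
          using q by (intro add_mono mult_left_mono mult_right_mono) (auto simp: G_def)
        finally have "?W ?y * (cmod ?a)\<^sup>2 \<le> ?W ?y * (2 * G ?y + 2 * (G x / m\<^sup>2 * (cmod (\<Psi> ?y))\<^sup>2))"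
          by (rule mult_left_mono) simp
        then have "2 * (?W ?y * (cmod ?a)\<^sup>2) \<le> 4 * (?W ?y * G ?y) + 4 * (G x / m\<^sup>2) * (?W ?y * (cmod (\<Psi> ?y))\<^sup>2)"
          by (simp only: distrib_left mult_ac)
        then show ?thesis using ny True False by (simp add: U1_def U2_def)
      qed
    next
      case False
      \<comment> \<open>A point of the cube is the shortest one in its lattice class.\<close>
      have "norm x \<le> norm ?y"
        unfolding norm_vec_def
      proof (rule L2_set_mono)
        fix i
        have xi: "- pi \<le> x $ i" "x $ i < pi" using x by (auto simp: cube_def)
        obtain z :: int where z: "\<alpha> $ i = 2 * pi * of_int z" using a by (auto simp: lattice_iff elim!: Ints_cases allE[of _ i] simp: field_simps)
        show "norm (x $ i) \<le> norm (?y $ i)"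
        proof (cases "z = 0")
          case True then show ?thesis using z by simp
        next
          case False
          then have "\<bar>real_of_int z\<bar> \<ge> 1" by linarith
          then have "2 * pi * \<bar>real_of_int z\<bar> \<ge> 2 * pi * 1" by (intro mult_left_mono) auto
          then have "\<bar>\<alpha> $ i\<bar> \<ge> 2 * pi" by (simp add: z abs_mult)
          then show ?thesis using xi by (auto simp: abs_if split: if_splits)
        qed
      qed simp
      then have ny: "norm ?y \<ge> r" using False by simp
      have a: "?a = g (?i *\<^sub>R ?y)" using False by (simp add: t_def)
      have "2 * (?W ?y * (cmod ?a)\<^sup>2) = 2 * (?W ?y * G ?y)" unfolding a G_def ..
      also have "\<dots> \<le> 4 * (?W ?y * G ?y)" using G0[of ?y] by (intro mult_right_mono) auto
      also have "\<dots> = U1 ?y" unfolding U1_def using ny by simp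
      finally have "2 * (?W ?y * (cmod ?a)\<^sup>2) \<le> U1 ?y" .
      then show ?thesis using U0(2)[of x \<alpha>] by linarith
    qed
    then show ?thesis using 1 by linarith
  qed
  define c1 where "c1 = 4 * (1 / r) powr (2 * (k - s)) * h powr (2 * (k - s))"
  define c2 where "c2 = 4 * (1 + 2 powr (2 * s)) * A / m\<^sup>2 * h powr (2 * (k - s))"
  have c0: "c1 \<ge> 0" "c2 \<ge> 0" unfolding c1_def c2_def using A by auto
  have U1b: "U1 y \<le> c1 * J y" for y
  proof (cases "norm y \<ge> r")
    case True
    let ?n = "1 + norm (?i *\<^sub>R y)"
    have n: "?n \<ge> r / h" using True h by (simp add: field_simps)
    have rh: "r / h > 0" using r h by simp
    have "?n powr (2 * s) = ?n powr (2 * k) * ?n powr (- (2 * (k - s)))" by (simp add: powr_add[symmetric] algebra_simps)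
    also have "\<dots> \<le> ?n powr (2 * k) * (r / h) powr (- (2 * (k - s)))"
      using n rh ks by (intro mult_left_mono powr_mono2') auto
    also have "(r / h) powr (- (2 * (k - s))) = (1 / r) powr (2 * (k - s)) * h powr (2 * (k - s))"
    proof -
      have "(r / h) powr (- q) = (1 / r) powr q * h powr q" for q
        using r h by (simp add: powr_minus powr_divide divide_simps)
      then show ?thesis .
    qed
    finally have "?W y * G y \<le> ?n powr (2 * k) * ((1 / r) powr (2 * (k - s)) * h powr (2 * (k - s))) * G y"
      by (rule mult_right_mono) (rule G0)
    then have "4 * (?W y * G y) \<le> c1 * J y" unfolding c1_def J_def by (simp only: mult_ac)
    then show ?thesis using True by (simp add: U1_def)
  next
    case False then show ?thesis using c0 J0 by (simp add: U1_def)
  qed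
  have s2: "(\<integral>\<^sup>+\<alpha>. ennreal (U2 x \<alpha>) \<partial>count_space ?L) \<le> ennreal (c2 * J x)" for x
  proof (rule nn_integral_count_space_le[OF countable_lattice])
    fix S assume S: "finite S" "S \<subseteq> ?L"
    show "(\<Sum>\<alpha>\<in>S. U2 x \<alpha>) \<le> c2 * J x"
    proof (cases "norm x \<le> r")
      case True
      let ?c = "1 + 2 powr (2 * s)"
      have "(\<Sum>\<alpha>\<in>S. U2 x \<alpha>) = (\<Sum>\<alpha>\<in>S - {0}. 4 * (G x / m\<^sup>2) * (?W (x + \<alpha>) * (cmod (\<Psi> (x + \<alpha>)))\<^sup>2))"
        using S True by (intro sum.mono_neutral_cong_right) (auto simp: U2_def)
      also have "\<dots> \<le> (\<Sum>\<alpha>\<in>S - {0}. 4 * (G x / m\<^sup>2) * ((?c * ?i powr (2 * s)) * (norm (x + \<alpha>) powr (2 * s) * (cmod (\<Psi> (x + \<alpha>)))\<^sup>2)))"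
      proof (intro sum_mono mult_left_mono)
        fix \<alpha> assume "\<alpha> \<in> S - {0}"
        then have "norm \<alpha> \<ge> 2 * pi" using lattice_norm_ge[of "2 * pi" \<alpha>] S by auto
        then have ny: "norm (x + \<alpha>) \<ge> 1" using norm_triangle_ineq4[of "x + \<alpha>" x] True r pi_gt3 by simp
        have ny': "?i * norm (x + \<alpha>) \<ge> 1" using ny h mult_mono[of 1 ?i 1 "norm (x + \<alpha>)"] by simp
        have "?W (x + \<alpha>) \<le> (1 powr (2 * s) + 2 powr (2 * s)) * (?i * norm (x + \<alpha>)) powr (2 * s)"
        proof (rule powr_comparable)
          have n: "norm (?i *\<^sub>R (x + \<alpha>)) = ?i * norm (x + \<alpha>)" using h by (simp only: norm_scaleR) simp
          show "0 < ?i * norm (x + \<alpha>)" "1 * (?i * norm (x + \<alpha>)) \<le> 1 + norm (?i *\<^sub>R (x + \<alpha>))"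
            "1 + norm (?i *\<^sub>R (x + \<alpha>)) \<le> 2 * (?i * norm (x + \<alpha>))"
            unfolding n using ny' by linarith+
        qed simp
        also have "(?i * norm (x + \<alpha>)) powr (2 * s) = ?i powr (2 * s) * norm (x + \<alpha>) powr (2 * s)" using h by (intro powr_mult)
        finally have "?W (x + \<alpha>) * (cmod (\<Psi> (x + \<alpha>)))\<^sup>2 \<le> ((1 powr (2 * s) + 2 powr (2 * s)) * (?i powr (2 * s) * norm (x + \<alpha>) powr (2 * s))) * (cmod (\<Psi> (x + \<alpha>)))\<^sup>2"
          by (rule mult_right_mono) simp
        then show "?W (x + \<alpha>) * (cmod (\<Psi> (x + \<alpha>)))\<^sup>2 \<le> (?c * ?i powr (2 * s)) * (norm (x + \<alpha>) powr (2 * s) * (cmod (\<Psi> (x + \<alpha>)))\<^sup>2)"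
          by (simp only: powr_one_eq_one mult_ac)
      qed (use G0 in auto)
      also have "\<dots> = 4 * (G x / m\<^sup>2) * ((?c * ?i powr (2 * s)) * (\<Sum>\<alpha>\<in>S - {0}. norm (x + \<alpha>) powr (2 * s) * (cmod (\<Psi> (x + \<alpha>)))\<^sup>2))"
        by (simp only: sum_distrib_left)
      also have "\<dots> \<le> 4 * (G x / m\<^sup>2) * ((?c * ?i powr (2 * s)) * (A * norm x powr (2 * k)))"
        by (intro mult_left_mono A(2) True) (use S G0 in auto)
      also have "\<dots> \<le> 4 * (G x / m\<^sup>2) * ((?c * ?i powr (2 * s)) * (A * (h powr (2 * k) * (1 + norm (?i *\<^sub>R x)) powr (2 * k))))"
      proof (intro mult_left_mono)
        have "norm x = h * norm (?i *\<^sub>R x)" using h by simp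
        also have "\<dots> \<le> h * (1 + norm (?i *\<^sub>R x))" using h by (intro mult_left_mono) auto
        finally have "norm x powr (2 * k) \<le> (h * (1 + norm (?i *\<^sub>R x))) powr (2 * k)" using k by (intro powr_mono2) auto
        also have "\<dots> = h powr (2 * k) * (1 + norm (?i *\<^sub>R x)) powr (2 * k)" using h by (simp add: powr_mult)
        finally show "norm x powr (2 * k) \<le> h powr (2 * k) * (1 + norm (?i *\<^sub>R x)) powr (2 * k)" .
      qed (use G0 A in auto)
      also have "\<dots> = (4 * ?c * A / m\<^sup>2) * (?i powr (2 * s) * h powr (2 * k)) * J x"
        unfolding J_def by (simp add: mult_ac)
      also have "?i powr (2 * s) * h powr (2 * k) = h powr (2 * (k - s))"
        using h by (simp add: powr_divide powr_diff right_diff_distrib)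
      finally show ?thesis unfolding c2_def .
    next
      case False then show ?thesis using c0 J0 by (simp add: U2_def)
    qed
  qed (rule U0)
  have s3: "(\<integral>\<^sup>+\<alpha>. ennreal (U3 x \<alpha>) \<partial>count_space ?L) \<le> ennreal (c3 * (cmod (t x - p x))\<^sup>2)" for x
  proof (rule nn_integral_count_space_le[OF countable_lattice])
    fix S assume S: "finite S" "S \<subseteq> ?L"
    have "(\<Sum>\<alpha>\<in>S. U3 x \<alpha>) \<le> (\<Sum>\<alpha>\<in>S. 2 * (h ^ CARD('d))\<^sup>2 * (cmod (t x - p x))\<^sup>2 * (K * ((1 + norm (x + \<alpha>)) powr (2 * s) * (cmod (\<Psi> (x + \<alpha>)))\<^sup>2)))"
      unfolding U3_def
    proof (intro sum_mono mult_left_mono)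
      fix \<alpha>
      let ?n = "norm (x + \<alpha>)"
      have "(1 + norm (?i *\<^sub>R (x + \<alpha>))) powr (2 * s) \<le> (1 powr (2 * s) + ?i powr (2 * s)) * (1 + ?n) powr (2 * s)"
      proof (rule powr_comparable)
        have n: "norm (?i *\<^sub>R (x + \<alpha>)) = ?n / h" using h by (simp only: norm_scaleR) simp
        have "?n * h \<le> ?n * 1" using h by (intro mult_left_mono) auto
        then show "1 * (1 + ?n) \<le> 1 + norm (?i *\<^sub>R (x + \<alpha>))" "1 + norm (?i *\<^sub>R (x + \<alpha>)) \<le> ?i * (1 + ?n)"
          unfolding n using h by (simp_all add: field_simps)
      qed (use h in \<open>auto simp: add_pos_nonneg\<close>)
      then have "?W (x + \<alpha>) * (cmod (\<Psi> (x + \<alpha>)))\<^sup>2 \<le> (K * (1 + ?n) powr (2 * s)) * (cmod (\<Psi> (x + \<alpha>)))\<^sup>2"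
        unfolding K_def powr_one_eq_one by (rule mult_right_mono) simp
      then show "?W (x + \<alpha>) * (cmod (\<Psi> (x + \<alpha>)))\<^sup>2 \<le> K * ((1 + ?n) powr (2 * s) * (cmod (\<Psi> (x + \<alpha>)))\<^sup>2)"
        by (simp only: mult.assoc)
    qed auto
    also have "\<dots> = 2 * (h ^ CARD('d))\<^sup>2 * (cmod (t x - p x))\<^sup>2 * (K * (\<Sum>\<alpha>\<in>S. (1 + norm (x + \<alpha>)) powr (2 * s) * (cmod (\<Psi> (x + \<alpha>)))\<^sup>2))"
      by (simp only: sum_distrib_left)
    also have "\<dots> \<le> 2 * (h ^ CARD('d))\<^sup>2 * (cmod (t x - p x))\<^sup>2 * (K * B)"
      by (intro mult_left_mono B(2) S) (auto simp: K_def)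
    finally show "(\<Sum>\<alpha>\<in>S. U3 x \<alpha>) \<le> c3 * (cmod (t x - p x))\<^sup>2" unfolding c3_def by (simp only: mult_ac)
  qed (rule U0)
  have "(\<integral>\<^sup>+y. ennreal (F y) \<partial>lborel) = (\<integral>\<^sup>+x. (\<integral>\<^sup>+\<alpha>. ennreal (F (x + \<alpha>)) \<partial>count_space ?L) * indicator cube x \<partial>lborel)"
    by (rule nn_integral_periodize) measurable
  also have "\<dots> \<le> (\<integral>\<^sup>+x. (\<integral>\<^sup>+\<alpha>. ennreal (U1 (x + \<alpha>)) \<partial>count_space ?L) * indicator cube x + (ennreal (c2 * J x) + ennreal (c3 * (cmod (t x - p x))\<^sup>2) * indicator cube x) \<partial>lborel)"
  proof (rule nn_integral_mono)
    fix x :: "real^'d"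
    show "(\<integral>\<^sup>+\<alpha>. ennreal (F (x + \<alpha>)) \<partial>count_space ?L) * indicator cube x \<le> (\<integral>\<^sup>+\<alpha>. ennreal (U1 (x + \<alpha>)) \<partial>count_space ?L) * indicator cube x + (ennreal (c2 * J x) + ennreal (c3 * (cmod (t x - p x))\<^sup>2) * indicator cube x)"
    proof (cases "x \<in> cube")
      case True
      have "(\<integral>\<^sup>+\<alpha>. ennreal (F (x + \<alpha>)) \<partial>count_space ?L) \<le> (\<integral>\<^sup>+\<alpha>. ennreal (U1 (x + \<alpha>)) + ennreal (U2 x \<alpha>) + ennreal (U3 x \<alpha>) \<partial>count_space ?L)"
        using pt[OF True] U0 by (intro nn_integral_mono) (auto simp: ennreal_plus[symmetric] simp del: ennreal_plus intro!: ennreal_leI)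
      also have "\<dots> = (\<integral>\<^sup>+\<alpha>. ennreal (U1 (x + \<alpha>)) \<partial>count_space ?L) + (\<integral>\<^sup>+\<alpha>. ennreal (U2 x \<alpha>) \<partial>count_space ?L) + (\<integral>\<^sup>+\<alpha>. ennreal (U3 x \<alpha>) \<partial>count_space ?L)"
        by (simp add: nn_integral_add)
      also have "\<dots> \<le> (\<integral>\<^sup>+\<alpha>. ennreal (U1 (x + \<alpha>)) \<partial>count_space ?L) + ennreal (c2 * J x) + ennreal (c3 * (cmod (t x - p x))\<^sup>2)"
        by (intro add_mono s2 s3 order_refl)
      finally show ?thesis using True by (simp add: add.assoc)
    qed simp
  qed
  also have "\<dots> = (\<integral>\<^sup>+x. (\<integral>\<^sup>+\<alpha>. ennreal (U1 (x + \<alpha>)) \<partial>count_space ?L) * indicator cube x \<partial>lborel) + ((\<integral>\<^sup>+x. ennreal (c2 * J x) \<partial>lborel) + (\<integral>\<^sup>+x. ennreal (c3 * (cmod (t x - p x))\<^sup>2) * indicator cube x \<partial>lborel))"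
  proof -
    have mm: "(\<lambda>x. \<integral>\<^sup>+\<alpha>. ennreal (U1 (x + \<alpha>)) \<partial>count_space ?L) \<in> borel_measurable lborel"
      by (rule measurable_nn_integral_count_space[OF countable_lattice]) measurable
    show ?thesis using mm by (subst nn_integral_add) (auto simp: nn_integral_add)
  qed
  also have "\<dots> \<le> ennreal (c1 * (h ^ CARD('d) * I)) + (ennreal (c2 * (h ^ CARD('d) * I)) + ennreal (e * h ^ CARD('d)))"
  proof (intro add_mono)
    have "(\<integral>\<^sup>+x. (\<integral>\<^sup>+\<alpha>. ennreal (U1 (x + \<alpha>)) \<partial>count_space ?L) * indicator cube x \<partial>lborel) = (\<integral>\<^sup>+y. ennreal (U1 y) \<partial>lborel)"
      by (rule nn_integral_periodize[symmetric]) measurable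
    also have "\<dots> \<le> (\<integral>\<^sup>+y. ennreal (c1 * J y) \<partial>lborel)"
      by (intro nn_integral_mono ennreal_leI U1b)
    also have "\<dots> = ennreal (c1 * (h ^ CARD('d) * I))"
      using c0 J0 hd I0 by (subst ennreal_mult) (auto simp: nn_integral_cmult intJ ennreal_mult)
    finally show "(\<integral>\<^sup>+x. (\<integral>\<^sup>+\<alpha>. ennreal (U1 (x + \<alpha>)) \<partial>count_space ?L) * indicator cube x \<partial>lborel) \<le> ennreal (c1 * (h ^ CARD('d) * I))" .
    have "(\<integral>\<^sup>+y. ennreal (c2 * J y) \<partial>lborel) = ennreal (c2 * (h ^ CARD('d) * I))"
      using c0 J0 hd I0 by (subst ennreal_mult) (auto simp: nn_integral_cmult intJ ennreal_mult)
    then show "(\<integral>\<^sup>+y. ennreal (c2 * J y) \<partial>lborel) \<le> ennreal (c2 * (h ^ CARD('d) * I))" by simp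
    have "(\<integral>\<^sup>+x. ennreal (c3 * (cmod (t x - p x))\<^sup>2) * indicator cube x \<partial>lborel) = ennreal c3 * sqint (\<lambda>x. t x - p x)"
      unfolding nn_integral_cube_open_cube sqint_def using c30 by (subst nn_integral_cmult[symmetric]) (auto simp: ennreal_mult mult.assoc)
    also have "\<dots> \<le> ennreal c3 * ennreal e'" by (intro mult_left_mono p) simp
    also have "\<dots> = ennreal (c3 * e')" using c30 e' by (intro ennreal_mult[symmetric]) auto
    also have "\<dots> \<le> ennreal (e * h ^ CARD('d))" by (intro ennreal_leI e')
    finally show "(\<integral>\<^sup>+x. ennreal (c3 * (cmod (t x - p x))\<^sup>2) * indicator cube x \<partial>lborel) \<le> ennreal (e * h ^ CARD('d))" .
  qed
  also have "\<dots> = ennreal (h ^ CARD('d) * ((c1 + c2) * I + e))"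
    using c0 hd I0 e by (simp add: ennreal_plus[symmetric] algebra_simps del: ennreal_plus)
  finally have total: "(\<integral>\<^sup>+y. ennreal (F y) \<partial>lborel) \<le> ennreal (h ^ CARD('d) * ((c1 + c2) * I + e))" .
  have "(\<integral>\<^sup>+\<omega>. ennreal ((1 + norm \<omega>) powr (2 * s) * (cmod (g \<omega> - ?hd * (p (h *\<^sub>R \<omega>) * \<Psi> (h *\<^sub>R \<omega>))))\<^sup>2) \<partial>lborel)
     = ennreal (\<bar>?i\<bar> ^ DIM(real^'d)) * (\<integral>\<^sup>+y. ennreal (F y) \<partial>lborel)"
    using h by (subst nn_integral_lborel_affine[of _ ?i 0]) (auto simp: F_def)
  also have "\<dots> \<le> ennreal (\<bar>?i\<bar> ^ CARD('d)) * ennreal (h ^ CARD('d) * ((c1 + c2) * I + e))"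
    using total by (simp add: mult_left_mono)
  also have "\<dots> = ennreal ((\<bar>?i\<bar> ^ CARD('d) * h ^ CARD('d)) * ((c1 + c2) * I + e))"
    using h c0 I0 e hd by (subst ennreal_mult[symmetric]) (auto simp: mult.assoc)
  also have "\<bar>?i\<bar> ^ CARD('d) * h ^ CARD('d) = 1" using h by (simp add: power_one_over)
  also have "c1 + c2 = (4 * (1 / r) powr (2 * (k - s)) + 4 * (1 + 2 powr (2 * s)) * A / m\<^sup>2) * h powr (2 * (k - s))"
    unfolding c1_def c2_def by (simp only: distrib_right)
  finally show ?thesis using p(1) by (intro exI[of _ p]) simp
qed

text \<open>For \<open>h < 1\<close> this is the preceding estimate with \<open>e\<close> tending to 0.  For \<open>h \<ge> 1\<close> the zero element of the
space already suffices, because \<open>h\<^sup>k\<^sup>-\<^sup>s \<ge> 1\<close> and the norm of \<open>W\<^sub>2\<^sup>s\<close> is at most that of \<open>W\<^sub>2\<^sup>k\<close>.\<close>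

theorem superfunction_approx_order:
  fixes \<psi> :: "'d::finite tdist"
  assumes ks: "k > s" and k: "k > 0" and \<rho>: "\<rho> > 0" and sob: "\<psi> \<in> sobolev s" and cont: "continuous_on UNIV (tfourier \<psi>)"
    and nz: "tfourier \<psi> 0 \<noteq> 0"
    and B: "B \<ge> 0" "\<And>S x. finite S \<Longrightarrow> S \<subseteq> lattice (2 * pi) \<Longrightarrow> (\<Sum>\<alpha>\<in>S. (1 + norm (x + \<alpha>)) powr (2 * s) * (cmod (tfourier \<psi> (x + \<alpha>)))\<^sup>2) \<le> B"
    and A: "A \<ge> 0" "\<And>S x. norm x < \<rho> \<Longrightarrow> finite S \<Longrightarrow> S \<subseteq> lattice (2 * pi) - {0} \<Longrightarrow>
      (\<Sum>\<alpha>\<in>S. norm (x + \<alpha>) powr (2 * s) * (cmod (tfourier \<psi> (x + \<alpha>)))\<^sup>2) \<le> A * norm x powr (2 * k)"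
    and S: "tdist.subspace S" "shift_invariant S" "\<psi> \<in> S"
  shows "approx_order s k S"
proof -
  let ?\<Psi> = "tfourier \<psi>"
  define m where "m = cmod (?\<Psi> 0) / 2"
  have m: "m > 0" unfolding m_def using nz by simp
  have "isCont ?\<Psi> 0" using cont by (simp add: continuous_on_eq_continuous_at)
  then obtain d where d: "d > 0" "\<And>x. dist x 0 < d \<Longrightarrow> dist (?\<Psi> x) (?\<Psi> 0) < m"
    using m unfolding continuous_at_eps_delta by blast
  define r where "r = min (min (\<rho> / 2) (d / 2)) (1 / 2)"
  have r: "0 < r" "r < 1" "r < \<rho>" "r < d" unfolding r_def using \<rho> d(1) by auto
  have low: "m \<le> cmod (?\<Psi> x)" if "norm x \<le> r" for x
  proof -
    have "cmod (?\<Psi> x - ?\<Psi> 0) < m" using d(2)[of x] that r by (simp add: dist_norm)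
    then show ?thesis using norm_triangle_ineq2[of "?\<Psi> 0" "?\<Psi> 0 - ?\<Psi> x"] unfolding m_def by (simp add: norm_minus_commute)
  qed
  have A2: "(\<Sum>\<alpha>\<in>S. norm (x + \<alpha>) powr (2 * s) * (cmod (?\<Psi> (x + \<alpha>)))\<^sup>2) \<le> A * norm x powr (2 * k)"
    if "norm x \<le> r" "finite S" "S \<subseteq> lattice (2 * pi) - {0}" for S x
    using that r by (intro A(2)) auto
  define Q where "Q = 4 * (1 / r) powr (2 * (k - s)) + 4 * (1 + 2 powr (2 * s)) * A / m\<^sup>2"
  have Q0: "Q \<ge> 0" unfolding Q_def using A by simp
  show ?thesis unfolding approx_order_def
  proof (intro exI[of _ "max 1 (sqrt Q)"] ballI allI impI)
    fix f :: "'d tdist" and h :: real assume f: "f \<in> sobolev k" and h: "h > 0"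
    note F = sobolevD[OF f]
    define I where "I = (LINT \<omega>|lborel. (1 + norm \<omega>) powr (2 * k) * (cmod (tfourier f \<omega>))\<^sup>2)"
    have I0: "I \<ge> 0" unfolding I_def by (intro integral_nonneg_AE AE_I2) auto
    have nf: "sobolev_norm k f = sqrt I" by (simp add: sobolev_norm_def I_def)
    let ?inf = "INF g\<in>tdilate h ` S. sobolev_norm s (f - g)"
    have bdd: "bdd_below ((\<lambda>g. sobolev_norm s (f - g)) ` (tdilate h ` S))"
      by (intro bdd_belowI2[of _ 0] sobolev_norm_nonneg)
    have le: "?inf \<le> c" if "T \<in> S" "sobolev_norm s (f - tdilate h T) \<le> c" for T c
    proof -
      have "tdilate h T \<in> tdilate h ` S" using that(1) by simp
      then have "?inf \<le> sobolev_norm s (f - tdilate h T)" by (rule cINF_lower[OF bdd])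
      then show ?thesis using that(2) by linarith
    qed
    have inf0: "?inf \<ge> 0" using S(3) by (intro cINF_greatest sobolev_norm_nonneg) auto
    show "?inf \<le> max 1 (sqrt Q) * h powr (k - s) * sobolev_norm k f"
    proof (cases "h < 1")
      case True
      have "?inf\<^sup>2 \<le> Q * h powr (2 * (k - s)) * I"
      proof (rule field_le_epsilon)
        fix e :: real assume e: "e > 0"
        have "\<exists>p. trig_poly p \<and> (\<integral>\<^sup>+\<omega>. ennreal ((1 + norm \<omega>) powr (2 * s) *
            (cmod (tfourier f \<omega> - of_real (h ^ CARD('d)) * (p (h *\<^sub>R \<omega>) * ?\<Psi> (h *\<^sub>R \<omega>))))\<^sup>2) \<partial>lborel)
          \<le> ennreal (Q * h powr (2 * (k - s)) * I + e)"
          unfolding Q_def I_def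
          by (rule dilated_trig_approximation[OF ks k h True r(1,2) m F(4) cont low B(1) B(2) A(1) A2 F(3) e])
        then obtain p where p: "trig_poly p" and b: "(\<integral>\<^sup>+\<omega>. ennreal ((1 + norm \<omega>) powr (2 * s) *
            (cmod (tfourier f \<omega> - of_real (h ^ CARD('d)) * (p (h *\<^sub>R \<omega>) * ?\<Psi> (h *\<^sub>R \<omega>))))\<^sup>2) \<partial>lborel)
          \<le> ennreal (Q * h powr (2 * (k - s)) * I + e)" by blast
        obtain T where T: "has_fourier T (\<lambda>\<omega>. p \<omega> * ?\<Psi> \<omega>)" "T \<in> S"
          by (rule trig_multiple[OF sobolevD(2)[OF sob] p]) (use S in blast)
        have c: "Q * h powr (2 * (k - s)) * I + e \<ge> 0" using Q0 I0 e by simp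
        have "sobolev_norm s (f - tdilate h T) \<le> sqrt (Q * h powr (2 * (k - s)) * I + e)"
          by (rule sobolev_norm_le_nn[OF has_fourier_diff[OF F(2) has_fourier_dilate[OF T(1) h]] c b])
        from le[OF T(2) this] have "?inf \<le> sqrt (Q * h powr (2 * (k - s)) * I + e)" .
        then have "?inf\<^sup>2 \<le> (sqrt (Q * h powr (2 * (k - s)) * I + e))\<^sup>2" using inf0 by (intro power_mono) auto
        then show "?inf\<^sup>2 \<le> Q * h powr (2 * (k - s)) * I + e" using c by simp
      qed
      then have "?inf \<le> sqrt (Q * h powr (2 * (k - s)) * I)" by (rule real_le_rsqrt)
      also have "\<dots> = sqrt Q * h powr (k - s) * sqrt I"
      proof -
        have "h powr (2 * (k - s)) = (h powr (k - s))\<^sup>2" by (simp add: power2_eq_square powr_add[symmetric])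
        then show ?thesis by (simp add: real_sqrt_mult)
      qed
      also have "\<dots> \<le> max 1 (sqrt Q) * h powr (k - s) * sqrt I" using I0 by (intro mult_right_mono) auto
      finally show ?thesis unfolding nf .
    next
      case False
      have z: "(\<lambda>\<phi>. 0) \<in> S" using tdist.subspace_0[OF S(1)] by (simp add: zero_fun_def)
      have hf: "has_fourier (f - tdilate h (\<lambda>\<phi>. 0)) (\<lambda>\<omega>. tfourier f \<omega> - 0)"
        by (intro has_fourier_diff F) (simp add: tdilate_def has_fourier_zero)
      have "sobolev_norm s (f - tdilate h (\<lambda>\<phi>. 0)) \<le> sqrt I"
      proof (rule sobolev_norm_le_nn[OF hf I0])
        have "(\<integral>\<^sup>+\<omega>. ennreal ((1 + norm \<omega>) powr (2 * s) * (cmod (tfourier f \<omega> - 0))\<^sup>2) \<partial>lborel)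
          \<le> (\<integral>\<^sup>+\<omega>. ennreal ((1 + norm \<omega>) powr (2 * k) * (cmod (tfourier f \<omega>))\<^sup>2) \<partial>lborel)"
          using ks by (intro nn_integral_mono ennreal_leI) (auto intro!: mult_right_mono powr_mono)
        also have "\<dots> = ennreal I" unfolding I_def by (rule nn_integral_eq_integral[OF F(3)]) auto
        finally show "(\<integral>\<^sup>+\<omega>. ennreal ((1 + norm \<omega>) powr (2 * s) * (cmod (tfourier f \<omega> - 0))\<^sup>2) \<partial>lborel) \<le> ennreal I" .
      qed
      from le[OF z this] have "?inf \<le> 1 * 1 * sqrt I" by simp
      also have "\<dots> \<le> max 1 (sqrt Q) * h powr (k - s) * sqrt I"
        using False ks I0 by (intro mult_mono mult_right_mono ge_one_powr_ge_zero) auto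
      finally show ?thesis unfolding nf .
    qed
  qed
qed

section \<open>Finite dimension of the space of refinable vectors\<close>

text \<open>The monomial that accompanies the iterated derivative along \<open>js\<close>.  Summing over all words instead of
multi-indices keeps the Taylor coefficients free of multinomial factors.\<close>

definition word_weight :: "real^'d::finite \<Rightarrow> 'd list \<Rightarrow> complex" where
  "word_weight y js = prod_list (map (\<lambda>j. complex_of_real (y $ j)) js)"

lemma finite_words: "finite {js::'d::finite list. length js < m}" "finite {js::'d list. length js = m}"
proof -
  have f: "finite {js::'d list. length js \<le> m}" using finite_lists_length_le[of "UNIV :: 'd set" m] by simp
  show "finite {js::'d::finite list. length js < m}" by (rule finite_subset[OF _ f]) auto
  show "finite {js::'d::finite list. length js = m}" by (rule finite_subset[OF _ f]) auto
qed

lemma word_weight_bound: "cmod (word_weight y js) \<le> norm y ^ length js"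
proof (induction js)
  case (Cons j js)
  have "cmod (word_weight y (j # js)) = \<bar>y $ j\<bar> * cmod (word_weight y js)" by (simp add: word_weight_def norm_mult)
  also have "\<dots> \<le> norm y * norm y ^ length js" by (intro mult_mono component_le_norm_cart Cons) auto
  finally show ?case by simp
qed (simp add: word_weight_def)

lemma ray_derivative:
  fixes f :: "real^'d::finite \<Rightarrow> complex"
  assumes f: "f \<in> schwartz"
  shows "((\<lambda>u. \<Sum>js | length js = n. word_weight y js * dparts js f (x + u *\<^sub>R y)) has_vector_derivative
     (\<Sum>js | length js = Suc n. word_weight y js * dparts js f (x + u *\<^sub>R y))) (at u within S)"
proof -
  have "((\<lambda>u. \<Sum>js | length js = n. word_weight y js * dparts js f (x + u *\<^sub>R y)) has_vector_derivative
     (\<Sum>js | length js = n. word_weight y js * (\<Sum>j\<in>UNIV. of_real (y $ j) * dpart j (dparts js f) (x + u *\<^sub>R y)))) (at u within S)"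
    by (intro has_vector_derivative_sum has_vector_derivative_mult_right has_vector_derivative_ray schwartz_differentiable schwartz_dparts f)
  moreover have "(\<Sum>js | length js = n. word_weight y js * (\<Sum>j\<in>UNIV. of_real (y $ j) * dpart j (dparts js f) (x + u *\<^sub>R y)))
     = (\<Sum>js | length js = Suc n. word_weight y js * dparts js f (x + u *\<^sub>R y))"
  proof -
    have e: "{js::'d list. length js = Suc n} = (\<lambda>(js, j). j # js) ` ({js. length js = n} \<times> UNIV)"
      by (force simp: length_Suc_conv)
    have "(\<Sum>js | length js = Suc n. word_weight y js * dparts js f (x + u *\<^sub>R y)) = (\<Sum>(js, j)\<in>{js. length js = n} \<times> UNIV. word_weight y (j # js) * dparts (j # js) f (x + u *\<^sub>R y))"
      unfolding e by (subst sum.reindex) (auto simp: inj_on_def case_prod_unfold)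
    also have "\<dots> = (\<Sum>js | length js = n. \<Sum>j\<in>UNIV. word_weight y (j # js) * dparts (j # js) f (x + u *\<^sub>R y))"
      by (rule sum.cartesian_product[symmetric])
    finally show ?thesis by (simp add: word_weight_def dparts_Cons sum_distrib_left mult_ac)
  qed
  ultimately show ?thesis by simp
qed

text \<open>Taylor's formula with integral remainder along the segment from \<open>x\<close> to \<open>x + y\<close>; the remainder keeps the
decay in \<open>x\<close>.\<close>

lemma schwartz_taylor:
  fixes f :: "real^'d::finite \<Rightarrow> complex"
  assumes f: "f \<in> schwartz" and m: "m > 0"
  obtains C where "C \<ge> 0" "\<And>x y. norm y \<le> 1 \<Longrightarrow>
    cmod (f (x + y) - (\<Sum>js | length js < m. word_weight y js / fact (length js) * dparts js f x)) \<le> C * norm y ^ m / (1 + norm x) ^ N"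
proof -
  have "\<forall>js. \<exists>C>0. \<forall>x y. norm y \<le> 1 \<longrightarrow> cmod (dparts js f (x + y)) \<le> C / (1 + norm x) ^ N"
    using rapid_shift_bound[OF schwartz_rapid[OF schwartz_dparts[OF f]], of _ N] by metis
  then obtain C where C: "\<And>js. C js > 0" "\<And>js x y. norm y \<le> 1 \<Longrightarrow> cmod (dparts js f (x + y)) \<le> C js / (1 + norm x) ^ N" by metis
  let ?D = "\<lambda>x y n u. \<Sum>js | length js = n. word_weight y js * dparts js f (x + u *\<^sub>R y)"
  show thesis
  proof (rule that[of "\<Sum>js | length js = m. C js"])
    show "0 \<le> (\<Sum>js | length js = m. C js)" using C(1) by (intro sum_nonneg) (auto simp: less_imp_le)
    fix x y :: "real^'d" assume y: "norm y \<le> 1"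
    have pos: "(1 + norm x) ^ N > 0" by (intro zero_less_power) (simp add: add_pos_nonneg)
    let ?B = "(\<Sum>js | length js = m. C js) * norm y ^ m / (1 + norm x) ^ N"
    have B0: "?B \<ge> 0" using C(1) pos by (intro divide_nonneg_pos mult_nonneg_nonneg sum_nonneg) (auto simp: less_imp_le)
    have "((\<lambda>u. ((1 - u) ^ (m - 1) / fact (m - 1)) *\<^sub>R ?D x y m u) has_integral f (x + 1 *\<^sub>R y) - (\<Sum>i<m. ((1 - 0) ^ i / fact i) *\<^sub>R ?D x y i 0)) {0..1}"
    proof (rule Taylor_has_integral[OF m])
      show "?D x y 0 = (\<lambda>u. f (x + u *\<^sub>R y))" by (auto simp: word_weight_def)
      show "(?D x y i has_vector_derivative ?D x y (Suc i) t) (at t within {0..1})" for i t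
        by (rule ray_derivative[OF f])
    qed simp
    then have hi: "((\<lambda>u. ((1 - u) ^ (m - 1) / fact (m - 1)) *\<^sub>R ?D x y m u) has_integral f (x + y) - (\<Sum>i<m. (1 / fact i) *\<^sub>R ?D x y i 0)) (cbox 0 1)" by simp
    have "norm (f (x + y) - (\<Sum>i<m. (1 / fact i) *\<^sub>R ?D x y i 0)) \<le> ?B * measure lborel (cbox 0 (1::real))"
    proof (rule has_integral_bound[OF B0 hi])
      fix u :: real assume u: "u \<in> cbox 0 1"
      have "norm (((1 - u) ^ (m - 1) / fact (m - 1)) *\<^sub>R ?D x y m u) = ((1 - u) ^ (m - 1) / fact (m - 1)) * cmod (?D x y m u)"
        using u by (simp add: abs_of_nonneg)
      also have "\<dots> \<le> 1 * cmod (?D x y m u)"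
      proof (intro mult_right_mono)
        have "(1 - u) ^ (m - 1) \<le> 1" using u by (intro power_le_one) auto
        moreover have "(1::real) \<le> fact (m - 1)" by simp
        ultimately have "(1 - u) ^ (m - 1) \<le> fact (m - 1)" by linarith
        then show "(1 - u) ^ (m - 1) / fact (m - 1) \<le> 1" by (simp add: divide_le_eq)
      qed simp
      also have "cmod (?D x y m u) \<le> (\<Sum>js | length js = m. norm y ^ m * (C js / (1 + norm x) ^ N))"
      proof (rule order_trans[OF norm_sum], rule sum_mono)
        fix js :: "'d list" assume js: "js \<in> {js. length js = m}"
        have "norm (u *\<^sub>R y) \<le> 1" using u y by (simp add: mult_le_one)
        then show "cmod (word_weight y js * dparts js f (x + u *\<^sub>R y)) \<le> norm y ^ m * (C js / (1 + norm x) ^ N)"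
          unfolding norm_mult using word_weight_bound[of y js] js by (intro mult_mono C) auto
      qed
      also have "\<dots> = norm y ^ m * ((\<Sum>js | length js = m. C js) / (1 + norm x) ^ N)"
        by (simp only: sum_distrib_left sum_divide_distrib)
      also have "\<dots> = ?B" by (simp only: times_divide_eq_right mult.commute)
      finally show "norm (((1 - u) ^ (m - 1) / fact (m - 1)) *\<^sub>R ?D x y m u) \<le> ?B" by simp
    qed
    moreover have "(\<Sum>i<m. (1 / fact i) *\<^sub>R ?D x y i 0) = (\<Sum>js | length js < m. word_weight y js / fact (length js) * dparts js f x)"
    proof -
      have e: "{js::'d list. length js < m} = (\<Union>i\<in>{..<m}. {js. length js = i})" by auto
      have "(\<Sum>js | length js < m. word_weight y js / fact (length js) * dparts js f x) = (\<Sum>i<m. \<Sum>js | length js = i. word_weight y js / fact (length js) * dparts js f x)"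
        unfolding e by (rule sum.UNION_disjoint) (auto simp: finite_words)
      also have "\<dots> = (\<Sum>i<m. (1 / fact i) *\<^sub>R ?D x y i 0)"
        by (intro sum.cong refl) (simp add: scaleR_conv_of_real sum_distrib_left mult_ac)
      finally show ?thesis by simp
    qed
    ultimately show "cmod (f (x + y) - (\<Sum>js | length js < m. word_weight y js / fact (length js) * dparts js f x)) \<le> ?B" by simp
  qed
qed

text \<open>The Taylor expansion of the reproducing kernel is integrated against the transform.\<close>

lemma csupp_taylor:
  fixes T :: "'d::finite tdist"
  assumes sob: "T \<in> sobolev s" and cs: "compactly_supported T" and m: "m > 0"
  shows "\<exists>c C. \<forall>\<omega>. norm \<omega> \<le> 1 \<longrightarrow> cmod (tfourier T \<omega> - (\<Sum>js | length js < m. word_weight \<omega> js / fact (length js) * c js)) \<le> C * norm \<omega> ^ m"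
proof -
  let ?g = "tfourier T"
  note T = sobolevD[OF sob]
  note [measurable] = T(4)
  obtain k where k: "k \<in> schwartz" and rep: "\<And>x. ?g x = (LINT t|lborel. k (x - t) * ?g t)" "\<And>x. integrable lborel (\<lambda>t. k (x - t) * ?g t)"
    by (rule csupp_fourier_representation[OF sob cs]) blast
  obtain N where N: "integrable lborel (\<lambda>t. cmod (?g t) / (1 + norm t) ^ N)" by (rule sobolev_moderate[OF sob])
  obtain C where C: "C \<ge> 0" "\<And>x y. norm y \<le> 1 \<Longrightarrow>
    cmod (k (x + y) - (\<Sum>js | length js < m. word_weight y js / fact (length js) * dparts js k x)) \<le> C * norm y ^ m / (1 + norm x) ^ N"
    by (rule schwartz_taylor[OF k m]) blast
  have ij: "integrable lborel (\<lambda>t. dparts js k (0 - t) * ?g t)" for js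
    by (rule moderate_convolution(1)[OF schwartz_dparts[OF k] T(4) N])
  define c where "c js = (LINT t|lborel. dparts js k (0 - t) * ?g t)" for js
  define K where "K = (LINT t|lborel. cmod (?g t) / (1 + norm t) ^ N)"
  have "cmod (?g \<omega> - (\<Sum>js | length js < m. word_weight \<omega> js / fact (length js) * c js)) \<le> (C * K) * norm \<omega> ^ m" if w: "norm \<omega> \<le> 1" for \<omega>
  proof -
    let ?P = "\<lambda>t. \<Sum>js | length js < m. word_weight \<omega> js / fact (length js) * dparts js k (- t)"
    have eP: "?P t * ?g t = (\<Sum>js | length js < m. word_weight \<omega> js / fact (length js) * (dparts js k (0 - t) * ?g t))" for t
      unfolding sum_distrib_right by (intro sum.cong refl) simp
    have iP: "integrable lborel (\<lambda>t. ?P t * ?g t)"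
      unfolding eP by (intro Bochner_Integration.integrable_sum integrable_mult_right ij)
    have "(\<Sum>js | length js < m. word_weight \<omega> js / fact (length js) * c js) = (LINT t|lborel. ?P t * ?g t)"
      unfolding eP c_def by (subst Bochner_Integration.integral_sum) (auto intro!: integrable_mult_right ij[simplified])
    then have "?g \<omega> - (\<Sum>js | length js < m. word_weight \<omega> js / fact (length js) * c js) = (LINT t|lborel. k (\<omega> - t) * ?g t - ?P t * ?g t)"
      using rep(1)[of \<omega>] Bochner_Integration.integral_diff[OF rep(2)[of \<omega>] iP] by simp
    also have "cmod \<dots> \<le> (LINT t|lborel. (C * norm \<omega> ^ m) * (cmod (?g t) / (1 + norm t) ^ N))"
    proof (rule Bochner_Integration.integral_norm_bound_integral)
      show "integrable lborel (\<lambda>t. k (\<omega> - t) * ?g t - ?P t * ?g t)" by (intro Bochner_Integration.integrable_diff rep(2) iP)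
      show "integrable lborel (\<lambda>t. (C * norm \<omega> ^ m) * (cmod (?g t) / (1 + norm t) ^ N))" by (rule integrable_mult_right[OF N])
      fix t
      have "cmod (k (- t + \<omega>) - ?P t) \<le> C * norm \<omega> ^ m / (1 + norm (- t)) ^ N" by (rule C(2)[OF w])
      then have "cmod (k (- t + \<omega>) - ?P t) * cmod (?g t) \<le> C * norm \<omega> ^ m / (1 + norm t) ^ N * cmod (?g t)"
        by (intro mult_right_mono) auto
      then have "cmod ((k (- t + \<omega>) - ?P t) * ?g t) \<le> C * norm \<omega> ^ m / (1 + norm t) ^ N * cmod (?g t)" by (simp only: norm_mult)
      moreover have "k (\<omega> - t) * ?g t - ?P t * ?g t = (k (- t + \<omega>) - ?P t) * ?g t"
      proof -
        have kk: "\<omega> - t = - t + \<omega>" by simp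
        show ?thesis unfolding kk left_diff_distrib ..
      qed
      ultimately show "cmod (k (\<omega> - t) * ?g t - ?P t * ?g t) \<le> (C * norm \<omega> ^ m) * (cmod (?g t) / (1 + norm t) ^ N)" by simp
    qed
    also have "\<dots> = (C * K) * norm \<omega> ^ m" unfolding K_def integral_mult_right_zero by (simp only: mult_ac)
    finally show ?thesis .
  qed
  then show ?thesis by (intro exI[of _ c] exI[of _ "C * K"]) blast
qed

text \<open>The coefficients are attached by a relation \<open>\<rho>\<close> that is compatible with linear combinations, so that no choice
has to be made.  Induction on the index set: if some vector has a nonzero coefficient at \<open>i\<close>,
subtracting multiples of it removes that coefficient from all others.\<close>

lemma finite_span_if_finitely_many_coefficients:
  assumes "finite I"
    and sub: "tvec.subspace V" and tot: "\<And>x. x \<in> V \<Longrightarrow> \<exists>c. \<rho> x c"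
    and lin: "\<And>x y c d a. x \<in> V \<Longrightarrow> y \<in> V \<Longrightarrow> \<rho> x c \<Longrightarrow> \<rho> y d \<Longrightarrow> \<rho> (x + tvscale a y) (\<lambda>i. c i + a * d i)"
    and zero: "\<And>x c. x \<in> V \<Longrightarrow> \<rho> x c \<Longrightarrow> (\<And>i. i \<in> I \<Longrightarrow> c i = 0) \<Longrightarrow> x = 0"
  shows "\<exists>B. finite B \<and> B \<subseteq> V \<and> V \<subseteq> tvec.span B"
  using assms
proof (induction I arbitrary: V \<rho> rule: finite_induct)
  case empty
  then have "V \<subseteq> {0}" by blast
  then show ?case by (intro exI[of _ "{}"]) simp
next
  case (insert i I)
  note sub = insert.prems(1) and tot = insert.prems(2) and lin = insert.prems(3) and zero = insert.prems(4)
  show ?case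
  proof (cases "\<exists>x0 c0. x0 \<in> V \<and> \<rho> x0 c0 \<and> c0 i \<noteq> 0")
    case False
    show ?thesis
    proof (rule insert.IH[OF sub tot lin])
      fix x c assume x: "x \<in> V" "\<rho> x c" "\<And>j. j \<in> I \<Longrightarrow> c j = 0"
      have "c i = 0" using False x by blast
      then show "x = 0" using x by (intro zero[of x c]) auto
    qed auto
  next
    case True
    then obtain x0 c0 where x0: "x0 \<in> V" "\<rho> x0 c0" "c0 i \<noteq> 0" by blast
    define V' where "V' = {x \<in> V. \<exists>c. \<rho> x c \<and> c i = 0}"
    have comb: "x + tvscale a y \<in> V" if "x \<in> V" "y \<in> V" for x y a
      using that sub by (intro tvec.subspace_add tvec.subspace_scale)
    have comb': "x + tvscale a y \<in> V'" if xy: "x \<in> V'" "y \<in> V'" for x y a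
    proof -
      obtain c d where "\<rho> x c" "c i = 0" "\<rho> y d" "d i = 0" using xy unfolding V'_def by blast
      then show ?thesis using lin[of x y c d a] comb[of x y a] xy unfolding V'_def
        by (intro CollectI conjI exI[of _ "\<lambda>j. c j + a * d j"]) auto
    qed
    have z: "0 \<in> V'"
    proof -
      have "x0 + tvscale (-1) x0 = 0" by (simp add: tvec.scale_minus_left)
      then have "\<rho> 0 (\<lambda>j. c0 j + (-1) * c0 j)" using lin[OF x0(1) x0(1) x0(2) x0(2), of "-1"] by simp
      then show ?thesis using tvec.subspace_0[OF sub] unfolding V'_def
        by (intro CollectI conjI exI[of _ "\<lambda>j. c0 j + (-1) * c0 j"]) auto
    qed
    have sub': "tvec.subspace V'"
    proof (rule tvec.subspaceI[OF z])
      show "x + y \<in> V'" if "x \<in> V'" "y \<in> V'" for x y using comb'[OF that, of 1] by simp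
      show "tvscale a x \<in> V'" if "x \<in> V'" for a x using comb'[OF z that, of a] by simp
    qed
    have "\<exists>B. finite B \<and> B \<subseteq> V' \<and> V' \<subseteq> tvec.span B"
    proof (rule insert.IH[OF sub', where \<rho>="\<lambda>x c. \<rho> x c \<and> c i = 0"])
      show "\<exists>c. \<rho> x c \<and> c i = 0" if "x \<in> V'" for x using that unfolding V'_def by blast
      show "\<rho> (x + tvscale a y) (\<lambda>i. c i + a * d i) \<and> c i + a * d i = 0"
        if "x \<in> V'" "y \<in> V'" "\<rho> x c \<and> c i = 0" "\<rho> y d \<and> d i = 0" for x y c d a
        using that lin[of x y c d a] unfolding V'_def by auto
      show "x = 0" if "x \<in> V'" "\<rho> x c \<and> c i = 0" "\<And>j. j \<in> I \<Longrightarrow> c j = 0" for x c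
        using that by (intro zero[of x c]) (auto simp: V'_def)
    qed
    then obtain B where B: "finite B" "B \<subseteq> V'" "V' \<subseteq> tvec.span B" by blast
    have "x \<in> tvec.span (insert x0 B)" if x: "x \<in> V" for x
    proof -
      obtain c where c: "\<rho> x c" using tot[OF x] by blast
      define a where "a = - (c i / c0 i)"
      have ca: "c i + a * c0 i = 0" using x0(3) by (simp add: a_def)
      have "x + tvscale a x0 \<in> V'" unfolding V'_def
        using lin[OF x x0(1) c x0(2), of a] comb[OF x x0(1), of a] ca
        by (intro CollectI conjI exI[of _ "\<lambda>j. c j + a * c0 j"]) simp_all
      then have "x + tvscale a x0 \<in> tvec.span (insert x0 B)" using B(3) tvec.span_mono[of B "insert x0 B"] by blast
      moreover have "tvscale (- a) x0 \<in> tvec.span (insert x0 B)" by (intro tvec.span_scale tvec.span_base) simp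
      ultimately have "(x + tvscale a x0) + tvscale (- a) x0 \<in> tvec.span (insert x0 B)" by (rule tvec.span_add)
      moreover have "(x + tvscale a x0) + tvscale (- a) x0 = x" by (simp add: tvec.scale_minus_left)
      ultimately show ?thesis by simp
    qed
    then show ?thesis using B x0(1) by (intro exI[of _ "insert x0 B"]) (auto simp: V'_def)
  qed
qed

lemma norm_complex_vec_le: "norm (x :: complex^'r::finite) \<le> (\<Sum>i\<in>UNIV. cmod (x $ i))"
  unfolding norm_vec_def by (rule L2_set_le_sum) simp

locale refinement =
  fixes P :: "real^'d::finite \<Rightarrow> complex^'r^'r::finite" and s :: real
  assumes P_trig: "\<And>i j. trig_poly (\<lambda>\<omega>. P \<omega> $ i $ j)"
    and R_sob: "\<And>\<Phi> i. \<Phi> \<in> refinable_space P \<Longrightarrow> \<Phi> $ i \<in> sobolev s"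
begin

lemma R_csupp: "\<Phi> \<in> refinable_space P \<Longrightarrow> compactly_supported (\<Phi> $ i)"
  and R_tempered: "\<Phi> \<in> refinable_space P \<Longrightarrow> \<Phi> $ i \<in> tempered"
  and R_refine: "\<Phi> \<in> refinable_space P \<Longrightarrow> vfourier \<Phi> (2 *\<^sub>R \<omega>) = P \<omega> *v vfourier \<Phi> \<omega>"
  unfolding refinable_space_def by auto

lemma R_fourier: "\<Phi> \<in> refinable_space P \<Longrightarrow> has_fourier (\<Phi> $ i) (tfourier (\<Phi> $ i))"
  using sobolevD(2)[OF R_sob] by blast

lemma R_cont1: "\<Phi> \<in> refinable_space P \<Longrightarrow> continuous_on UNIV (tfourier (\<Phi> $ i))"
  using csupp_fourier_representation[OF R_sob R_csupp] by metis

lemma R_cont: "\<Phi> \<in> refinable_space P \<Longrightarrow> continuous_on UNIV (vfourier \<Phi>)"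
proof -
  assume F: "\<Phi> \<in> refinable_space P"
  have "continuous_on UNIV (\<lambda>\<omega>. \<chi> i. tfourier (\<Phi> $ i) \<omega>)"
    by (intro continuous_on_vec_lambda R_cont1 F)
  then show ?thesis by (simp add: vfourier_def[abs_def])
qed

lemma R_combination:
  assumes x: "\<Phi> \<in> refinable_space P" and y: "\<Psi> \<in> refinable_space P"
  shows "vfourier (\<Phi> + tvscale a \<Psi>) \<omega> = vfourier \<Phi> \<omega> + a *s vfourier \<Psi> \<omega>"
    and "\<Phi> + tvscale a \<Psi> \<in> refinable_space P"
proof -
  have comp: "(\<Phi> + tvscale a \<Psi>) $ i = (\<lambda>\<phi>. (\<Phi> $ i) \<phi> + a * (\<Psi> $ i) \<phi>)" for i
    by (simp add: tvscale_def tscale_def plus_fun_def)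
  have hf: "has_fourier ((\<Phi> + tvscale a \<Psi>) $ i) (\<lambda>\<omega>. tfourier (\<Phi> $ i) \<omega> + a * tfourier (\<Psi> $ i) \<omega>)" for i
    unfolding comp by (intro has_fourier_add has_fourier_scale R_fourier x y)
  have "tfourier ((\<Phi> + tvscale a \<Psi>) $ i) = (\<lambda>\<omega>. tfourier (\<Phi> $ i) \<omega> + a * tfourier (\<Psi> $ i) \<omega>)" for i
    by (rule tfourier_eqI[OF hf]) (intro continuous_intros R_cont1 x y)
  then show vf: "vfourier (\<Phi> + tvscale a \<Psi>) \<omega> = vfourier \<Phi> \<omega> + a *s vfourier \<Psi> \<omega>" for \<omega>
    by (simp add: vfourier_def vec_eq_iff)
  show "\<Phi> + tvscale a \<Psi> \<in> refinable_space P"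
    unfolding refinable_space_def
  proof (intro CollectI conjI allI)
    show "(\<Phi> + tvscale a \<Psi>) $ i \<in> tempered" for i
      unfolding comp by (intro tempered_add tempered_scale R_tempered x y)
    show "compactly_supported ((\<Phi> + tvscale a \<Psi>) $ i)" for i
      unfolding comp by (intro csupp_add csupp_scale R_csupp x y)
    show "vfourier (\<Phi> + tvscale a \<Psi>) (2 *\<^sub>R \<omega>) = P \<omega> *v vfourier (\<Phi> + tvscale a \<Psi>) \<omega>" for \<omega>
      unfolding vf R_refine[OF x] R_refine[OF y]
      by (simp add: matrix_vector_right_distrib vector_scalar_commute)
  qed
qed

lemma R_zero: "0 \<in> refinable_space P"
proof -
  have z: "(0 :: ('d tdist)^'r) $ i = (\<lambda>\<phi>. 0)" for i by (simp add: zero_fun_def)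
  have "tfourier ((0 :: ('d tdist)^'r) $ i) = (\<lambda>\<omega>. 0)" for i unfolding z by (rule tfourier_eqI[OF has_fourier_zero]) simp
  then have "vfourier (0 :: ('d tdist)^'r) \<omega> = 0" for \<omega> by (simp add: vfourier_def vec_eq_iff)
  moreover have "(0 :: 'd tdist) \<in> tempered" "compactly_supported (0 :: 'd tdist)"
    using tempered_zero csupp_zero by (simp_all add: zero_fun_def)
  ultimately show ?thesis unfolding refinable_space_def by simp
qed

lemma R_subspace: "tvec.subspace (refinable_space P)"
proof (rule tvec.subspaceI[OF R_zero])
  show "x + y \<in> refinable_space P" if "x \<in> refinable_space P" "y \<in> refinable_space P" for x y
    using R_combination(2)[OF that, of 1] by simp
  show "tvscale a x \<in> refinable_space P" if "x \<in> refinable_space P" for a x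
    using R_combination(2)[OF R_zero that, of a] by simp
qed

lemma P_bounded: obtains M where "M \<ge> 0" "\<And>\<omega> x. norm (P \<omega> *v x) \<le> M * norm x"
proof -
  have "\<forall>i j. \<exists>B\<ge>0. \<forall>\<omega>. cmod (P \<omega> $ i $ j) \<le> B" using trig_poly_bounded[OF P_trig] by metis
  then obtain B where B: "\<And>i j. B i j \<ge> 0" "\<And>i j \<omega>. cmod (P \<omega> $ i $ j) \<le> B i j" by metis
  show thesis
  proof (rule that[of "\<Sum>i\<in>UNIV. \<Sum>j\<in>UNIV. B i j"])
    show "0 \<le> (\<Sum>i\<in>UNIV. \<Sum>j\<in>UNIV. B i j)" using B(1) by (intro sum_nonneg)
    fix \<omega> and x :: "complex^'r"
    have "norm (P \<omega> *v x) \<le> (\<Sum>i\<in>UNIV. cmod ((P \<omega> *v x) $ i))" by (rule norm_complex_vec_le)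
    also have "\<dots> \<le> (\<Sum>i\<in>UNIV. \<Sum>j\<in>UNIV. B i j * norm x)"
    proof (rule sum_mono)
      fix i
      have "cmod ((P \<omega> *v x) $ i) \<le> (\<Sum>j\<in>UNIV. cmod (P \<omega> $ i $ j * x $ j))"
        unfolding matrix_vector_mult_def by (simp add: norm_sum)
      also have "\<dots> \<le> (\<Sum>j\<in>UNIV. B i j * norm x)"
        unfolding norm_mult by (intro sum_mono mult_mono B Finite_Cartesian_Product.norm_nth_le) auto
      finally show "cmod ((P \<omega> *v x) $ i) \<le> (\<Sum>j\<in>UNIV. B i j * norm x)" .
    qed
    finally show "norm (P \<omega> *v x) \<le> (\<Sum>i\<in>UNIV. \<Sum>j\<in>UNIV. B i j) * norm x" by (simp add: sum_distrib_right)
  qed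
qed

text \<open>Iterating the refinement equation gives \<open>|F(\<omega>)| \<le> M\<^sup>n |F(\<omega>/2\<^sup>n)|\<close>, and a zero of order \<open>m\<close> at the origin bounds
the right-hand side by a multiple of \<open>(M/2\<^sup>m)\<^sup>n\<close>.\<close>

lemma R_flat_imp_zero:
  assumes x: "\<Phi> \<in> refinable_space P" and M: "M \<ge> 0" "\<And>\<omega> x. norm (P \<omega> *v x) \<le> M * norm x" "M < 2 ^ m"
    and fl: "\<And>\<omega>. norm \<omega> \<le> 1 \<Longrightarrow> norm (vfourier \<Phi> \<omega>) \<le> C * norm \<omega> ^ m"
  shows "\<Phi> = 0"
proof -
  have it: "norm (vfourier \<Phi> \<omega>) \<le> M ^ n * norm (vfourier \<Phi> ((1/2) ^ n *\<^sub>R \<omega>))" for n \<omega>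
  proof (induction n)
    case (Suc n)
    have "vfourier \<Phi> ((1/2) ^ n *\<^sub>R \<omega>) = P ((1/2) ^ Suc n *\<^sub>R \<omega>) *v vfourier \<Phi> ((1/2) ^ Suc n *\<^sub>R \<omega>)"
      using R_refine[OF x, of "(1/2) ^ Suc n *\<^sub>R \<omega>"] by simp
    then have "norm (vfourier \<Phi> ((1/2) ^ n *\<^sub>R \<omega>)) \<le> M * norm (vfourier \<Phi> ((1/2) ^ Suc n *\<^sub>R \<omega>))" using M(2) by simp
    then have "M ^ n * norm (vfourier \<Phi> ((1/2) ^ n *\<^sub>R \<omega>)) \<le> M ^ n * (M * norm (vfourier \<Phi> ((1/2) ^ Suc n *\<^sub>R \<omega>)))"
      using M(1) by (intro mult_left_mono) auto
    then show ?case using Suc by (simp add: mult_ac)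
  qed simp
  have "vfourier \<Phi> \<omega> = 0" for \<omega>
  proof -
    have h: "(\<lambda>n. (1/2::real) ^ n * norm \<omega>) \<longlonglongrightarrow> 0 * norm \<omega>" by (intro tendsto_intros LIMSEQ_realpow_zero) auto
    then have "\<forall>\<^sub>F n in sequentially. (1/2::real) ^ n * norm \<omega> < 1" by (intro order_tendstoD(2)[OF h]) simp
    then have ev: "\<forall>\<^sub>F n in sequentially. norm (vfourier \<Phi> \<omega>) \<le> C * norm \<omega> ^ m * (M / 2 ^ m) ^ n"
    proof eventually_elim
      case (elim n)
      have "norm (vfourier \<Phi> ((1/2) ^ n *\<^sub>R \<omega>)) \<le> C * norm ((1/2) ^ n *\<^sub>R \<omega>) ^ m" using elim by (intro fl) simp
      then have "M ^ n * norm (vfourier \<Phi> ((1/2) ^ n *\<^sub>R \<omega>)) \<le> M ^ n * (C * norm ((1/2) ^ n *\<^sub>R \<omega>) ^ m)"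
        using M(1) by (intro mult_left_mono) auto
      also have "\<dots> = C * norm \<omega> ^ m * (M / 2 ^ m) ^ n"
        by (simp add: power_mult_distrib power_divide power_mult[symmetric] mult.commute)
      finally show ?case using it[of \<omega> n] by linarith
    qed
    have "(\<lambda>n. C * norm \<omega> ^ m * (M / 2 ^ m) ^ n) \<longlonglongrightarrow> C * norm \<omega> ^ m * 0"
      using M by (intro tendsto_intros LIMSEQ_realpow_zero) auto
    then have "norm (vfourier \<Phi> \<omega>) \<le> C * norm \<omega> ^ m * 0" by (rule tendsto_lowerbound[OF _ ev]) simp
    then show ?thesis by simp
  qed
  then have "tfourier (\<Phi> $ i) = (\<lambda>\<omega>. 0)" for i by (auto simp: vfourier_def vec_eq_iff)
  then have "has_fourier (\<Phi> $ i) (\<lambda>\<omega>. 0)" for i using R_fourier[OF x, of i] by simp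
  then have "\<Phi> $ i = (\<lambda>\<phi>. 0)" for i by (rule tempered_eqI[OF R_tempered[OF x] tempered_zero _ has_fourier_zero])
  then show ?thesis by (simp add: vec_eq_iff zero_fun_def)
qed

text \<open>Elements are determined by their Taylor coefficients below an order \<open>m\<close> with \<open>sup |P| < 2\<^sup>m\<close>, so a basis
has at most as many members as there are coefficients.\<close>

theorem refinable_basis_exists: "\<exists>\<Phi>s. refinable_basis P \<Phi>s"
proof -
  obtain M where M: "M \<ge> 0" "\<And>\<omega> x. norm (P \<omega> *v x) \<le> M * norm x" by (rule P_bounded) blast
  obtain m0 where "M < 2 ^ m0" using real_arch_pow[of 2 M] by auto
  then have m: "M < 2 ^ Suc m0" using M(1) by simp
  let ?m = "Suc m0"
  let ?W = "{js::'d list. length js < ?m}"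
  define \<rho> where "\<rho> \<Phi> c \<longleftrightarrow> (\<exists>C. \<forall>\<omega> i. norm \<omega> \<le> 1 \<longrightarrow> cmod (vfourier \<Phi> \<omega> $ i - (\<Sum>js\<in>?W. word_weight \<omega> js / fact (length js) * c (i, js))) \<le> C * norm \<omega> ^ ?m)"
    for \<Phi> :: "('d tdist)^'r" and c :: "'r \<times> 'd list \<Rightarrow> complex"
  have "\<exists>B. finite B \<and> B \<subseteq> refinable_space P \<and> refinable_space P \<subseteq> tvec.span B"
  proof (rule finite_span_if_finitely_many_coefficients[where I="UNIV \<times> ?W" and \<rho>=\<rho>])
    show "finite (UNIV \<times> ?W :: ('r \<times> 'd list) set)" by (intro finite_cartesian_product finite_words(1) finite)
    show "\<exists>c. \<rho> \<Phi> c" if x: "\<Phi> \<in> refinable_space P" for \<Phi>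
    proof -
      have "\<forall>i. \<exists>c C. \<forall>\<omega>. norm \<omega> \<le> 1 \<longrightarrow> cmod (tfourier (\<Phi> $ i) \<omega> - (\<Sum>js\<in>?W. word_weight \<omega> js / fact (length js) * c js)) \<le> C * norm \<omega> ^ ?m"
        using csupp_taylor[OF R_sob[OF x] R_csupp[OF x], of ?m] by blast
      from choice[OF this] obtain c where "\<forall>i. \<exists>C. \<forall>\<omega>. norm \<omega> \<le> 1 \<longrightarrow> cmod (tfourier (\<Phi> $ i) \<omega> - (\<Sum>js\<in>?W. word_weight \<omega> js / fact (length js) * c i js)) \<le> C * norm \<omega> ^ ?m" ..
      from choice[OF this] obtain C where C: "\<forall>i \<omega>. norm \<omega> \<le> 1 \<longrightarrow> cmod (tfourier (\<Phi> $ i) \<omega> - (\<Sum>js\<in>?W. word_weight \<omega> js / fact (length js) * c i js)) \<le> C i * norm \<omega> ^ ?m" ..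
      have "cmod (vfourier \<Phi> \<omega> $ i - (\<Sum>js\<in>?W. word_weight \<omega> js / fact (length js) * (case (i, js) of (i, js) \<Rightarrow> c i js))) \<le> (\<Sum>i\<in>UNIV. \<bar>C i\<bar>) * norm \<omega> ^ ?m"
        if w: "norm \<omega> \<le> 1" for \<omega> i
      proof -
        have "cmod (vfourier \<Phi> \<omega> $ i - (\<Sum>js\<in>?W. word_weight \<omega> js / fact (length js) * c i js)) \<le> C i * norm \<omega> ^ ?m"
          using C w by (simp add: vfourier_def)
        also have "\<dots> \<le> (\<Sum>i\<in>UNIV. \<bar>C i\<bar>) * norm \<omega> ^ ?m"
        proof (rule mult_right_mono)
          have "C i \<le> \<bar>C i\<bar>" by simp
          also have "\<dots> \<le> (\<Sum>i\<in>UNIV. \<bar>C i\<bar>)" by (intro member_le_sum) auto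
          finally show "C i \<le> (\<Sum>i\<in>UNIV. \<bar>C i\<bar>)" .
        qed simp
        finally show ?thesis by simp
      qed
      then show ?thesis unfolding \<rho>_def by blast
    qed
    show "\<rho> (\<Phi> + tvscale a \<Psi>) (\<lambda>p. c p + a * d p)"
      if x: "\<Phi> \<in> refinable_space P" and y: "\<Psi> \<in> refinable_space P" and c: "\<rho> \<Phi> c" and d: "\<rho> \<Psi> d" for \<Phi> \<Psi> c d a
    proof -
      obtain C where C: "\<And>\<omega> i. norm \<omega> \<le> 1 \<Longrightarrow> cmod (vfourier \<Phi> \<omega> $ i - (\<Sum>js\<in>?W. word_weight \<omega> js / fact (length js) * c (i, js))) \<le> C * norm \<omega> ^ ?m"
        using c unfolding \<rho>_def by blast
      obtain D where D: "\<And>\<omega> i. norm \<omega> \<le> 1 \<Longrightarrow> cmod (vfourier \<Psi> \<omega> $ i - (\<Sum>js\<in>?W. word_weight \<omega> js / fact (length js) * d (i, js))) \<le> D * norm \<omega> ^ ?m"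
        using d unfolding \<rho>_def by blast
      have "cmod (vfourier (\<Phi> + tvscale a \<Psi>) \<omega> $ i - (\<Sum>js\<in>?W. word_weight \<omega> js / fact (length js) * (c (i, js) + a * d (i, js)))) \<le> (C + cmod a * D) * norm \<omega> ^ ?m"
        if w: "norm \<omega> \<le> 1" for \<omega> i
      proof -
        let ?U = "vfourier \<Phi> \<omega> $ i - (\<Sum>js\<in>?W. word_weight \<omega> js / fact (length js) * c (i, js))"
        let ?V = "vfourier \<Psi> \<omega> $ i - (\<Sum>js\<in>?W. word_weight \<omega> js / fact (length js) * d (i, js))"
        have "vfourier (\<Phi> + tvscale a \<Psi>) \<omega> $ i - (\<Sum>js\<in>?W. word_weight \<omega> js / fact (length js) * (c (i, js) + a * d (i, js))) = ?U + a * ?V"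
          unfolding R_combination(1)[OF x y]
          by (simp add: distrib_left sum.distrib right_diff_distrib sum_distrib_left mult_ac)
        also have "cmod \<dots> \<le> C * norm \<omega> ^ ?m + cmod a * (D * norm \<omega> ^ ?m)"
          by (rule order_trans[OF norm_triangle_ineq]) (unfold norm_mult, intro add_mono mult_left_mono C[OF w] D[OF w], simp)
        finally show ?thesis by (simp add: distrib_right mult.assoc)
      qed
      then show ?thesis unfolding \<rho>_def by blast
    qed
    show "\<Phi> = 0" if x: "\<Phi> \<in> refinable_space P" and c: "\<rho> \<Phi> c" and z: "\<And>p. p \<in> UNIV \<times> ?W \<Longrightarrow> c p = 0" for \<Phi> c
    proof -
      obtain C where C: "\<And>\<omega> i. norm \<omega> \<le> 1 \<Longrightarrow> cmod (vfourier \<Phi> \<omega> $ i - (\<Sum>js\<in>?W. word_weight \<omega> js / fact (length js) * c (i, js))) \<le> C * norm \<omega> ^ ?m"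
        using c unfolding \<rho>_def by blast
      have "norm (vfourier \<Phi> \<omega>) \<le> (real CARD('r) * C) * norm \<omega> ^ ?m" if w: "norm \<omega> \<le> 1" for \<omega>
      proof -
        have "(\<Sum>js\<in>?W. word_weight \<omega> js / fact (length js) * c (i, js)) = 0" for i
          using z by (intro sum.neutral) simp
        then have "cmod (vfourier \<Phi> \<omega> $ i) \<le> C * norm \<omega> ^ ?m" for i using C[OF w, of i] by simp
        then have "(\<Sum>i\<in>UNIV. cmod (vfourier \<Phi> \<omega> $ i)) \<le> (\<Sum>i\<in>(UNIV::'r set). C * norm \<omega> ^ ?m)" by (intro sum_mono) simp
        then show ?thesis using norm_complex_vec_le[of "vfourier \<Phi> \<omega>"] by simp
      qed
      then show ?thesis by (rule R_flat_imp_zero[OF x M m])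
    qed
  qed (rule R_subspace)
  then obtain B0 where B0: "finite B0" "refinable_space P \<subseteq> tvec.span B0" by blast
  obtain B where B: "B \<subseteq> refinable_space P" "tvec.independent B" "refinable_space P \<subseteq> tvec.span B"
    by (rule tvec.maximal_independent_subset)
  have "finite B" using tvec.independent_span_bound[OF B0(1) B(2)] B(1) B0(2) by blast
  then obtain \<Phi>s where \<Phi>s: "set \<Phi>s = B" "distinct \<Phi>s" using finite_distinct_list by blast
  have "tvec.span B = refinable_space P" using B(3) tvec.span_minimal[OF B(1) R_subspace] by blast
  then show ?thesis unfolding refinable_basis_def using \<Phi>s B(2) by blast
qed

end

section \<open>Gramian forms\<close>

lemma norm_sq_complex_vec: "(norm (x :: complex^'r::finite))\<^sup>2 = (\<Sum>i\<in>UNIV. (cmod (x $ i))\<^sup>2)"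
  unfolding norm_vec_def L2_set_def by (rule real_sqrt_pow2) (auto intro: sum_nonneg)

lemma bounded_linear_herm_form: "bounded_linear (\<lambda>G. herm_form G (x :: complex^'r::finite))"
proof (subst linear_conv_bounded_linear[symmetric], rule linearI)
  show "herm_form (G + H) x = herm_form G x + herm_form H x" for G H
    by (simp add: herm_form_def adj_prod_def matrix_vector_mult_def distrib_left distrib_right sum.distrib)
  have e: "adj_prod x ((c *\<^sub>R G) *v x) = of_real c * adj_prod x (G *v x)" for c G
    by (simp add: adj_prod_def matrix_vector_mult_def sum_distrib_left scaleR_conv_of_real[where 'a=complex] mult_ac)
  show "herm_form (c *\<^sub>R G) x = c *\<^sub>R herm_form G x" for c G
    unfolding herm_form_def e by simp
qed

text \<open>This turns the Gramian form into a sum of squares.\<close>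

lemma herm_form_outer: "herm_form (\<chi> i j. y $ i * cnj (y $ j)) x = (cmod (adj_prod x y))\<^sup>2"
proof -
  have "adj_prod x ((\<chi> i j. y $ i * cnj (y $ j)) *v x) = (\<Sum>i\<in>UNIV. \<Sum>j\<in>UNIV. (cnj (x $ i) * y $ i) * (x $ j * cnj (y $ j)))"
    by (simp add: adj_prod_def matrix_vector_mult_def sum_distrib_left mult_ac)
  also have "\<dots> = adj_prod x y * cnj (adj_prod x y)"
    by (simp add: adj_prod_def sum_product)
  finally show ?thesis unfolding herm_form_def by (simp only: complex_norm_square[symmetric] Re_complex_of_real)
qed

lemma norm_outer: "norm (\<chi> i j. y $ i * cnj (y $ j)) = (norm (y :: complex^'r::finite))\<^sup>2"
proof -
  have "norm (\<chi> j. y $ i * cnj (y $ j)) = norm y * cmod (y $ i)" for i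
  proof -
    have "norm (\<chi> j. y $ i * cnj (y $ j)) = L2_set (\<lambda>j. cmod (y $ i) * cmod (y $ j)) UNIV"
      unfolding norm_vec_def by (simp add: norm_mult)
    also have "\<dots> = cmod (y $ i) * L2_set (\<lambda>j. cmod (y $ j)) UNIV"
      by (rule L2_set_right_distrib[symmetric]) simp
    finally show ?thesis by (simp only: norm_vec_def[of y] mult.commute)
  qed
  then have "norm (\<chi> i j. y $ i * cnj (y $ j)) = L2_set (\<lambda>i. norm y * cmod (y $ i)) UNIV"
    by (simp add: norm_vec_def[where x="\<chi> i j. y $ i * cnj (y $ j)"])
  also have "\<dots> = norm y * L2_set (\<lambda>i. cmod (y $ i)) UNIV" by (simp add: L2_set_right_distrib)
  finally show ?thesis by (simp add: norm_vec_def[symmetric] power2_eq_square)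
qed

lemma infsum_eq_nn_integral:
  fixes f :: "'a \<Rightarrow> real"
  assumes "f summable_on A" "\<And>x. f x \<ge> 0"
  shows "infsum f A = enn2real (\<integral>\<^sup>+x. ennreal (f x) \<partial>count_space A)" "infsum f A \<ge> 0"
proof -
  have "Infinite_Sum.abs_summable_on f A" using assms by (simp add: abs_of_nonneg)
  then have a: "Infinite_Set_Sum.abs_summable_on f A" by (simp only: abs_summable_equivalent)
  show nn: "infsum f A \<ge> 0" using assms(2) by (rule infsum_nonneg)
  have "(\<integral>\<^sup>+x. ennreal (f x) \<partial>count_space A) = ennreal (infsum f A)"
    using nn_integral_conv_infsetsum[OF a] assms(2) infsetsum_infsum[OF a] by simp
  then show "infsum f A = enn2real (\<integral>\<^sup>+x. ennreal (f x) \<partial>count_space A)" using nn by simp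
qed

lemma continuous_herm_form: "continuous_on UNIV (\<lambda>x. herm_form G (x :: complex^'r::finite))"
  unfolding herm_form_def adj_prod_def matrix_vector_mult_def
  by (simp, intro continuous_intros)

text \<open>The set of all \<open>x\<close> with denominator nonzero and quotient below a given bound is open, so it meets a dense set.  On the
dense set a vanishing denominator receives the value \<open>top\<close>, which is neutral for the
infimum.  A countable dense set makes the infimum measurable in parameters.\<close>

lemma INF_quotient_dense:
  fixes f g :: "'a::topological_space \<Rightarrow> real"
  assumes f: "continuous_on UNIV f" and g: "continuous_on UNIV g"
    and D: "\<And>U. open U \<Longrightarrow> U \<noteq> {} \<Longrightarrow> \<exists>d\<in>D. d \<in> U"
  shows "(INF x\<in>{x. f x \<noteq> 0}. ennreal (g x / f x)) = (INF x\<in>D. if f x = 0 then top else ennreal (g x / f x))"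
proof (rule antisym)
  show "(INF x\<in>{x. f x \<noteq> 0}. ennreal (g x / f x)) \<le> (INF x\<in>D. if f x = 0 then top else ennreal (g x / f x))"
    by (rule INF_greatest) (auto intro: INF_lower)
  show "(INF x\<in>D. if f x = 0 then top else ennreal (g x / f x)) \<le> (INF x\<in>{x. f x \<noteq> 0}. ennreal (g x / f x))"
  proof (rule INF_greatest, rule dense_ge)
    fix x c assume x: "x \<in> {x. f x \<noteq> 0}" and c: "ennreal (g x / f x) < c"
    have o: "open {x. f x \<noteq> 0}" by (intro open_Collect_neq f continuous_on_const)
    have "continuous_on {x. f x \<noteq> 0} (\<lambda>x. ennreal (g x / f x))"
      by (rule continuous_on_ennreal, rule continuous_on_divide[OF continuous_on_subset[OF g] continuous_on_subset[OF f]]) auto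
    from continuous_open_preimage[OF this o open_lessThan, of c]
    have "open ({x. f x \<noteq> 0} \<inter> (\<lambda>x. ennreal (g x / f x)) -` {..<c})" .
    moreover have "x \<in> {x. f x \<noteq> 0} \<inter> (\<lambda>x. ennreal (g x / f x)) -` {..<c}" using x c by simp
    ultimately obtain d where d: "d \<in> D" "d \<in> {x. f x \<noteq> 0} \<inter> (\<lambda>x. ennreal (g x / f x)) -` {..<c}" using D by blast
    have "(INF x\<in>D. if f x = 0 then top else ennreal (g x / f x)) \<le> (if f d = 0 then top else ennreal (g d / f d))"
      by (rule INF_lower[OF d(1)])
    also have "\<dots> \<le> c" using d(2) by (auto simp: less_imp_le)
    finally show "(INF x\<in>D. if f x = 0 then top else ennreal (g x / f x)) \<le> c" .
  qed
qed

context refinement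
begin

lemma R_bracket:
  assumes x: "\<Phi> \<in> refinable_space P" and c: "c > 0"
  obtains B where "B \<ge> 0" "\<And>S x. finite S \<Longrightarrow> S \<subseteq> lattice c \<Longrightarrow>
    (\<Sum>\<beta>\<in>S. (1 + norm (x + \<beta>)) powr (2 * s) * (norm (vfourier \<Phi> (x + \<beta>)))\<^sup>2) \<le> B"
proof -
  have "\<forall>i. \<exists>B\<ge>0. \<forall>S x. finite S \<longrightarrow> S \<subseteq> lattice c \<longrightarrow> (\<Sum>\<beta>\<in>S. (1 + norm (x + \<beta>)) powr (2 * s) * (cmod (tfourier (\<Phi> $ i) (x + \<beta>)))\<^sup>2) \<le> B"
  proof
    fix i
    obtain B where "B \<ge> 0" "\<And>S x. finite S \<Longrightarrow> S \<subseteq> lattice c \<Longrightarrow> (\<Sum>\<beta>\<in>S. (1 + norm (x + \<beta>)) powr (2 * s) * (cmod (tfourier (\<Phi> $ i) (x + \<beta>)))\<^sup>2) \<le> B"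
      by (rule bracket_bound[OF R_sob[OF x, of i] R_csupp[OF x, of i] c]) (rule that)
    then show "\<exists>B\<ge>0. \<forall>S x. finite S \<longrightarrow> S \<subseteq> lattice c \<longrightarrow> (\<Sum>\<beta>\<in>S. (1 + norm (x + \<beta>)) powr (2 * s) * (cmod (tfourier (\<Phi> $ i) (x + \<beta>)))\<^sup>2) \<le> B"
      by (intro exI[of _ B] conjI allI impI)
  qed
  from choice[OF this] obtain B where B': "\<forall>i. B i \<ge> 0 \<and> (\<forall>S x. finite S \<longrightarrow> S \<subseteq> lattice c \<longrightarrow> (\<Sum>\<beta>\<in>S. (1 + norm (x + \<beta>)) powr (2 * s) * (cmod (tfourier (\<Phi> $ i) (x + \<beta>)))\<^sup>2) \<le> B i)" by (rule exE)
  note B = B'[THEN spec, THEN conjunct1] B'[THEN spec, THEN conjunct2, rule_format]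
  show thesis
  proof (rule that[of "\<Sum>i\<in>UNIV. B i"])
    show "0 \<le> (\<Sum>i\<in>UNIV. B i)" using B(1) by (intro sum_nonneg)
    fix S :: "(real^'d) set" and x :: "real^'d" assume S: "finite S" "S \<subseteq> lattice c"
    have "(\<Sum>\<beta>\<in>S. (1 + norm (x + \<beta>)) powr (2 * s) * (norm (vfourier \<Phi> (x + \<beta>)))\<^sup>2)
      = (\<Sum>\<beta>\<in>S. \<Sum>i\<in>UNIV. (1 + norm (x + \<beta>)) powr (2 * s) * (cmod (tfourier (\<Phi> $ i) (x + \<beta>)))\<^sup>2)"
      by (simp add: norm_sq_complex_vec vfourier_def sum_distrib_left)
    also have "\<dots> = (\<Sum>i\<in>UNIV. \<Sum>\<beta>\<in>S. (1 + norm (x + \<beta>)) powr (2 * s) * (cmod (tfourier (\<Phi> $ i) (x + \<beta>)))\<^sup>2)" by (rule sum.swap)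
    also have "\<dots> \<le> (\<Sum>i\<in>UNIV. B i)" by (intro sum_mono B S)
    finally show "(\<Sum>\<beta>\<in>S. (1 + norm (x + \<beta>)) powr (2 * s) * (norm (vfourier \<Phi> (x + \<beta>)))\<^sup>2) \<le> (\<Sum>i\<in>UNIV. B i)" .
  qed
qed

text \<open>For \<open>\<alpha> \<noteq> 0\<close> the numbers \<open>|\<omega> + \<alpha>|\<close> and \<open>1 + |\<omega> + \<alpha>|\<close> are comparable, and the term with \<open>\<alpha> = 0\<close> is a
single number.\<close>

lemma R_weighted_summable:
  assumes x: "\<Phi> \<in> refinable_space P" and w: "norm \<omega> < 1" and A: "A \<subseteq> lattice (2 * pi)"
  shows "(\<lambda>\<alpha>. norm (\<omega> + \<alpha>) powr (2 * s) * (norm (vfourier \<Phi> (\<omega> + \<alpha>)))\<^sup>2) summable_on A" (is "?f summable_on A")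
proof (rule nonneg_bdd_above_summable_on)
  obtain B where B: "B \<ge> 0" "\<And>S x. finite S \<Longrightarrow> S \<subseteq> lattice (2 * pi) \<Longrightarrow>
    (\<Sum>\<beta>\<in>S. (1 + norm (x + \<beta>)) powr (2 * s) * (norm (vfourier \<Phi> (x + \<beta>)))\<^sup>2) \<le> B"
    using R_bracket[OF x, of "2 * pi"] by auto
  let ?c = "(1/2) powr (2 * s) + 1 powr (2 * s)"
  have "sum ?f S \<le> ?f 0 + ?c * B" if S: "S \<subseteq> A" "finite S" for S
  proof -
    have "sum ?f S \<le> sum ?f (insert 0 (S - {0}))" using S by (intro sum_mono2) auto
    also have "\<dots> = ?f 0 + sum ?f (S - {0})" using S by (subst sum.insert) auto
    also have "sum ?f (S - {0}) \<le> (\<Sum>\<alpha>\<in>S - {0}. ?c * ((1 + norm (\<omega> + \<alpha>)) powr (2 * s) * (norm (vfourier \<Phi> (\<omega> + \<alpha>)))\<^sup>2))"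
    proof (rule sum_mono)
      fix \<alpha> assume "\<alpha> \<in> S - {0}"
      then have "norm \<alpha> \<ge> 2 * pi" using lattice_norm_ge[of "2 * pi" \<alpha>] S A by auto
      then have ny: "norm (\<omega> + \<alpha>) \<ge> 1" using norm_triangle_ineq4[of "\<omega> + \<alpha>" \<omega>] w pi_gt3 by simp
      have "norm (\<omega> + \<alpha>) powr (2 * s) \<le> ?c * (1 + norm (\<omega> + \<alpha>)) powr (2 * s)"
        by (rule powr_comparable) (use ny in auto)
      then have "norm (\<omega> + \<alpha>) powr (2 * s) * (norm (vfourier \<Phi> (\<omega> + \<alpha>)))\<^sup>2 \<le> ?c * (1 + norm (\<omega> + \<alpha>)) powr (2 * s) * (norm (vfourier \<Phi> (\<omega> + \<alpha>)))\<^sup>2"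
        by (rule mult_right_mono) simp
      then show "?f \<alpha> \<le> ?c * ((1 + norm (\<omega> + \<alpha>)) powr (2 * s) * (norm (vfourier \<Phi> (\<omega> + \<alpha>)))\<^sup>2)" by (simp only: mult.assoc)
    qed
    also have "\<dots> \<le> ?c * B"
      unfolding sum_distrib_left[symmetric] by (intro mult_left_mono B(2)) (use S A in auto)
    finally show ?thesis by simp
  qed
  then show "bdd_above (sum ?f ` {F. F \<subseteq> A \<and> finite F})" by (intro bdd_aboveI2[where M="?f 0 + ?c * B"]) auto
qed simp

lemma R_form_summable:
  assumes x: "\<Phi> \<in> refinable_space P" and w: "norm \<omega> < 1" and A: "A \<subseteq> lattice (2 * pi)"
  shows "(\<lambda>\<alpha>. norm (\<omega> + \<alpha>) powr (2 * s) * (cmod (adj_prod y (vfourier \<Phi> (\<omega> + \<alpha>))))\<^sup>2) summable_on A"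
proof (rule summable_on_comparison_test[OF summable_on_cmult_right[OF R_weighted_summable[OF x w A], of "(norm y)\<^sup>2"]])
  fix \<alpha>
  have "(cmod (adj_prod y (vfourier \<Phi> (\<omega> + \<alpha>))))\<^sup>2 \<le> (norm y * norm (vfourier \<Phi> (\<omega> + \<alpha>)))\<^sup>2"
    by (intro power_mono adj_prod_bound) auto
  then have "norm (\<omega> + \<alpha>) powr (2 * s) * (cmod (adj_prod y (vfourier \<Phi> (\<omega> + \<alpha>))))\<^sup>2 \<le> norm (\<omega> + \<alpha>) powr (2 * s) * (norm y * norm (vfourier \<Phi> (\<omega> + \<alpha>)))\<^sup>2"
    by (rule mult_left_mono) simp
  then show "norm (\<omega> + \<alpha>) powr (2 * s) * (cmod (adj_prod y (vfourier \<Phi> (\<omega> + \<alpha>))))\<^sup>2 \<le> (norm y)\<^sup>2 * (norm (\<omega> + \<alpha>) powr (2 * s) * (norm (vfourier \<Phi> (\<omega> + \<alpha>)))\<^sup>2)"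
    by (simp only: power_mult_distrib mult_ac)
qed simp

lemma herm_form_gramian:
  assumes \<Phi>s: "set \<Phi>s \<subseteq> refinable_space P" and w: "norm \<omega> < 1" and A: "A \<subseteq> lattice (2 * pi)"
  shows "herm_form (gramian_over A s \<Phi>s \<omega>) y =
    (\<Sum>\<Phi>\<leftarrow>\<Phi>s. \<Sum>\<^sub>\<infinity>\<alpha>\<in>A. norm (\<omega> + \<alpha>) powr (2 * s) * (cmod (adj_prod y (vfourier \<Phi> (\<omega> + \<alpha>))))\<^sup>2)"
  using \<Phi>s
proof (induction \<Phi>s)
  case Nil
  show ?case by (simp add: gramian_over_def linear_0[OF bounded_linear.linear[OF bounded_linear_herm_form]])
next
  case (Cons \<Phi> \<Phi>s)
  then have x: "\<Phi> \<in> refinable_space P" by simp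
  let ?M = "\<lambda>\<alpha>. norm (\<omega> + \<alpha>) powr (2 * s) *\<^sub>R (\<chi> i j. vfourier \<Phi> (\<omega> + \<alpha>) $ i * cnj (vfourier \<Phi> (\<omega> + \<alpha>) $ j))"
  have "(\<lambda>\<alpha>. norm (?M \<alpha>)) summable_on A"
    using R_weighted_summable[OF x w A] by (simp only: norm_scaleR norm_outer) simp
  then have s: "?M summable_on A" by (rule abs_summable_summable)
  have "herm_form (infsum ?M A) y = (\<Sum>\<^sub>\<infinity>\<alpha>\<in>A. herm_form (?M \<alpha>) y)"
    by (rule infsumI[OF has_sum_bounded_linear[OF bounded_linear_herm_form has_sum_infsum[OF s]], symmetric])
  also have "(\<lambda>\<alpha>. herm_form (?M \<alpha>) y) = (\<lambda>\<alpha>. norm (\<omega> + \<alpha>) powr (2 * s) * (cmod (adj_prod y (vfourier \<Phi> (\<omega> + \<alpha>))))\<^sup>2)"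
    by (simp only: linear_cmul[OF bounded_linear.linear[OF bounded_linear_herm_form]] herm_form_outer real_scaleR_def)
  finally have 1: "herm_form (infsum ?M A) y = (\<Sum>\<^sub>\<infinity>\<alpha>\<in>A. norm (\<omega> + \<alpha>) powr (2 * s) * (cmod (adj_prod y (vfourier \<Phi> (\<omega> + \<alpha>))))\<^sup>2)" .
  have "gramian_over A s (\<Phi> # \<Phi>s) \<omega> = infsum ?M A + gramian_over A s \<Phi>s \<omega>" by (simp add: gramian_over_def)
  then show ?case using Cons 1 by (simp add: linear_add[OF bounded_linear.linear[OF bounded_linear_herm_form]])
qed

lemma measurable_gramian_form:
  assumes \<Phi>s: "set \<Phi>s \<subseteq> refinable_space P" and A: "A \<subseteq> lattice (2 * pi)"
  obtains q where "q \<in> borel_measurable borel" "\<And>\<omega>. norm \<omega> < 1 \<Longrightarrow> herm_form (gramian_over A s \<Phi>s \<omega>) y = q \<omega>"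
proof -
  let ?f = "\<lambda>\<Phi> \<omega> \<alpha>. norm (\<omega> + \<alpha>) powr (2 * s) * (cmod (adj_prod y (vfourier \<Phi> (\<omega> + \<alpha>))))\<^sup>2"
  let ?q = "\<lambda>\<Phi> \<omega>. enn2real (\<integral>\<^sup>+\<alpha>. ennreal (?f \<Phi> \<omega> \<alpha>) \<partial>count_space A)"
  have m: "?q \<Phi> \<in> borel_measurable borel" if x: "\<Phi> \<in> refinable_space P" for \<Phi>
  proof -
    have "continuous_on UNIV (\<lambda>\<omega>. adj_prod y (vfourier \<Phi> (\<omega> + \<alpha>)))" for \<alpha>
      unfolding adj_prod_def vfourier_def by (simp, intro continuous_intros continuous_on_compose2[OF R_cont1[OF x]]) auto
    then have [measurable]: "(\<lambda>\<omega>. adj_prod y (vfourier \<Phi> (\<omega> + \<alpha>))) \<in> borel_measurable borel" for \<alpha>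
      by (rule borel_measurable_continuous_onI)
    have "(\<lambda>\<omega>. \<integral>\<^sup>+\<alpha>. ennreal (?f \<Phi> \<omega> \<alpha>) \<partial>count_space A) \<in> borel_measurable borel"
      by (rule measurable_nn_integral_count_space[OF countable_subset[OF A countable_lattice]]) measurable
    then show ?thesis by simp
  qed
  show thesis
  proof (rule that[of "\<lambda>\<omega>. \<Sum>\<Phi>\<leftarrow>\<Phi>s. ?q \<Phi> \<omega>"])
    show "(\<lambda>\<omega>. \<Sum>\<Phi>\<leftarrow>\<Phi>s. ?q \<Phi> \<omega>) \<in> borel_measurable borel"
      using \<Phi>s
    proof (induction \<Phi>s)
      case (Cons \<Phi> \<Phi>s)
      then have "?q \<Phi> \<in> borel_measurable borel" "(\<lambda>\<omega>. \<Sum>\<Phi>\<leftarrow>\<Phi>s. ?q \<Phi> \<omega>) \<in> borel_measurable borel" using m by auto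
      from borel_measurable_add[OF this] show ?case by (simp only: list.map sum_list.Cons)
    qed simp
    fix \<omega> :: "real^'d" assume w: "norm \<omega> < 1"
    show "herm_form (gramian_over A s \<Phi>s \<omega>) y = (\<Sum>\<Phi>\<leftarrow>\<Phi>s. ?q \<Phi> \<omega>)"
      unfolding herm_form_gramian[OF \<Phi>s w A] using \<Phi>s
      by (intro arg_cong[where f=sum_list] map_cong refl infsum_eq_nn_integral R_form_summable w A) auto
  qed
qed

lemma coherent_quotient_measurable:
  assumes \<Phi>s: "set \<Phi>s \<subseteq> refinable_space P" and r: "r \<le> 1"
  shows "coherent_quotient s k \<Phi>s \<in> borel_measurable (restrict_space lebesgue (ball 0 r))"
proof -
  obtain D :: "(complex^'r) set" where D: "countable D" "\<And>U. open U \<Longrightarrow> U \<noteq> {} \<Longrightarrow> \<exists>d\<in>D. d \<in> U"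
    using countable_dense_exists by blast
  have sub: "two_pi_lattice \<subseteq> lattice (2 * pi)" "two_pi_lattice - {0} \<subseteq> lattice (2 * pi)" by (auto simp: two_pi_lattice_eq)
  have "\<forall>y. \<exists>q. q \<in> borel_measurable borel \<and> (\<forall>\<omega>. norm \<omega> < 1 \<longrightarrow> herm_form (gramian s \<Phi>s \<omega>) y = q \<omega>)"
    using measurable_gramian_form[OF \<Phi>s sub(1)] by metis
  from choice[OF this] obtain q1 where q1: "\<And>y. q1 y \<in> borel_measurable borel" "\<And>y \<omega>. norm \<omega> < 1 \<Longrightarrow> herm_form (gramian s \<Phi>s \<omega>) y = q1 y \<omega>" by blast
  have "\<forall>y. \<exists>q. q \<in> borel_measurable borel \<and> (\<forall>\<omega>. norm \<omega> < 1 \<longrightarrow> herm_form (gramian0 s \<Phi>s \<omega>) y = q \<omega>)"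
    using measurable_gramian_form[OF \<Phi>s sub(2)] by metis
  from choice[OF this] obtain q0 where q0: "\<And>y. q0 y \<in> borel_measurable borel" "\<And>y \<omega>. norm \<omega> < 1 \<Longrightarrow> herm_form (gramian0 s \<Phi>s \<omega>) y = q0 y \<omega>" by blast
  note [measurable] = q1(1) q0(1)
  let ?Q = "\<lambda>\<omega>. ennreal (norm \<omega> powr (- (2 * k - 2 * s))) * (INF y\<in>D. if q1 y \<omega> = 0 then top else ennreal (q0 y \<omega> / q1 y \<omega>))"
  have "(\<lambda>\<omega>. INF y\<in>D. if q1 y \<omega> = 0 then top else ennreal (q0 y \<omega> / q1 y \<omega>)) \<in> borel_measurable (borel :: (real^'d) measure)"
    by (rule borel_measurable_INF[OF D(1)]) measurable
  then have "?Q \<in> borel_measurable (lborel :: (real^'d) measure)" by simp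
  then have m: "?Q \<in> borel_measurable (restrict_space lebesgue (ball 0 r))"
    by (intro measurable_restrict_space1 measurable_completion)
  show ?thesis
  proof (subst measurable_cong[where g="?Q"])
    fix \<omega> :: "real^'d" assume "\<omega> \<in> space (restrict_space lebesgue (ball 0 r))"
    then have w: "norm \<omega> < 1" using r by (simp add: space_restrict_space)
    have c1: "continuous_on UNIV (\<lambda>y. q1 y \<omega>)" and c0: "continuous_on UNIV (\<lambda>y. q0 y \<omega>)"
      using continuous_herm_form unfolding q1(2)[OF w, symmetric] q0(2)[OF w, symmetric] by blast+
    show "coherent_quotient s k \<Phi>s \<omega> = ?Q \<omega>"
      unfolding coherent_quotient_def
      unfolding q1(2)[OF w] q0(2)[OF w] by (subst INF_quotient_dense[OF c1 c0 D(2)]) (assumption | rule refl)+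
  qed (rule m)
qed

end

section \<open>The supervector and its superfunctions\<close>

locale super_refinement = refinement +
  fixes v :: "real^'d::finite \<Rightarrow> complex^'r::finite" and k :: real
  assumes v_trig: "\<And>i. trig_poly (\<lambda>\<omega>. v \<omega> $ i)" and k_pos: "k > 0" and cond_Z: "condition_Z k P v"
begin

abbreviation super :: "('d tdist)^'r \<Rightarrow> real^'d \<Rightarrow> complex" where
  "super \<Phi> \<equiv> symbol v (vfourier \<Phi>)"

lemma super_eq: "super \<Phi> = (\<lambda>\<omega>. \<Sum>i\<in>UNIV. cnj (v \<omega> $ i) * tfourier (\<Phi> $ i) \<omega>)"
  by (simp add: symbol_def[abs_def] adj_prod_def vfourier_def)

lemma v_cont: "continuous_on UNIV v"
proof -
  have "continuous_on UNIV (\<lambda>\<omega>. \<chi> i. v \<omega> $ i)" by (intro continuous_on_vec_lambda trig_poly_cont v_trig)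
  then show ?thesis by simp
qed

lemma v_periodic: "\<alpha> \<in> lattice (2 * pi) \<Longrightarrow> v (\<omega> + \<alpha>) = v \<omega>"
  using trig_poly_periodic[OF v_trig] by (simp add: vec_eq_iff)

lemma v_bounded: obtains V where "V > 0" "\<And>\<omega>. norm (v \<omega>) \<le> V"
proof -
  have "\<forall>i. \<exists>B\<ge>0. \<forall>\<omega>. cmod (v \<omega> $ i) \<le> B"
  proof
    fix i
    obtain B where "B \<ge> 0" "\<And>\<omega>. cmod (v \<omega> $ i) \<le> B" by (rule trig_poly_bounded[OF v_trig[of i]]) (rule that)
    then show "\<exists>B\<ge>0. \<forall>\<omega>. cmod (v \<omega> $ i) \<le> B" by (intro exI[of _ B] conjI allI)
  qed
  from choice[OF this] obtain B where B: "\<And>i. B i \<ge> 0" "\<And>i \<omega>. cmod (v \<omega> $ i) \<le> B i" by blast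
  show thesis
  proof (rule that[of "(\<Sum>i\<in>UNIV. B i) + 1"])
    show "0 < (\<Sum>i\<in>UNIV. B i) + 1" using B(1) by (intro add_nonneg_pos sum_nonneg) auto
    show "norm (v \<omega>) \<le> (\<Sum>i\<in>UNIV. B i) + 1" for \<omega>
    proof -
      have "(\<Sum>i\<in>UNIV. cmod (v \<omega> $ i)) \<le> (\<Sum>i\<in>UNIV. B i)" by (rule sum_mono[OF B(2)])
      then show ?thesis using norm_complex_vec_le[of "v \<omega>"] by linarith
    qed
  qed
qed

lemma super_cont: "\<Phi> \<in> refinable_space P \<Longrightarrow> continuous_on UNIV (super \<Phi>)"
  unfolding super_eq by (intro continuous_intros R_cont1 trig_poly_cont v_trig)

lemma super_distribution:
  assumes x: "\<Phi> \<in> refinable_space P"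
  obtains \<psi> where "\<psi> \<in> tempered" "compactly_supported \<psi>" "has_fourier \<psi> (super \<Phi>)"
    "\<And>S. tdist.subspace S \<Longrightarrow> shift_invariant S \<Longrightarrow> range (($) \<Phi>) \<subseteq> S \<Longrightarrow> \<psi> \<in> S"
proof -
  have "\<forall>i. \<exists>T. has_fourier T (\<lambda>\<omega>. cnj (v \<omega> $ i) * tfourier (\<Phi> $ i) \<omega>) \<and>
    (\<forall>S. tdist.subspace S \<longrightarrow> shift_invariant S \<longrightarrow> \<Phi> $ i \<in> S \<longrightarrow> T \<in> S) \<and> T \<in> tempered \<and> compactly_supported T"
  proof
    fix i
    show "\<exists>T. has_fourier T (\<lambda>\<omega>. cnj (v \<omega> $ i) * tfourier (\<Phi> $ i) \<omega>) \<and>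
      (\<forall>S. tdist.subspace S \<longrightarrow> shift_invariant S \<longrightarrow> \<Phi> $ i \<in> S \<longrightarrow> T \<in> S) \<and> T \<in> tempered \<and> compactly_supported T"
      by (rule trig_multiple[OF R_fourier[OF x, of i] trig_poly_cnj[OF v_trig[of i]]]) (use R_tempered[OF x] R_csupp[OF x] in blast)
  qed
  from choice[OF this] obtain T where T': "\<forall>i. has_fourier (T i) (\<lambda>\<omega>. cnj (v \<omega> $ i) * tfourier (\<Phi> $ i) \<omega>) \<and>
    (\<forall>S. tdist.subspace S \<longrightarrow> shift_invariant S \<longrightarrow> \<Phi> $ i \<in> S \<longrightarrow> T i \<in> S) \<and> T i \<in> tempered \<and> compactly_supported (T i)" by (rule exE)
  note T = T'[THEN spec, THEN conjunct1] T'[THEN spec, THEN conjunct2, THEN conjunct1, rule_format]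
    T'[THEN spec, THEN conjunct2, THEN conjunct2, THEN conjunct1] T'[THEN spec, THEN conjunct2, THEN conjunct2, THEN conjunct2]
  show thesis
  proof (rule that[of "\<lambda>\<phi>. \<Sum>i\<in>UNIV. T i \<phi>"])
    show "(\<lambda>\<phi>. \<Sum>i\<in>UNIV. T i \<phi>) \<in> S" if "tdist.subspace S" "shift_invariant S" "range (($) \<Phi>) \<subseteq> S" for S
      using that by (intro subspace_pointwise_sum T(2)) auto
  qed (unfold super_eq, auto intro!: tempered_sum csupp_sum has_fourier_sum T)
qed

lemma super_sq_bound:
  assumes V: "\<And>\<omega>. norm (v \<omega>) \<le> V"
  shows "(cmod (super \<Phi> \<omega>))\<^sup>2 \<le> V\<^sup>2 * (norm (vfourier \<Phi> \<omega>))\<^sup>2"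
proof -
  have "cmod (super \<Phi> \<omega>) \<le> V * norm (vfourier \<Phi> \<omega>)"
    unfolding symbol_def by (rule order_trans[OF adj_prod_bound mult_right_mono[OF V]]) simp
  then have "(cmod (super \<Phi> \<omega>))\<^sup>2 \<le> (V * norm (vfourier \<Phi> \<omega>))\<^sup>2" by (intro power_mono) auto
  then show ?thesis by (simp only: power_mult_distrib)
qed

lemma super_sobolev:
  assumes x: "\<Phi> \<in> refinable_space P" and t: "\<psi> \<in> tempered" "has_fourier \<psi> (super \<Phi>)"
  shows "\<psi> \<in> sobolev s"
proof (rule sobolevI[OF t])
  obtain V where V: "V > 0" "\<And>\<omega>. norm (v \<omega>) \<le> V" by (rule v_bounded) blast
  have [measurable]: "super \<Phi> \<in> borel_measurable borel" by (rule has_fourier_measurable[OF t(2)])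
  have i: "integrable lborel (\<lambda>\<omega>. V\<^sup>2 * (\<Sum>i\<in>UNIV. (1 + norm \<omega>) powr (2 * s) * (cmod (tfourier (\<Phi> $ i) \<omega>))\<^sup>2))"
    by (intro integrable_mult_right Bochner_Integration.integrable_sum sobolevD(3) R_sob x)
  show "integrable lborel (\<lambda>\<omega>. (1 + norm \<omega>) powr (2 * s) * (cmod (super \<Phi> \<omega>))\<^sup>2)"
  proof (rule Bochner_Integration.integrable_bound[OF i])
    show "AE \<omega> in lborel. norm ((1 + norm \<omega>) powr (2 * s) * (cmod (super \<Phi> \<omega>))\<^sup>2) \<le> norm (V\<^sup>2 * (\<Sum>i\<in>UNIV. (1 + norm \<omega>) powr (2 * s) * (cmod (tfourier (\<Phi> $ i) \<omega>))\<^sup>2))"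
    proof (rule AE_I2)
      fix \<omega>
      have "(1 + norm \<omega>) powr (2 * s) * (cmod (super \<Phi> \<omega>))\<^sup>2 \<le> (1 + norm \<omega>) powr (2 * s) * (V\<^sup>2 * (norm (vfourier \<Phi> \<omega>))\<^sup>2)"
        by (intro mult_left_mono super_sq_bound V) simp
      also have "\<dots> = V\<^sup>2 * (\<Sum>i\<in>UNIV. (1 + norm \<omega>) powr (2 * s) * (cmod (tfourier (\<Phi> $ i) \<omega>))\<^sup>2)"
        by (simp add: norm_sq_complex_vec vfourier_def sum_distrib_left mult_ac)
      finally show "norm ((1 + norm \<omega>) powr (2 * s) * (cmod (super \<Phi> \<omega>))\<^sup>2) \<le> norm (V\<^sup>2 * (\<Sum>i\<in>UNIV. (1 + norm \<omega>) powr (2 * s) * (cmod (tfourier (\<Phi> $ i) \<omega>))\<^sup>2))"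
        by simp
    qed
  qed measurable
qed

lemma super_bracket:
  assumes x: "\<Phi> \<in> refinable_space P"
  obtains B where "B \<ge> 0" "\<And>S x. finite S \<Longrightarrow> S \<subseteq> lattice (2 * pi) \<Longrightarrow> (\<Sum>\<alpha>\<in>S. (1 + norm (x + \<alpha>)) powr (2 * s) * (cmod (super \<Phi> (x + \<alpha>)))\<^sup>2) \<le> B"
proof -
  obtain V where V: "V > 0" "\<And>\<omega>. norm (v \<omega>) \<le> V" by (rule v_bounded) blast
  obtain B where B: "B \<ge> 0" "\<And>S x. finite S \<Longrightarrow> S \<subseteq> lattice (2 * pi) \<Longrightarrow>
    (\<Sum>\<beta>\<in>S. (1 + norm (x + \<beta>)) powr (2 * s) * (norm (vfourier \<Phi> (x + \<beta>)))\<^sup>2) \<le> B"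
    using R_bracket[OF x, of "2 * pi"] by auto
  show thesis
  proof (rule that[of "V\<^sup>2 * B"])
    show "0 \<le> V\<^sup>2 * B" using B by simp
    fix S :: "(real^'d) set" and x assume S: "finite S" "S \<subseteq> lattice (2 * pi)"
    have "(\<Sum>\<alpha>\<in>S. (1 + norm (x + \<alpha>)) powr (2 * s) * (cmod (super \<Phi> (x + \<alpha>)))\<^sup>2) \<le> (\<Sum>\<alpha>\<in>S. (1 + norm (x + \<alpha>)) powr (2 * s) * (V\<^sup>2 * (norm (vfourier \<Phi> (x + \<alpha>)))\<^sup>2))"
      by (intro sum_mono mult_left_mono super_sq_bound V) simp
    also have "\<dots> = V\<^sup>2 * (\<Sum>\<alpha>\<in>S. (1 + norm (x + \<alpha>)) powr (2 * s) * (norm (vfourier \<Phi> (x + \<alpha>)))\<^sup>2)"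
      by (simp add: sum_distrib_left mult_ac)
    also have "\<dots> \<le> V\<^sup>2 * B" by (intro mult_left_mono B(2) S) simp
    finally show "(\<Sum>\<alpha>\<in>S. (1 + norm (x + \<alpha>)) powr (2 * s) * (cmod (super \<Phi> (x + \<alpha>)))\<^sup>2) \<le> V\<^sup>2 * B" .
  qed
qed

lemma super_step:
  obtains \<rho> C where "\<rho> > 0" "\<rho> < 1" "C \<ge> 0"
    "\<And>\<Phi> \<omega> \<alpha>. \<Phi> \<in> refinable_space P \<Longrightarrow> norm \<omega> < \<rho> \<Longrightarrow> \<alpha> \<in> lattice (2 * pi) \<Longrightarrow>
      cmod (super \<Phi> (\<omega> + \<alpha>) - (if (1/2) *\<^sub>R \<alpha> \<in> lattice (2 * pi) then super \<Phi> ((1/2) *\<^sub>R (\<omega> + \<alpha>)) else 0))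
        \<le> C * norm \<omega> powr k * norm (vfourier \<Phi> ((1/2) *\<^sub>R (\<omega> + \<alpha>)))"
proof (rule refinement_step[OF P_trig v_trig k_pos cond_Z])
  fix \<rho> C
  assume st: "\<rho> > 0" "\<rho> < 1" "C \<ge> 0"
    "\<And>F \<omega> \<alpha>. (\<And>\<omega>. F (2 *\<^sub>R \<omega>) = P \<omega> *v F \<omega>) \<Longrightarrow> norm \<omega> < \<rho> \<Longrightarrow> \<alpha> \<in> lattice (2 * pi) \<Longrightarrow>
      cmod (symbol v F (\<omega> + \<alpha>) - (if (1/2) *\<^sub>R \<alpha> \<in> lattice (2 * pi) then symbol v F ((1/2) *\<^sub>R (\<omega> + \<alpha>)) else 0))
        \<le> C * norm \<omega> powr k * norm (F ((1/2) *\<^sub>R (\<omega> + \<alpha>)))"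
  show thesis
    by (rule that[OF st(1-3)], rule st(4)) (rule R_refine)
qed

lemma super_order:
  assumes ks: "k > s"
  obtains \<rho> where "\<rho> > 0" "\<rho> < 1" "\<And>\<Phi>. \<Phi> \<in> refinable_space P \<Longrightarrow>
    \<exists>A\<ge>0. \<forall>S \<omega>. norm \<omega> < \<rho> \<longrightarrow> finite S \<longrightarrow> S \<subseteq> lattice (2 * pi) - {0} \<longrightarrow>
     (\<Sum>\<alpha>\<in>S. norm (\<omega> + \<alpha>) powr (2 * s) * (cmod (super \<Phi> (\<omega> + \<alpha>)))\<^sup>2) \<le> A * norm \<omega> powr (2 * k)"
proof -
  obtain \<rho> C where st: "\<rho> > 0" "\<rho> < 1" "C \<ge> 0"
    "\<And>\<Phi> \<omega> \<alpha>. \<Phi> \<in> refinable_space P \<Longrightarrow> norm \<omega> < \<rho> \<Longrightarrow> \<alpha> \<in> lattice (2 * pi) \<Longrightarrow>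
      cmod (super \<Phi> (\<omega> + \<alpha>) - (if (1/2) *\<^sub>R \<alpha> \<in> lattice (2 * pi) then super \<Phi> ((1/2) *\<^sub>R (\<omega> + \<alpha>)) else 0))
        \<le> C * norm \<omega> powr k * norm (vfourier \<Phi> ((1/2) *\<^sub>R (\<omega> + \<alpha>)))"
    by (rule super_step) (rule that)
  show thesis
  proof (rule that[OF st(1,2)])
    fix \<Phi> :: "('d tdist)^'r" assume x: "\<Phi> \<in> refinable_space P"
    obtain B where B: "B \<ge> 0" "\<And>S x. finite S \<Longrightarrow> S \<subseteq> lattice pi \<Longrightarrow>
      (\<Sum>\<beta>\<in>S. (1 + norm (x + \<beta>)) powr (2 * s) * (norm (vfourier \<Phi> (x + \<beta>)))\<^sup>2) \<le> B"
      using R_bracket[OF x pi_gt_zero] by auto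
    obtain A where "A \<ge> 0" "\<And>S \<omega>. norm \<omega> < \<rho> \<Longrightarrow> finite S \<Longrightarrow> S \<subseteq> lattice (2 * pi) - {0} \<Longrightarrow>
      (\<Sum>\<alpha>\<in>S. norm (\<omega> + \<alpha>) powr (2 * s) * (cmod (super \<Phi> (\<omega> + \<alpha>)))\<^sup>2) \<le> A * norm \<omega> powr (2 * k)"
      by (rule bracket_zero_order[OF ks st(3) st(2) B st(4)[OF x]]) (assumption+, rule that)
    then show "\<exists>A\<ge>0. \<forall>S \<omega>. norm \<omega> < \<rho> \<longrightarrow> finite S \<longrightarrow> S \<subseteq> lattice (2 * pi) - {0} \<longrightarrow>
     (\<Sum>\<alpha>\<in>S. norm (\<omega> + \<alpha>) powr (2 * s) * (cmod (super \<Phi> (\<omega> + \<alpha>)))\<^sup>2) \<le> A * norm \<omega> powr (2 * k)" by (intro exI[of _ A] conjI allI impI)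
  qed
qed

lemma super_strang_fix:
  assumes x: "\<Phi> \<in> refinable_space P" and tf: "tfourier \<psi> = super \<Phi>"
  shows "strang_fix k \<psi>" and "(\<lambda>\<omega>. cmod (tfourier \<psi> \<omega> - tfourier \<psi> 0)) \<in> O[nhds 0](\<lambda>\<omega>. norm \<omega> powr k)"
proof -
  obtain \<rho> C where st: "\<rho> > 0" "\<rho> < 1" "C \<ge> 0"
    "\<And>\<Phi> \<omega> \<alpha>. \<Phi> \<in> refinable_space P \<Longrightarrow> norm \<omega> < \<rho> \<Longrightarrow> \<alpha> \<in> lattice (2 * pi) \<Longrightarrow>
      cmod (super \<Phi> (\<omega> + \<alpha>) - (if (1/2) *\<^sub>R \<alpha> \<in> lattice (2 * pi) then super \<Phi> ((1/2) *\<^sub>R (\<omega> + \<alpha>)) else 0))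
        \<le> C * norm \<omega> powr k * norm (vfourier \<Phi> ((1/2) *\<^sub>R (\<omega> + \<alpha>)))"
    by (rule super_step) (rule that)
  show "strang_fix k \<psi>"
    unfolding strang_fix_def tf two_pi_lattice_eq
  proof
    fix \<alpha> :: "real^'d" assume a: "\<alpha> \<in> lattice (2 * pi) - {0}"
    obtain J where J: "norm \<alpha> < 2 ^ J" using real_arch_pow[of 2 "norm \<alpha>"] by auto
    have "\<exists>A\<ge>0. \<forall>\<omega>. norm \<omega> < \<rho> \<longrightarrow> cmod (super \<Phi> (\<omega> + \<alpha>)) \<le> A * norm \<omega> powr k"
      by (rule strang_fix_pointwise[OF R_cont[OF x] k_pos st(3) st(4)[OF x] _ _ J]) (use a in auto)
    then obtain A where "\<And>\<omega>. norm \<omega> < \<rho> \<Longrightarrow> cmod (super \<Phi> (\<omega> + \<alpha>)) \<le> A * norm \<omega> powr k" by blast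
    then show "(\<lambda>\<omega>. cmod (super \<Phi> (\<omega> + \<alpha>))) \<in> O[nhds 0](\<lambda>\<omega>. norm \<omega> powr k)"
      by (intro bigo_nhdsI[OF st(1), where c=A]) (simp add: dist_norm)
  qed
  have "\<exists>A\<ge>0. \<forall>\<omega>. norm \<omega> < \<rho> \<longrightarrow> cmod (super \<Phi> \<omega> - super \<Phi> 0) \<le> A * norm \<omega> powr k"
    by (rule symbol_near_zero[OF R_cont[OF x] super_cont[OF x] k_pos st(3) st(1) st(4)[OF x]])
  then obtain A where "\<And>\<omega>. norm \<omega> < \<rho> \<Longrightarrow> cmod (super \<Phi> \<omega> - super \<Phi> 0) \<le> A * norm \<omega> powr k" by blast
  then show "(\<lambda>\<omega>. cmod (tfourier \<psi> \<omega> - tfourier \<psi> 0)) \<in> O[nhds 0](\<lambda>\<omega>. norm \<omega> powr k)"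
    unfolding tf by (intro bigo_nhdsI[OF st(1), where c=A]) (simp add: dist_norm)
qed

lemma super_approx_order:
  assumes x: "\<Phi> \<in> refinable_space P" and ks: "k > s" and t: "\<psi> \<in> tempered" "has_fourier \<psi> (super \<Phi>)" and nz: "super \<Phi> 0 \<noteq> 0"
    and S: "tdist.subspace S" "shift_invariant S" "\<psi> \<in> S"
  shows "approx_order s k S"
proof -
  have tf: "tfourier \<psi> = super \<Phi>" by (rule tfourier_eqI[OF t(2) super_cont[OF x]])
  obtain \<rho> where \<rho>: "\<rho> > 0" and "\<And>\<Phi>. \<Phi> \<in> refinable_space P \<Longrightarrow>
    \<exists>A\<ge>0. \<forall>S \<omega>. norm \<omega> < \<rho> \<longrightarrow> finite S \<longrightarrow> S \<subseteq> lattice (2 * pi) - {0} \<longrightarrow>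
     (\<Sum>\<alpha>\<in>S. norm (\<omega> + \<alpha>) powr (2 * s) * (cmod (super \<Phi> (\<omega> + \<alpha>)))\<^sup>2) \<le> A * norm \<omega> powr (2 * k)"
    by (rule super_order[OF ks]) (rule that)
  from this(2)[OF x] obtain A where A: "A \<ge> 0" "\<And>S \<omega>. norm \<omega> < \<rho> \<Longrightarrow> finite S \<Longrightarrow> S \<subseteq> lattice (2 * pi) - {0} \<Longrightarrow>
     (\<Sum>\<alpha>\<in>S. norm (\<omega> + \<alpha>) powr (2 * s) * (cmod (super \<Phi> (\<omega> + \<alpha>)))\<^sup>2) \<le> A * norm \<omega> powr (2 * k)" by blast
  obtain B where B: "B \<ge> 0" "\<And>S x. finite S \<Longrightarrow> S \<subseteq> lattice (2 * pi) \<Longrightarrow> (\<Sum>\<alpha>\<in>S. (1 + norm (x + \<alpha>)) powr (2 * s) * (cmod (super \<Phi> (x + \<alpha>)))\<^sup>2) \<le> B"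
    by (rule super_bracket[OF x]) (rule that)
  show ?thesis
    by (rule superfunction_approx_order[OF ks k_pos \<rho> super_sobolev[OF x t] _ _ B(1) _ A(1) _ S, unfolded tf])
       (use super_cont[OF x] nz B(2) A(2) in auto)
qed

text \<open>The form at \<open>v\<close> is the sum over the basis of the brackets of the superfunctions.  Its part with \<open>\<alpha> \<noteq> 0\<close>
is bounded by \<open>super_order\<close>; its part with \<open>\<alpha> = 0\<close> is bounded above and below by continuity of the superfunction
transforms at the origin, where one of them does not vanish.\<close>

lemma form_bounds:
  assumes ks: "k > s" and basis: "refinable_basis P \<Phi>s" and ex: "\<exists>\<Phi>\<in>refinable_space P. super \<Phi> 0 \<noteq> 0"
  obtains r c C n V where "0 < r" "r < 1" "0 < c" "0 < C" "0 < n" "0 < V"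
    "\<And>\<omega>. norm \<omega> < r \<Longrightarrow> n \<le> norm (v \<omega>) \<and> norm (v \<omega>) \<le> V"
    "\<And>\<omega>. norm \<omega> < r \<Longrightarrow> \<omega> \<noteq> 0 \<Longrightarrow> c * norm \<omega> powr (2 * s) \<le> herm_form (gramian s \<Phi>s \<omega>) (v \<omega>)"
    "\<And>\<omega>. norm \<omega> < r \<Longrightarrow> \<omega> \<noteq> 0 \<Longrightarrow> herm_form (gramian s \<Phi>s \<omega>) (v \<omega>) \<le> C * norm \<omega> powr (2 * s)"
    "\<And>\<omega>. norm \<omega> < r \<Longrightarrow> 0 \<le> herm_form (gramian0 s \<Phi>s \<omega>) (v \<omega>) \<and> herm_form (gramian0 s \<Phi>s \<omega>) (v \<omega>) \<le> C * norm \<omega> powr (2 * k)"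
proof -
  have sub: "set \<Phi>s \<subseteq> refinable_space P" and sp: "tvec.span (set \<Phi>s) = refinable_space P"
    using basis tvec.span_superset[of "set \<Phi>s"] unfolding refinable_basis_def by auto
  have "\<exists>\<Phi>\<in>set \<Phi>s. super \<Phi> 0 \<noteq> 0"
  proof (rule ccontr)
    assume no: "\<not> ?thesis"
    \<comment> \<open>Vanishing at the origin is a linear condition; if it held on a basis, it would hold on all of \<open>R(P)\<close>.\<close>
    define W where "W = {\<Phi> \<in> refinable_space P. super \<Phi> 0 = 0}"
    have comb: "\<Phi> + tvscale a \<Psi> \<in> W" if "\<Phi> \<in> W" "\<Psi> \<in> W" for \<Phi> \<Psi> a
    proof -
      have R: "\<Phi> \<in> refinable_space P" "\<Psi> \<in> refinable_space P" and z: "super \<Phi> 0 = 0" "super \<Psi> 0 = 0" using that unfolding W_def by auto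
      have "super (\<Phi> + tvscale a \<Psi>) 0 = super \<Phi> 0 + a * super \<Psi> 0"
        unfolding symbol_def R_combination(1)[OF R] by (simp add: adj_prod_def distrib_left sum.distrib sum_distrib_left mult_ac)
      then show ?thesis using R_combination(2)[OF R] z unfolding W_def by simp
    qed
    have z: "0 \<in> W"
    proof -
      have "super (0 + tvscale 1 0) 0 = super 0 0 + 1 * super 0 0"
        unfolding symbol_def R_combination(1)[OF R_zero R_zero] by (simp add: adj_prod_def distrib_left sum.distrib sum_distrib_left mult_ac)
      then have "super 0 0 = 0" by simp
      then show ?thesis using R_zero unfolding W_def by simp
    qed
    have "tvec.subspace W"
    proof (rule tvec.subspaceI[OF z])
      show "x + y \<in> W" if "x \<in> W" "y \<in> W" for x y using comb[OF that, of 1] by simp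
      show "tvscale a x \<in> W" if "x \<in> W" for a x using comb[OF z that, of a] by simp
    qed
    moreover have "set \<Phi>s \<subseteq> W" using no sub unfolding W_def by auto
    ultimately have "refinable_space P \<subseteq> W" unfolding sp[symmetric] by (intro tvec.span_minimal)
    then show False using ex unfolding W_def by blast
  qed
  then obtain \<Phi>0 where \<Phi>0: "\<Phi>0 \<in> set \<Phi>s" "super \<Phi>0 0 \<noteq> 0" by blast
  obtain \<rho> where \<rho>: "\<rho> > 0" "\<rho> < 1" and "\<And>\<Phi>. \<Phi> \<in> refinable_space P \<Longrightarrow>
    \<exists>A\<ge>0. \<forall>S \<omega>. norm \<omega> < \<rho> \<longrightarrow> finite S \<longrightarrow> S \<subseteq> lattice (2 * pi) - {0} \<longrightarrow>
     (\<Sum>\<alpha>\<in>S. norm (\<omega> + \<alpha>) powr (2 * s) * (cmod (super \<Phi> (\<omega> + \<alpha>)))\<^sup>2) \<le> A * norm \<omega> powr (2 * k)"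
    by (rule super_order[OF ks]) (rule that)
  then have "\<forall>\<Phi>\<in>refinable_space P. \<exists>A. A \<ge> 0 \<and> (\<forall>S \<omega>. norm \<omega> < \<rho> \<longrightarrow> finite S \<longrightarrow> S \<subseteq> lattice (2 * pi) - {0} \<longrightarrow>
     (\<Sum>\<alpha>\<in>S. norm (\<omega> + \<alpha>) powr (2 * s) * (cmod (super \<Phi> (\<omega> + \<alpha>)))\<^sup>2) \<le> A * norm \<omega> powr (2 * k))" by (intro ballI)
  from bchoice[OF this] obtain A where A': "\<forall>\<Phi>\<in>refinable_space P. A \<Phi> \<ge> 0 \<and> (\<forall>S \<omega>. norm \<omega> < \<rho> \<longrightarrow> finite S \<longrightarrow> S \<subseteq> lattice (2 * pi) - {0} \<longrightarrow>
     (\<Sum>\<alpha>\<in>S. norm (\<omega> + \<alpha>) powr (2 * s) * (cmod (super \<Phi> (\<omega> + \<alpha>)))\<^sup>2) \<le> A \<Phi> * norm \<omega> powr (2 * k))" by (rule exE)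
  note A = A'[THEN bspec, THEN conjunct1] A'[THEN bspec, THEN conjunct2, rule_format]
  obtain V where V: "V > 0" "\<And>\<omega>. norm (v \<omega>) \<le> V" by (rule v_bounded) blast
  have "\<forall>\<Phi>\<in>refinable_space P. \<exists>M. \<forall>\<omega>. norm \<omega> \<le> 1 \<longrightarrow> norm (super \<Phi> \<omega>) \<le> M"
  proof
    fix \<Phi> assume "\<Phi> \<in> refinable_space P"
    then obtain M where "\<And>\<omega>. norm \<omega> \<le> 1 \<Longrightarrow> norm (super \<Phi> \<omega>) \<le> M"
      by (rule continuous_bounded_cball[OF super_cont]) (rule that)
    then show "\<exists>M. \<forall>\<omega>. norm \<omega> \<le> 1 \<longrightarrow> norm (super \<Phi> \<omega>) \<le> M" by blast
  qed
  from bchoice[OF this] obtain M where M: "\<And>\<Phi> \<omega>. \<Phi> \<in> refinable_space P \<Longrightarrow> norm \<omega> \<le> 1 \<Longrightarrow> cmod (super \<Phi> \<omega>) \<le> M \<Phi>" by blast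
  define n where "n = norm (v 0) / 2"
  have v0: "v 0 \<noteq> 0" using cond_Z unfolding condition_Z_def by blast
  then have n: "n > 0" unfolding n_def by simp
  define c0 where "c0 = cmod (super \<Phi>0 0) / 2"
  have c0: "c0 > 0" using \<Phi>0 unfolding c0_def by simp
  have "isCont v 0" using v_cont by (simp add: continuous_on_eq_continuous_at)
  then obtain d1 where d1: "d1 > 0" "\<And>x. dist x 0 < d1 \<Longrightarrow> dist (v x) (v 0) < n"
    using n unfolding continuous_at_eps_delta by blast
  have "isCont (super \<Phi>0) 0" using super_cont \<Phi>0(1) sub by (auto simp: continuous_on_eq_continuous_at)
  then obtain d2 where d2: "d2 > 0" "\<And>x. dist x 0 < d2 \<Longrightarrow> dist (super \<Phi>0 x) (super \<Phi>0 0) < c0"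
    using c0 unfolding continuous_at_eps_delta by blast
  define r where "r = min \<rho> (min d1 d2)"
  have r: "0 < r" "r < 1" "r \<le> \<rho>" "r \<le> d1" "r \<le> d2" unfolding r_def using \<rho> d1 d2 by auto
  have vlow: "n \<le> norm (v \<omega>)" if "norm \<omega> < r" for \<omega>
    using d1(2)[of \<omega>] that r norm_triangle_ineq2[of "v 0" "v 0 - v \<omega>"] unfolding n_def by (simp add: dist_norm norm_minus_commute)
  have slow: "c0\<^sup>2 \<le> (cmod (super \<Phi>0 \<omega>))\<^sup>2" if "norm \<omega> < r" for \<omega>
  proof -
    have "c0 \<le> cmod (super \<Phi>0 \<omega>)"
      using d2(2)[of \<omega>] that r norm_triangle_ineq2[of "super \<Phi>0 0" "super \<Phi>0 0 - super \<Phi>0 \<omega>"] unfolding c0_def by (simp add: dist_norm norm_minus_commute)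
    then show ?thesis using c0 by (intro power_mono) auto
  qed
  let ?f = "\<lambda>\<Phi> \<omega> \<alpha>. norm (\<omega> + \<alpha>) powr (2 * s) * (cmod (super \<Phi> (\<omega> + \<alpha>)))\<^sup>2"
  let ?L = "lattice (2 * pi) :: (real^'d) set"
  have z: "(0 :: real^'d) \<in> ?L" by (simp add: lattice_iff)
  have fadj: "norm (\<omega> + \<alpha>) powr (2 * s) * (cmod (adj_prod (v \<omega>) (vfourier \<Phi> (\<omega> + \<alpha>))))\<^sup>2 = ?f \<Phi> \<omega> \<alpha>" if "\<alpha> \<in> ?L" for \<Phi> \<omega> \<alpha>
    by (simp add: symbol_def v_periodic[OF that])
  have summ: "(?f \<Phi> \<omega>) summable_on B" if "\<Phi> \<in> refinable_space P" "norm \<omega> < 1" "B \<subseteq> ?L" for \<Phi> \<omega> B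
  proof -
    have "(?f \<Phi> \<omega>) summable_on B \<longleftrightarrow> (\<lambda>\<alpha>. norm (\<omega> + \<alpha>) powr (2 * s) * (cmod (adj_prod (v \<omega>) (vfourier \<Phi> (\<omega> + \<alpha>))))\<^sup>2) summable_on B"
      by (rule summable_on_cong) (rule fadj[symmetric], use that(3) in blast)
    then show ?thesis using R_form_summable[OF that, of "v \<omega>"] by (simp only:)
  qed
  have form: "herm_form (gramian_over B s \<Phi>s \<omega>) (v \<omega>) = (\<Sum>\<Phi>\<leftarrow>\<Phi>s. infsum (?f \<Phi> \<omega>) B)" if "norm \<omega> < 1" "B \<subseteq> ?L" for B \<omega>
  proof -
    have "(\<Sum>\<^sub>\<infinity>\<alpha>\<in>B. norm (\<omega> + \<alpha>) powr (2 * s) * (cmod (adj_prod (v \<omega>) (vfourier \<Phi> (\<omega> + \<alpha>))))\<^sup>2) = infsum (?f \<Phi> \<omega>) B" for \<Phi>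
      using that(2) fadj by (intro infsum_cong) auto
    then show ?thesis by (simp only: herm_form_gramian[OF sub that])
  qed
  define Asum where "Asum = (\<Sum>\<Phi>\<leftarrow>\<Phi>s. A \<Phi>)"
  define Msum where "Msum = (\<Sum>\<Phi>\<leftarrow>\<Phi>s. (M \<Phi>)\<^sup>2)"
  have Asum0: "Asum \<ge> 0" unfolding Asum_def using sub A(1) by (intro sum_list_nonneg) auto
  have Msum0: "Msum \<ge> 0" unfolding Msum_def by (intro sum_list_nonneg) auto
  have g0: "0 \<le> herm_form (gramian0 s \<Phi>s \<omega>) (v \<omega>) \<and> herm_form (gramian0 s \<Phi>s \<omega>) (v \<omega>) \<le> Asum * norm \<omega> powr (2 * k)" if w: "norm \<omega> < r" for \<omega>
  proof -
    have w1: "norm \<omega> < 1" "norm \<omega> < \<rho>" using w r by auto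
    have e: "herm_form (gramian0 s \<Phi>s \<omega>) (v \<omega>) = (\<Sum>\<Phi>\<leftarrow>\<Phi>s. infsum (?f \<Phi> \<omega>) (?L - {0}))"
      unfolding two_pi_lattice_eq by (rule form[OF w1(1)]) auto
    have b: "infsum (?f \<Phi> \<omega>) (?L - {0}) \<le> A \<Phi> * norm \<omega> powr (2 * k)" if "\<Phi> \<in> set \<Phi>s" for \<Phi>
      using that sub w1 by (intro infsum_le_finite_sums summ A(2)) auto
    have "(\<Sum>\<Phi>\<leftarrow>\<Phi>s. infsum (?f \<Phi> \<omega>) (?L - {0})) \<le> (\<Sum>\<Phi>\<leftarrow>\<Phi>s. A \<Phi> * norm \<omega> powr (2 * k))"
      using b by (rule sum_list_mono)
    also have "\<dots> = Asum * norm \<omega> powr (2 * k)" unfolding Asum_def by (simp add: sum_list_mult_const)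
    finally have "(\<Sum>\<Phi>\<leftarrow>\<Phi>s. infsum (?f \<Phi> \<omega>) (?L - {0})) \<le> Asum * norm \<omega> powr (2 * k)" .
    moreover have "0 \<le> (\<Sum>\<Phi>\<leftarrow>\<Phi>s. infsum (?f \<Phi> \<omega>) (?L - {0}))" by (intro sum_list_nonneg) (auto intro!: infsum_nonneg)
    ultimately show ?thesis unfolding e by simp
  qed
  have g: "herm_form (gramian s \<Phi>s \<omega>) (v \<omega>) = norm \<omega> powr (2 * s) * (\<Sum>\<Phi>\<leftarrow>\<Phi>s. (cmod (super \<Phi> \<omega>))\<^sup>2) + herm_form (gramian0 s \<Phi>s \<omega>) (v \<omega>)" if w: "norm \<omega> < r" for \<omega>
  proof -
    have w1: "norm \<omega> < 1" using w r by auto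
    have "herm_form (gramian s \<Phi>s \<omega>) (v \<omega>) = (\<Sum>\<Phi>\<leftarrow>\<Phi>s. infsum (?f \<Phi> \<omega>) ?L)"
      unfolding two_pi_lattice_eq by (rule form[OF w1]) auto
    also have "\<dots> = (\<Sum>\<Phi>\<leftarrow>\<Phi>s. ?f \<Phi> \<omega> 0 + infsum (?f \<Phi> \<omega>) (?L - {0}))"
    proof (intro arg_cong[where f=sum_list] map_cong refl)
      fix \<Phi> assume "\<Phi> \<in> set \<Phi>s"
      then have "(?f \<Phi> \<omega>) summable_on (?L - {0})" using sub w1 by (intro summ) auto
      from infsum_insert[OF this, of 0] show "infsum (?f \<Phi> \<omega>) ?L = ?f \<Phi> \<omega> 0 + infsum (?f \<Phi> \<omega>) (?L - {0})"
        using z by (simp add: insert_absorb)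
    qed
    also have "\<dots> = norm \<omega> powr (2 * s) * (\<Sum>\<Phi>\<leftarrow>\<Phi>s. (cmod (super \<Phi> \<omega>))\<^sup>2) + (\<Sum>\<Phi>\<leftarrow>\<Phi>s. infsum (?f \<Phi> \<omega>) (?L - {0}))"
      by (simp add: sum_list_addf sum_list_const_mult)
    also have "(\<Sum>\<Phi>\<leftarrow>\<Phi>s. infsum (?f \<Phi> \<omega>) (?L - {0})) = herm_form (gramian0 s \<Phi>s \<omega>) (v \<omega>)"
      unfolding two_pi_lattice_eq by (rule form[OF w1, symmetric]) auto
    finally show ?thesis .
  qed
  show thesis
  proof (rule that[of r "c0\<^sup>2" "Msum + Asum + 1" n V])
    show "0 < r" "r < 1" "0 < c0\<^sup>2" "0 < Msum + Asum + 1" "0 < n" "0 < V" using r c0 Msum0 Asum0 n V by auto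
    fix \<omega> :: "real^'d" assume w: "norm \<omega> < r"
    show "n \<le> norm (v \<omega>) \<and> norm (v \<omega>) \<le> V" using vlow[OF w] V by blast
    have "Asum * norm \<omega> powr (2 * k) \<le> (Msum + Asum + 1) * norm \<omega> powr (2 * k)" using Msum0 by (intro mult_right_mono) auto
    then show "0 \<le> herm_form (gramian0 s \<Phi>s \<omega>) (v \<omega>) \<and> herm_form (gramian0 s \<Phi>s \<omega>) (v \<omega>) \<le> (Msum + Asum + 1) * norm \<omega> powr (2 * k)"
      using g0[OF w] by linarith
    assume nz: "\<omega> \<noteq> 0"
    have "(cmod (super \<Phi>0 \<omega>))\<^sup>2 \<le> (\<Sum>\<Phi>\<leftarrow>\<Phi>s. (cmod (super \<Phi> \<omega>))\<^sup>2)"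
      using \<Phi>0(1) by (intro member_le_sum_list) auto
    then have "c0\<^sup>2 \<le> (\<Sum>\<Phi>\<leftarrow>\<Phi>s. (cmod (super \<Phi> \<omega>))\<^sup>2)" using slow[OF w] by linarith
    then have "norm \<omega> powr (2 * s) * c0\<^sup>2 \<le> norm \<omega> powr (2 * s) * (\<Sum>\<Phi>\<leftarrow>\<Phi>s. (cmod (super \<Phi> \<omega>))\<^sup>2)" by (rule mult_left_mono) simp
    then show "c0\<^sup>2 * norm \<omega> powr (2 * s) \<le> herm_form (gramian s \<Phi>s \<omega>) (v \<omega>)"
      unfolding g[OF w] using g0[OF w] by (simp only: mult.commute[of "c0\<^sup>2"]) linarith
    have "(\<Sum>\<Phi>\<leftarrow>\<Phi>s. (cmod (super \<Phi> \<omega>))\<^sup>2) \<le> Msum" unfolding Msum_def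
    proof (rule sum_list_mono)
      fix \<Phi> assume "\<Phi> \<in> set \<Phi>s"
      then show "(cmod (super \<Phi> \<omega>))\<^sup>2 \<le> (M \<Phi>)\<^sup>2" using M[of \<Phi> \<omega>] sub w r by (intro power_mono) auto
    qed
    then have 1: "norm \<omega> powr (2 * s) * (\<Sum>\<Phi>\<leftarrow>\<Phi>s. (cmod (super \<Phi> \<omega>))\<^sup>2) \<le> norm \<omega> powr (2 * s) * Msum" by (rule mult_left_mono) simp
    have "norm \<omega> powr (2 * k) \<le> norm \<omega> powr (2 * s)" using ks nz w r by (intro powr_mono') auto
    then have "Asum * norm \<omega> powr (2 * k) \<le> Asum * norm \<omega> powr (2 * s)" using Asum0 by (rule mult_left_mono)
    then have "herm_form (gramian s \<Phi>s \<omega>) (v \<omega>) \<le> norm \<omega> powr (2 * s) * Msum + Asum * norm \<omega> powr (2 * s)"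
      unfolding g[OF w] using 1 g0[OF w] by linarith
    also have "\<dots> \<le> (Msum + Asum + 1) * norm \<omega> powr (2 * s)" by (simp add: algebra_simps)
    finally show "herm_form (gramian s \<Phi>s \<omega>) (v \<omega>) \<le> (Msum + Asum + 1) * norm \<omega> powr (2 * s)" .
  qed
qed

lemma AE_lebesgue_nonzero: "AE \<omega> in lebesgue. \<omega> \<noteq> (0 :: real^'d)"
  using AE_not_in[of "{0 :: real^'d}" lebesgue] negligible_sing[of "0 :: real^'d"] by (simp add: negligible_iff_null_sets)

text \<open>The infimum is at most the quotient at \<open>v(\<omega>)\<close>.\<close>

theorem coherent_order:
  assumes ks: "k > s" and ex: "\<exists>\<Phi>\<in>refinable_space P. super \<Phi> 0 \<noteq> 0"
  shows "coherent_approx_order s k P"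
  unfolding coherent_approx_order_def
proof (intro conjI allI impI refinable_basis_exists)
  fix \<Phi>s assume basis: "refinable_basis P \<Phi>s"
  then have sub: "set \<Phi>s \<subseteq> refinable_space P" using tvec.span_superset[of "set \<Phi>s"] unfolding refinable_basis_def by auto
  obtain r c C where r: "0 < r" "r < 1" and c: "0 < c" "0 < C"
    and lo: "\<And>\<omega>. norm \<omega> < r \<Longrightarrow> \<omega> \<noteq> 0 \<Longrightarrow> c * norm \<omega> powr (2 * s) \<le> herm_form (gramian s \<Phi>s \<omega>) (v \<omega>)"
    and up: "\<And>\<omega>. norm \<omega> < r \<Longrightarrow> 0 \<le> herm_form (gramian0 s \<Phi>s \<omega>) (v \<omega>) \<and> herm_form (gramian0 s \<Phi>s \<omega>) (v \<omega>) \<le> C * norm \<omega> powr (2 * k)"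
    by (rule form_bounds[OF ks basis ex]) blast
  have q: "coherent_quotient s k \<Phi>s \<omega> \<le> ennreal (C / c)" if w: "norm \<omega> < r" "\<omega> \<noteq> 0" for \<omega>
  proof -
    let ?H = "herm_form (gramian s \<Phi>s \<omega>) (v \<omega>)" and ?N = "herm_form (gramian0 s \<Phi>s \<omega>) (v \<omega>)"
    have p: "norm \<omega> powr (2 * s) > 0" using w by simp
    have H: "?H > 0" using lo[OF w] c p by (meson less_le_trans mult_pos_pos)
    have "(INF x\<in>{x. herm_form (gramian s \<Phi>s \<omega>) x \<noteq> 0}. ennreal (herm_form (gramian0 s \<Phi>s \<omega>) x / herm_form (gramian s \<Phi>s \<omega>) x)) \<le> ennreal (?N / ?H)"
      using H by (intro INF_lower) simp
    also have "\<dots> \<le> ennreal ((C * norm \<omega> powr (2 * k)) / (c * norm \<omega> powr (2 * s)))"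
      using up[OF w(1)] lo[OF w] c p by (intro ennreal_leI frac_le) auto
    finally have "coherent_quotient s k \<Phi>s \<omega> \<le> ennreal (norm \<omega> powr (- (2 * k - 2 * s))) * ennreal ((C * norm \<omega> powr (2 * k)) / (c * norm \<omega> powr (2 * s)))"
      unfolding coherent_quotient_def by (rule mult_left_mono) simp
    also have "\<dots> = ennreal (norm \<omega> powr (- (2 * k - 2 * s)) * ((C * norm \<omega> powr (2 * k)) / (c * norm \<omega> powr (2 * s))))"
      using c by (intro ennreal_mult[symmetric]) auto
    also have "norm \<omega> powr (- (2 * k - 2 * s)) * ((C * norm \<omega> powr (2 * k)) / (c * norm \<omega> powr (2 * s))) = C / c"
    proof -
      have "norm \<omega> powr (2 * k) / norm \<omega> powr (2 * s) = norm \<omega> powr (2 * k - 2 * s)" by (rule powr_diff[symmetric])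
      moreover have "norm \<omega> powr (- (2 * k - 2 * s)) * norm \<omega> powr (2 * k - 2 * s) = 1"
        using w by (simp only: powr_add[symmetric]) simp
      moreover have "norm \<omega> powr (- (2 * k - 2 * s)) * ((C * norm \<omega> powr (2 * k)) / (c * norm \<omega> powr (2 * s))) = (C / c) * (norm \<omega> powr (- (2 * k - 2 * s)) * (norm \<omega> powr (2 * k) / norm \<omega> powr (2 * s)))"
        by simp
      ultimately show ?thesis by simp
    qed
    finally show ?thesis .
  qed
  show "\<exists>\<Omega>. open \<Omega> \<and> 0 \<in> \<Omega> \<and> coherent_quotient s k \<Phi>s \<in> borel_measurable (restrict_space lebesgue \<Omega>) \<and>
          (\<exists>C::real. AE \<omega> in lebesgue. \<omega> \<in> \<Omega> \<longrightarrow> coherent_quotient s k \<Phi>s \<omega> \<le> ennreal C)"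
  proof (intro exI[of _ "ball 0 r"] conjI exI[of _ "C / c"])
    show "coherent_quotient s k \<Phi>s \<in> borel_measurable (restrict_space lebesgue (ball 0 r))"
      using r by (intro coherent_quotient_measurable sub) simp
    show "AE \<omega> in lebesgue. \<omega> \<in> ball 0 r \<longrightarrow> coherent_quotient s k \<Phi>s \<omega> \<le> ennreal (C / c)"
      using AE_lebesgue_nonzero by eventually_elim (auto intro: q)
  qed (use r in auto)
qed

theorem regular_supervector:
  assumes ks: "k > s" and ex: "\<exists>\<Phi>\<in>refinable_space P. super \<Phi> 0 \<noteq> 0"
  shows "regular_universal_supervector s k P v"
  unfolding regular_universal_supervector_def
proof (intro conjI allI impI refinable_basis_exists)
  have "v \<in> borel_measurable lborel" using borel_measurable_continuous_onI[OF v_cont] by simp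
  then show "v \<in> borel_measurable lebesgue" by (rule measurable_completion)
  fix \<Phi>s assume basis: "refinable_basis P \<Phi>s"
  obtain r c C n V where r: "0 < r" "r < 1" and c: "0 < c" "0 < C" "0 < n" "0 < V"
    and nv: "\<And>\<omega>. norm \<omega> < r \<Longrightarrow> n \<le> norm (v \<omega>) \<and> norm (v \<omega>) \<le> V"
    and lo: "\<And>\<omega>. norm \<omega> < r \<Longrightarrow> \<omega> \<noteq> 0 \<Longrightarrow> c * norm \<omega> powr (2 * s) \<le> herm_form (gramian s \<Phi>s \<omega>) (v \<omega>)"
    and hi: "\<And>\<omega>. norm \<omega> < r \<Longrightarrow> \<omega> \<noteq> 0 \<Longrightarrow> herm_form (gramian s \<Phi>s \<omega>) (v \<omega>) \<le> C * norm \<omega> powr (2 * s)"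
    and up: "\<And>\<omega>. norm \<omega> < r \<Longrightarrow> 0 \<le> herm_form (gramian0 s \<Phi>s \<omega>) (v \<omega>) \<and> herm_form (gramian0 s \<Phi>s \<omega>) (v \<omega>) \<le> C * norm \<omega> powr (2 * k)"
    by (rule form_bounds[OF ks basis ex]) blast
  have est: "c / V\<^sup>2 * norm \<omega> powr (2 * s) \<le> herm_form (gramian s \<Phi>s \<omega>) (v \<omega>) / (norm (v \<omega>))\<^sup>2 \<and>
     herm_form (gramian s \<Phi>s \<omega>) (v \<omega>) / (norm (v \<omega>))\<^sup>2 \<le> C / n\<^sup>2 * norm \<omega> powr (2 * s) \<and>
     \<bar>herm_form (gramian0 s \<Phi>s \<omega>) (v \<omega>) / (norm (v \<omega>))\<^sup>2\<bar> \<le> C / n\<^sup>2 * norm \<omega> powr (2 * k)" if w: "norm \<omega> < r" "\<omega> \<noteq> 0" for \<omega>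
  proof -
    have n2: "n\<^sup>2 \<le> (norm (v \<omega>))\<^sup>2" "(norm (v \<omega>))\<^sup>2 \<le> V\<^sup>2" using nv[OF w(1)] c by (auto intro!: power_mono)
    have p: "0 < n\<^sup>2" "0 < V\<^sup>2" "0 < (norm (v \<omega>))\<^sup>2" using c n2 by (auto intro: less_le_trans[of 0 "n\<^sup>2"])
    have cp: "0 < c * norm \<omega> powr (2 * s)" using w c by simp
    have "(c * norm \<omega> powr (2 * s)) / V\<^sup>2 \<le> herm_form (gramian s \<Phi>s \<omega>) (v \<omega>) / (norm (v \<omega>))\<^sup>2"
      using lo[OF w] n2 p cp by (intro frac_le) auto
    moreover have "herm_form (gramian s \<Phi>s \<omega>) (v \<omega>) / (norm (v \<omega>))\<^sup>2 \<le> (C * norm \<omega> powr (2 * s)) / n\<^sup>2"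
      using hi[OF w] lo[OF w] n2 p c by (intro frac_le) auto
    moreover have "herm_form (gramian0 s \<Phi>s \<omega>) (v \<omega>) / (norm (v \<omega>))\<^sup>2 \<le> (C * norm \<omega> powr (2 * k)) / n\<^sup>2"
      using up[OF w(1)] n2 p c by (intro frac_le) auto
    moreover have "0 \<le> herm_form (gramian0 s \<Phi>s \<omega>) (v \<omega>) / (norm (v \<omega>))\<^sup>2" using up[OF w(1)] by simp
    ultimately show ?thesis by simp
  qed
  show "\<exists>\<Omega> c C. open \<Omega> \<and> 0 \<in> \<Omega> \<and> c > 0 \<and> C > 0 \<and>
          (AE \<omega> in lebesgue. \<omega> \<in> \<Omega> \<longrightarrow>
             c * norm \<omega> powr (2 * s) \<le> herm_form (gramian s \<Phi>s \<omega>) (v \<omega>) / (norm (v \<omega>))\<^sup>2 \<and>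
             herm_form (gramian s \<Phi>s \<omega>) (v \<omega>) / (norm (v \<omega>))\<^sup>2 \<le> C * norm \<omega> powr (2 * s) \<and>
             \<bar>herm_form (gramian0 s \<Phi>s \<omega>) (v \<omega>) / (norm (v \<omega>))\<^sup>2\<bar> \<le> C * norm \<omega> powr (2 * k))"
  proof (rule exI[of _ "ball 0 r"], rule exI[of _ "c / V\<^sup>2"], rule exI[of _ "C / n\<^sup>2"], intro conjI)
    show "AE \<omega> in lebesgue. \<omega> \<in> ball 0 r \<longrightarrow>
             c / V\<^sup>2 * norm \<omega> powr (2 * s) \<le> herm_form (gramian s \<Phi>s \<omega>) (v \<omega>) / (norm (v \<omega>))\<^sup>2 \<and>
             herm_form (gramian s \<Phi>s \<omega>) (v \<omega>) / (norm (v \<omega>))\<^sup>2 \<le> C / n\<^sup>2 * norm \<omega> powr (2 * s) \<and>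
             \<bar>herm_form (gramian0 s \<Phi>s \<omega>) (v \<omega>) / (norm (v \<omega>))\<^sup>2\<bar> \<le> C / n\<^sup>2 * norm \<omega> powr (2 * k)"
      using AE_lebesgue_nonzero by eventually_elim (use est in \<open>simp add: dist_norm\<close>)
  qed (use r c in auto)
qed

end

section \<open>Closed shift-invariant spaces\<close>

lemma si_space_member:
  "\<psi> \<in> si_space s A \<longleftrightarrow> (\<forall>S. tdist.subspace S \<longrightarrow> sobolev_closed s S \<longrightarrow> shift_invariant S \<longrightarrow> A \<subseteq> S \<longrightarrow> \<psi> \<in> S)"
  unfolding si_space_def by blast

lemma si_space_subspace: "tdist.subspace (si_space s A)"
proof (rule tdist.subspaceI)
  show "0 \<in> si_space s A" unfolding si_space_member using tdist.subspace_0 by blast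
  show "x + y \<in> si_space s A" if "x \<in> si_space s A" "y \<in> si_space s A" for x y
    using that unfolding si_space_member using tdist.subspace_add by blast
  show "tscale c x \<in> si_space s A" if "x \<in> si_space s A" for c x
    using that unfolding si_space_member using tdist.subspace_scale by blast
qed

lemma si_space_shift_invariant: "shift_invariant (si_space s (A :: ('a::finite) tdist set))"
  unfolding shift_invariant_def
proof (intro ballI)
  fix f :: "'a tdist" and \<alpha> :: "real^'a" assume f: "f \<in> si_space s A" "\<alpha> \<in> int_lattice"
  show "ttranslate \<alpha> f \<in> si_space s A"
    unfolding si_space_member
  proof (intro allI impI)
    fix S assume S: "tdist.subspace S" "sobolev_closed s S" "shift_invariant S" "A \<subseteq> S"
    then have "f \<in> S" using f(1) unfolding si_space_member by blast
    then show "ttranslate \<alpha> f \<in> S" using S(3) f(2) unfolding shift_invariant_def by blast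
  qed
qed

theorem corollary52:
  fixes P :: "real^'d::finite \<Rightarrow> complex^'r^'r::finite"
    and v :: "real^'d \<Rightarrow> complex^'r"
    and s k :: real
  assumes "\<And>i j. trig_poly (\<lambda>\<omega>. P \<omega> $ i $ j)"
    and "\<And>i. trig_poly (\<lambda>\<omega>. v \<omega> $ i)"
    and "\<And>\<Phi> i. \<Phi> \<in> refinable_space P \<Longrightarrow> \<Phi> $ i \<in> sobolev s"
    and "k > 0"
    and "condition_Z k P v"
  shows "(\<forall>\<Phi> \<in> refinable_space P.
           (\<exists>!\<psi>. \<psi> \<in> tempered \<and> has_fourier \<psi> (\<lambda>\<omega>. adj_prod (v \<omega>) (vfourier \<Phi> \<omega>))) \<and>
           (\<forall>\<psi>. \<psi> \<in> tempered \<and> has_fourier \<psi> (\<lambda>\<omega>. adj_prod (v \<omega>) (vfourier \<Phi> \<omega>)) \<longrightarrow>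
              compactly_supported \<psi> \<and> strang_fix k \<psi> \<and>
              (\<lambda>\<omega>. cmod (tfourier \<psi> \<omega> - tfourier \<psi> 0)) \<in> O[nhds 0](\<lambda>\<omega>. norm \<omega> powr k) \<and>
              (k > s \<and> adj_prod (v 0) (vfourier \<Phi> 0) \<noteq> 0 \<longrightarrow>
                 approx_order s k (si_space_vec s \<Phi>) \<and>
                 \<psi> \<in> si_space_vec s \<Phi> \<and> approx_order s k (si_space s {\<psi>})))) \<and>
         (k > s \<and> (\<exists>\<Phi> \<in> refinable_space P. adj_prod (v 0) (vfourier \<Phi> 0) \<noteq> 0) \<longrightarrow>
           coherent_approx_order s k P \<and> regular_universal_supervector s k P v)"
proof -
  interpret super_refinement P s v k
    by unfold_locales (use assms in auto)
  have sup: "(\<lambda>\<omega>. adj_prod (v \<omega>) (vfourier \<Phi> \<omega>)) = super \<Phi>" for \<Phi>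
    by (simp add: symbol_def[abs_def])
  have sup0: "adj_prod (v 0) (vfourier \<Phi> 0) = super \<Phi> 0" for \<Phi>
    by (simp add: symbol_def)
  show ?thesis
    unfolding sup sup0
  proof (intro conjI ballI impI; (elim conjE)?)
    fix \<Phi> assume x: "\<Phi> \<in> refinable_space P"
    obtain \<psi>0 where p0: "\<psi>0 \<in> tempered" "compactly_supported \<psi>0" "has_fourier \<psi>0 (super \<Phi>)"
      "\<And>S. tdist.subspace S \<Longrightarrow> shift_invariant S \<Longrightarrow> range (($) \<Phi>) \<subseteq> S \<Longrightarrow> \<psi>0 \<in> S"
      by (rule super_distribution[OF x]) blast
    have uniq: "\<psi> = \<psi>0" if "\<psi> \<in> tempered" "has_fourier \<psi> (super \<Phi>)" for \<psi>
      by (rule tempered_eqI[OF that(1) p0(1) that(2) p0(3)])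
    show "\<exists>!\<psi>. \<psi> \<in> tempered \<and> has_fourier \<psi> (super \<Phi>)"
      using p0 uniq by blast
    have tf: "tfourier \<psi>0 = super \<Phi>" by (rule tfourier_eqI[OF p0(3) super_cont[OF x]])
    have mem: "\<psi>0 \<in> si_space_vec s \<Phi>" unfolding si_space_member using p0(4) by blast
    have mem1: "\<psi>0 \<in> si_space s {\<psi>0}" unfolding si_space_member by blast
    have ap: "approx_order s k S" if "s < k" "super \<Phi> 0 \<noteq> 0" "tdist.subspace S" "shift_invariant S" "\<psi>0 \<in> S" for S
      by (rule super_approx_order[OF x that(1) p0(1,3) that(2-5)])
    show "\<forall>\<psi>. \<psi> \<in> tempered \<and> has_fourier \<psi> (super \<Phi>) \<longrightarrow>
              compactly_supported \<psi> \<and> strang_fix k \<psi> \<and>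
              (\<lambda>\<omega>. cmod (tfourier \<psi> \<omega> - tfourier \<psi> 0)) \<in> O[nhds 0](\<lambda>\<omega>. norm \<omega> powr k) \<and>
              (k > s \<and> super \<Phi> 0 \<noteq> 0 \<longrightarrow>
                 approx_order s k (si_space_vec s \<Phi>) \<and>
                 \<psi> \<in> si_space_vec s \<Phi> \<and> approx_order s k (si_space s {\<psi>}))"
    proof (intro allI impI)
      fix \<psi> assume "\<psi> \<in> tempered \<and> has_fourier \<psi> (super \<Phi>)"
      then have e: "\<psi> = \<psi>0" using uniq by blast
      show "compactly_supported \<psi> \<and> strang_fix k \<psi> \<and>
              (\<lambda>\<omega>. cmod (tfourier \<psi> \<omega> - tfourier \<psi> 0)) \<in> O[nhds 0](\<lambda>\<omega>. norm \<omega> powr k) \<and>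
              (k > s \<and> super \<Phi> 0 \<noteq> 0 \<longrightarrow>
                 approx_order s k (si_space_vec s \<Phi>) \<and>
                 \<psi> \<in> si_space_vec s \<Phi> \<and> approx_order s k (si_space s {\<psi>}))"
        unfolding e using p0(2) super_strang_fix[OF x tf] mem
          ap[OF _ _ si_space_subspace si_space_shift_invariant mem] ap[OF _ _ si_space_subspace si_space_shift_invariant mem1]
        by (intro conjI impI) auto
    qed
  next
    assume "s < k" "\<exists>\<Phi>\<in>refinable_space P. super \<Phi> 0 \<noteq> 0"
    then show "coherent_approx_order s k P" by (rule coherent_order)
  next
    assume "s < k" "\<exists>\<Phi>\<in>refinable_space P. super \<Phi> 0 \<noteq> 0"
    then show "regular_universal_supervector s k P v" by (rule regular_supervector)
  qed
qed

end
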